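(* Let $(M,\omega)$ be a compact symplectic manifold and $L\subset(M,\omega)$ a compact Lagrangian submanifold, with auxiliary data $\psi,V,U,V',U',f$ fixed as in the context. Then the map $$\overline{q}:\frac{\mathcal{D}_{\mathcal{U}'}(\omega,L)}{\sim}\to\frac{\mathrm{Def}_L(\omega)}{\sim},\qquad [(\omega',L')]\mapsto[\phi_{L'}^*\omega']$$ is a (well-defined) bijection.
   Context: Setup. $(M,\omega)$ is a compact symplectic manifold, $L\subset(M,\omega)$ a compact Lagrangian submanifold. $T^*L$, with projection $p:T^*L\to L$, carries $\omega_{can}$, equal to $\sum_i dx_i\wedge dy_i$ in cotangent coordinates; $L$ is identified with the zero section. Using Weinstein's Lagrangian neighborhood theorem, fix a symplectomorphism $\psi:(V,\omega_{can})\to(U,\omega)$ from a neighborhood $V$ of $L$ in $T^*L$ to a neighborhood $U$ of $L$ in $M$, restricting to the identity on $L$. Fix smaller open neighborhoods $V'$ and $U'=\psi(V')$ of $L$ with $\overline{V'}\subset V$, $\overline{U'}\subset U$ and $V'$ fiberwise convex. Let $\Gamma_{V'}(T^*L)=\{\sigma\in\Gamma(T^*L):\sigma(L)\subset V'\}$, and let $\mathcal{U}'$ be the set of submanifolds of $M$ that are images of $\psi\circ\sigma:L\to M$ with $\sigma\in\Gamma_{V'}(T^*L)$; each $L'\in\mathcal{U}'$ corresponds to a unique such $\sigma$. Fix $f\in C^\infty(M)$ with $f|_{\overline{U'}}\equiv1$ and $\mathrm{supp}(f)\subset U$. For $\sigma\in\Gamma(T^*L)$ let $X_\sigma$ be the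 vertical, fiberwise constant vector field on $T^*L$ defined by $\sigma$, i.e. $\iota_{X_\sigma}\omega_{can}=-p^*\sigma$. For $L'\in\mathcal{U}'$ corresponding to $\sigma$, put $X_{L'}:=f\,\psi_*(X_\sigma)\in\mathfrak{X}(M)$ (extended by zero outside $U$) and let $\phi_{L'}$ be its time-$1$ flow; then $\phi_{L'}(L)=L'$ and $\phi_L=\mathrm{Id}$. An isotopy $(\phi_t)_{t\in[0,1]}$ is a smooth family of diffeomorphisms of $M$ with $\phi_0=\mathrm{Id}$. $\Omega_{symp}(M)$ is the set of symplectic forms on $M$. $\mathcal{D}_{\mathcal{U}'}(\omega,L)=\{(\omega',L')\in\Omega_{symp}(M)\times\mathcal{U}': L'\subset(M,\omega')\text{ is Lagrangian}\}$; here $(\omega',L')\sim(\omega'',L'')$ iff there is an isotopy $(\phi_t)_{t\in[0,1]}$ of $M$ with $\phi_1(L')=L''$, $\phi_1^*\omega''=\omega'$ and $\phi_t(L')\in\mathcal{U}'$ for all $t\in[0,1]$. $\mathrm{Def}_L(\omega)=\{\omega'\in\Omega_{symp}(M): L\subset(M,\omega')\text{ is Lagrangian}\}$; here $\omega'\sim\omega''$ iff there is an isotopy $(\rho_t)_{t\in[0,1]}$ of $M$ with $\rho_1^*\omega''=\omega'$ and $\rho_t(L)=L$ for all $t\in[0,1]$. *)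

theory Defs
  imports "HOL-Analysis.Analysis"
begin

section \<open>Smooth maps between Euclidean spaces\<close>

primrec Ck_open ::
  "nat \<Rightarrow> 'a::euclidean_space set \<Rightarrow> ('a \<Rightarrow> 'b::euclidean_space) \<Rightarrow> bool" where
  "Ck_open 0 S f \<longleftrightarrow> continuous_on S f"
| "Ck_open (Suc k) S f \<longleftrightarrow> (\<forall>x\<in>S. f differentiable (at x)) \<and>
     (\<forall>v. Ck_open k S (\<lambda>x. frechet_derivative f (at x) v))"

text \<open>\<open>Ck_open\<close> is only meaningful on open sets. A map on an arbitrary subset (such as
  \<open>[0,1] \<times> W\<close>) is smooth if it extends smoothly to a neighbourhood of each point.\<close>

definition smooth_on ::
  "'a::euclidean_space set \<Rightarrow> ('a \<Rightarrow> 'b::euclidean_space) \<Rightarrow> bool" where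
  "smooth_on S f \<longleftrightarrow> (\<forall>x\<in>S. \<exists>T g. open T \<and> x \<in> T \<and> (\<forall>k. Ck_open k T g) \<and>
     (\<forall>y\<in>S \<inter> T. g y = f y))"

section \<open>Smooth manifolds\<close>

text \<open>A chart is a pair of a domain and a coordinate map. A manifold is represented by an atlas
  (not necessarily maximal), which determines the underlying set, the topology and the smooth
  structure. Values of a coordinate map outside the domain of its chart are irrelevant.\<close>

type_synonym ('a, 'e) chart = "'a set \<times> ('a \<Rightarrow> 'e)"

type_synonym ('a, 'e) tvector = "('a, 'e) chart \<Rightarrow> 'e"

definition points :: "('a, 'e) chart set \<Rightarrow> 'a set" where
  "points A = (\<Union>c\<in>A. fst c)"

definition chart_inv :: "('a, 'e) chart \<Rightarrow> 'e \<Rightarrow> 'a" where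
  "chart_inv c = inv_into (fst c) (snd c)"

definition manifold_topology :: "('a, 'e::euclidean_space) chart set \<Rightarrow> 'a topology" where
  "manifold_topology A =
     topology (\<lambda>W. W \<subseteq> points A \<and> (\<forall>c\<in>A. open (snd c ` (W \<inter> fst c))))"

definition smooth_manifold :: "('a, 'e::euclidean_space) chart set \<Rightarrow> bool" where
  "smooth_manifold A \<longleftrightarrow>
     (\<forall>c\<in>A. inj_on (snd c) (fst c)) \<and>
     (\<forall>c\<in>A. \<forall>d\<in>A. open (snd c ` (fst c \<inter> fst d)) \<and>
        smooth_on (snd c ` (fst c \<inter> fst d)) (snd d \<circ> chart_inv c)) \<and>
     Hausdorff_space (manifold_topology A) \<and>
     second_countable (manifold_topology A)"

definition smooth_map_on ::
  "('a, 'e::euclidean_space) chart set \<Rightarrow> 'a set \<Rightarrow> ('b, 'g::euclidean_space) chart set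
     \<Rightarrow> ('a \<Rightarrow> 'b) \<Rightarrow> bool" where
  "smooth_map_on A S B f \<longleftrightarrow>
     continuous_map (subtopology (manifold_topology A) S) (manifold_topology B) f \<and>
     (\<forall>c\<in>A. \<forall>d\<in>B. smooth_on (snd c ` {x \<in> fst c \<inter> S. f x \<in> fst d})
                              (snd d \<circ> f \<circ> chart_inv c))"

definition smooth_function :: "('a, 'e::euclidean_space) chart set \<Rightarrow> ('a \<Rightarrow> real) \<Rightarrow> bool" where
  "smooth_function A f \<longleftrightarrow> smooth_map_on A (points A) {(UNIV, id)} f"

definition diffeo :: "('a, 'e::euclidean_space) chart set \<Rightarrow> ('a \<Rightarrow> 'a) \<Rightarrow> bool" where
  "diffeo A h \<longleftrightarrow> bij_betw h (points A) (points A) \<and> smooth_map_on A (points A) A h \<and>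
     smooth_map_on A (points A) A (inv_into (points A) h)"

section \<open>Tangent vectors and differentials\<close>

text \<open>A tangent vector at \<open>x\<close> is the family of its coordinate representations in all charts
  around \<open>x\<close>, related by the derivatives of the transition maps. The value is \<open>0\<close> at charts not
  containing \<open>x\<close>, so that tangent vectors have a unique representation.\<close>

definition tangent_space ::
  "('a, 'e::euclidean_space) chart set \<Rightarrow> 'a \<Rightarrow> ('a, 'e) tvector set" where
  "tangent_space A x = {v.
     (\<forall>c\<in>A. \<forall>d\<in>A. x \<in> fst c \<inter> fst d \<longrightarrow>
        v d = frechet_derivative (snd d \<circ> chart_inv c) (at (snd c x)) (v c)) \<and>
     (\<forall>c. c \<notin> A \<or> x \<notin> fst c \<longrightarrow> v c = 0)}"

definition lincomb ::
  "real \<Rightarrow> ('i \<Rightarrow> 'e::real_vector) \<Rightarrow> real \<Rightarrow> ('i \<Rightarrow> 'e) \<Rightarrow> 'i \<Rightarrow> 'e" where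
  "lincomb a v b w = (\<lambda>i. a *\<^sub>R v i + b *\<^sub>R w i)"

text \<open>The tangent vector at \<open>x\<close> with constant coordinates \<open>b\<close> in the chart \<open>c\<close>.\<close>

definition coord_vector ::
  "('a, 'e::euclidean_space) chart set \<Rightarrow> ('a, 'e) chart \<Rightarrow> 'a \<Rightarrow> 'e \<Rightarrow> ('a, 'e) tvector" where
  "coord_vector A c x b = (\<lambda>d. if d \<in> A \<and> x \<in> fst d
     then frechet_derivative (snd d \<circ> chart_inv c) (at (snd c x)) b else 0)"

definition differential ::
  "('a, 'e::euclidean_space) chart set \<Rightarrow> ('b, 'g::euclidean_space) chart set \<Rightarrow> ('a \<Rightarrow> 'b)
     \<Rightarrow> 'a \<Rightarrow> ('a, 'e) tvector \<Rightarrow> ('b, 'g) tvector" where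
  "differential A B f x v =
     (let c = (SOME c. c \<in> A \<and> x \<in> fst c)
      in (\<lambda>d. if d \<in> B \<and> f x \<in> fst d
           then frechet_derivative (snd d \<circ> f \<circ> chart_inv c) (at (snd c x)) (v c) else 0))"

section \<open>Two-forms and symplectic forms\<close>

type_synonym ('a, 'e) form2 = "'a \<Rightarrow> ('a, 'e) tvector \<Rightarrow> ('a, 'e) tvector \<Rightarrow> real"

text \<open>The coefficient \<open>\<omega>(\<partial>\<^sub>a, \<partial>\<^sub>b)\<close> of a two-form, as a function of the coordinates in the chart \<open>c\<close>.\<close>

definition form_coeff ::
  "('a, 'e::euclidean_space) chart set \<Rightarrow> ('a, 'e) form2 \<Rightarrow> ('a, 'e) chart
     \<Rightarrow> 'e \<Rightarrow> 'e \<Rightarrow> 'e \<Rightarrow> real" where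
  "form_coeff A \<omega> c a b u =
     \<omega> (chart_inv c u) (coord_vector A c (chart_inv c u) a) (coord_vector A c (chart_inv c u) b)"

text \<open>The second clause makes equality of two-forms on the manifold coincide with equality of
  the functions representing them.\<close>

definition two_forms :: "('a, 'e::euclidean_space) chart set \<Rightarrow> ('a, 'e) form2 set" where
  "two_forms A = {\<omega>.
     (\<forall>x\<in>points A. \<forall>v\<in>tangent_space A x. \<forall>v'\<in>tangent_space A x. \<forall>w\<in>tangent_space A x. \<forall>a b.
        \<omega> x (lincomb a v b v') w = a * \<omega> x v w + b * \<omega> x v' w \<and> \<omega> x v w = - \<omega> x w v) \<and>
     (\<forall>x v w. x \<notin> points A \<or> v \<notin> tangent_space A x \<or> w \<notin> tangent_space A x \<longrightarrow> \<omega> x v w = 0) \<and>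
     (\<forall>c\<in>A. \<forall>a b. smooth_on (snd c ` fst c) (form_coeff A \<omega> c a b))}"

text \<open>\<open>d\<omega> = 0\<close>, with \<open>d\<omega>\<close> evaluated on the constant coordinate fields of each chart.\<close>

definition closed_form :: "('a, 'e::euclidean_space) chart set \<Rightarrow> ('a, 'e) form2 \<Rightarrow> bool" where
  "closed_form A \<omega> \<longleftrightarrow> (\<forall>c\<in>A. \<forall>u\<in>snd c ` fst c. \<forall>a b e.
     frechet_derivative (form_coeff A \<omega> c b e) (at u) a +
     frechet_derivative (form_coeff A \<omega> c e a) (at u) b +
     frechet_derivative (form_coeff A \<omega> c a b) (at u) e = 0)"

definition nondegenerate :: "('a, 'e::euclidean_space) chart set \<Rightarrow> ('a, 'e) form2 \<Rightarrow> bool" where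
  "nondegenerate A \<omega> \<longleftrightarrow> (\<forall>x\<in>points A. \<forall>v\<in>tangent_space A x.
     (\<forall>w\<in>tangent_space A x. \<omega> x v w = 0) \<longrightarrow> v = (\<lambda>_. 0))"

definition symplectic_forms :: "('a, 'e::euclidean_space) chart set \<Rightarrow> ('a, 'e) form2 set" where
  "symplectic_forms A = {\<omega> \<in> two_forms A. closed_form A \<omega> \<and> nondegenerate A \<omega>}"

definition pullback ::
  "('a, 'e::euclidean_space) chart set \<Rightarrow> ('b, 'g::euclidean_space) chart set \<Rightarrow> ('a \<Rightarrow> 'b)
     \<Rightarrow> ('b, 'g) form2 \<Rightarrow> ('a, 'e) form2" where
  "pullback A B f \<omega> = (\<lambda>x v w.
     if x \<in> points A \<and> v \<in> tangent_space A x \<and> w \<in> tangent_space A x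
     then \<omega> (f x) (differential A B f x v) (differential A B f x w) else 0)"

section \<open>Lagrangian submanifolds\<close>

text \<open>\<open>B\<close> is an atlas of an embedded submanifold of the manifold with atlas \<open>A\<close>.\<close>

definition embedded_submanifold ::
  "('a, 'e::euclidean_space) chart set \<Rightarrow> ('a, 'n::euclidean_space) chart set \<Rightarrow> bool" where
  "embedded_submanifold A B \<longleftrightarrow> smooth_manifold B \<and> points B \<subseteq> points A \<and>
     manifold_topology B = subtopology (manifold_topology A) (points B) \<and>
     smooth_map_on B (points B) A id \<and>
     (\<forall>x\<in>points B. inj_on (differential B A id x) (tangent_space B x))"

definition lagrangian_atlas ::
  "('a, 'e::euclidean_space) chart set \<Rightarrow> ('a, 'e) form2 \<Rightarrow> ('a, 'n::euclidean_space) chart set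
     \<Rightarrow> bool" where
  "lagrangian_atlas A \<omega> B \<longleftrightarrow> embedded_submanifold A B \<and> DIM('e) = 2 * DIM('n) \<and>
     pullback B A id \<omega> = (\<lambda>x v w. 0)"

text \<open>For subsets of \<open>M\<close>; the first argument only fixes the type of the model space.\<close>

definition lagrangian ::
  "'n::euclidean_space itself \<Rightarrow> ('a, 'e::euclidean_space) chart set \<Rightarrow> ('a, 'e) form2
     \<Rightarrow> 'a set \<Rightarrow> bool" where
  "lagrangian _ A \<omega> S \<longleftrightarrow>
     (\<exists>B::('a, 'n) chart set. points B = S \<and> lagrangian_atlas A \<omega> B)"

section \<open>Cotangent bundles\<close>

type_synonym ('a, 'n) covector = "('a, 'n) tvector \<Rightarrow> real"

type_synonym ('a, 'n) cotangent = "'a \<times> ('a, 'n) covector"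

text \<open>As for two-forms, covectors vanish outside the tangent space.\<close>

definition cotangent_space ::
  "('a, 'n::euclidean_space) chart set \<Rightarrow> 'a \<Rightarrow> ('a, 'n) covector set" where
  "cotangent_space B x = {\<alpha>.
     (\<forall>v\<in>tangent_space B x. \<forall>w\<in>tangent_space B x. \<forall>a b.
        \<alpha> (lincomb a v b w) = a * \<alpha> v + b * \<alpha> w) \<and>
     (\<forall>v. v \<notin> tangent_space B x \<longrightarrow> \<alpha> v = 0)}"

text \<open>Cotangent coordinates \<open>(x\<^sub>i, y\<^sub>i)\<close>, with \<open>\<alpha> = \<Sum> y\<^sub>i dx\<^sub>i\<close> and hence \<open>y\<^sub>i = \<alpha>(\<partial>\<^sub>i)\<close>.\<close>

definition cotangent_chart ::
  "('a, 'n::euclidean_space) chart set \<Rightarrow> ('a, 'n) chart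
     \<Rightarrow> (('a, 'n) cotangent, 'n \<times> 'n) chart" where
  "cotangent_chart B c =
     (Sigma (fst c) (cotangent_space B),
      \<lambda>(x, \<alpha>). (snd c x, \<Sum>b\<in>Basis. \<alpha> (coord_vector B c x b) *\<^sub>R b))"

definition cotangent_atlas ::
  "('a, 'n::euclidean_space) chart set \<Rightarrow> (('a, 'n) cotangent, 'n \<times> 'n) chart set" where
  "cotangent_atlas B = cotangent_chart B ` B"

definition zero_section :: "('a, 'n::euclidean_space) chart set \<Rightarrow> ('a, 'n) cotangent set" where
  "zero_section B = (\<lambda>x. (x, \<lambda>_. 0)) ` points B"

text \<open>\<open>\<Sum> dx\<^sub>i \<and> dy\<^sub>i\<close> in every system of cotangent coordinates.\<close>

definition omega_can ::
  "('a, 'n::euclidean_space) chart set \<Rightarrow> (('a, 'n) cotangent, 'n \<times> 'n) form2" where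
  "omega_can B z v w = (THE r. \<forall>c\<in>B. fst z \<in> fst c \<longrightarrow>
     (let c' = cotangent_chart B c
      in r = (\<Sum>b\<in>Basis. (fst (v c') \<bullet> b) * (snd (w c') \<bullet> b) - (snd (v c') \<bullet> b) * (fst (w c') \<bullet> b))))"

definition fiberwise_convex ::
  "('a, 'n::euclidean_space) chart set \<Rightarrow> ('a, 'n) cotangent set \<Rightarrow> bool" where
  "fiberwise_convex B W \<longleftrightarrow> (\<forall>x\<in>points B. \<forall>\<alpha> \<beta>. \<forall>t\<in>{0..1}.
     (x, \<alpha>) \<in> W \<longrightarrow> (x, \<beta>) \<in> W \<longrightarrow> (x, lincomb (1 - t) \<alpha> t \<beta>) \<in> W)"

text \<open>Smooth sections are normalised to be \<open>0\<close> outside of \<open>L\<close>, so that they are determined by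
  their restriction to \<open>L\<close>.\<close>

definition sections_in ::
  "('a, 'n::euclidean_space) chart set \<Rightarrow> ('a, 'n) cotangent set
     \<Rightarrow> ('a \<Rightarrow> ('a, 'n) covector) set" where
  "sections_in B W = {\<sigma>. (\<forall>x\<in>points B. \<sigma> x \<in> cotangent_space B x \<and> (x, \<sigma> x) \<in> W) \<and>
     (\<forall>x. x \<notin> points B \<longrightarrow> \<sigma> x = (\<lambda>_. 0)) \<and>
     smooth_map_on B (points B) (cotangent_atlas B) (\<lambda>x. (x, \<sigma> x))}"

definition weinstein_chart ::
  "('a, 'e::euclidean_space) chart set \<Rightarrow> ('a, 'e) form2 \<Rightarrow> ('a, 'n::euclidean_space) chart set
     \<Rightarrow> ('a, 'n) cotangent set \<Rightarrow> 'a set \<Rightarrow> (('a, 'n) cotangent \<Rightarrow> 'a) \<Rightarrow> bool" where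
  "weinstein_chart A \<omega> B V U \<psi> \<longleftrightarrow>
     openin (manifold_topology (cotangent_atlas B)) V \<and> zero_section B \<subseteq> V \<and>
     openin (manifold_topology A) U \<and> points B \<subseteq> U \<and>
     bij_betw \<psi> V U \<and>
     smooth_map_on (cotangent_atlas B) V A \<psi> \<and>
     smooth_map_on A U (cotangent_atlas B) (inv_into V \<psi>) \<and>
     (\<forall>z\<in>V. \<forall>v\<in>tangent_space (cotangent_atlas B) z. \<forall>w\<in>tangent_space (cotangent_atlas B) z.
        \<omega> (\<psi> z) (differential (cotangent_atlas B) A \<psi> z v) (differential (cotangent_atlas B) A \<psi> z w)
          = omega_can B z v w) \<and>
     (\<forall>x\<in>points B. \<psi> (x, \<lambda>_. 0) = x)"

section \<open>Nearby submanifolds and the associated flows\<close>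

definition section_image ::
  "('a, 'n::euclidean_space) chart set \<Rightarrow> (('a, 'n) cotangent \<Rightarrow> 'a)
     \<Rightarrow> ('a \<Rightarrow> ('a, 'n) covector) \<Rightarrow> 'a set" where
  "section_image B \<psi> \<sigma> = (\<lambda>x. \<psi> (x, \<sigma> x)) ` points B"

definition nearby ::
  "('a, 'n::euclidean_space) chart set \<Rightarrow> (('a, 'n) cotangent \<Rightarrow> 'a) \<Rightarrow> ('a, 'n) cotangent set
     \<Rightarrow> 'a set set" where
  "nearby B \<psi> V' = section_image B \<psi> ` sections_in B V'"

definition section_of ::
  "('a, 'n::euclidean_space) chart set \<Rightarrow> (('a, 'n) cotangent \<Rightarrow> 'a) \<Rightarrow> ('a, 'n) cotangent set
     \<Rightarrow> 'a set \<Rightarrow> 'a \<Rightarrow> ('a, 'n) covector" where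
  "section_of B \<psi> V' S = (THE \<sigma>. \<sigma> \<in> sections_in B V' \<and> section_image B \<psi> \<sigma> = S)"

text \<open>\<open>X\<^sub>\<sigma>\<close> is determined by \<open>\<iota>(X\<^sub>\<sigma>) \<omega>\<^sub>c\<^sub>a\<^sub>n = - p\<^sup>*\<sigma>\<close>, where \<open>p = fst\<close> is the bundle projection.\<close>

definition vertical_field ::
  "('a, 'n::euclidean_space) chart set \<Rightarrow> ('a \<Rightarrow> ('a, 'n) covector)
     \<Rightarrow> ('a, 'n) cotangent \<Rightarrow> (('a, 'n) cotangent, 'n \<times> 'n) tvector" where
  "vertical_field B \<sigma> z = (THE v. v \<in> tangent_space (cotangent_atlas B) z \<and>
     (\<forall>w\<in>tangent_space (cotangent_atlas B) z.
        omega_can B z v w = - \<sigma> (fst z) (differential (cotangent_atlas B) B fst z w)))"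

definition cutoff_field ::
  "('a, 'e::euclidean_space) chart set \<Rightarrow> ('a, 'n::euclidean_space) chart set
     \<Rightarrow> ('a, 'n) cotangent set \<Rightarrow> 'a set \<Rightarrow> (('a, 'n) cotangent \<Rightarrow> 'a) \<Rightarrow> ('a \<Rightarrow> real)
     \<Rightarrow> ('a \<Rightarrow> ('a, 'n) covector) \<Rightarrow> 'a \<Rightarrow> ('a, 'e) tvector" where
  "cutoff_field A B V U \<psi> f \<sigma> y =
     (if y \<in> U then
        (let z = inv_into V \<psi> y
         in (\<lambda>d. f y *\<^sub>R differential (cotangent_atlas B) A \<psi> z (vertical_field B \<sigma> z) d))
      else (\<lambda>_. 0))"

definition integral_curve ::
  "('a, 'e::euclidean_space) chart set \<Rightarrow> ('a \<Rightarrow> ('a, 'e) tvector) \<Rightarrow> (real \<Rightarrow> 'a) \<Rightarrow> bool" where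
  "integral_curve A X \<gamma> \<longleftrightarrow> continuous_map euclideanreal (manifold_topology A) \<gamma> \<and>
     (\<forall>t. \<forall>c\<in>A. \<gamma> t \<in> fst c \<longrightarrow> ((snd c \<circ> \<gamma>) has_vector_derivative X (\<gamma> t) c) (at t))"

definition time_one_flow ::
  "('a, 'e::euclidean_space) chart set \<Rightarrow> ('a \<Rightarrow> ('a, 'e) tvector) \<Rightarrow> 'a \<Rightarrow> 'a" where
  "time_one_flow A X x = (THE y. \<exists>\<gamma>. integral_curve A X \<gamma> \<and> \<gamma> 0 = x \<and> \<gamma> 1 = y)"

definition nearby_diffeo ::
  "('a, 'e::euclidean_space) chart set \<Rightarrow> ('a, 'n::euclidean_space) chart set
     \<Rightarrow> ('a, 'n) cotangent set \<Rightarrow> 'a set \<Rightarrow> (('a, 'n) cotangent \<Rightarrow> 'a) \<Rightarrow> ('a, 'n) cotangent set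
     \<Rightarrow> ('a \<Rightarrow> real) \<Rightarrow> 'a set \<Rightarrow> 'a \<Rightarrow> 'a" where
  "nearby_diffeo A B V U \<psi> V' f S =
     time_one_flow A (cutoff_field A B V U \<psi> f (section_of B \<psi> V' S))"

section \<open>Isotopies and the two deformation spaces\<close>

text \<open>Smoothness of the family means joint smoothness of \<open>(t, x) \<mapsto> \<phi>\<^sub>t(x)\<close> on \<open>[0,1] \<times> M\<close>.\<close>

definition is_isotopy ::
  "('a, 'e::euclidean_space) chart set \<Rightarrow> (real \<Rightarrow> 'a \<Rightarrow> 'a) \<Rightarrow> bool" where
  "is_isotopy A \<phi> \<longleftrightarrow>
     (\<forall>t\<in>{0..1}. diffeo A (\<phi> t)) \<and> (\<forall>x\<in>points A. \<phi> 0 x = x) \<and>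
     continuous_map (prod_topology (top_of_set {0..1}) (manifold_topology A))
                    (manifold_topology A) (\<lambda>(t, x). \<phi> t x) \<and>
     (\<forall>c\<in>A. \<forall>d\<in>A. smooth_on {(t, u). t \<in> {0..1} \<and> u \<in> snd c ` {x \<in> fst c. \<phi> t x \<in> fst d}}
                              (\<lambda>(t, u). snd d (\<phi> t (chart_inv c u))))"

definition D_nearby ::
  "('a, 'e::euclidean_space) chart set \<Rightarrow> ('a, 'n::euclidean_space) chart set
     \<Rightarrow> (('a, 'n) cotangent \<Rightarrow> 'a) \<Rightarrow> ('a, 'n) cotangent set \<Rightarrow> (('a, 'e) form2 \<times> 'a set) set" where
  "D_nearby A B \<psi> V' = {(\<omega>', L'). \<omega>' \<in> symplectic_forms A \<and> L' \<in> nearby B \<psi> V' \<and>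
     lagrangian TYPE('n) A \<omega>' L'}"

definition D_nearby_rel ::
  "('a, 'e::euclidean_space) chart set \<Rightarrow> ('a, 'n::euclidean_space) chart set
     \<Rightarrow> (('a, 'n) cotangent \<Rightarrow> 'a) \<Rightarrow> ('a, 'n) cotangent set
     \<Rightarrow> ((('a, 'e) form2 \<times> 'a set) \<times> (('a, 'e) form2 \<times> 'a set)) set" where
  "D_nearby_rel A B \<psi> V' = {((\<omega>', L'), (\<omega>'', L'')).
     (\<omega>', L') \<in> D_nearby A B \<psi> V' \<and> (\<omega>'', L'') \<in> D_nearby A B \<psi> V' \<and>
     (\<exists>\<phi>. is_isotopy A \<phi> \<and> \<phi> 1 ` L' = L'' \<and> pullback A A (\<phi> 1) \<omega>'' = \<omega>' \<and>
        (\<forall>t\<in>{0..1}. \<phi> t ` L' \<in> nearby B \<psi> V'))}"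

definition Def_L ::
  "('a, 'e::euclidean_space) chart set \<Rightarrow> ('a, 'n::euclidean_space) chart set
     \<Rightarrow> ('a, 'e) form2 set" where
  "Def_L A B = {\<omega>' \<in> symplectic_forms A. lagrangian TYPE('n) A \<omega>' (points B)}"

definition Def_L_rel ::
  "('a, 'e::euclidean_space) chart set \<Rightarrow> ('a, 'n::euclidean_space) chart set
     \<Rightarrow> (('a, 'e) form2 \<times> ('a, 'e) form2) set" where
  "Def_L_rel A B = {(\<omega>', \<omega>''). \<omega>' \<in> Def_L A B \<and> \<omega>'' \<in> Def_L A B \<and>
     (\<exists>\<rho>. is_isotopy A \<rho> \<and> pullback A A (\<rho> 1) \<omega>'' = \<omega>' \<and>
        (\<forall>t\<in>{0..1}. \<rho> t ` points B = points B))}"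

definition q_map ::
  "('a, 'e::euclidean_space) chart set \<Rightarrow> ('a, 'n::euclidean_space) chart set
     \<Rightarrow> ('a, 'n) cotangent set \<Rightarrow> 'a set \<Rightarrow> (('a, 'n) cotangent \<Rightarrow> 'a) \<Rightarrow> ('a, 'n) cotangent set
     \<Rightarrow> ('a \<Rightarrow> real) \<Rightarrow> ('a, 'e) form2 \<times> 'a set \<Rightarrow> ('a, 'e) form2" where
  "q_map A B V U \<psi> V' f = (\<lambda>(\<omega>', L'). pullback A A (nearby_diffeo A B V U \<psi> V' f L') \<omega>')"

text \<open>The induced map on classes, written as a union over representatives as in
  \<^theory>\<open>HOL.Equiv_Relations\<close>.\<close>

definition q_bar ::
  "('a, 'e::euclidean_space) chart set \<Rightarrow> ('a, 'n::euclidean_space) chart set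
     \<Rightarrow> ('a, 'n) cotangent set \<Rightarrow> 'a set \<Rightarrow> (('a, 'n) cotangent \<Rightarrow> 'a) \<Rightarrow> ('a, 'n) cotangent set
     \<Rightarrow> ('a \<Rightarrow> real) \<Rightarrow> (('a, 'e) form2 \<times> 'a set) set \<Rightarrow> ('a, 'e) form2 set" where
  "q_bar A B V U \<psi> V' f C = (\<Union>p\<in>C. Def_L_rel A B `` {q_map A B V U \<psi> V' f p})"

end

theory Submission
  imports Defs
begin

text \<open>Let \<open>\<Phi>\<^sub>\<sigma>\<close> be the time-one flow of the cut-off vertical field of a section \<open>\<sigma>\<close>. Inside \<open>U\<close> this field is a
  multiple of a field that is constant along the fibres, so in the fibre through \<open>z = (x, \<alpha>)\<close> the flow is
  \<open>\<alpha> + u(t) \<sigma>(x)\<close> with \<open>u\<close> the solution of the scalar equation \<open>u' = f(\<psi>(x, \<alpha> + u \<sigma>(x)))\<close>, \<open>u(0) = 0\<close>. Smooth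
  dependence of \<open>u\<close> on parameters makes \<open>\<Phi>\<^sub>\<sigma>\<close> a diffeomorphism with inverse \<open>\<Phi>\<^bsub>-\<sigma>\<^esub>\<close>, smooth in \<open>\<sigma>\<close>, and convexity of
  the fibres of \<open>V'\<close> gives \<open>\<Phi>\<^sub>\<sigma>(L) = L'\<close> for \<open>L'\<close> the graph of \<open>\<sigma>\<close>.

  The relation on pairs is the inverse image of the relation on forms under \<open>q(\<omega>', L') = \<Phi>\<^sub>\<sigma>\<^sup>*\<omega>'\<close>. An isotopy
  \<open>\<rho>\<^sub>t\<close> preserving \<open>L\<close> yields \<open>\<Phi>\<^bsub>\<sigma>(t)\<^esub> \<rho>\<^sub>t \<Phi>\<^bsub>\<sigma>'\<^esub>\<^sup>-\<^sup>1\<close> with \<open>\<sigma>(t) = (1 - t)\<sigma>' + t\<sigma>''\<close>; conversely an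
  isotopy \<open>\<phi>\<^sub>t\<close> with \<open>\<phi>\<^sub>t(L')\<close> the graph of \<open>\<sigma>(t)\<close> yields \<open>\<Phi>\<^bsub>\<sigma>(t)\<^esub>\<^sup>-\<^sup>1 \<phi>\<^sub>t \<Phi>\<^bsub>\<sigma>'\<^esub>\<close>, which preserves \<open>L\<close>. As
  \<open>q(\<omega>', L) = \<omega>'\<close>, the map \<open>q\<close> is onto, so it induces a bijection of the quotients.\<close>

section \<open>Calculus of smooth maps\<close>

text \<open>Three obstacles shape the proof. The map \<open>time_one_flow\<close> is specified by
  uniqueness among all integral curves on M, so curves that might enter or leave U have to be
  controlled as well. V is an arbitrary neighbourhood, so a line in a fibre may leave V and return;
  the cut-off is therefore extended by zero to the whole cotangent bundle, and the support of f,
  compact because M is, makes the scalar equation Lipschitz on entire fibres and hence solvable for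
  all times. Finally, the relation on pairs only says that each \<open>\<phi> t\<close> carries L'
  to some member of \<open>nearby\<close>: a section is obtained at each time separately, and its
  smooth dependence on time has to be recovered.

  Isotopies are smooth up to both ends of the time interval. Smoothness is therefore handled through
  local extensions, with [0,1] x M regarded as a subset of the manifold R x M. The flows need not
  preserve any of the forms; the forms are compared by functoriality of the pullback alone.\<close>

lemma Ck_open_cong:
  assumes "open S" "\<And>x. x \<in> S \<Longrightarrow> f x = g x" "Ck_open k S f"
  shows "Ck_open k S g"
  using assms(2,3)
proof (induction k arbitrary: f g)
  case 0
  then show ?case by (simp cong: continuous_on_cong)
next
  case (Suc k)
  have der: "(g has_derivative frechet_derivative f (at x)) (at x)" if "x \<in> S" for x
    using Suc.prems that assms(1) frechet_derivative_works
    by (metis Ck_open.simps(2) has_derivative_transform_within_open)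
  have eq: "frechet_derivative f (at x) v = frechet_derivative g (at x) v" if "x \<in> S" for x v
    by (simp only: frechet_derivative_at[OF der[OF that]])
  have "Ck_open k S (\<lambda>x. frechet_derivative g (at x) v)" for v
  proof (rule Suc.IH[of "\<lambda>x. frechet_derivative f (at x) v"])
    show "Ck_open k S (\<lambda>x. frechet_derivative f (at x) v)" using Suc.prems(2) by simp
  qed (rule eq)
  with der show ?case by (auto simp: differentiable_def)
qed

lemma Ck_open_mono: "Ck_open k S f \<Longrightarrow> T \<subseteq> S \<Longrightarrow> Ck_open k T f"
  by (induction k arbitrary: f) (auto intro: continuous_on_subset)

lemma Ck_open_continuous: "Ck_open k S f \<Longrightarrow> continuous_on S f"
  by (cases k) (auto intro!: continuous_at_imp_continuous_on differentiable_imp_continuous_within)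

lemma Ck_open_Suc_D: "Ck_open (Suc k) S f \<Longrightarrow> Ck_open k S f"
proof (induction k arbitrary: f)
  case 0
  show ?case using Ck_open_continuous[OF 0] by simp
next
  case (Suc k)
  then show ?case by (metis Ck_open.simps(2))
qed

lemma Ck_open_local:
  assumes "\<And>x. x \<in> S \<Longrightarrow> \<exists>T. open T \<and> x \<in> T \<and> Ck_open k T f"
  shows "Ck_open k S f"
  using assms
proof (induction k arbitrary: f)
  case 0
  then show ?case
    by (metis Ck_open.simps(1) continuous_at_imp_continuous_on continuous_on_eq_continuous_at)
next
  case (Suc k)
  have "Ck_open k S (\<lambda>x. frechet_derivative f (at x) v)" for v
  proof (rule Suc.IH)
    fix x assume "x \<in> S"
    from Suc.prems[OF this] show "\<exists>T. open T \<and> x \<in> T \<and> Ck_open k T (\<lambda>x. frechet_derivative f (at x) v)"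
      by fastforce
  qed
  moreover have "f differentiable (at x)" if "x \<in> S" for x
    using Suc.prems[OF that] by auto
  ultimately show ?case by simp
qed

text \<open>\<open>frechet_derivative\<close> is a choice operator; uniqueness of derivatives allows
  any explicitly given family \<open>f'\<close> in its place.\<close>

lemma Ck_open_SucI:
  assumes "open S" "\<And>x. x \<in> S \<Longrightarrow> (f has_derivative f' x) (at x)"
    "\<And>v. Ck_open k S (\<lambda>x. f' x v)"
  shows "Ck_open (Suc k) S f"
proof -
  have "f' x v = frechet_derivative f (at x) v" if "x \<in> S" for x v
    by (simp only: frechet_derivative_at[OF assms(2)[OF that]])
  then have "Ck_open k S (\<lambda>x. frechet_derivative f (at x) v)" for v
    by (rule Ck_open_cong[OF assms(1) _ assms(3)])
  then show ?thesis using assms(2) by (auto simp: differentiable_def)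
qed

lemma Ck_open_Suc_has_derivative:
  "Ck_open (Suc k) S f \<Longrightarrow> x \<in> S \<Longrightarrow> (f has_derivative frechet_derivative f (at x)) (at x)"
  by (simp add: frechet_derivative_works[symmetric])

lemma Ck_open_const: "open S \<Longrightarrow> Ck_open k S (\<lambda>x. c)"
proof (induction k arbitrary: c)
  case (Suc k)
  then show ?case by (intro Ck_open_SucI[where f' = "\<lambda>_ _. 0"]) auto
qed auto

lemma Ck_open_linear:
  assumes "bounded_linear L" "open S" "Ck_open k S f"
  shows "Ck_open k S (\<lambda>x. L (f x))"
  using assms(3)
proof (induction k arbitrary: f)
  case 0
  then show ?case using assms(1) by (auto intro: bounded_linear.continuous_on)
next
  case (Suc k)
  show ?case
  proof (rule Ck_open_SucI[OF assms(2)])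
    show "((\<lambda>x. L (f x)) has_derivative (\<lambda>v. L (frechet_derivative f (at x) v))) (at x)"
      if "x \<in> S" for x
      using Ck_open_Suc_has_derivative[OF Suc.prems that] assms(1)
      by (rule bounded_linear.has_derivative[rotated])
  qed (use Suc in auto)
qed

lemma Ck_open_id: "open S \<Longrightarrow> Ck_open k S (\<lambda>x. x)"
proof (cases k)
  case (Suc k)
  assume "open S"
  then have "Ck_open (Suc k) S (\<lambda>x. x)"
    by (intro Ck_open_SucI[where f' = "\<lambda>_ v. v"]) (auto intro: Ck_open_const)
  with Suc show ?thesis by simp
qed auto

lemma Ck_open_add:
  assumes "open S" "Ck_open k S f" "Ck_open k S g"
  shows "Ck_open k S (\<lambda>x. f x + g x)"
  using assms(2,3)
proof (induction k arbitrary: f g)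
  case 0
  then show ?case by (auto intro: continuous_intros)
next
  case (Suc k)
  show ?case
  proof (rule Ck_open_SucI[OF assms(1)])
    show "((\<lambda>x. f x + g x) has_derivative
       (\<lambda>v. frechet_derivative f (at x) v + frechet_derivative g (at x) v)) (at x)"
      if "x \<in> S" for x
      using Suc.prems that by (intro has_derivative_add Ck_open_Suc_has_derivative)
  qed (use Suc in auto)
qed

lemma Ck_open_sum:
  assumes "open S" "\<And>i. i \<in> I \<Longrightarrow> Ck_open k S (f i)"
  shows "Ck_open k S (\<lambda>x. \<Sum>i\<in>I. f i x)"
  using assms(2) by (induction I rule: infinite_finite_induct)
    (auto intro!: Ck_open_add Ck_open_const assms(1))

lemma Ck_open_bilinear:
  fixes prod :: "'b::euclidean_space \<Rightarrow> 'c::euclidean_space \<Rightarrow> 'd::euclidean_space"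
  assumes "bounded_bilinear prod" "open S" "Ck_open k S f" "Ck_open k S g"
  shows "Ck_open k S (\<lambda>x. prod (f x) (g x))"
  using assms(3,4)
proof (induction k arbitrary: f g)
  case 0
  then show ?case using assms(1) by (auto intro: bounded_bilinear.continuous_on)
next
  case (Suc k)
  show ?case
  proof (rule Ck_open_SucI[OF assms(2)])
    show "((\<lambda>x. prod (f x) (g x)) has_derivative
       (\<lambda>v. prod (f x) (frechet_derivative g (at x) v) + prod (frechet_derivative f (at x) v) (g x))) (at x)"
      if "x \<in> S" for x
      using Ck_open_Suc_has_derivative[OF Suc.prems(1) that] Ck_open_Suc_has_derivative[OF Suc.prems(2) that]
      by (rule bounded_bilinear.FDERIV[OF assms(1)])
    show "Ck_open k S (\<lambda>x. prod (f x) (frechet_derivative g (at x) v)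
            + prod (frechet_derivative f (at x) v) (g x))" for v
      using Suc.prems Ck_open_Suc_D[OF Suc.prems(1)] Ck_open_Suc_D[OF Suc.prems(2)]
      by (intro Ck_open_add assms Suc.IH) simp_all
  qed
qed

text \<open>The direction fed to the derivative of \<open>g\<close> moves with \<open>x\<close>,
  whereas \<open>Ck_open\<close> speaks of fixed directions. Expanding it in the basis leaves
  products of coordinates of the derivative of \<open>f\<close> with derivatives of \<open>g\<close>
  in basis directions composed with \<open>f\<close>, to which the induction hypothesis
  applies.\<close>

lemma Ck_open_compose:
  fixes f :: "'a::euclidean_space \<Rightarrow> 'b::euclidean_space"
    and g :: "'b \<Rightarrow> 'c::euclidean_space"
  assumes "open S" "open T" "Ck_open k S f" "Ck_open k T g" "f ` S \<subseteq> T"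
  shows "Ck_open k S (\<lambda>x. g (f x))"
  using assms(3,4)
proof (induction k arbitrary: g)
  case 0
  then show ?case using assms(5)
    by (auto intro: continuous_on_compose2[OF _ _ assms(5)])
next
  case (Suc k)
  have f: "Ck_open k S f" using Suc.prems(1) by (rule Ck_open_Suc_D)
  have g: "(g has_derivative frechet_derivative g (at (f x))) (at (f x))" if "x \<in> S" for x
    using assms(5) that by (intro Ck_open_Suc_has_derivative[OF Suc.prems(2)]) auto
  show ?case
  proof (rule Ck_open_SucI[OF assms(1)])
    fix x assume x: "x \<in> S"
    have "linear (frechet_derivative g (at (f x)))"
      using g[OF x] has_derivative_linear by blast
    then have eq: "frechet_derivative g (at (f x)) w =
        (\<Sum>b\<in>Basis. (w \<bullet> b) *\<^sub>R frechet_derivative g (at (f x)) b)" for w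
      using linear_sum[of "frechet_derivative g (at (f x))" "\<lambda>b. (w \<bullet> b) *\<^sub>R b" Basis]
      by (simp only: euclidean_representation linear_scale)
    show "((\<lambda>x. g (f x)) has_derivative
        (\<lambda>v. \<Sum>b\<in>Basis. (frechet_derivative f (at x) v \<bullet> b) *\<^sub>R frechet_derivative g (at (f x)) b)) (at x)"
      using has_derivative_compose[OF Ck_open_Suc_has_derivative[OF Suc.prems(1) x] g[OF x]]
      by (simp only: eq[symmetric])
  next
    fix v
    show "Ck_open k S (\<lambda>x. \<Sum>b\<in>Basis. (frechet_derivative f (at x) v \<bullet> b) *\<^sub>R frechet_derivative g (at (f x)) b)"
    proof (intro Ck_open_sum assms(1) Ck_open_bilinear[OF bounded_bilinear_scaleR])
      fix b :: 'b
      show "Ck_open k S (\<lambda>x. frechet_derivative f (at x) v \<bullet> b)"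
        using Suc.prems by (intro Ck_open_linear[OF bounded_linear_inner_left assms(1)]) auto
      show "Ck_open k S (\<lambda>x. frechet_derivative g (at (f x)) b)"
        using Suc.prems(2) by (intro Suc.IH[OF f, of "\<lambda>y. frechet_derivative g (at y) b"]) auto
    qed
  qed
qed

definition Cinf :: "'a::euclidean_space set \<Rightarrow> ('a \<Rightarrow> 'b::euclidean_space) \<Rightarrow> bool" where
  "Cinf S f \<longleftrightarrow> (\<forall>k. Ck_open k S f)"

lemma Cinf_cong: "open S \<Longrightarrow> (\<And>x. x \<in> S \<Longrightarrow> f x = g x) \<Longrightarrow> Cinf S f \<Longrightarrow> Cinf S g"
  unfolding Cinf_def using Ck_open_cong by blast

lemma Cinf_mono: "Cinf S f \<Longrightarrow> T \<subseteq> S \<Longrightarrow> Cinf T f"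
  unfolding Cinf_def using Ck_open_mono by blast

lemma Cinf_local:
  assumes "\<And>x. x \<in> S \<Longrightarrow> \<exists>T. open T \<and> x \<in> T \<and> Cinf T f"
  shows "Cinf S f"
  using assms unfolding Cinf_def by (metis Ck_open_local)

lemma Cinf_continuous: "Cinf S f \<Longrightarrow> continuous_on S f"
  unfolding Cinf_def using Ck_open_continuous by blast

lemma Cinf_has_derivative:
  "Cinf S f \<Longrightarrow> x \<in> S \<Longrightarrow> (f has_derivative frechet_derivative f (at x)) (at x)"
  unfolding Cinf_def using Ck_open_Suc_has_derivative by blast

lemma Cinf_derivative: "Cinf S f \<Longrightarrow> Cinf S (\<lambda>x. frechet_derivative f (at x) v)"
  unfolding Cinf_def using Ck_open.simps(2) by blast

lemma Cinf_const [intro]: "open S \<Longrightarrow> Cinf S (\<lambda>x. c)"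
  and Cinf_id [intro]: "open S \<Longrightarrow> Cinf S (\<lambda>x. x)"
  by (simp_all add: Cinf_def Ck_open_const Ck_open_id)

lemma Cinf_linear: "bounded_linear L \<Longrightarrow> open S \<Longrightarrow> Cinf S f \<Longrightarrow> Cinf S (\<lambda>x. L (f x))"
  by (simp add: Cinf_def Ck_open_linear)

lemma Cinf_add: "open S \<Longrightarrow> Cinf S f \<Longrightarrow> Cinf S g \<Longrightarrow> Cinf S (\<lambda>x. f x + g x)"
  by (simp add: Cinf_def Ck_open_add)

lemma Cinf_sum: "open S \<Longrightarrow> (\<And>i. i \<in> I \<Longrightarrow> Cinf S (f i)) \<Longrightarrow> Cinf S (\<lambda>x. \<Sum>i\<in>I. f i x)"
  by (simp add: Cinf_def Ck_open_sum)

lemma Cinf_bilinear: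
  fixes prod :: "'b::euclidean_space \<Rightarrow> 'c::euclidean_space \<Rightarrow> 'd::euclidean_space"
  shows "bounded_bilinear prod \<Longrightarrow> open S \<Longrightarrow> Cinf S f \<Longrightarrow> Cinf S g \<Longrightarrow> Cinf S (\<lambda>x. prod (f x) (g x))"
  by (simp add: Cinf_def Ck_open_bilinear)

lemmas Cinf_scaleR = Cinf_bilinear[OF bounded_bilinear_scaleR]
lemmas Cinf_mult = Cinf_bilinear[OF bounded_bilinear_mult[where 'a = real]]
lemmas Cinf_inner = Cinf_bilinear[OF bounded_bilinear_inner]

lemma Cinf_compose: "open S \<Longrightarrow> open T \<Longrightarrow> Cinf S f \<Longrightarrow> Cinf T g \<Longrightarrow> f ` S \<subseteq> T \<Longrightarrow> Cinf S (\<lambda>x. g (f x))"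
  by (simp add: Cinf_def Ck_open_compose)

lemma Ck_open_Pair:
  fixes f :: "'a::euclidean_space \<Rightarrow> 'b::euclidean_space" and g :: "'a \<Rightarrow> 'c::euclidean_space"
  assumes "open S" "Ck_open k S f" "Ck_open k S g"
  shows "Ck_open k S (\<lambda>x. (f x, g x))"
proof -
  have "bounded_linear (\<lambda>a::'b. (a, 0::'c))" "bounded_linear (\<lambda>a::'c. (0::'b, a))"
    by (auto intro!: bounded_linear_Pair bounded_linear_ident bounded_linear_zero)
  from Ck_open_add[OF assms(1) Ck_open_linear[OF this(1) assms(1,2)] Ck_open_linear[OF this(2) assms(1,3)]]
  show ?thesis by simp
qed

lemma Cinf_Pair: "open S \<Longrightarrow> Cinf S f \<Longrightarrow> Cinf S g \<Longrightarrow> Cinf S (\<lambda>x. (f x, g x))"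
  by (simp add: Cinf_def Ck_open_Pair)

lemma Cinf_fst: "open S \<Longrightarrow> Cinf S f \<Longrightarrow> Cinf S (\<lambda>x. fst (f x))"
  and Cinf_snd: "open S \<Longrightarrow> Cinf S f \<Longrightarrow> Cinf S (\<lambda>x. snd (f x))"
  by (auto intro: Cinf_linear bounded_linear_fst bounded_linear_snd)

lemma Cinf_uminus: "open S \<Longrightarrow> Cinf S f \<Longrightarrow> Cinf S (\<lambda>x. - f x)"
  by (intro Cinf_linear[OF bounded_linear_minus[OF bounded_linear_ident]])

lemma Cinf_diff: "open S \<Longrightarrow> Cinf S f \<Longrightarrow> Cinf S g \<Longrightarrow> Cinf S (\<lambda>x. f x - g x)"
  using Cinf_add[OF _ _ Cinf_uminus, of S f g] by simp

lemmas Cinf_intros = Cinf_const Cinf_id Cinf_add Cinf_uminus Cinf_diff Cinf_sum Cinf_scaleR Cinf_mult Cinf_inner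
  Cinf_Pair Cinf_fst Cinf_snd

lemma smooth_on_open: "open S \<Longrightarrow> smooth_on S f \<longleftrightarrow> Cinf S f"
proof
  assume S: "open S" "smooth_on S f"
  show "Cinf S f"
  proof (rule Cinf_local)
    fix x assume "x \<in> S"
    with S(2) obtain T g where T: "open T" "x \<in> T" "Cinf T g" "\<forall>y\<in>S \<inter> T. g y = f y"
      unfolding smooth_on_def Cinf_def by blast
    have "Cinf (S \<inter> T) f"
      using T S(1) Cinf_mono by (intro Cinf_cong[of "S \<inter> T" g f]) (auto intro: Cinf_mono)
    with T S(1) \<open>x \<in> S\<close> show "\<exists>T. open T \<and> x \<in> T \<and> Cinf T f" by blast
  qed
next
  assume "open S" "Cinf S f"
  then show "smooth_on S f" unfolding smooth_on_def Cinf_def by blast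
qed

lemma smooth_onI:
  assumes "\<And>x. x \<in> S \<Longrightarrow> \<exists>T g. open T \<and> x \<in> T \<and> Cinf T g \<and> (\<forall>y\<in>S \<inter> T. g y = f y)"
  shows "smooth_on S f"
  using assms unfolding smooth_on_def Cinf_def by blast

lemma smooth_onD:
  assumes "smooth_on S f" "x \<in> S"
  obtains T g where "open T" "x \<in> T" "Cinf T g" "\<And>y. y \<in> S \<Longrightarrow> y \<in> T \<Longrightarrow> g y = f y"
proof -
  from assms obtain T g where "open T" "x \<in> T" "Cinf T g" "\<forall>y\<in>S \<inter> T. g y = f y"
    unfolding smooth_on_def Cinf_def by meson
  then show thesis by (intro that[of T g]) auto
qed

section \<open>Families of linear maps, differentiability from slopes, and the inverse function
  theorem\<close>

lemma continuous_on_linear_family: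
  fixes M :: "'x::topological_space \<Rightarrow> 'a::euclidean_space \<Rightarrow> 'b::real_normed_vector"
  assumes "\<And>x. x \<in> S \<Longrightarrow> linear (M x)" "\<And>b. b \<in> Basis \<Longrightarrow> continuous_on S (\<lambda>x. M x b)"
    "continuous_on S w"
  shows "continuous_on S (\<lambda>x. M x (w x))"
proof -
  have "M x (w x) = (\<Sum>b\<in>Basis. (w x \<bullet> b) *\<^sub>R M x b)" if "x \<in> S" for x
    using linear_sum[OF assms(1)[OF that], of "\<lambda>b. (w x \<bullet> b) *\<^sub>R b" Basis] assms(1)[OF that]
    by (simp only: euclidean_representation linear_scale)
  moreover have "continuous_on S (\<lambda>x. \<Sum>b\<in>Basis. (w x \<bullet> b) *\<^sub>R M x b)"
    using assms(2,3) by (intro continuous_intros)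
  ultimately show ?thesis by (simp cong: continuous_on_cong)
qed

lemma Ck_open_linear_family:
  fixes M :: "'x::euclidean_space \<Rightarrow> 'a::euclidean_space \<Rightarrow> 'b::euclidean_space"
  assumes "open S" "\<And>x. x \<in> S \<Longrightarrow> linear (M x)" "\<And>b. b \<in> Basis \<Longrightarrow> Ck_open k S (\<lambda>x. M x b)"
    "Ck_open k S w"
  shows "Ck_open k S (\<lambda>x. M x (w x))"
proof -
  have eq: "(\<Sum>b\<in>Basis. (w x \<bullet> b) *\<^sub>R M x b) = M x (w x)" if "x \<in> S" for x
    using linear_sum[OF assms(2)[OF that], of "\<lambda>b. (w x \<bullet> b) *\<^sub>R b" Basis] assms(2)[OF that]
    by (simp only: euclidean_representation linear_scale)
  have *: "Ck_open k S (\<lambda>x. \<Sum>b\<in>Basis. (w x \<bullet> b) *\<^sub>R M x b)"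
    using assms by (intro Ck_open_sum Ck_open_bilinear[OF bounded_bilinear_scaleR]
        Ck_open_linear[OF bounded_linear_inner_left])
  show ?thesis by (rule Ck_open_cong[OF assms(1) eq *])
qed

lemma Ck_open_frechet_linear: "Ck_open (Suc k) S f \<Longrightarrow> x \<in> S \<Longrightarrow> linear (frechet_derivative f (at x))"
  using Ck_open_Suc_has_derivative has_derivative_linear by blast

lemma Cinf_frechet_linear: "Cinf S f \<Longrightarrow> x \<in> S \<Longrightarrow> linear (frechet_derivative f (at x))"
  using Cinf_has_derivative has_derivative_linear by blast

lemma continuous_on_frechet:
  fixes f :: "'a::euclidean_space \<Rightarrow> 'b::euclidean_space"
  assumes "open S" "Ck_open (Suc 0) S f" "continuous_on T g" "continuous_on T w" "g ` T \<subseteq> S"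
  shows "continuous_on T (\<lambda>x. frechet_derivative f (at (g x)) (w x))"
proof (rule continuous_on_linear_family[OF _ _ assms(4)])
  show "linear (frechet_derivative f (at (g x)))" if "x \<in> T" for x
    using assms(5) that by (intro Ck_open_frechet_linear[OF assms(2)]) auto
  show "continuous_on T (\<lambda>x. frechet_derivative f (at (g x)) b)" for b
    using assms(2,5) by (intro continuous_on_compose2[OF _ assms(3), of S "\<lambda>y. frechet_derivative f (at y) b"]) auto
qed

text \<open>Fundamental theorem of calculus along the segment. The increment becomes an averaged
  linear map applied to \<open>x - x0\<close>: an exact identity that can be inverted or solved,
  unlike a first-order expansion with a remainder.\<close>

lemma hadamard:
  fixes f :: "'a::euclidean_space \<Rightarrow> 'b::euclidean_space"
  assumes "open S" "convex S" "Ck_open (Suc 0) S f" "x0 \<in> S" "x \<in> S"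
  shows "f x - f x0 = integral {0..1} (\<lambda>\<theta>. frechet_derivative f (at (x0 + \<theta> *\<^sub>R (x - x0))) (x - x0))"
proof -
  have S: "x0 + \<theta> *\<^sub>R (x - x0) \<in> S" if "\<theta> \<in> {0..1}" for \<theta>
  proof -
    have "x0 + \<theta> *\<^sub>R (x - x0) = (1 - \<theta>) *\<^sub>R x0 + \<theta> *\<^sub>R x" by (simp add: algebra_simps)
    then show ?thesis using that assms by (auto intro: convexD)
  qed
  have "((\<lambda>\<theta>. f (x0 + \<theta> *\<^sub>R (x - x0))) has_vector_derivative
      frechet_derivative f (at (x0 + \<theta> *\<^sub>R (x - x0))) (x - x0)) (at \<theta> within {0..1})"
    if "\<theta> \<in> {0..1}" for \<theta>
  proof -
    have "((\<lambda>\<theta>. x0 + \<theta> *\<^sub>R (x - x0)) has_derivative (\<lambda>h. h *\<^sub>R (x - x0))) (at \<theta> within {0..1})"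
      by (auto intro!: derivative_eq_intros)
    from has_derivative_compose[OF this Ck_open_Suc_has_derivative[OF assms(3) S[OF that]]]
    show ?thesis
      unfolding has_vector_derivative_def
      by (simp only: linear_scale[OF Ck_open_frechet_linear[OF assms(3) S[OF that]]])
  qed
  then have "((\<lambda>\<theta>. frechet_derivative f (at (x0 + \<theta> *\<^sub>R (x - x0))) (x - x0)) has_integral
      f (x0 + 1 *\<^sub>R (x - x0)) - f (x0 + 0 *\<^sub>R (x - x0))) {0..1}"
    by (intro fundamental_theorem_of_calculus) auto
  then show ?thesis by (simp add: integral_unique)
qed

text \<open>Caratheodory's criterion. The error is \<open>L x - L x0\<close> applied to the
  increment, so its quotient by the norm is bounded by the sum \<open>e\<close> of the differences
  on basis vectors, which tends to 0.\<close>

lemma caratheodory_derivative: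
  fixes f :: "'a::euclidean_space \<Rightarrow> 'b::real_normed_vector"
  assumes "open S" "x0 \<in> S" "\<And>x. x \<in> S \<Longrightarrow> linear (L x)"
    "\<And>x. x \<in> S \<Longrightarrow> f x - f x0 = L x (x - x0)"
    "\<And>b. b \<in> Basis \<Longrightarrow> isCont (\<lambda>x. L x b) x0"
  shows "(f has_derivative L x0) (at x0)"
proof -
  define e where "e x = (\<Sum>b\<in>Basis. norm (L x b - L x0 b))" for x
  have "isCont e x0"
    unfolding e_def using assms(5) by (intro continuous_intros)
  then have e: "(e \<longlongrightarrow> 0) (at x0)"
    unfolding isCont_def by (simp add: e_def)
  show ?thesis
  proof (rule has_derivativeI)
    show "bounded_linear (L x0)" using assms(2,3) by (simp add: linear_conv_bounded_linear)
    have bd: "norm ((f x - f x0 - L x0 (x - x0)) /\<^sub>R norm (x - x0)) \<le> e x" if "x \<in> S" for x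
    proof -
      have lin: "linear (\<lambda>w. L x w - L x0 w)"
        using assms(2,3) that by (intro linear_compose_sub)
      have "norm (f x - f x0 - L x0 (x - x0)) = norm (L x (x - x0) - L x0 (x - x0))"
        using assms(4)[OF that] by simp
      also have "L x (x - x0) - L x0 (x - x0) =
          (\<Sum>b\<in>Basis. ((x - x0) \<bullet> b) *\<^sub>R (L x b - L x0 b))"
        using linear_sum[OF lin, of "\<lambda>b. ((x - x0) \<bullet> b) *\<^sub>R b" Basis]
        by (simp only: euclidean_representation linear_scale[OF lin])
      also have "norm \<dots> \<le> (\<Sum>b\<in>Basis. norm (x - x0) * norm (L x b - L x0 b))"
      proof (rule order_trans[OF norm_sum], rule sum_mono)
        fix b :: 'a assume "b \<in> Basis"
        then show "norm (((x - x0) \<bullet> b) *\<^sub>R (L x b - L x0 b)) \<le> norm (x - x0) * norm (L x b - L x0 b)"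
          using Basis_le_norm[of b "x - x0"] by (simp add: mult_right_mono)
      qed
      also have "\<dots> = norm (x - x0) * e x" by (simp add: e_def sum_distrib_left)
      finally have "norm (f x - f x0 - L x0 (x - x0)) \<le> norm (x - x0) * e x" .
      moreover have "0 \<le> e x" by (auto simp: e_def intro: sum_nonneg)
      ultimately show ?thesis
        by (cases "x = x0") (simp_all add: inverse_eq_divide pos_divide_le_eq mult.commute)
    qed
    show "((\<lambda>x. (f x - f x0 - L x0 (x - x0)) /\<^sub>R norm (x - x0)) \<longlongrightarrow> 0) (at x0)"
    proof (rule Lim_null_comparison[OF _ e])
      have "eventually (\<lambda>x. x \<in> S) (at x0)"
        using assms(1,2) by (simp add: eventually_at_topological) blast
      then show "\<forall>\<^sub>F x in at x0. norm ((f x - f x0 - L x0 (x - x0)) /\<^sub>R norm (x - x0)) \<le> e x"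
        by (rule eventually_mono) (rule bd)
    qed
  qed
qed

text \<open>Invertibility persists quantitatively: near \<open>x0\<close> the maps are bounded below
  by half the lower bound of \<open>M x0\<close>, so the error of the solution is at most
  \<open>2 / c\<close> times the residual \<open>v x - M x y0\<close> of the fixed vector
  \<open>y0\<close>.\<close>

lemma isCont_inv_linear:
  fixes M :: "'x::t2_space \<Rightarrow> 'a::euclidean_space \<Rightarrow> 'a"
  assumes "open S" "x0 \<in> S" "\<And>x. x \<in> S \<Longrightarrow> linear (M x)" "\<And>x. x \<in> S \<Longrightarrow> bij (M x)"
    "\<And>b. b \<in> Basis \<Longrightarrow> continuous_on S (\<lambda>x. M x b)" "isCont v x0"
  shows "isCont (\<lambda>x. inv (M x) (v x)) x0"
proof -
  define e where "e x = (\<Sum>b\<in>Basis. norm (M x b - M x0 b))" for x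
  have "isCont e x0"
    unfolding e_def using assms(1,2,5)
    by (intro continuous_intros) (metis continuous_on_eq_continuous_at)
  then have e: "(e \<longlongrightarrow> 0) (at x0)"
    unfolding isCont_def by (simp add: e_def)
  obtain c where c: "c > 0" "\<And>w. c * norm w \<le> norm (M x0 w)"
    using linear_inj_bounded_below_pos[OF assms(3)[OF assms(2)]] assms(4)[OF assms(2)] bij_is_inj by metis
  have bd: "c / 2 * norm w \<le> norm (M x w)" if "x \<in> S" "e x < c / 2" for x w
  proof -
    have lin: "linear (\<lambda>w. M x w - M x0 w)"
      using assms(2,3) that by (intro linear_compose_sub)
    have "M x w - M x0 w = (\<Sum>b\<in>Basis. (w \<bullet> b) *\<^sub>R (M x b - M x0 b))"
      using linear_sum[OF lin, of "\<lambda>b. (w \<bullet> b) *\<^sub>R b" Basis]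
      by (simp only: euclidean_representation linear_scale[OF lin])
    also have "norm \<dots> \<le> (\<Sum>b\<in>Basis. norm w * norm (M x b - M x0 b))"
    proof (rule order_trans[OF norm_sum], rule sum_mono)
      fix b :: 'a assume "b \<in> Basis"
      then show "norm ((w \<bullet> b) *\<^sub>R (M x b - M x0 b)) \<le> norm w * norm (M x b - M x0 b)"
        using Basis_le_norm[of b w] by (simp add: mult_right_mono)
    qed
    also have "\<dots> = norm w * e x" by (simp add: e_def sum_distrib_left)
    also have "\<dots> \<le> norm w * (c / 2)" using that by (intro mult_left_mono) auto
    finally have "norm (M x w - M x0 w) \<le> c / 2 * norm w" by (simp add: mult.commute)
    moreover have "norm (M x0 w) \<le> norm (M x w) + norm (M x w - M x0 w)"
      by (metis norm_minus_commute norm_triangle_sub add.commute)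
    ultimately show ?thesis using c(2)[of w] by (simp add: field_simps)
  qed
  define y0 where "y0 = inv (M x0) (v x0)"
  have "isCont (\<lambda>x. M x y0) x0"
  proof -
    have "continuous_on S (\<lambda>x. M x y0)"
      using assms(3,5) by (rule continuous_on_linear_family[OF _ _ continuous_on_const])
    then show ?thesis using assms(1,2) by (simp add: continuous_on_eq_continuous_at)
  qed
  then have "isCont (\<lambda>x. 2 / c * norm (v x - M x y0)) x0"
    using assms(6) by (intro continuous_intros)
  moreover have "M x0 y0 = v x0"
    unfolding y0_def using assms(4)[OF assms(2)] by (meson bij_inv_eq_iff)
  ultimately have lim: "((\<lambda>x. 2 / c * norm (v x - M x y0)) \<longlongrightarrow> 0) (at x0)"
    unfolding isCont_def by simp
  have "((\<lambda>x. inv (M x) (v x) - y0) \<longlongrightarrow> 0) (at x0)"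
  proof (rule Lim_null_comparison[OF _ lim])
    have "eventually (\<lambda>x. x \<in> S) (at x0)"
      using assms(1,2) by (simp add: eventually_at_topological) blast
    moreover have "eventually (\<lambda>x. e x < c / 2) (at x0)"
      using order_tendstoD(2)[OF e, of "c / 2"] c(1) by simp
    ultimately show "\<forall>\<^sub>F x in at x0. norm (inv (M x) (v x) - y0) \<le> 2 / c * norm (v x - M x y0)"
    proof eventually_elim
      fix x assume x: "x \<in> S" "e x < c / 2"
      have "M x (inv (M x) (v x)) = v x" using assms(4)[OF x(1)] by (meson bij_inv_eq_iff)
      then have eq: "M x (inv (M x) (v x) - y0) = v x - M x y0"
        using assms(3)[OF x(1)] by (simp add: linear_diff)
      show "norm (inv (M x) (v x) - y0) \<le> 2 / c * norm (v x - M x y0)"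
        using bd[OF x, of "inv (M x) (v x) - y0", unfolded eq] c(1) by (simp add: field_simps)
    qed
  qed
  then show ?thesis unfolding isCont_def y0_def by (simp add: LIM_zero_cancel)
qed

text \<open>For \<open>y x = inv (M x) (v x)\<close> the derivative is \<open>inv (M x)\<close>
  applied to the derivative of \<open>v\<close> minus that of \<open>M\<close> evaluated at
  \<open>y x\<close>. This has the same shape with one order of smoothness less, hence the induction
  on \<open>k\<close> for all \<open>v\<close> at once. Differentiability of \<open>y\<close> comes
  from an exact slope formula and \<open>caratheodory_derivative\<close>.\<close>

lemma Ck_open_inv_linear:
  fixes M :: "'x::euclidean_space \<Rightarrow> 'a::euclidean_space \<Rightarrow> 'a"
  assumes S: "open S" and lin: "\<And>x. x \<in> S \<Longrightarrow> linear (M x)" and bij: "\<And>x. x \<in> S \<Longrightarrow> bij (M x)"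
    and M: "\<And>b. Ck_open k S (\<lambda>x. M x b)" and v: "Ck_open k S v"
  shows "Ck_open k S (\<lambda>x. inv (M x) (v x))"
  using M v
proof (induction k arbitrary: v)
  case 0
  show ?case
    using 0 S lin bij isCont_inv_linear[OF S _ lin bij]
    by (auto intro!: continuous_at_imp_continuous_on simp: continuous_on_eq_continuous_at)
next
  case (Suc k)
  have M': "Ck_open k S (\<lambda>x. M x b)" and v': "Ck_open k S v" for b
    using Suc.prems Ck_open_Suc_D by blast+
  define y where "y x = inv (M x) (v x)" for x
  have y: "Ck_open k S y" unfolding y_def by (rule Suc.IH[OF M' v'])
  have linM': "linear (\<lambda>w. frechet_derivative (\<lambda>x. M x w) (at x) h)" if "x \<in> S" for x h
  proof (rule linearI)
    fix a b c
    have 1: "((\<lambda>x. M x a + M x b) has_derivative (\<lambda>h. frechet_derivative (\<lambda>x. M x a) (at x) h +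
        frechet_derivative (\<lambda>x. M x b) (at x) h)) (at x)"
      by (intro has_derivative_add Ck_open_Suc_has_derivative[OF Suc.prems(1) that])
    have "((\<lambda>x. M x (a + b)) has_derivative (\<lambda>h. frechet_derivative (\<lambda>x. M x a) (at x) h +
        frechet_derivative (\<lambda>x. M x b) (at x) h)) (at x)"
      by (rule has_derivative_transform_within_open[OF 1 S that]) (simp add: lin linear_add)
    from frechet_derivative_at[OF this, symmetric]
    show "frechet_derivative (\<lambda>x. M x (a + b)) (at x) h =
        frechet_derivative (\<lambda>x. M x a) (at x) h + frechet_derivative (\<lambda>x. M x b) (at x) h" by simp
    have 1: "((\<lambda>x. c *\<^sub>R M x b) has_derivative (\<lambda>h. c *\<^sub>R frechet_derivative (\<lambda>x. M x b) (at x) h)) (at x)"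
      by (intro has_derivative_scaleR_right Ck_open_Suc_has_derivative[OF Suc.prems(1) that])
    have "((\<lambda>x. M x (c *\<^sub>R b)) has_derivative (\<lambda>h. c *\<^sub>R frechet_derivative (\<lambda>x. M x b) (at x) h)) (at x)"
      by (rule has_derivative_transform_within_open[OF 1 S that]) (simp add: lin linear_scale)
    from frechet_derivative_at[OF this, symmetric]
    show "frechet_derivative (\<lambda>x. M x (c *\<^sub>R b)) (at x) h =
        c *\<^sub>R frechet_derivative (\<lambda>x. M x b) (at x) h" by simp
  qed
  have "Ck_open (Suc k) S y"
  proof (rule Ck_open_SucI[OF S])
    fix x0 assume x0: "x0 \<in> S"
    then obtain r where r: "r > 0" "ball x0 r \<subseteq> S" using S open_contains_ball by blast
    \<comment> \<open>Freezing \<open>y\<close> at \<open>x0\<close> gives a function as smooth as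
      \<open>M\<close> and \<open>v\<close>, although \<open>y\<close> is so far only of class
      \<open>k\<close>. Since \<open>q x = M x (y x - y x0)\<close>, the averaged derivative
      \<open>K\<close> of \<open>q\<close> becomes a slope of \<open>y\<close> once
      \<open>M x\<close> is inverted.\<close>
    define q where "q x = v x - M x (y x0)" for x
    have qk: "Ck_open (Suc k) S q"
      unfolding q_def diff_conv_add_uminus
      using Suc.prems by (intro Ck_open_add S Ck_open_linear[OF bounded_linear_minus[OF bounded_linear_ident]]) auto
    then have q1: "Ck_open (Suc 0) S q"
      by (induction k) (use Ck_open_Suc_D in blast)+
    define K where "K x h = integral {0..1} (\<lambda>\<theta>. frechet_derivative q (at (x0 + \<theta> *\<^sub>R (x - x0))) h)" for x h
    have inS: "x0 + \<theta> *\<^sub>R (x - x0) \<in> ball x0 r" if "x \<in> ball x0 r" "\<theta> \<in> {0..1}" for x \<theta>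
    proof -
      have "norm (\<theta> *\<^sub>R (x - x0)) \<le> norm (x - x0)" using that by (auto intro: mult_left_le_one_le)
      then show ?thesis using that by (simp add: dist_norm norm_minus_commute)
    qed
    have int: "(\<lambda>\<theta>. frechet_derivative q (at (x0 + \<theta> *\<^sub>R (x - x0))) h) integrable_on {0..1}"
      if "x \<in> ball x0 r" for x h
      using inS[OF that] r
      by (intro integrable_continuous_real continuous_on_frechet[OF S q1]) (auto intro!: continuous_intros)
    have Klin: "linear (K x)" if x: "x \<in> ball x0 r" for x
    proof (rule linearI)
      fix a b c
      have l: "linear (frechet_derivative q (at (x0 + \<theta> *\<^sub>R (x - x0))))" if "\<theta> \<in> {0..1}" for \<theta>
        using inS[OF x that] r by (intro Ck_open_frechet_linear[OF q1]) auto
      show "K x (a + b) = K x a + K x b"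
        unfolding K_def integral_add[OF int[OF x] int[OF x], symmetric]
        by (rule integral_cong) (simp add: l linear_add)
      show "K x (c *\<^sub>R b) = c *\<^sub>R K x b"
        unfolding K_def integral_cmul[symmetric]
        by (rule integral_cong) (simp add: l linear_scale)
    qed
    have Kcont: "isCont (\<lambda>x. K x b) x0" for b
    proof -
      have "continuous_on (ball x0 r) (\<lambda>x. integral (cbox 0 1) (\<lambda>\<theta>. frechet_derivative q (at (x0 + \<theta> *\<^sub>R (x - x0))) b))"
      proof (rule integral_continuous_on_param)
        show "continuous_on (ball x0 r \<times> cbox 0 1) (\<lambda>(x, \<theta>). frechet_derivative q (at (x0 + \<theta> *\<^sub>R (x - x0))) b)"
          unfolding case_prod_unfold using inS r
          by (intro continuous_on_frechet[OF S q1]) (fastforce intro!: continuous_intros)+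
      qed
      then show ?thesis unfolding K_def using r
        by (simp add: continuous_on_eq_continuous_at)
    qed
    have My: "M x (y x) = v x" if "x \<in> S" for x
      unfolding y_def using bij[OF that] by (meson bij_inv_eq_iff)
    have "(y has_derivative (\<lambda>h. inv (M x0) (K x0 h))) (at x0)"
    proof (rule caratheodory_derivative[of "ball x0 r" x0 "\<lambda>x h. inv (M x) (K x h)"])
      show "linear (\<lambda>h. inv (M x) (K x h))" if "x \<in> ball x0 r" for x
      proof -
        have "linear (inv (M x))"
          using that r lin bij by (intro inj_linear_imp_inv_linear bij_is_inj) auto
        from linear_compose[OF Klin[OF that] this] show ?thesis by (simp add: o_def)
      qed
      show "y x - y x0 = inv (M x) (K x (x - x0))" if "x \<in> ball x0 r" for x
      proof -
        have xS: "x \<in> S" using that r by auto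
        have "q x - q x0 = K x (x - x0)"
          unfolding K_def using r that
          by (intro hadamard[of "ball x0 r"] Ck_open_mono[OF q1]) auto
        moreover have "q x0 = 0" unfolding q_def using My[OF x0] by simp
        moreover have "q x = M x (y x - y x0)"
          unfolding q_def using My[OF xS] lin[OF xS] by (simp add: linear_diff)
        ultimately have "M x (y x - y x0) = K x (x - x0)" by simp
        then show ?thesis using bij[OF xS] by (metis bij_inv_eq_iff)
      qed
      show "isCont (\<lambda>x. inv (M x) (K x b)) x0" for b
        by (rule isCont_inv_linear[OF S x0 lin bij Ck_open_continuous[OF M'] Kcont])
    qed (use r in auto)
    moreover have "K x0 h = frechet_derivative v (at x0) h - frechet_derivative (\<lambda>x. M x (y x0)) (at x0) h" for h
    proof -
      have "(q has_derivative (\<lambda>h. frechet_derivative v (at x0) h - frechet_derivative (\<lambda>x. M x (y x0)) (at x0) h)) (at x0)"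
        unfolding q_def
        by (intro has_derivative_diff Ck_open_Suc_has_derivative[OF Suc.prems(1) x0]
            Ck_open_Suc_has_derivative[OF Suc.prems(2) x0])
      from frechet_derivative_at[OF this, symmetric] show ?thesis by (simp add: K_def)
    qed
    ultimately show "(y has_derivative (\<lambda>h. inv (M x0) (frechet_derivative v (at x0) h -
        frechet_derivative (\<lambda>x. M x (y x0)) (at x0) h))) (at x0)" by simp
  next
    fix h
    have 1: "Ck_open k S (\<lambda>x. frechet_derivative (\<lambda>x'. M x' (y x)) (at x) h)"
    proof (rule Ck_open_linear_family[OF S linM' _ y])
      show "Ck_open k S (\<lambda>x. frechet_derivative (\<lambda>x'. M x' b) (at x) h)" for b
        using Suc.prems(1)[of b] by simp
    qed
    have 2: "Ck_open k S (\<lambda>x. frechet_derivative v (at x) h)" using Suc.prems(2) by simp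
    have "Ck_open k S (\<lambda>x. frechet_derivative v (at x) h - frechet_derivative (\<lambda>x'. M x' (y x)) (at x) h)"
      using Ck_open_add[OF S 2 Ck_open_linear[OF bounded_linear_minus[OF bounded_linear_ident] S 1]] by simp
    then show "Ck_open k S (\<lambda>x. inv (M x) (frechet_derivative v (at x) h -
        frechet_derivative (\<lambda>x'. M x' (y x)) (at x) h))"
      by (rule Suc.IH[OF M'])
  qed
  then show ?case unfolding y_def .
qed

text \<open>The derivative of the local inverse is the inverse of the derivative of \<open>f\<close>
  at \<open>g y\<close>, so \<open>Ck_open_inv_linear\<close> raises the class of \<open>g\<close>
  by one at each step.\<close>

lemma Cinf_inverse_function:
  fixes f :: "'a::euclidean_space \<Rightarrow> 'a"
  assumes U: "open U" and f: "Cinf U f" and x0: "x0 \<in> U" and inj: "inj (frechet_derivative f (at x0))"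
  obtains U' V g where "open U'" "U' \<subseteq> U" "x0 \<in> U'" "open V" "f x0 \<in> V" "homeomorphism U' V f g"
    "Cinf V g"
proof -
  define f' where "f' x = Blinfun (frechet_derivative f (at x))" for x
  have f': "blinfun_apply (f' x) = frechet_derivative f (at x)" if "x \<in> U" for x
    unfolding f'_def using Cinf_has_derivative[OF f that]
    by (simp add: bounded_linear_Blinfun_apply has_derivative_bounded_linear)
  have der: "(f has_derivative blinfun_apply (f' x)) (at x)" if "x \<in> U" for x
    using Cinf_has_derivative[OF f that] f'[OF that] by simp
  have cont: "continuous_on U f'"
  proof (rule continuous_on_blinfun_componentwise)
    fix i :: 'a
    have "continuous_on U (\<lambda>x. frechet_derivative f (at x) i)"
      using Cinf_continuous[OF Cinf_derivative[OF f]] .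
    then show "continuous_on U (\<lambda>x. blinfun_apply (f' x) i)"
      by (simp add: f' cong: continuous_on_cong)
  qed
  have lin: "linear (frechet_derivative f (at x0))" using Cinf_frechet_linear[OF f x0] .
  then obtain h where h: "linear h" "h \<circ> frechet_derivative f (at x0) = id"
    using linear_injective_left_inverse[OF lin inj] by metis
  define invf where "invf = Blinfun h"
  have "invf o\<^sub>L f' x0 = id_blinfun"
  proof (rule blinfun_eqI)
    fix i
    have "h (frechet_derivative f (at x0) i) = i" using h(2) by (metis comp_apply id_apply)
    then show "blinfun_apply (invf o\<^sub>L f' x0) i = blinfun_apply id_blinfun i"
      using h(1) by (simp add: invf_def f'[OF x0] bounded_linear_Blinfun_apply linear_conv_bounded_linear)
  qed
  from inverse_function_theorem[OF U der cont x0 this]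
  obtain U' V g g' where *: "open U'" "U' \<subseteq> U" "x0 \<in> U'" "open V" "f x0 \<in> V" "homeomorphism U' V f g"
    and g: "\<And>y. y \<in> V \<Longrightarrow> (g has_derivative (g' y)) (at y)"
    and g': "\<And>y. y \<in> V \<Longrightarrow> g' y = inv (blinfun_apply (f' (g y)))"
    and bij: "\<And>y. y \<in> V \<Longrightarrow> bij (blinfun_apply (f' (g y)))"
    by metis
  have gU: "g y \<in> U" if "y \<in> V" for y
    using *(2,6) that by (auto simp: homeomorphism_def)
  have "Ck_open k V g" for k
  proof (induction k)
    case 0
    then show ?case using *(6) by (simp add: homeomorphism_def)
  next
    case (Suc k)
    show ?case
    proof (rule Ck_open_SucI[OF \<open>open V\<close> g])
      fix v
      have "Ck_open k V (\<lambda>y. inv (frechet_derivative f (at (g y))) v)"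
      proof (rule Ck_open_inv_linear[OF \<open>open V\<close>])
        show "linear (frechet_derivative f (at (g y)))" if "y \<in> V" for y
          using Cinf_frechet_linear[OF f gU[OF that]] .
        show "bij (frechet_derivative f (at (g y)))" if "y \<in> V" for y
          using bij[OF that] f'[OF gU[OF that]] by simp
        show "Ck_open k V (\<lambda>y. frechet_derivative f (at (g y)) b)" for b
          using Cinf_derivative[OF f] gU unfolding Cinf_def
          by (intro Ck_open_compose[OF \<open>open V\<close> U Suc]) auto
      qed (rule Ck_open_const[OF \<open>open V\<close>])
      then show "Ck_open k V (\<lambda>x. g' x v)"
        by (rule Ck_open_cong[OF \<open>open V\<close>, rotated]) (simp add: g' f'[OF gU])
    qed
  qed
  then have "Cinf V g" by (simp add: Cinf_def)
  with * show thesis using that by blast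
qed

section \<open>Integrals depending on a parameter and the symmetry of second derivatives\<close>

lemma partial_has_derivative:
  assumes "(g has_derivative g') (at (r, p))"
  shows "((\<lambda>p. g (r, p)) has_derivative (\<lambda>v. g' (0, v))) (at p)"
proof -
  have "((\<lambda>p. (r, p)) has_derivative (\<lambda>v. (0, v))) (at p)"
    by (auto intro!: derivative_eq_intros)
  from has_derivative_compose[OF this assms] show ?thesis .
qed

text \<open>Leibniz rule on a closed interval. The integrand is given on an open set
  \<open>W\<close> around \<open>{0..1} \<times> P\<close> because the classes
  \<open>Ck_open\<close> are meaningful only on open sets.\<close>

lemma integral_has_derivative:
  fixes g :: "real \<times> 'p::euclidean_space \<Rightarrow> 'b::euclidean_space"
  assumes P: "open P" and W: "open W" "{0..1} \<times> P \<subseteq> W" and g: "Ck_open (Suc 0) W g" and p0: "p0 \<in> P"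
  shows "((\<lambda>p. integral {0..1} (\<lambda>r. g (r, p))) has_derivative
        (\<lambda>v. integral {0..1} (\<lambda>r. frechet_derivative g (at (r, p0)) (0, v)))) (at p0)"
proof -
  have inW: "(r, p) \<in> W" if "r \<in> {0..1}" "p \<in> P" for r p using W(2) that by auto
  have g0: "continuous_on W g" using Ck_open_continuous[OF g] .
    obtain e where e: "e > 0" "ball p0 e \<subseteq> P" using P p0 open_contains_ball by blast
    define fx where "fx p r = Blinfun (\<lambda>v. frechet_derivative g (at (r, p)) (0, v))" for p r
    have pd: "((\<lambda>p. g (r, p)) has_derivative (\<lambda>v. frechet_derivative g (at (r, p)) (0, v))) (at p)"
      if "r \<in> {0..1}" "p \<in> P" for r p
      by (rule partial_has_derivative[OF Ck_open_Suc_has_derivative[OF g inW[OF that]]])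
    have fx: "blinfun_apply (fx p r) = (\<lambda>v. frechet_derivative g (at (r, p)) (0, v))"
      if "r \<in> {0..1}" "p \<in> P" for r p
      unfolding fx_def using pd[OF that]
      by (simp add: bounded_linear_Blinfun_apply has_derivative_bounded_linear)
    have cfx: "continuous_on (ball p0 e \<times> {0..1}) (\<lambda>(p, r). fx p r)"
    proof (rule continuous_on_blinfun_componentwise)
      fix i :: 'p
      have "continuous_on (ball p0 e \<times> {0..1}) (\<lambda>x. frechet_derivative g (at (snd x, fst x)) (0, i))"
        using e inW by (intro continuous_on_frechet[OF W(1) g]) (auto intro!: continuous_intros)
      moreover have "frechet_derivative g (at (snd x, fst x)) (0, i) = blinfun_apply (case x of (p, r) \<Rightarrow> fx p r) i"
        if "x \<in> ball p0 e \<times> {0..1}" for x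
        using that e fx by (cases x) (simp add: subset_iff)
      ultimately show "continuous_on (ball p0 e \<times> {0..1}) (\<lambda>x. blinfun_apply (case x of (p, r) \<Rightarrow> fx p r) i)"
        using continuous_on_cong by (metis (no_types, lifting))
    qed
    have ci: "continuous_on {0..1} (fx p0)"
      using e by (intro continuous_on_compose2[OF cfx, of _ "\<lambda>r. (p0, r)", simplified])
        (auto intro!: continuous_intros)
    have "((\<lambda>p. integral (cbox 0 1) (\<lambda>r. g (r, p))) has_derivative
        integral (cbox 0 1) (fx p0)) (at p0 within ball p0 e)"
    proof (rule leibniz_rule)
      fix p r assume "p \<in> ball p0 e" "r \<in> cbox (0::real) 1"
      then show "((\<lambda>p. g (r, p)) has_derivative blinfun_apply (fx p r)) (at p within ball p0 e)"
        using e pd[of r p] fx[of r p] by (auto simp: subset_iff intro: has_derivative_at_withinI)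
    next
      fix p assume "p \<in> ball p0 e"
      then show "(\<lambda>r. g (r, p)) integrable_on cbox 0 1"
        using e inW
        by (intro integrable_continuous continuous_on_compose2[OF g0])
           (auto intro!: continuous_intros)
    qed (use e cfx in auto)
    moreover have "at p0 within ball p0 e = at p0"
      using e by (intro at_within_open) auto
    moreover have "blinfun_apply (integral (cbox 0 1) (fx p0)) =
        (\<lambda>v. integral {0..1} (\<lambda>r. frechet_derivative g (at (r, p0)) (0, v)))"
    proof
      fix v
      have "blinfun_apply (integral {0..1} (fx p0)) v = integral {0..1} (\<lambda>r. blinfun_apply (fx p0 r) v)"
        using ci by (intro blinfun_apply_integral integrable_continuous_real)
      also have "\<dots> = integral {0..1} (\<lambda>r. frechet_derivative g (at (r, p0)) (0, v))"
        using p0 by (intro integral_cong) (simp add: fx)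
      finally show "blinfun_apply (integral (cbox 0 1) (fx p0)) v = \<dots>" by simp
    qed
    ultimately show ?thesis by simp
qed

text \<open>The derivative is again an integral of the same kind, with integrand the derivative of
  \<open>g\<close> in a direction \<open>(0, v)\<close>, so the induction runs over all
  integrands.\<close>

lemma Ck_open_integral:
  fixes g :: "real \<times> 'p::euclidean_space \<Rightarrow> 'b::euclidean_space"
  assumes P: "open P" and W: "open W" "{0..1} \<times> P \<subseteq> W" and g: "Ck_open k W g"
  shows "Ck_open k P (\<lambda>p. integral {0..1} (\<lambda>r. g (r, p)))"
  using g
proof (induction k arbitrary: g)
  case 0
  then have "continuous_on (P \<times> cbox 0 1) (\<lambda>(p, r). g (r, p))"
    unfolding case_prod_unfold using W(2)
    by (intro continuous_on_compose2[of W g _ "\<lambda>x. (snd x, fst x)"]) (auto intro!: continuous_intros)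
  from integral_continuous_on_param[OF this] show ?case by simp
next
  case (Suc k)
  have g1: "Ck_open (Suc 0) W g"
    using Suc.prems by (induction k) (use Ck_open_Suc_D in blast)+
  show ?case
  proof (rule Ck_open_SucI[OF P integral_has_derivative[OF P W g1]])
    fix v
    show "Ck_open k P (\<lambda>p. integral {0..1} (\<lambda>r. frechet_derivative g (at (r, p)) (0, v)))"
      using Suc.prems by (intro Suc.IH) simp
  qed
qed

text \<open>Differentiating \<open>f(x + sa) - f(x) = s \<integral> D\<^sub>af(x + rsa) dr\<close> in the direction \<open>b\<close> in two ways shows
  that the integrals of \<open>D\<^sub>bD\<^sub>af\<close> and \<open>D\<^sub>aD\<^sub>bf\<close> over short segments agree.\<close>

lemma frechet_derivative_commute:
  fixes f :: "'a::euclidean_space \<Rightarrow> 'b::euclidean_space"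
  assumes S: "open S" and f: "Cinf S f" and x: "x \<in> S"
  shows "frechet_derivative (\<lambda>x. frechet_derivative f (at x) a) (at x) b =
         frechet_derivative (\<lambda>x. frechet_derivative f (at x) b) (at x) a"
proof -
  define D where "D v x = frechet_derivative f (at x) v" for v x
  define DD where "DD v w x = frechet_derivative (D v) (at x) w" for v w x
  have D: "Cinf S (D v)" for v unfolding D_def using Cinf_derivative[OF f] .
  have DD: "Cinf S (DD v w)" for v w unfolding DD_def using Cinf_derivative[OF D] .
  obtain e where e: "e > 0" "ball x e \<subseteq> S" using S x open_contains_ball by blast
  \<comment> \<open>Keeps the displacements \<open>(r * s) *\<^sub>R a\<close> of length at most
    \<open>e / 2\<close>; the added 1 covers \<open>a = 0\<close>.\<close>
  define d where "d = e / (2 * (norm a + 1))"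
  have d: "d > 0" using e by (simp add: d_def add_nonneg_pos)
  have near: "y + (r * s) *\<^sub>R a \<in> ball x e" if "y \<in> ball x (e / 2)" "\<bar>r\<bar> \<le> 1" "\<bar>s\<bar> < d" for y r s
  proof -
    have "norm ((r * s) *\<^sub>R a) \<le> d * norm a"
      using that by (auto simp: abs_mult intro!: mult_mono mult_left_le_one_le) (metis abs_ge_zero less_imp_le mult_mono' mult_1)
    also have "\<dots> \<le> d * (norm a + 1)" using d by simp
    also have "\<dots> = e / 2" using add_nonneg_pos[OF norm_ge_zero[of a] zero_less_one] by (simp add: d_def field_simps)
    finally show ?thesis using that(1) norm_triangle_ineq4[of "x - y" "(r * s) *\<^sub>R a"]
      by (simp add: dist_norm algebra_simps)
  qed
  have key: "integral {0..1} (\<lambda>r. DD a b (x + (r * s) *\<^sub>R a)) = integral {0..1} (\<lambda>r. DD b a (x + (r * s) *\<^sub>R a))"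
    if s: "\<bar>s\<bar> < d" "s \<noteq> 0" for s
  proof -
    have had: "h (y + s *\<^sub>R a) - h y = s *\<^sub>R integral {0..1} (\<lambda>r. frechet_derivative h (at (y + (r * s) *\<^sub>R a)) a)"
      if h: "Cinf S h" and y: "y \<in> ball x (e / 2)" for h :: "'a \<Rightarrow> 'b" and y
    proof -
      have "h (y + s *\<^sub>R a) - h y = integral {0..1} (\<lambda>r. frechet_derivative h (at (y + r *\<^sub>R (y + s *\<^sub>R a - y))) (y + s *\<^sub>R a - y))"
        using near[OF y, of 1 s] near[OF y, of 0 s] s e(2)
        by (intro hadamard[of "ball x e"] Ck_open_mono[OF h[unfolded Cinf_def, rule_format] e(2)]) auto
      also have "\<dots> = integral {0..1} (\<lambda>r. s *\<^sub>R frechet_derivative h (at (y + (r * s) *\<^sub>R a)) a)"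
      proof (rule integral_cong)
        fix r :: real assume r: "r \<in> {0..1}"
        have "y + (r * s) *\<^sub>R a \<in> S" using near[OF y, of r s] r s e(2) by auto
        then show "frechet_derivative h (at (y + r *\<^sub>R (y + s *\<^sub>R a - y))) (y + s *\<^sub>R a - y) =
            s *\<^sub>R frechet_derivative h (at (y + (r * s) *\<^sub>R a)) a"
          using Cinf_frechet_linear[OF h] by (simp add: linear_scale)
      qed
      finally show ?thesis by (simp add: integral_cmul)
    qed
    have x2: "x \<in> ball x (e / 2)" using e by simp
    define W where "W = (\<lambda>p. snd p + (fst p * s) *\<^sub>R a) -` S"
    have openW: "open W" unfolding W_def by (intro open_vimage S) (auto intro!: continuous_intros)
    have WW: "{0..1} \<times> ball x (e / 2) \<subseteq> W"
      unfolding W_def using near s e(2) by fastforce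
    define G where "G = (\<lambda>p. D a (snd p + (fst p * s) *\<^sub>R a))"
    have inner: "Cinf W (\<lambda>p. snd p + (fst p * s) *\<^sub>R a)"
      by (intro Cinf_intros openW)
    have G: "Cinf W G" unfolding G_def
      by (rule Cinf_compose[OF openW S inner D]) (auto simp: W_def)
    have "((\<lambda>y. f (y + s *\<^sub>R a) - f y) has_derivative (\<lambda>v. s *\<^sub>R integral {0..1} (\<lambda>r. frechet_derivative G (at (r, x)) (0, v)))) (at x)"
    proof (rule has_derivative_transform_within_open)
      show "((\<lambda>y. s *\<^sub>R integral {0..1} (\<lambda>r. G (r, y))) has_derivative (\<lambda>v. s *\<^sub>R integral {0..1} (\<lambda>r. frechet_derivative G (at (r, x)) (0, v)))) (at x)"
        using integral_has_derivative[OF open_ball openW WW _ x2, of G] G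
        unfolding Cinf_def by (intro has_derivative_scaleR_right) blast
      show "s *\<^sub>R integral {0..1} (\<lambda>r. G (r, y)) = f (y + s *\<^sub>R a) - f y" if "y \<in> ball x (e / 2)" for y
        using had[OF f that] by (simp add: G_def D_def)
    qed (use x2 in auto)
    moreover have "((\<lambda>y. f (y + s *\<^sub>R a) - f y) has_derivative (\<lambda>v. D v (x + s *\<^sub>R a) - D v x)) (at x)"
    proof -
      have *: "(f has_derivative (\<lambda>v. D v (x + s *\<^sub>R a))) (at (x + s *\<^sub>R a))"
        unfolding D_def using near[OF x2, of 1 s] s e(2) by (intro Cinf_has_derivative[OF f]) auto
      have "((\<lambda>y. y + s *\<^sub>R a) has_derivative (\<lambda>v. v)) (at x)" by (auto intro!: derivative_eq_intros)
      from has_derivative_compose[OF this *] show ?thesis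
        unfolding D_def by (intro has_derivative_diff Cinf_has_derivative[OF f x])
    qed
    ultimately have "(\<lambda>v. s *\<^sub>R integral {0..1} (\<lambda>r. frechet_derivative G (at (r, x)) (0, v))) = (\<lambda>v. D v (x + s *\<^sub>R a) - D v x)"
      by (rule has_derivative_unique)
    then have "s *\<^sub>R integral {0..1} (\<lambda>r. frechet_derivative G (at (r, x)) (0, b)) = D b (x + s *\<^sub>R a) - D b x"
      by (rule fun_cong)
    also have "\<dots> = s *\<^sub>R integral {0..1} (\<lambda>r. DD b a (x + (r * s) *\<^sub>R a))"
      unfolding DD_def by (rule had[OF D x2])
    finally have "integral {0..1} (\<lambda>r. frechet_derivative G (at (r, x)) (0, b)) = integral {0..1} (\<lambda>r. DD b a (x + (r * s) *\<^sub>R a))"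
      using s by simp
    moreover have "integral {0..1} (\<lambda>r. frechet_derivative G (at (r, x)) (0, b)) = integral {0..1} (\<lambda>r. DD a b (x + (r * s) *\<^sub>R a))"
    proof (rule integral_cong)
      fix r :: real assume r: "r \<in> {0..1}"
      then have "x + (r * s) *\<^sub>R a \<in> S" using near[OF x2, of r s] s e(2) by auto
      then have *: "(D a has_derivative (\<lambda>v. DD a v (x + (r * s) *\<^sub>R a))) (at (snd (r, x) + (fst (r, x) * s) *\<^sub>R a))"
        unfolding DD_def using Cinf_has_derivative[OF D] by simp
      have "((\<lambda>p. snd p + (fst p * s) *\<^sub>R a) has_derivative (\<lambda>v. snd v + (fst v * s) *\<^sub>R a)) (at (r, x))"
        by (auto intro!: derivative_eq_intros)
      from fun_cong[OF frechet_derivative_at[OF has_derivative_compose[OF this *]], of "(0, b)"]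
      show "frechet_derivative G (at (r, x)) (0, b) = DD a b (x + (r * s) *\<^sub>R a)"
        unfolding G_def by simp
    qed
    ultimately show ?thesis by simp
  qed
  \<comment> \<open>As \<open>s\<close> tends to 0 the averages over the segments tend to the values
    at \<open>x\<close>, which turns the equality of integrals into one of derivatives.\<close>
  have lim: "((\<lambda>s. integral {0..1} (\<lambda>r. h (x + (r * s) *\<^sub>R a))) \<longlongrightarrow> h x) (at 0)"
    if h: "continuous_on S h" for h :: "'a \<Rightarrow> 'b"
  proof -
    have "continuous_on {-d<..<d} (\<lambda>s. integral (cbox 0 1) (\<lambda>r. h (x + (r * s) *\<^sub>R a)))"
    proof (rule integral_continuous_on_param)
      show "continuous_on ({-d<..<d} \<times> cbox 0 1) (\<lambda>(s, r). h (x + (r * s) *\<^sub>R a))"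
        unfolding case_prod_unfold
      proof (rule continuous_on_compose2[OF h])
        show "(\<lambda>p. x + (snd p * fst p) *\<^sub>R a) ` ({-d<..<d} \<times> cbox 0 1) \<subseteq> S"
          using near[of x] e by (auto simp: subset_iff abs_less_iff)
      qed (auto intro!: continuous_intros)
    qed
    then have "isCont (\<lambda>s. integral {0..1} (\<lambda>r. h (x + (r * s) *\<^sub>R a))) 0"
      using d by (simp add: continuous_on_eq_continuous_at)
    then show ?thesis by (simp add: isCont_def)
  qed
  have "eventually (\<lambda>s. s \<in> {-d<..<d} - {0}) (at (0::real))"
    using d eventually_at_topological by (metis (no_types, lifting) Diff_iff greaterThanLessThan_iff neg_less_0_iff_less open_greaterThanLessThan singletonD)
  then have "eventually (\<lambda>s. integral {0..1} (\<lambda>r. DD a b (x + (r * s) *\<^sub>R a)) = integral {0..1} (\<lambda>r. DD b a (x + (r * s) *\<^sub>R a))) (at 0)"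
    by (rule eventually_mono) (auto intro: key)
  from tendsto_cong[OF this] lim[OF Cinf_continuous[OF DD[of a b]]] lim[OF Cinf_continuous[OF DD[of b a]]]
  have "DD a b x = DD b a x" using tendsto_unique[OF at_neq_bot] by blast
  then show ?thesis unfolding DD_def D_def .
qed

section \<open>Scalar differential equations with parameters\<close>

text \<open>The square avoids differentiating an absolute value. In its derivative,
  \<open>2 * K\<close> comes from the linear bound, and the further 1 absorbs the mixed term
  \<open>2 * e * \<bar>w x\<bar>\<close>, which is at most the sum of the squares of
  \<open>e\<close> and \<open>w x\<close>. Hence the weighted square minus a linear term does not
  increase.\<close>

lemma gronwall_square:
  fixes w w' :: "real \<Rightarrow> real"
  assumes w: "\<And>r. r \<in> {0..1} \<Longrightarrow> (w has_real_derivative w' r) (at r)"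
    and bd: "\<And>r. r \<in> {0..1} \<Longrightarrow> \<bar>w' r\<bar> \<le> K * \<bar>w r\<bar> + e" and "w 0 = 0" "K \<ge> 0" "r \<in> {0..1}"
  shows "(w r)\<^sup>2 \<le> e\<^sup>2 * exp (2 * K + 1)"
proof -
  define z where "z r = (w r)\<^sup>2 * exp (- (2 * K + 1) * r) - e\<^sup>2 * r" for r
  have "z r \<le> z 0"
  proof (rule DERIV_nonpos_imp_nonincreasing[of 0 r z])
    fix x assume x: "0 \<le> x" "x \<le> r"
    then have x1: "x \<in> {0..1}" using assms(5) by auto
    define E where "E = exp (- (2 * K + 1) * x)"
    have "(2 * K + 1) * x \<ge> 0" using x(1) assms(4) by simp
    then have E: "0 < E" "E \<le> 1" by (simp_all add: E_def algebra_simps)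
    have "(z has_real_derivative (2 * w x * w' x - (2 * K + 1) * (w x)\<^sup>2) * E - e\<^sup>2) (at x)"
      unfolding z_def E_def
      by (rule derivative_eq_intros w[OF x1] refl)+ (simp add: algebra_simps power2_eq_square)
    moreover have "(2 * w x * w' x - (2 * K + 1) * (w x)\<^sup>2) * E - e\<^sup>2 \<le> 0"
    proof -
      have "2 * w x * w' x \<le> 2 * (\<bar>w x\<bar> * \<bar>w' x\<bar>)"
        by (metis abs_ge_self abs_mult mult.assoc mult_left_mono zero_le_numeral)
      also have "\<dots> \<le> 2 * (\<bar>w x\<bar> * (K * \<bar>w x\<bar> + e))"
        using bd[OF x1] by (intro mult_left_mono) auto
      also have "\<dots> = 2 * K * (w x)\<^sup>2 + 2 * e * \<bar>w x\<bar>"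
        by (simp add: algebra_simps power2_eq_square)
      finally have "2 * w x * w' x - (2 * K + 1) * (w x)\<^sup>2 \<le> 2 * e * \<bar>w x\<bar> - (w x)\<^sup>2"
        by (simp add: algebra_simps)
      also have "\<dots> \<le> e\<^sup>2" using sum_squares_bound[of e "\<bar>w x\<bar>"] by simp
      finally have "(2 * w x * w' x - (2 * K + 1) * (w x)\<^sup>2) * E \<le> e\<^sup>2 * E"
        using E by (intro mult_right_mono) auto
      also have "\<dots> \<le> e\<^sup>2" using E by (simp add: mult_left_le)
      finally show ?thesis by simp
    qed
    ultimately show "\<exists>y. (z has_real_derivative y) (at x) \<and> y \<le> 0" by blast
  qed (use assms in auto)
  then have "(w r)\<^sup>2 * exp (- (2 * K + 1) * r) \<le> e\<^sup>2 * r" by (simp add: z_def assms(3))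
  then have "(w r)\<^sup>2 * exp (- (2 * K + 1) * r) * exp ((2 * K + 1) * r) \<le> e\<^sup>2 * r * exp ((2 * K + 1) * r)"
    by (intro mult_right_mono) auto
  moreover have "exp (- (2 * K + 1) * r) * exp ((2 * K + 1) * r) = 1"
    unfolding exp_add[symmetric] by (simp add: algebra_simps)
  ultimately have "(w r)\<^sup>2 \<le> e\<^sup>2 * r * exp ((2 * K + 1) * r)"
    by (simp only: mult.assoc mult_1_right)
  also have "\<dots> \<le> e\<^sup>2 * exp (2 * K + 1)"
  proof -
    have "(2 * K + 1) * r \<le> 2 * K + 1" using assms(4,5) by (simp add: mult_left_le)
    then have "r * exp ((2 * K + 1) * r) \<le> 1 * exp (2 * K + 1)"
      using assms(5) by (intro mult_mono) auto
    then show ?thesis by (simp add: mult.assoc mult_left_mono)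
  qed
  finally show ?thesis .
qed

text \<open>Integrating factor normalised to 1 at the end point: the product of \<open>E\<close> and
  \<open>w\<close> has derivative \<open>E r * b r\<close>, and \<open>w 0 = 0\<close> removes the
  other boundary term.\<close>

lemma linear_ode_solution:
  fixes w a b :: "real \<Rightarrow> real"
  assumes w: "\<And>r. r \<in> {0..1} \<Longrightarrow> (w has_real_derivative a r * w r + b r) (at r)"
    and a: "continuous_on {0..1} a" and "w 0 = 0"
  shows "w 1 = integral {0..1} (\<lambda>r. exp (integral {r..1} a) * b r)"
proof -
  define E where "E r = exp (integral {r..1} a)" for r
  have E: "(E has_real_derivative - a r * E r) (at r within {0..1})" if "r \<in> {0..1}" for r
  proof -
    have "((\<lambda>r. integral {r..1} a) has_vector_derivative - a r) (at r within {0..1})"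
      using integral_has_vector_derivative'[OF a that] .
    then have "((\<lambda>r. integral {r..1} a) has_real_derivative - a r) (at r within {0..1})"
      by (simp add: has_real_derivative_iff_has_vector_derivative)
    from DERIV_chain2[OF DERIV_exp this] show ?thesis unfolding E_def by (simp add: mult.commute)
  qed
  have "((\<lambda>r. E r * w r) has_vector_derivative E r * b r) (at r within {0..1})" if "r \<in> {0..1}" for r
  proof -
    have "((\<lambda>r. E r * w r) has_real_derivative (- a r * E r) * w r + (a r * w r + b r) * E r) (at r within {0..1})"
      by (rule DERIV_mult[OF E[OF that] has_field_derivative_at_within[OF w[OF that]]])
    then show ?thesis
      by (simp add: has_real_derivative_iff_has_vector_derivative[symmetric] algebra_simps)
  qed
  then have "((\<lambda>r. E r * b r) has_integral E 1 * w 1 - E 0 * w 0) {0..1}"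
    by (intro fundamental_theorem_of_calculus) auto
  then show ?thesis using assms(3) by (simp add: E_def integral_unique)
qed

text \<open>Moves the variable limit into the integrand, so that the results on integrals over the
  fixed interval \<open>{0..1}\<close> apply to the integrating factor.\<close>

lemma integral_lower_scale:
  fixes a :: "real \<Rightarrow> real"
  assumes "continuous_on {0..1} a" "r \<in> {0..1}"
  shows "integral {r..1} a = (1 - r) * integral {0..1} (\<lambda>\<rho>. a (r + (1 - r) * \<rho>))"
proof (cases "r = 1")
  case False
  then have r: "1 - r > 0" using assms(2) by auto
  have "(a has_integral integral {r..1} a) (cbox r 1)"
    using assms by (auto intro!: integrable_integral integrable_continuous_real continuous_on_subset[OF assms(1)])
  from has_integral_affinity[OF this, of "1 - r" r] r
  have "((\<lambda>\<rho>. a ((1 - r) * \<rho> + r)) has_integral (1 / (1 - r)) * integral {r..1} a)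
      ((\<lambda>x. (1 / (1 - r)) * x + - ((1 / (1 - r)) * r)) ` cbox r 1)" by simp
  moreover have "(\<lambda>x. (1 / (1 - r)) * x + - ((1 / (1 - r)) * r)) ` cbox r 1 = {0..1}"
    using r assms(2) unfolding cbox_interval image_affinity_atLeastAtMost
    by (simp add: diff_divide_distrib[symmetric])
  ultimately have "((\<lambda>\<rho>. a ((1 - r) * \<rho> + r)) has_integral (1 / (1 - r)) * integral {r..1} a) {0..1}" by simp
  then have "integral {0..1} (\<lambda>\<rho>. a (r + (1 - r) * \<rho>)) = (1 / (1 - r)) * integral {r..1} a"
    by (simp add: integral_unique add.commute)
  then show ?thesis using r by simp
qed simp

text \<open>The function is the primitive of \<open>g\<close> vanishing at 0, written over a fixed
  interval so that positive and negative times need no distinction.\<close>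

lemma antiderivative_scale:
  fixes g :: "real \<Rightarrow> real"
  assumes "continuous_on UNIV g"
  shows "((\<lambda>\<tau>. \<tau> * integral {0..1} (\<lambda>q. g (\<tau> * q))) has_real_derivative g \<tau>) (at \<tau>)"
proof -
  \<comment> \<open>The extra 1 makes \<open>\<tau>\<close> an interior point of the auxiliary
    interval.\<close>
  define a where "a = \<bar>\<tau>\<bar> + 1"
  define G where "G t = integral {-a..t} g" for t
  have G: "(G has_real_derivative g t) (at t)" if "\<bar>t\<bar> < a" for t
  proof -
    have "(G has_vector_derivative g t) (at t within {-a..a})"
      unfolding G_def using that
      by (intro integral_has_vector_derivative continuous_on_subset[OF assms]) auto
    moreover have "at t within {-a..a} = at t"
      using that by (intro at_within_interior) auto
    ultimately show ?thesis by (simp add: has_real_derivative_iff_has_vector_derivative)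
  qed
  have eq: "G t - G 0 = t * integral {0..1} (\<lambda>q. g (t * q))" if t: "\<bar>t\<bar> < a" for t
  proof -
    have "((\<lambda>q. g (t * q) * t) has_integral G (t * 1) - G (t * 0)) {0..1}"
    proof (rule fundamental_theorem_of_calculus)
      fix q :: real assume q: "q \<in> {0..1}"
      have "\<bar>t * q\<bar> \<le> \<bar>t\<bar>" using q by (simp add: abs_mult mult_left_le)
      then have "(G has_real_derivative g (t * q)) (at (t * q))" using t by (intro G) auto
      moreover have "((\<lambda>q. t * q) has_real_derivative t) (at q within {0..1})"
        by (auto intro!: derivative_eq_intros)
      ultimately have "((\<lambda>q. G (t * q)) has_real_derivative g (t * q) * t) (at q within {0..1})"
        by (rule DERIV_chain2)
      then show "((\<lambda>q. G (t * q)) has_vector_derivative g (t * q) * t) (at q within {0..1})"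
        by (simp add: has_real_derivative_iff_has_vector_derivative)
    qed auto
    then show ?thesis using integral_unique[of "\<lambda>q. t * g (t * q)"] by (simp add: mult.commute[of _ t])
  qed
  have "((\<lambda>t. G t - G 0) has_real_derivative g \<tau>) (at \<tau>)"
    using DERIV_diff[OF G DERIV_const] by (simp add: a_def)
  then show ?thesis
  proof (rule has_field_derivative_transform_within_open[where S = "{-a<..<a}"])
    show "G t - G 0 = t * integral {0..1} (\<lambda>q. g (t * q))" if "t \<in> {-a<..<a}" for t
      using eq[of t] that by (auto simp: abs_less_iff)
  qed (auto simp: a_def)
qed

text \<open>Picard's operator for \<open>u = exp(2K|\<tau>|) w\<close> is a contraction of the space of bounded continuous
  functions; the substitution makes the solution global.\<close>

lemma scalar_ode_exists:
  fixes h :: "real \<Rightarrow> real"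
  assumes lip0: "\<And>a b. \<bar>h a - h b\<bar> \<le> K0 * \<bar>a - b\<bar>"
  shows "\<exists>u. u 0 = 0 \<and> (\<forall>t. (u has_real_derivative h (u t)) (at t))"
proof -
  \<comment> \<open>The rate must be strictly positive, since bounds are divided by
    \<open>2 * K\<close> below.\<close>
  define K where "K = \<bar>K0\<bar> + 1"
  have K: "K > 0" by (simp add: K_def)
  have lip: "\<bar>h a - h b\<bar> \<le> K * \<bar>a - b\<bar>" for a b
    using order_trans[OF lip0[of a b], of "K * \<bar>a - b\<bar>"] by (simp add: K_def mult_right_mono)
  have "K-lipschitz_on UNIV h" using lip K by (intro lipschitz_onI) (auto simp: dist_real_def)
  then have hc: "continuous_on UNIV h" by (rule lipschitz_on_continuous_on)
  define I where "I g \<tau> = exp (- 2 * K * \<bar>\<tau>\<bar>) * (\<tau> * integral {0..1} (\<lambda>q. g (\<tau> * q)))" for g :: "real \<Rightarrow> real" and \<tau>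
  define G where "G w s = h (exp (2 * K * \<bar>s\<bar>) * w s)" for w s
  have Gc: "continuous_on UNIV (G w)" if "continuous_on UNIV w" for w
    unfolding G_def using that by (intro continuous_on_compose2[OF hc]) (auto intro!: continuous_intros)
  \<comment> \<open>The exponential weight has twice the Lipschitz rate: integration of a function
    bounded by \<open>c\<close> times the weight gains a factor \<open>1 / (2 * K)\<close> once the
    weight is removed. The Lipschitz estimate contributes \<open>K\<close>, which leaves the
    contraction factor 1/2 below.\<close>
  have bound: "\<bar>I g \<tau>\<bar> \<le> c / (2 * K)"
    if g: "continuous_on UNIV g" "\<And>s. \<bar>g s\<bar> \<le> c * exp (2 * K * \<bar>s\<bar>)" for g c \<tau>
  proof -
    have c: "c \<ge> 0" using g(2)[of 0] by simp
    have "((\<lambda>q. 2 * K * \<bar>\<tau>\<bar> * exp (2 * K * \<bar>\<tau>\<bar> * q)) has_integral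
        exp (2 * K * \<bar>\<tau>\<bar> * 1) - exp (2 * K * \<bar>\<tau>\<bar> * 0)) {0..1}"
    proof (rule fundamental_theorem_of_calculus)
      fix q :: real
      show "((\<lambda>q. exp (2 * K * \<bar>\<tau>\<bar> * q)) has_vector_derivative 2 * K * \<bar>\<tau>\<bar> * exp (2 * K * \<bar>\<tau>\<bar> * q)) (at q within {0..1})"
        unfolding has_real_derivative_iff_has_vector_derivative[symmetric]
        by (auto intro!: derivative_eq_intros)
    qed simp
    from has_integral_mult_right[OF this, of "c / (2 * K)"] K
    have int: "((\<lambda>q. c * \<bar>\<tau>\<bar> * exp (2 * K * \<bar>\<tau>\<bar> * q)) has_integral c / (2 * K) * (exp (2 * K * \<bar>\<tau>\<bar>) - 1)) {0..1}"
      by (simp add: mult.assoc)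
    have "\<bar>\<tau> * integral {0..1} (\<lambda>q. g (\<tau> * q))\<bar> = norm (integral {0..1} (\<lambda>q. \<tau> * g (\<tau> * q)))"
      by simp
    also have "\<dots> \<le> integral {0..1} (\<lambda>q. c * \<bar>\<tau>\<bar> * exp (2 * K * \<bar>\<tau>\<bar> * q))"
    proof (rule integral_norm_bound_integral)
      show "(\<lambda>q. \<tau> * g (\<tau> * q)) integrable_on {0..1}"
        by (intro integrable_continuous_real continuous_intros continuous_on_compose2[OF g(1)]) auto
      fix q :: real assume "q \<in> {0..1}"
      then have "\<bar>g (\<tau> * q)\<bar> \<le> c * exp (2 * K * \<bar>\<tau>\<bar> * q)"
        using g(2)[of "\<tau> * q"] by (simp add: abs_mult mult.assoc)
      from mult_left_mono[OF this, of "\<bar>\<tau>\<bar>"]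
      show "norm (\<tau> * g (\<tau> * q)) \<le> c * \<bar>\<tau>\<bar> * exp (2 * K * \<bar>\<tau>\<bar> * q)"
        by (simp add: abs_mult mult_ac)
    qed (use int in blast)
    also have "\<dots> = c / (2 * K) * (exp (2 * K * \<bar>\<tau>\<bar>) - 1)" using int by (rule integral_unique)
    also have "\<dots> \<le> c / (2 * K) * exp (2 * K * \<bar>\<tau>\<bar>)" using c K by (intro mult_left_mono) auto
    finally have "exp (- 2 * K * \<bar>\<tau>\<bar>) * \<bar>\<tau> * integral {0..1} (\<lambda>q. g (\<tau> * q))\<bar> \<le>
        exp (- 2 * K * \<bar>\<tau>\<bar>) * (c / (2 * K) * exp (2 * K * \<bar>\<tau>\<bar>))"
      by (intro mult_left_mono) auto
    also have "\<dots> = c / (2 * K)" by (simp add: exp_minus field_simps)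
    finally show ?thesis by (simp add: I_def abs_mult)
  qed
  have Ic: "continuous_on UNIV (I g)" if "continuous_on UNIV g" for g
    unfolding I_def
    by (intro continuous_intros DERIV_continuous_on[OF has_field_derivative_at_within[OF antiderivative_scale[OF that]]])
  define T where "T w = Bcontfun (I (G (apply_bcontfun w)))" for w :: "real \<Rightarrow>\<^sub>C real"
  have Tw: "apply_bcontfun (T w) = I (G (apply_bcontfun w))" for w
  proof -
    obtain M where M: "\<And>s. \<bar>apply_bcontfun w s\<bar> \<le> M"
      using bounded_apply_bcontfun[of w] unfolding bounded_iff by auto
    have "\<bar>G (apply_bcontfun w) s\<bar> \<le> (\<bar>h 0\<bar> + K * M) * exp (2 * K * \<bar>s\<bar>)" for s
    proof -
      have "\<bar>G (apply_bcontfun w) s\<bar> \<le> \<bar>h 0\<bar> + K * (exp (2 * K * \<bar>s\<bar>) * \<bar>apply_bcontfun w s\<bar>)"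
        using lip[of "exp (2 * K * \<bar>s\<bar>) * apply_bcontfun w s" 0] by (simp add: G_def abs_mult)
      also have "\<dots> \<le> \<bar>h 0\<bar> * exp (2 * K * \<bar>s\<bar>) + K * (exp (2 * K * \<bar>s\<bar>) * M)"
        using M[of s] K by (intro add_mono mult_left_mono) (auto simp: mult_le_cancel_left1)
      finally show ?thesis by (simp add: algebra_simps)
    qed
    then have "I (G (apply_bcontfun w)) \<in> bcontfun"
      using Ic[OF Gc]
      by (intro bcontfun_normI[of _ "(\<bar>h 0\<bar> + K * M) / (2 * K)"]) (simp_all add: bound Gc)
    then show ?thesis by (simp add: T_def Bcontfun_inverse)
  qed
  have "\<exists>!w. T w = w"
  proof (rule banach_fix_type[of "1 / 2"]; clarify?)
    fix w v :: "real \<Rightarrow>\<^sub>C real"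
    show "dist (T w) (T v) \<le> 1 / 2 * dist w v"
    proof (rule dist_bound)
      fix \<tau>
      have "I (G (apply_bcontfun w)) \<tau> - I (G (apply_bcontfun v)) \<tau> = I (\<lambda>s. G (apply_bcontfun w) s - G (apply_bcontfun v) s) \<tau>"
        unfolding I_def
        by (subst integral_diff) (auto simp: algebra_simps intro!: integrable_continuous_real continuous_on_compose2[OF Gc] continuous_intros)
      also have "\<bar>\<dots>\<bar> \<le> (K * dist w v) / (2 * K)"
      proof (rule bound)
        fix s
        have "\<bar>G (apply_bcontfun w) s - G (apply_bcontfun v) s\<bar> \<le> K * (exp (2 * K * \<bar>s\<bar>) * dist (apply_bcontfun w s) (apply_bcontfun v s))"
          using lip[of "exp (2 * K * \<bar>s\<bar>) * apply_bcontfun w s" "exp (2 * K * \<bar>s\<bar>) * apply_bcontfun v s"]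
          by (simp add: G_def dist_real_def right_diff_distrib[symmetric] abs_mult)
        also have "\<dots> \<le> K * (exp (2 * K * \<bar>s\<bar>) * dist w v)"
          using K dist_bounded[of w s v] by (intro mult_left_mono) auto
        finally show "\<bar>G (apply_bcontfun w) s - G (apply_bcontfun v) s\<bar> \<le> K * dist w v * exp (2 * K * \<bar>s\<bar>)"
          by (simp add: mult_ac)
      qed (intro continuous_intros Gc continuous_on_apply_bcontfun)
      finally show "dist (apply_bcontfun (T w) \<tau>) (apply_bcontfun (T v) \<tau>) \<le> 1 / 2 * dist w v"
        using K by (simp add: Tw dist_real_def)
    qed
  qed auto
  then obtain w where "T w = w" by blast
  then have w: "apply_bcontfun w \<tau> = I (G (apply_bcontfun w)) \<tau>" for \<tau> using Tw by metis
  define u where "u \<tau> = exp (2 * K * \<bar>\<tau>\<bar>) * apply_bcontfun w \<tau>" for \<tau>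
  have Gu: "G (apply_bcontfun w) = (\<lambda>s. h (u s))" by (rule ext) (simp add: G_def u_def)
  have u: "u \<tau> = \<tau> * integral {0..1} (\<lambda>q. h (u (\<tau> * q)))" for \<tau>
    unfolding u_def[of \<tau>] w[of \<tau>] I_def Gu by (simp add: mult.assoc[symmetric] exp_add[symmetric])
  have "continuous_on UNIV (\<lambda>s. h (u s))" using Gc[of "apply_bcontfun w"] by (simp add: Gu)
  have "(u has_real_derivative h (u t)) (at t)" for t
    using antiderivative_scale[OF \<open>continuous_on UNIV (\<lambda>s. h (u s))\<close>, of t] by (simp only: u[symmetric])
  moreover have "u 0 = 0" using u[of 0] by simp
  ultimately show ?thesis by blast
qed

lemma scalar_ode_unique:
  fixes h :: "real \<Rightarrow> real"
  assumes lip: "\<And>a b. \<bar>h a - h b\<bar> \<le> K * \<bar>a - b\<bar>" and "u 0 = v 0"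
    and u: "\<And>t. t \<in> {0..1} \<Longrightarrow> (u has_real_derivative h (u t)) (at t)"
    and v: "\<And>t. t \<in> {0..1} \<Longrightarrow> (v has_real_derivative h (v t)) (at t)" and "r \<in> {0..1}"
  shows "u r = v r"
proof -
  have "(u r - v r)\<^sup>2 \<le> 0\<^sup>2 * exp (2 * \<bar>K\<bar> + 1)"
  proof (rule gronwall_square[where w = "\<lambda>r. u r - v r" and w' = "\<lambda>r. h (u r) - h (v r)"])
    show "((\<lambda>r. u r - v r) has_real_derivative h (u r) - h (v r)) (at r)" if "r \<in> {0..1}" for r
      by (intro DERIV_diff u v that)
    show "\<bar>h (u r) - h (v r)\<bar> \<le> \<bar>K\<bar> * \<bar>u r - v r\<bar> + 0" for r
      using order_trans[OF lip[of "u r" "v r"], of "\<bar>K\<bar> * \<bar>u r - v r\<bar>"] by (simp add: mult_right_mono)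
  qed (use assms in auto)
  then show ?thesis by simp
qed

lemma Cinf_exp: "Cinf UNIV (exp :: real \<Rightarrow> real)"
proof -
  have "Ck_open k UNIV (\<lambda>x::real. c * exp x)" for k c
  proof (induction k arbitrary: c)
    case (Suc k)
    show ?case
    proof (rule Ck_open_SucI)
      show "((\<lambda>x::real. c * exp x) has_derivative (\<lambda>v. (c * v) * exp x)) (at x)" for x
        by (auto intro!: derivative_eq_intros)
    qed (use Suc in auto)
  qed (auto intro!: continuous_intros)
  from this[of _ 1] show ?thesis by (simp add: Cinf_def)
qed

text \<open>With \<open>y(r, (\<lambda>, p)) = u(r\<lambda>, p)\<close> the flow at an arbitrary time becomes a time-one flow whose
  parameters include the time. Hadamard's lemma turns the difference of two solutions into a linear
  equation, whose explicit solution yields differentiability and, inductively, all derivatives.\<close>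

locale scalar_ode_family =
  fixes P :: "'p::euclidean_space set" and h u :: "real \<times> 'p \<Rightarrow> real" and K :: real
  assumes P: "open P" and h: "Cinf (UNIV \<times> P) h"
    and lip: "\<And>p a b. p \<in> P \<Longrightarrow> \<bar>h (a, p) - h (b, p)\<bar> \<le> K * \<bar>a - b\<bar>"
    and u0: "\<And>p. p \<in> P \<Longrightarrow> u (0, p) = 0"
    and u: "\<And>p t. p \<in> P \<Longrightarrow> ((\<lambda>t. u (t, p)) has_real_derivative h (u (t, p), p)) (at t)"
begin

definition Q :: "(real \<times> 'p) set" where "Q = UNIV \<times> P"
definition j :: "real \<times> (real \<times> 'p) \<Rightarrow> real" where "j z = fst (snd z) * h (fst z, snd (snd z))"
definition y :: "real \<Rightarrow> real \<times> 'p \<Rightarrow> real" where "y r q = u (r * fst q, snd q)"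

lemma openQ: "open Q" unfolding Q_def by (intro open_Times P) auto

lemma openUQ: "open (UNIV \<times> Q)" by (intro open_Times openQ) auto

lemma openUP: "open (UNIV \<times> P)" by (intro open_Times P) auto

lemma Cinf_j: "Cinf (UNIV \<times> Q) j"
proof -
  have "Cinf (UNIV \<times> Q) (\<lambda>z. (fst z, snd (snd z)))"
    by (intro Cinf_intros openUQ)
  from Cinf_compose[OF openUQ openUP this h]
  have "Cinf (UNIV \<times> Q) (\<lambda>z. h (fst z, snd (snd z)))" by (force simp: Q_def)
  moreover have "Cinf (UNIV \<times> Q) (\<lambda>z. fst (snd z))" by (intro Cinf_intros openUQ)
  ultimately show ?thesis unfolding j_def by (intro Cinf_mult openUQ)
qed

lemma y_derivative:
  assumes "q \<in> Q"
  shows "((\<lambda>r. y r q) has_real_derivative j (y r q, q)) (at r)"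
proof -
  obtain l p where q: "q = (l, p)" "p \<in> P" using assms by (auto simp: Q_def)
  have "((\<lambda>r. r * l) has_real_derivative l) (at r)" by (auto intro!: derivative_eq_intros)
  from DERIV_chain2[OF u[OF q(2)] this] show ?thesis
    by (simp add: y_def j_def q mult.commute)
qed

lemma y_0: "q \<in> Q \<Longrightarrow> y 0 q = 0" by (auto simp: y_def Q_def u0)

lemma y_1: "y 1 q = u q" by (simp add: y_def)

lemma y_continuous: "q \<in> Q \<Longrightarrow> continuous_on S (\<lambda>r. y r q)"
  by (intro DERIV_continuous_on[OF has_field_derivative_at_within[OF y_derivative]])

text \<open>Gronwall's inequality for the difference of the solutions at \<open>q\<close> and
  \<open>q0\<close>. The bound \<open>L\<close> on the time component controls the Lipschitz term,
  and the remaining change of the equation along the solution at \<open>q0\<close> is small by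
  uniform continuity on the compact set \<open>{0..1} \<times> cball q0 e\<close>.\<close>

lemma u_isCont:
  assumes q0: "q0 \<in> Q"
  shows "isCont u q0"
proof -
  obtain e where e: "e > 0" "cball q0 e \<subseteq> Q" using openQ q0 open_contains_cball by blast
  define L where "L = \<bar>fst q0\<bar> + e"
  have L: "\<bar>fst q\<bar> \<le> L" if "q \<in> cball q0 e" for q
  proof -
    have "\<bar>fst q0 - fst q\<bar> \<le> e"
      using that norm_fst_le[of "fst q0 - fst q" "snd q0 - snd q"] by (simp add: dist_norm minus_prod_def)
    then show ?thesis by (auto simp: L_def)
  qed
  define G where "G = (\<lambda>z. j (y (fst z) q0, snd z))"
  have "continuous_on ({0..1} \<times> cball q0 e) (\<lambda>z. y (fst z) q0)"
    by (rule continuous_on_compose2[OF y_continuous[OF q0, of UNIV]]) (auto intro!: continuous_intros)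
  then have "continuous_on ({0..1} \<times> cball q0 e) G"
    unfolding G_def using e(2)
    by (intro continuous_on_compose2[OF Cinf_continuous[OF Cinf_j]]) (auto intro!: continuous_intros)
  then have uc: "uniformly_continuous_on ({0..1} \<times> cball q0 e) G"
    by (intro compact_uniformly_continuous compact_Times) auto
  show ?thesis
    unfolding continuous_at_eps_delta
  proof (intro allI impI)
    fix \<epsilon> :: real assume \<epsilon>: "\<epsilon> > 0"
    define C where "C = exp (2 * (L * \<bar>K\<bar>) + 1)"
    have C: "C > 0" by (simp add: C_def)
    \<comment> \<open>Chosen so that the Gronwall bound \<open>\<eta> * sqrt C\<close> equals
      \<open>\<epsilon> / 2\<close>.\<close>
    define \<eta> where "\<eta> = \<epsilon> / (2 * sqrt C)"
    have \<eta>: "\<eta> > 0" using \<epsilon> C by (simp add: \<eta>_def)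
    obtain d where d: "d > 0" "\<And>z z'. z \<in> {0..1} \<times> cball q0 e \<Longrightarrow> z' \<in> {0..1} \<times> cball q0 e \<Longrightarrow>
        dist z' z < d \<Longrightarrow> dist (G z') (G z) < \<eta>"
      using uc \<eta> unfolding uniformly_continuous_on_def by metis
    show "\<exists>d>0. \<forall>q. dist q q0 < d \<longrightarrow> dist (u q) (u q0) < \<epsilon>"
    proof (intro exI[of _ "min d e"] conjI allI impI)
      fix q assume q: "dist q q0 < min d e"
      then have qe: "q \<in> cball q0 e" by (simp add: dist_commute)
      then have qQ: "q \<in> Q" using e by auto
      have "(y 1 q - y 1 q0)\<^sup>2 \<le> \<eta>\<^sup>2 * exp (2 * (L * \<bar>K\<bar>) + 1)"
      proof (rule gronwall_square[where w = "\<lambda>r. y r q - y r q0" and w' = "\<lambda>r. j (y r q, q) - j (y r q0, q0)"])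
        show "((\<lambda>r. y r q - y r q0) has_real_derivative j (y r q, q) - j (y r q0, q0)) (at r)" for r
          by (intro DERIV_diff y_derivative qQ q0)
        show "\<bar>j (y r q, q) - j (y r q0, q0)\<bar> \<le> L * \<bar>K\<bar> * \<bar>y r q - y r q0\<bar> + \<eta>" if r: "r \<in> {0..1}" for r
        proof -
          have "\<bar>j (y r q, q) - j (y r q0, q)\<bar> = \<bar>fst q\<bar> * \<bar>h (y r q, snd q) - h (y r q0, snd q)\<bar>"
            by (simp add: j_def right_diff_distrib[symmetric] abs_mult)
          also have "\<dots> \<le> L * (\<bar>K\<bar> * \<bar>y r q - y r q0\<bar>)"
          proof (rule mult_mono)
            have "K * \<bar>y r q - y r q0\<bar> \<le> \<bar>K\<bar> * \<bar>y r q - y r q0\<bar>" by (simp add: mult_right_mono)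
            then show "\<bar>h (y r q, snd q) - h (y r q0, snd q)\<bar> \<le> \<bar>K\<bar> * \<bar>y r q - y r q0\<bar>"
              using lip[of "snd q" "y r q" "y r q0"] qQ by (auto simp: Q_def)
          qed (use L[OF qe] in auto)
          finally have "\<bar>j (y r q, q) - j (y r q0, q)\<bar> \<le> L * \<bar>K\<bar> * \<bar>y r q - y r q0\<bar>" by (simp add: mult.assoc)
          moreover have "\<bar>j (y r q0, q) - j (y r q0, q0)\<bar> < \<eta>"
            using d(2)[of "(r, q0)" "(r, q)"] r qe q e by (simp add: G_def dist_real_def dist_Pair_Pair)
          ultimately show ?thesis by linarith
        qed
      qed (use y_0 qQ q0 e in \<open>auto simp: L_def\<close>)
      then have "(u q - u q0)\<^sup>2 \<le> (\<eta> * sqrt C)\<^sup>2" using C by (simp add: y_1 C_def[symmetric] power_mult_distrib)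
      then have "\<bar>u q - u q0\<bar> \<le> \<eta> * sqrt C" using \<eta> C by (simp add: abs_le_square_iff[symmetric])
      also have "\<dots> < \<epsilon>" using \<epsilon> C by (simp add: \<eta>_def)
      finally show "dist (u q) (u q0) < \<epsilon>" by (simp add: dist_real_def)
    qed (use d e in auto)
  qed
qed

lemma u_continuous: "continuous_on Q u"
  using u_isCont by (simp add: continuous_at_imp_continuous_on)

lemma y_continuous2:
  assumes "S \<subseteq> UNIV \<times> Q"
  shows "continuous_on S (\<lambda>z. y (fst z) (snd z))"
  unfolding y_def using assms
  by (intro continuous_on_compose2[OF u_continuous]) (fastforce simp: Q_def intro!: continuous_intros)+

text \<open>Together with \<open>b\<close> below, the coefficients of the equation of variations
  along the solution: the derivatives of the right-hand side in the unknown and in a parameter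
  direction \<open>v\<close>.\<close>

definition a :: "real \<Rightarrow> real \<times> 'p \<Rightarrow> real" where
  "a r q = frechet_derivative j (at (y r q, q)) (1, 0)"

definition b :: "real \<times> 'p \<Rightarrow> real \<Rightarrow> real \<times> 'p \<Rightarrow> real" where
  "b v r q = frechet_derivative j (at (y r q, q)) (0, v)"

text \<open>Variation of constants for the linearised equation. The formula is the value at
  \<open>q0\<close> of slopes \<open>L q\<close> that satisfy
  \<open>u q - u q0 = L q (q - q0)\<close> exactly, so that linearity and continuity of the slopes
  suffice.\<close>

lemma u_derivative:
  assumes q0: "q0 \<in> Q"
  shows "(u has_derivative (\<lambda>v. integral {0..1} (\<lambda>r.
    exp ((1 - r) * integral {0..1} (\<lambda>\<rho>. a (r + (1 - r) * \<rho>) q0)) * b v r q0))) (at q0)"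
proof -
  obtain e where e: "e > 0" "ball q0 e \<subseteq> Q" using openQ q0 open_contains_ball by blast
  define B where "B = ball q0 e"
  have B: "B \<subseteq> Q" "open B" "convex B" "q0 \<in> B" using e by (auto simp: B_def)
  have j1: "Ck_open (Suc 0) (UNIV \<times> Q) j" using Cinf_j unfolding Cinf_def by blast
  \<comment> \<open>The segment joining the two states, along which the derivative of
    \<open>j\<close> is averaged. The unknown ranges over the whole line, so convexity concerns only
    the ball of parameters.\<close>
  define \<zeta> where "\<zeta> \<theta> r q = (y r q0, q0) + \<theta> *\<^sub>R ((y r q, q) - (y r q0, q0))" for \<theta> r q
  have \<zeta>in: "\<zeta> \<theta> r q \<in> UNIV \<times> B" if "q \<in> B" "\<theta> \<in> {0..1}" for \<theta> r q
  proof -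
    have "\<zeta> \<theta> r q = (1 - \<theta>) *\<^sub>R (y r q0, q0) + \<theta> *\<^sub>R (y r q, q)" unfolding \<zeta>_def by (simp add: algebra_simps)
    moreover have "convex (UNIV \<times> B :: (real \<times> (real \<times> 'p)) set)" using B by (intro convex_Times) auto
    ultimately show ?thesis using that B(4) by (metis (no_types, lifting) SigmaI UNIV_I atLeastAtMost_iff convex_alt)
  qed
  define H where "H r q v = integral {0..1} (\<lambda>\<theta>. frechet_derivative j (at (\<zeta> \<theta> r q)) v)" for r q v
  have \<zeta>c: "continuous_on ((UNIV \<times> B) \<times> cbox 0 1) (\<lambda>z. \<zeta> (snd z) (fst (fst z)) (snd (fst z)))"
  proof -
    have "continuous_on ((UNIV \<times> B) \<times> cbox 0 1) (\<lambda>z::(real \<times> (real \<times> 'p)) \<times> real. y (fst (fst z)) (snd (fst z)))"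
      using B by (intro continuous_on_compose2[OF y_continuous2[of "UNIV \<times> B"]]) (auto intro!: continuous_intros)
    moreover have "continuous_on ((UNIV \<times> B) \<times> cbox 0 1) (\<lambda>z::(real \<times> (real \<times> 'p)) \<times> real. y (fst (fst z)) q0)"
      by (rule continuous_on_compose2[OF y_continuous[OF q0, of UNIV]]) (auto intro!: continuous_intros)
    ultimately show ?thesis unfolding \<zeta>_def by (intro continuous_intros)
  qed
  have \<zeta>Q: "\<zeta> \<theta> r q \<in> UNIV \<times> Q" if "q \<in> B" "\<theta> \<in> {0..1}" for \<theta> r q
    using \<zeta>in[OF that, of r] B(1) by auto
  have fc: "continuous_on ((UNIV \<times> B) \<times> cbox 0 1) (\<lambda>z. frechet_derivative j (at (\<zeta> (snd z) (fst (fst z)) (snd (fst z)))) v)" for v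
    by (rule continuous_on_frechet[OF openUQ j1 \<zeta>c continuous_on_const], rule image_subsetI, rule \<zeta>Q) auto
  have Hc: "continuous_on (UNIV \<times> B) (\<lambda>z. H (fst z) (snd z) v)" for v
    using integral_continuous_on_param[of "UNIV \<times> B" 0 1 "\<lambda>z \<theta>. frechet_derivative j (at (\<zeta> \<theta> (fst z) (snd z))) v"] fc[of v]
    unfolding H_def by (simp add: case_prod_unfold)
  have int: "(\<lambda>\<theta>. frechet_derivative j (at (\<zeta> \<theta> r q)) v) integrable_on {0..1}" if "q \<in> B" for r q v
    using that
    by (intro integrable_continuous_real continuous_on_compose2[OF fc[of v], of _ "\<lambda>\<theta>. ((r, q), \<theta>)", simplified])
       (auto intro!: continuous_intros)
  have Hlin: "linear (H r q)" if q: "q \<in> B" for r q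
  proof (rule linearI)
    have l: "linear (frechet_derivative j (at (\<zeta> \<theta> r q)))" if "\<theta> \<in> {0..1}" for \<theta>
      using \<zeta>Q[OF q that] by (intro Cinf_frechet_linear[OF Cinf_j])
    show "H r q (v + v') = H r q v + H r q v'" for v v'
      unfolding H_def integral_add[OF int[OF q] int[OF q], symmetric]
      by (rule integral_cong) (simp only: linear_add[OF l])
    show "H r q (c *\<^sub>R v) = c *\<^sub>R H r q v" for c v
      unfolding H_def integral_cmul[symmetric]
      by (rule integral_cong) (simp only: linear_scale[OF l])
  qed
  define L where "L q v = integral {0..1} (\<lambda>r. exp ((1 - r) * integral {0..1} (\<lambda>\<rho>. H (r + (1 - r) * \<rho>) q (1, 0))) * H r q (0, v))" for q v
  have innerc: "continuous_on (UNIV \<times> B) (\<lambda>z. integral {0..1} (\<lambda>\<rho>. H (fst z + (1 - fst z) * \<rho>) (snd z) (1, 0)))"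
  proof -
    have "continuous_on ((UNIV \<times> B) \<times> cbox 0 1) (\<lambda>w::(real \<times> (real \<times> 'p)) \<times> real. H (fst (fst w) + (1 - fst (fst w)) * snd w) (snd (fst w)) (1, 0))"
      by (rule continuous_on_compose2[OF Hc, of _ "\<lambda>w::(real \<times> (real \<times> 'p)) \<times> real. (fst (fst w) + (1 - fst (fst w)) * snd w, snd (fst w))", simplified])
         (auto intro!: continuous_intros)
    then show ?thesis
      using integral_continuous_on_param[of "UNIV \<times> B" 0 1 "\<lambda>z \<rho>. H (fst z + (1 - fst z) * \<rho>) (snd z) (1, 0)"]
      by (simp add: case_prod_unfold)
  qed
  have Lc0: "continuous_on (UNIV \<times> B) (\<lambda>z. exp ((1 - fst z) * integral {0..1} (\<lambda>\<rho>. H (fst z + (1 - fst z) * \<rho>) (snd z) (1, 0))) * H (fst z) (snd z) (0, v))" for v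
    by (intro continuous_intros innerc Hc)
  have Lint: "(\<lambda>r. exp ((1 - r) * integral {0..1} (\<lambda>\<rho>. H (r + (1 - r) * \<rho>) q (1, 0))) * H r q (0, v)) integrable_on {0..1}"
    if "q \<in> B" for q v
    using that
    by (intro integrable_continuous_real continuous_on_compose2[OF Lc0[of v], of _ "\<lambda>r. (r, q)", simplified])
       (auto intro!: continuous_intros)
  have "(u has_derivative L q0) (at q0)"
  proof (rule caratheodory_derivative[OF B(2,4)])
    show "linear (L q)" if q: "q \<in> B" for q
    proof (rule linearI)
      show "L q (v + v') = L q v + L q v'" for v v'
        unfolding L_def integral_add[OF Lint[OF q] Lint[OF q], symmetric]
        using linear_add[OF Hlin[OF q], of _ "(0, v)" "(0, v')"]
        by (intro integral_cong) (simp add: algebra_simps)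
      show "L q (c *\<^sub>R v) = c *\<^sub>R L q v" for c v
        unfolding L_def integral_cmul[symmetric]
        using linear_scale[OF Hlin[OF q], of _ c "(0, v)"]
        by (intro integral_cong) (simp add: algebra_simps)
    qed
    show "isCont (\<lambda>q. L q v) q0" for v
    proof -
      have "continuous_on B (\<lambda>q. integral (cbox 0 1) (\<lambda>r. exp ((1 - r) * integral {0..1} (\<lambda>\<rho>. H (r + (1 - r) * \<rho>) q (1, 0))) * H r q (0, v)))"
      proof (rule integral_continuous_on_param)
        show "continuous_on (B \<times> cbox 0 1) (\<lambda>(q, r). exp ((1 - r) * integral {0..1} (\<lambda>\<rho>. H (r + (1 - r) * \<rho>) q (1, 0))) * H r q (0, v))"
          unfolding case_prod_unfold
          by (rule continuous_on_compose2[OF Lc0[of v], of _ "\<lambda>w. (snd w, fst w)", simplified])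
             (auto intro!: continuous_intros)
      qed
      then show ?thesis unfolding L_def using B by (simp add: continuous_on_eq_continuous_at)
    qed
    show "u q - u q0 = L q (q - q0)" if q: "q \<in> B" for q
    proof -
      have qQ: "q \<in> Q" using q B by auto
      have Hq: "continuous_on {0..1} (\<lambda>r. H r q (1, 0))"
        using q by (intro continuous_on_compose2[OF Hc[of "(1, 0)"], of _ "\<lambda>r. (r, q)", simplified])
          (auto intro!: continuous_intros)
      have "y 1 q - y 1 q0 = integral {0..1} (\<lambda>r. exp (integral {r..1} (\<lambda>r. H r q (1, 0))) * H r q (0, q - q0))"
      proof (rule linear_ode_solution[OF _ Hq, of "\<lambda>r. y r q - y r q0"])
        fix r :: real
        have "j (y r q, q) - j (y r q0, q0) = H r q ((y r q, q) - (y r q0, q0))"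
          unfolding H_def \<zeta>_def using q B
          by (intro hadamard[of "UNIV \<times> B"] Ck_open_mono[OF j1] open_Times convex_Times) auto
        also have "(y r q, q) - (y r q0, q0) = (y r q - y r q0) *\<^sub>R (1, 0) + (0, q - q0)" by simp
        also have "H r q \<dots> = H r q (1, 0) * (y r q - y r q0) + H r q (0, q - q0)"
          by (simp only: linear_add[OF Hlin[OF q]] linear_scale[OF Hlin[OF q]] real_scaleR_def mult.commute)
        finally have eq: "j (y r q, q) - j (y r q0, q0) = H r q (1, 0) * (y r q - y r q0) + H r q (0, q - q0)" .
        show "((\<lambda>r. y r q - y r q0) has_real_derivative H r q (1, 0) * (y r q - y r q0) + H r q (0, q - q0)) (at r)"
          unfolding eq[symmetric] by (intro DERIV_diff y_derivative qQ q0)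
      qed (simp add: y_0 qQ q0)
      also have "\<dots> = L q (q - q0)"
        unfolding L_def by (intro integral_cong) (simp only: integral_lower_scale[OF Hq])
      finally show ?thesis by (simp add: y_1)
    qed
  qed
  moreover have "H r q0 v = frechet_derivative j (at (y r q0, q0)) v" for r v
    by (simp add: H_def \<zeta>_def zero_prod_def[symmetric])
  ultimately show ?thesis unfolding L_def a_def b_def by simp
qed

text \<open>If \<open>u\<close> is of class \<open>k\<close>, so are the coefficients
  \<open>a\<close> and \<open>b\<close> along the solution, and hence the derivative given by
  \<open>u_derivative\<close>.\<close>

theorem Cinf_u: "Cinf (UNIV \<times> P) u"
proof -
  have "Ck_open k Q u" for k
  proof (induction k)
    case 0
    then show ?case using u_continuous by simp
  next
    case (Suc k)
    have sc: "Ck_open k S f" if "Cinf S f" for S and f :: "'x::euclidean_space \<Rightarrow> 'z::euclidean_space"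
      using that by (simp add: Cinf_def)
    have yk: "Ck_open k (UNIV \<times> Q) (\<lambda>z. y (fst z) (snd z))"
      unfolding y_def
      by (intro Ck_open_compose[OF openUQ openQ _ Suc] sc Cinf_intros openUQ) (auto simp: Q_def)
    have Dk: "Ck_open k (UNIV \<times> Q) (\<lambda>z. frechet_derivative j (at (y (fst z) (snd z), snd z)) v)" for v
      by (rule Ck_open_compose[OF openUQ openUQ Ck_open_Pair[OF openUQ yk sc[OF Cinf_snd[OF openUQ Cinf_id[OF openUQ]]]]
          sc[OF Cinf_derivative[OF Cinf_j]]]) auto
    have ak: "Ck_open k (UNIV \<times> (UNIV \<times> Q)) (\<lambda>w. a (fst (snd w) + (1 - fst (snd w)) * fst w) (snd (snd w)))"
    proof -
      have o: "open (UNIV \<times> (UNIV \<times> Q) :: (real \<times> (real \<times> (real \<times> 'p))) set)" by (intro open_Times openQ) auto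
      have "Cinf (UNIV \<times> (UNIV \<times> Q)) (\<lambda>w::real \<times> (real \<times> (real \<times> 'p)). fst (snd w) + (1 - fst (snd w)) * fst w)"
        by (intro Cinf_intros o)
      then have "Cinf (UNIV \<times> (UNIV \<times> Q)) (\<lambda>w::real \<times> (real \<times> (real \<times> 'p)). (fst (snd w) + (1 - fst (snd w)) * fst w, snd (snd w)))"
        by (intro Cinf_Pair[OF o] Cinf_intros o)
      from Ck_open_compose[OF o openUQ sc[OF this] Dk[of "(1, 0)"]]
      show ?thesis unfolding a_def by force
    qed
    have ik: "Ck_open k (UNIV \<times> Q) (\<lambda>z. integral {0..1} (\<lambda>\<rho>. a (fst z + (1 - fst z) * \<rho>) (snd z)))"
      using Ck_open_integral[OF openUQ open_Times[OF open_UNIV openUQ] _ ak] by (simp add: Sigma_mono)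
    have ek: "Ck_open k (UNIV \<times> Q) (\<lambda>z. exp ((1 - fst z) * integral {0..1} (\<lambda>\<rho>. a (fst z + (1 - fst z) * \<rho>) (snd z))) * b v (fst z) (snd z))" for v
    proof -
      have "Cinf (UNIV \<times> Q) (\<lambda>z::real \<times> (real \<times> 'p). 1 - fst z)"
        by (intro Cinf_intros openUQ)
      then have "Ck_open k (UNIV \<times> Q) (\<lambda>z::real \<times> (real \<times> 'p). 1 - fst z)" by (rule sc)
      from Ck_open_compose[OF openUQ open_UNIV Ck_open_bilinear[OF bounded_bilinear_mult openUQ this ik] sc[OF Cinf_exp]]
      have "Ck_open k (UNIV \<times> Q) (\<lambda>z. exp ((1 - fst z) * integral {0..1} (\<lambda>\<rho>. a (fst z + (1 - fst z) * \<rho>) (snd z))))" by simp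
      moreover have "Ck_open k (UNIV \<times> Q) (\<lambda>z. b v (fst z) (snd z))" unfolding b_def by (rule Dk)
      ultimately show ?thesis by (rule Ck_open_bilinear[OF bounded_bilinear_mult openUQ])
    qed
    show ?case
    proof (rule Ck_open_SucI[OF openQ u_derivative])
      show "Ck_open k Q (\<lambda>q0. integral {0..1} (\<lambda>r. exp ((1 - r) * integral {0..1} (\<lambda>\<rho>. a (r + (1 - r) * \<rho>) q0)) * b v r q0))" for v
        using Ck_open_integral[OF openQ openUQ _ ek[of v]] by (simp add: Sigma_mono)
    qed
  qed
  then show ?thesis by (simp add: Cinf_def Q_def)
qed

end

section \<open>Smooth maps between manifolds\<close>

text \<open>A smooth atlas without the separation axioms, so that it applies to cotangent bundles and products
  before (or without) establishing those.\<close>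

definition smooth_atlas :: "('a, 'e::euclidean_space) chart set \<Rightarrow> bool" where
  "smooth_atlas A \<longleftrightarrow> (\<forall>c\<in>A. inj_on (snd c) (fst c)) \<and>
     (\<forall>c\<in>A. \<forall>d\<in>A. open (snd c ` (fst c \<inter> fst d)) \<and>
        smooth_on (snd c ` (fst c \<inter> fst d)) (snd d \<circ> chart_inv c))"

lemma smooth_manifold_atlas: "smooth_manifold A \<Longrightarrow> smooth_atlas A"
  by (simp add: smooth_manifold_def smooth_atlas_def)

lemma smooth_atlas_inj: "smooth_atlas A \<Longrightarrow> c \<in> A \<Longrightarrow> inj_on (snd c) (fst c)"
  by (simp add: smooth_atlas_def)

lemma chart_inv_chart: "smooth_atlas A \<Longrightarrow> c \<in> A \<Longrightarrow> x \<in> fst c \<Longrightarrow> chart_inv c (snd c x) = x"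
  unfolding chart_inv_def by (simp add: smooth_atlas_inj)

lemma chart_chart_inv: "u \<in> snd c ` fst c \<Longrightarrow> snd c (chart_inv c u) = u"
  unfolding chart_inv_def by (rule f_inv_into_f)

lemma chart_inv_in_dom: "u \<in> snd c ` fst c \<Longrightarrow> chart_inv c u \<in> fst c"
  unfolding chart_inv_def by (rule inv_into_into)

lemma smooth_atlas_transition:
  assumes "smooth_atlas A" "c \<in> A" "d \<in> A"
  shows "open (snd c ` (fst c \<inter> fst d))" "Cinf (snd c ` (fst c \<inter> fst d)) (\<lambda>u. snd d (chart_inv c u))"
  using assms smooth_on_open unfolding smooth_atlas_def comp_def by blast+

lemma open_chart: "smooth_atlas A \<Longrightarrow> c \<in> A \<Longrightarrow> open (snd c ` fst c)"
  using smooth_atlas_transition(1)[of A c c] by simp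

text \<open>The abstraction function \<open>topology\<close> has meaning only for families
  satisfying \<open>istopology\<close>. Injectivity of the charts makes this family stable under
  intersections.\<close>

lemma openin_manifold:
  assumes A: "smooth_atlas A"
  shows "openin (manifold_topology A) W \<longleftrightarrow> W \<subseteq> points A \<and> (\<forall>c\<in>A. open (snd c ` (W \<inter> fst c)))"
proof -
  have "istopology (\<lambda>W. W \<subseteq> points A \<and> (\<forall>c\<in>A. open (snd c ` (W \<inter> fst c))))"
    unfolding istopology_def
  proof (intro conjI allI impI)
    fix S T assume S: "S \<subseteq> points A \<and> (\<forall>c\<in>A. open (snd c ` (S \<inter> fst c)))"
      and T: "T \<subseteq> points A \<and> (\<forall>c\<in>A. open (snd c ` (T \<inter> fst c)))"
    show "\<forall>c\<in>A. open (snd c ` (S \<inter> T \<inter> fst c))"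
    proof
      fix c assume c: "c \<in> A"
      have "snd c ` (S \<inter> T \<inter> fst c) = snd c ` (S \<inter> fst c) \<inter> snd c ` (T \<inter> fst c)"
        using smooth_atlas_inj[OF A c] by (auto simp: inj_on_def image_iff)
      then show "open (snd c ` (S \<inter> T \<inter> fst c))" using S T c by auto
    qed
    show "S \<inter> T \<subseteq> points A" using S by auto
  next
    fix \<K> assume K: "\<forall>S\<in>\<K>. S \<subseteq> points A \<and> (\<forall>c\<in>A. open (snd c ` (S \<inter> fst c)))"
    show "\<forall>c\<in>A. open (snd c ` (\<Union>\<K> \<inter> fst c))"
    proof
      fix c assume c: "c \<in> A"
      have "snd c ` (\<Union>\<K> \<inter> fst c) = (\<Union>S\<in>\<K>. snd c ` (S \<inter> fst c))" by auto
      then show "open (snd c ` (\<Union>\<K> \<inter> fst c))" using K c by auto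
    qed
    show "\<Union>\<K> \<subseteq> points A" using K by auto
  qed
  then show ?thesis unfolding manifold_topology_def by simp
qed

lemma topspace_manifold [simp]:
  assumes A: "smooth_atlas A"
  shows "topspace (manifold_topology A) = points A"
proof -
  have "openin (manifold_topology A) (points A)"
    unfolding openin_manifold[OF A]
  proof (intro conjI ballI)
    fix c assume c: "c \<in> A"
    then have "points A \<inter> fst c = fst c" by (auto simp: points_def)
    then show "open (snd c ` (points A \<inter> fst c))" using open_chart[OF A c] by simp
  qed auto
  then show ?thesis
    using openin_manifold[OF A] by (metis openin_subset openin_topspace subset_antisym)
qed

lemma openin_chart_vimage:
  assumes A: "smooth_atlas A" and c: "c \<in> A" and T: "open T"
  shows "openin (manifold_topology A) {x \<in> fst c. snd c x \<in> T}"
  unfolding openin_manifold[OF A]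
proof (intro conjI ballI)
  show "{x \<in> fst c. snd c x \<in> T} \<subseteq> points A" using c by (auto simp: points_def)
  fix d assume d: "d \<in> A"
  note tr = smooth_atlas_transition[OF A d c]
  have "snd d ` ({x \<in> fst c. snd c x \<in> T} \<inter> fst d) =
      snd d ` (fst d \<inter> fst c) \<inter> (\<lambda>u. snd c (chart_inv d u)) -` T"
    using chart_inv_chart[OF A d] by auto
  then show "open (snd d ` ({x \<in> fst c. snd c x \<in> T} \<inter> fst d))"
    using continuous_open_preimage[OF Cinf_continuous[OF tr(2)] tr(1) T] by simp
qed

lemma openin_chart: "smooth_atlas A \<Longrightarrow> c \<in> A \<Longrightarrow> openin (manifold_topology A) (fst c)"
  using openin_chart_vimage[of A c UNIV] by simp

lemma open_chart_image: "smooth_atlas A \<Longrightarrow> c \<in> A \<Longrightarrow> openin (manifold_topology A) W \<Longrightarrow> open (snd c ` (W \<inter> fst c))"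
  by (simp add: openin_manifold)

lemma chart_image_iff:
  "smooth_atlas A \<Longrightarrow> c \<in> A \<Longrightarrow> x \<in> fst c \<Longrightarrow> W \<subseteq> fst c \<Longrightarrow> snd c x \<in> snd c ` W \<longleftrightarrow> x \<in> W"
  using smooth_atlas_inj[of A c] by (auto simp: inj_on_def)

lemma in_points: "c \<in> A \<Longrightarrow> x \<in> fst c \<Longrightarrow> x \<in> points A"
  by (auto simp: points_def)

lemma pointsE:
  assumes "x \<in> points A"
  obtains c where "c \<in> A" "x \<in> fst c"
  using assms by (auto simp: points_def)

text \<open>For a set \<open>S\<close> that need not be open, \<open>g\<close> prolongs the
  coordinate expression of \<open>f\<close> to an open set of coordinates; the last clause also
  ensures that \<open>f\<close> does not leave the target chart near the point.\<close>

definition local_rep :: "'a set \<Rightarrow> ('a \<Rightarrow> 'b) \<Rightarrow> ('a, 'e::euclidean_space) chart \<Rightarrow>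
    ('b, 'g::euclidean_space) chart \<Rightarrow> 'e set \<Rightarrow> ('e \<Rightarrow> 'g) \<Rightarrow> bool" where
  "local_rep S f c d T g \<longleftrightarrow> open T \<and> T \<subseteq> snd c ` fst c \<and> Cinf T g \<and> g ` T \<subseteq> snd d ` fst d \<and>
     (\<forall>y\<in>S \<inter> fst c. snd c y \<in> T \<longrightarrow> f y \<in> fst d \<and> g (snd c y) = snd d (f y))"

lemma smooth_map_on_points:
  assumes "smooth_map_on A S B f" "smooth_atlas A" "smooth_atlas B" "x \<in> S" "x \<in> points A"
  shows "f x \<in> points B"
  using assms by (auto simp: smooth_map_on_def continuous_map_def)

text \<open>Any two charts around the point and its image may be prescribed. Continuity of
  \<open>f\<close> and of the extension cuts the domain down until the nearby points of
  \<open>S\<close> are mapped into the target chart.\<close>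

lemma smooth_map_on_local:
  assumes f: "smooth_map_on A S B f" and A: "smooth_atlas A" and B: "smooth_atlas B"
    and x: "x \<in> S" "c \<in> A" "x \<in> fst c" "d \<in> B" "f x \<in> fst d"
  obtains T g where "snd c x \<in> T" "local_rep S f c d T g"
proof -
  have cont: "continuous_map (subtopology (manifold_topology A) S) (manifold_topology B) f"
    and sm: "smooth_on (snd c ` {x \<in> fst c \<inter> S. f x \<in> fst d}) (snd d \<circ> f \<circ> chart_inv c)"
    using f x by (auto simp: smooth_map_on_def)
  obtain T0 g where T0: "open T0" "snd c x \<in> T0" "Cinf T0 g"
    and g: "\<And>u. u \<in> snd c ` {x \<in> fst c \<inter> S. f x \<in> fst d} \<Longrightarrow> u \<in> T0 \<Longrightarrow> g u = (snd d \<circ> f \<circ> chart_inv c) u"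
    using smooth_onD[OF sm, of "snd c x"] x by blast
  have "openin (subtopology (manifold_topology A) S) {y \<in> topspace (subtopology (manifold_topology A) S). f y \<in> fst d}"
    using openin_continuous_map_preimage[OF cont openin_chart[OF B x(4)]] .
  then obtain W where W: "openin (manifold_topology A) W"
    "{y \<in> points A \<inter> S. f y \<in> fst d} = W \<inter> S"
    unfolding openin_subtopology using A by auto
  define T where "T = (T0 \<inter> g -` (snd d ` fst d)) \<inter> snd c ` (W \<inter> fst c)"
  have "open (T0 \<inter> g -` (snd d ` fst d))"
    by (intro continuous_open_preimage Cinf_continuous[OF T0(3)] T0(1) open_chart[OF B x(4)])
  then have T: "open T" unfolding T_def by (rule open_Int[OF _ open_chart_image[OF A x(2) W(1)]])
  have *: "f y \<in> fst d \<and> g (snd c y) = snd d (f y)" if y: "y \<in> S \<inter> fst c" "snd c y \<in> T" for y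
  proof -
    have "y \<in> W" using y chart_image_iff[OF A x(2), of y "W \<inter> fst c"] by (auto simp: T_def)
    with y W(2) have fy: "f y \<in> fst d" by auto
    with y g[of "snd c y"] show ?thesis
      by (auto simp: T_def chart_inv_chart[OF A x(2)])
  qed
  have xW: "x \<in> W" using W(2) x in_points[OF x(2,3)] by auto
  have "g (snd c x) = snd d (f x)"
    using g[of "snd c x"] x T0(2) by (auto simp: chart_inv_chart[OF A x(2)])
  then have "snd c x \<in> T" using xW x T0 by (auto simp: T_def)
  moreover have "local_rep S f c d T g"
    unfolding local_rep_def using T * T0(3) by (auto simp: T_def intro: Cinf_mono)
  ultimately show thesis by (rule that)
qed

lemma local_rep_subset: "local_rep S f c d T g \<Longrightarrow> S' \<subseteq> S \<Longrightarrow> local_rep S' f c d T g"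
  unfolding local_rep_def by blast

lemma local_rep_cong: "local_rep S f c d T g \<Longrightarrow> (\<And>x. x \<in> S \<Longrightarrow> f x = f' x) \<Longrightarrow> local_rep S f' c d T g"
  unfolding local_rep_def by simp

lemma local_rep_shrink:
  "local_rep S f c d T g \<Longrightarrow> open T' \<Longrightarrow> local_rep S f c d (T \<inter> T') g"
  unfolding local_rep_def by (auto intro: Cinf_mono)

text \<open>One pair of charts around each point is enough: a local representative yields
  continuity, and in other charts the coordinate expression arises by composing with smooth
  transitions.\<close>

lemma smooth_map_onI:
  assumes A: "smooth_atlas A" and B: "smooth_atlas B" and S: "S \<subseteq> points A"
    and loc: "\<And>x. x \<in> S \<Longrightarrow> \<exists>c\<in>A. \<exists>d\<in>B. x \<in> fst c \<and> (\<exists>T g. snd c x \<in> T \<and> local_rep S f c d T g)"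
  shows "smooth_map_on A S B f"
  unfolding smooth_map_on_def
proof (intro conjI ballI)
  have fB: "f x \<in> points B" if x: "x \<in> S" for x
  proof -
    obtain c d T g where *: "c \<in> A" "d \<in> B" "x \<in> fst c" "snd c x \<in> T" "local_rep S f c d T g"
      using loc[OF x] by blast
    then have "f x \<in> fst d" using x by (auto simp: local_rep_def)
    then show ?thesis by (rule in_points[OF *(2)])
  qed
  show "continuous_map (subtopology (manifold_topology A) S) (manifold_topology B) f"
    unfolding continuous_map_def
  proof (intro conjI allI impI)
    show "f \<in> topspace (subtopology (manifold_topology A) S) \<rightarrow> topspace (manifold_topology B)"
      using fB A B by auto
    fix W assume W: "openin (manifold_topology B) W"
    have "\<exists>V. openin (manifold_topology A) V \<and> x \<in> V \<and> V \<inter> S \<subseteq> {x \<in> S. f x \<in> W}"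
      if x: "x \<in> S" "f x \<in> W" for x
    proof -
      obtain c d T g where *: "c \<in> A" "d \<in> B" "x \<in> fst c" "snd c x \<in> T" and l: "local_rep S f c d T g"
        using loc[OF x(1)] by blast
      then have g: "open T" "Cinf T g" "g (snd c x) = snd d (f x)" "f x \<in> fst d"
        using x(1) by (auto simp: local_rep_def)
      define T' where "T' = T \<inter> g -` (snd d ` (W \<inter> fst d))"
      have "open T'" unfolding T'_def
        by (intro continuous_open_preimage Cinf_continuous[OF g(2)] g(1) open_chart_image[OF B *(2) W])
      then have "openin (manifold_topology A) {y \<in> fst c. snd c y \<in> T'}"
        by (rule openin_chart_vimage[OF A *(1)])
      moreover have "x \<in> {y \<in> fst c. snd c y \<in> T'}" using * g x by (auto simp: T'_def)
      moreover have "f y \<in> W" if y: "y \<in> S" "y \<in> fst c" "snd c y \<in> T'" for y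
      proof -
        have "f y \<in> fst d" "g (snd c y) = snd d (f y)" "g (snd c y) \<in> snd d ` (W \<inter> fst d)"
          using l y by (auto simp: local_rep_def T'_def)
        then show ?thesis using chart_image_iff[OF B *(2), of "f y" "W \<inter> fst d"] by auto
      qed
      ultimately show ?thesis by blast
    qed
    then have "\<exists>V. openin (subtopology (manifold_topology A) S) V \<and> x \<in> V \<and> V \<subseteq> {x \<in> S. f x \<in> W}"
      if "x \<in> {x \<in> S. f x \<in> W}" for x
      using that unfolding openin_subtopology by blast
    then have "openin (subtopology (manifold_topology A) S) {x \<in> S. f x \<in> W}"
      by (subst openin_subopen) blast
    moreover have "{x \<in> topspace (subtopology (manifold_topology A) S). f x \<in> W} = {x \<in> S. f x \<in> W}"
      using S A by auto
    ultimately show "openin (subtopology (manifold_topology A) S)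
        {x \<in> topspace (subtopology (manifold_topology A) S). f x \<in> W}" by simp
  qed
  fix c' d' assume c': "c' \<in> A" and d': "d' \<in> B"
  show "smooth_on (snd c' ` {x \<in> fst c' \<inter> S. f x \<in> fst d'}) (snd d' \<circ> f \<circ> chart_inv c')"
  proof (rule smooth_onI)
    fix u assume "u \<in> snd c' ` {x \<in> fst c' \<inter> S. f x \<in> fst d'}"
    then obtain x where x: "x \<in> S" "x \<in> fst c'" "f x \<in> fst d'" "u = snd c' x" by auto
    obtain c d T g where *: "c \<in> A" "d \<in> B" "x \<in> fst c" "snd c x \<in> T" and l: "local_rep S f c d T g"
      using loc[OF x(1)] by blast
    then have g: "open T" "Cinf T g" "g (snd c x) = snd d (f x)" "f x \<in> fst d"
      using x(1) by (auto simp: local_rep_def)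
    note tr = smooth_atlas_transition[OF A c' *(1)]
    note tr' = smooth_atlas_transition[OF B *(2) d']
    define \<tau> where "\<tau> = (\<lambda>u. snd c (chart_inv c' u))"
    define T1 where "T1 = snd c' ` (fst c' \<inter> fst c) \<inter> \<tau> -` T"
    have T1: "open T1" unfolding T1_def \<tau>_def
      by (intro continuous_open_preimage Cinf_continuous[OF tr(2)] tr(1) g(1))
    have gt: "Cinf T1 (\<lambda>u. g (\<tau> u))"
      by (rule Cinf_compose[OF T1 g(1) _ g(2)]) (auto simp: T1_def \<tau>_def intro: Cinf_mono[OF tr(2)])
    define T2 where "T2 = T1 \<inter> (\<lambda>u. g (\<tau> u)) -` (snd d ` (fst d \<inter> fst d'))"
    have T2: "open T2" unfolding T2_def
      by (intro continuous_open_preimage Cinf_continuous[OF gt] T1 tr'(1))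
    show "\<exists>T g. open T \<and> u \<in> T \<and> Cinf T g \<and>
        (\<forall>y\<in>snd c' ` {x \<in> fst c' \<inter> S. f x \<in> fst d'} \<inter> T. g y = (snd d' \<circ> f \<circ> chart_inv c') y)"
    proof (intro exI conjI ballI)
      show "Cinf T2 (\<lambda>u. snd d' (chart_inv d (g (\<tau> u))))"
        by (rule Cinf_compose[OF T2 tr'(1) _ tr'(2)]) (auto simp: T2_def intro: Cinf_mono[OF gt])
      have "u \<in> T1" using x * by (auto simp: T1_def \<tau>_def chart_inv_chart[OF A c'])
      moreover have "g (\<tau> u) \<in> snd d ` (fst d \<inter> fst d')"
        using x g by (auto simp: \<tau>_def chart_inv_chart[OF A c'])
      ultimately show "u \<in> T2" by (simp add: T2_def)
      fix v assume v: "v \<in> snd c' ` {x \<in> fst c' \<inter> S. f x \<in> fst d'} \<inter> T2"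
      then obtain y where y: "y \<in> fst c'" "y \<in> S" "f y \<in> fst d'" "v = snd c' y" by auto
      have yc: "y \<in> fst c" "snd c y \<in> T"
        using v y chart_image_iff[OF A c' y(1), of "fst c' \<inter> fst c"]
        by (auto simp: T2_def T1_def \<tau>_def chart_inv_chart[OF A c'])
      then have "f y \<in> fst d" "g (snd c y) = snd d (f y)" using l y by (auto simp: local_rep_def)
      then show "snd d' (chart_inv d (g (\<tau> v))) = (snd d' \<circ> f \<circ> chart_inv c') v"
        using y by (simp add: \<tau>_def chart_inv_chart[OF A c'] chart_inv_chart[OF B *(2)])
    qed (use T2 in auto)
  qed
qed

lemma smooth_map_on_compose:
  assumes A: "smooth_atlas A" and B: "smooth_atlas B" and C: "smooth_atlas C"
    and f: "smooth_map_on A S B f" and g: "smooth_map_on B T C g"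
    and "S \<subseteq> points A" "f ` S \<subseteq> T"
  shows "smooth_map_on A S C (\<lambda>x. g (f x))"
proof (rule smooth_map_onI[OF A C assms(6)])
  fix x assume x: "x \<in> S"
  then have xA: "x \<in> points A" and fT: "f x \<in> T" using assms by auto
  have fB: "f x \<in> points B" using smooth_map_on_points[OF f A B x xA] .
  have gC: "g (f x) \<in> points C" using smooth_map_on_points[OF g B C fT fB] .
  obtain c where c: "c \<in> A" "x \<in> fst c" using xA by (rule pointsE)
  obtain d where d: "d \<in> B" "f x \<in> fst d" using fB by (rule pointsE)
  obtain e where e: "e \<in> C" "g (f x) \<in> fst e" using gC by (rule pointsE)
  obtain T1 g1 where 1: "snd c x \<in> T1" "local_rep S f c d T1 g1"
    using smooth_map_on_local[OF f A B x c d] .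
  obtain T2 g2 where 2: "snd d (f x) \<in> T2" "local_rep T g d e T2 g2"
    using smooth_map_on_local[OF g B C fT d e] .
  have T: "open (T1 \<inter> g1 -` T2)"
    using 1 2 by (intro continuous_open_preimage Cinf_continuous[of T1 g1]) (auto simp: local_rep_def)
  have c12: "Cinf (T1 \<inter> g1 -` T2) (\<lambda>u. g2 (g1 u))"
    using 1(2) 2(2) by (intro Cinf_compose[OF T, of T2 g1 g2]) (auto simp: local_rep_def intro: Cinf_mono)
  have r1: "open T1" "T1 \<subseteq> snd c ` fst c" "\<And>y. y \<in> S \<Longrightarrow> y \<in> fst c \<Longrightarrow> snd c y \<in> T1 \<Longrightarrow> f y \<in> fst d \<and> g1 (snd c y) = snd d (f y)"
    using 1(2) by (auto simp: local_rep_def)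
  have r2: "g2 ` T2 \<subseteq> snd e ` fst e" "\<And>y. y \<in> T \<Longrightarrow> y \<in> fst d \<Longrightarrow> snd d y \<in> T2 \<Longrightarrow> g y \<in> fst e \<and> g2 (snd d y) = snd e (g y)"
    using 2(2) by (auto simp: local_rep_def)
  have "local_rep S (\<lambda>x. g (f x)) c e (T1 \<inter> g1 -` T2) (\<lambda>u. g2 (g1 u))"
    unfolding local_rep_def
  proof (intro conjI ballI impI)
    fix y assume y: "y \<in> S \<inter> fst c" "snd c y \<in> T1 \<inter> g1 -` T2"
    then have "f y \<in> fst d" "g1 (snd c y) = snd d (f y)" "snd d (f y) \<in> T2" "f y \<in> T"
      using r1(3)[of y] assms(7) by auto
    then show "g (f y) \<in> fst e" "g2 (g1 (snd c y)) = snd e (g (f y))" using r2(2)[of "f y"] by auto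
  qed (use T c12 r1(2) r2(1) in auto)
  moreover have "snd c x \<in> T1 \<inter> g1 -` T2" using 1(1) 2(1) r1(3)[OF x c(2)] by auto
  ultimately show "\<exists>c\<in>A. \<exists>d\<in>C. x \<in> fst c \<and> (\<exists>T g'. snd c x \<in> T \<and> local_rep S (\<lambda>x. g (f x)) c d T g')"
    using c e by blast
qed

lemma smooth_map_on_localE:
  assumes f: "smooth_map_on A S B f" and A: "smooth_atlas A" and B: "smooth_atlas B"
    and x: "x \<in> S" "x \<in> points A"
  obtains c d T g where "c \<in> A" "d \<in> B" "x \<in> fst c" "snd c x \<in> T" "local_rep S f c d T g"
proof -
  obtain c where c: "c \<in> A" "x \<in> fst c" using x(2) by (rule pointsE)
  obtain d where d: "d \<in> B" "f x \<in> fst d" using smooth_map_on_points[OF f A B x] by (rule pointsE)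
  obtain T g where "snd c x \<in> T" "local_rep S f c d T g"
    using smooth_map_on_local[OF f A B x(1) c d] .
  with c d show thesis using that by blast
qed

text \<open>Gluing; it serves for maps given by a formula on one open set and by zero or the
  identity on another.\<close>

lemma smooth_map_on_open_cover:
  assumes A: "smooth_atlas A" and B: "smooth_atlas B" and S: "S \<subseteq> points A"
    and cov: "\<And>x. x \<in> S \<Longrightarrow> \<exists>W. openin (manifold_topology A) W \<and> x \<in> W \<and> smooth_map_on A (S \<inter> W) B f"
  shows "smooth_map_on A S B f"
proof (rule smooth_map_onI[OF A B S])
  fix x assume x: "x \<in> S"
  then obtain W where W: "openin (manifold_topology A) W" "x \<in> W" "smooth_map_on A (S \<inter> W) B f"
    using cov by blast
  obtain c d T g where *: "c \<in> A" "d \<in> B" "x \<in> fst c" "snd c x \<in> T" "local_rep (S \<inter> W) f c d T g"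
    using smooth_map_on_localE[OF W(3) A B, of x] x S W by blast
  have "local_rep (S \<inter> W) f c d (T \<inter> snd c ` (W \<inter> fst c)) g"
    using *(5) open_chart_image[OF A *(1) W(1)] by (rule local_rep_shrink)
  then have "local_rep S f c d (T \<inter> snd c ` (W \<inter> fst c)) g"
    using chart_image_iff[OF A *(1), of _ "W \<inter> fst c"] unfolding local_rep_def by auto
  moreover have "snd c x \<in> T \<inter> snd c ` (W \<inter> fst c)" using *(3,4) W(2) by blast
  ultimately have "\<exists>T g. snd c x \<in> T \<and> local_rep S f c d T g" by (intro exI conjI)
  then show "\<exists>c\<in>A. \<exists>d\<in>B. x \<in> fst c \<and> (\<exists>T g. snd c x \<in> T \<and> local_rep S f c d T g)"
    using *(1-3) by blast
qed

lemma smooth_map_on_subset: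
  assumes "smooth_map_on A S B f" "smooth_atlas A" "smooth_atlas B" "S' \<subseteq> S" "S' \<subseteq> points A"
  shows "smooth_map_on A S' B f"
proof (rule smooth_map_onI[OF assms(2,3,5)])
  fix x assume x: "x \<in> S'"
  obtain c d T g where "c \<in> A" "d \<in> B" "x \<in> fst c" "snd c x \<in> T" "local_rep S f c d T g"
    using smooth_map_on_localE[OF assms(1-3), of x] x assms(4,5) by blast
  then show "\<exists>c\<in>A. \<exists>d\<in>B. x \<in> fst c \<and> (\<exists>T g. snd c x \<in> T \<and> local_rep S' f c d T g)"
    using local_rep_subset[OF _ assms(4)] by blast
qed

lemma smooth_map_on_cong:
  assumes "smooth_map_on A S B f" "smooth_atlas A" "smooth_atlas B" "S \<subseteq> points A"
    "\<And>x. x \<in> S \<Longrightarrow> f x = f' x"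
  shows "smooth_map_on A S B f'"
proof (rule smooth_map_onI[OF assms(2,3,4)])
  fix x assume x: "x \<in> S"
  obtain c d T g where *: "c \<in> A" "d \<in> B" "x \<in> fst c" "snd c x \<in> T" "local_rep S f c d T g"
    using smooth_map_on_localE[OF assms(1-3), of x] x assms(4) by blast
  have "local_rep S f' c d T g" by (rule local_rep_cong[OF *(5) assms(5)])
  then show "\<exists>c\<in>A. \<exists>d\<in>B. x \<in> fst c \<and> (\<exists>T g. snd c x \<in> T \<and> local_rep S f' c d T g)"
    using *(1-4) by blast
qed

lemma smooth_map_on_id:
  assumes A: "smooth_atlas A" and S: "S \<subseteq> points A"
  shows "smooth_map_on A S A (\<lambda>x. x)"
proof (rule smooth_map_onI[OF A A S])
  fix x assume "x \<in> S"
  then obtain c where c: "c \<in> A" "x \<in> fst c" using S by (meson pointsE subsetD)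
  have "local_rep S (\<lambda>x. x) c c (snd c ` fst c) (\<lambda>u. u)"
    using open_chart[OF A c(1)] by (auto simp: local_rep_def)
  then show "\<exists>c\<in>A. \<exists>d\<in>A. x \<in> fst c \<and> (\<exists>T g. snd c x \<in> T \<and> local_rep S (\<lambda>x. x) c d T g)"
    using c by blast
qed

lemma smooth_map_on_const:
  assumes A: "smooth_atlas A" and B: "smooth_atlas B" and S: "S \<subseteq> points A" and b: "b \<in> points B"
  shows "smooth_map_on A S B (\<lambda>x. b)"
proof (rule smooth_map_onI[OF A B S])
  fix x assume "x \<in> S"
  then obtain c where c: "c \<in> A" "x \<in> fst c" using S by (meson pointsE subsetD)
  obtain d where d: "d \<in> B" "b \<in> fst d" using b by (rule pointsE)
  have "local_rep S (\<lambda>x. b) c d (snd c ` fst c) (\<lambda>u. snd d b)"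
    using open_chart[OF A c(1)] d by (auto simp: local_rep_def)
  then show "\<exists>c\<in>A. \<exists>d\<in>B. x \<in> fst c \<and> (\<exists>T g. snd c x \<in> T \<and> local_rep S (\<lambda>x. b) c d T g)"
    using c d by blast
qed

text \<open>Real functions, coordinate maps and the time variable become smooth maps of manifolds in
  this way and obey the same composition lemma.\<close>

definition euclid :: "('e, 'e::euclidean_space) chart set" where
  "euclid = {(UNIV, id)}"

lemma chart_inv_euclid [simp]: "chart_inv (UNIV, id) = id"
  by (auto simp: chart_inv_def inv_id)

lemma smooth_atlas_euclid [simp]: "smooth_atlas euclid"
  using Cinf_id[of UNIV] by (simp add: smooth_atlas_def euclid_def smooth_on_open flip: id_def)

lemma points_euclid [simp]: "points euclid = UNIV"
  by (simp add: points_def euclid_def)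

lemma manifold_topology_euclid: "manifold_topology euclid = euclidean"
proof (rule topology_eq[THEN iffD2], rule allI)
  show "openin (manifold_topology euclid) W \<longleftrightarrow> openin euclidean W" for W :: "'a set"
    by (subst openin_manifold) (simp_all, simp add: euclid_def)
qed

lemma smooth_map_on_chart:
  assumes A: "smooth_atlas A" and c: "c \<in> A" and S: "S \<subseteq> fst c"
  shows "smooth_map_on A S euclid (snd c)"
proof (rule smooth_map_onI[OF A smooth_atlas_euclid])
  have "local_rep S (snd c) c (UNIV, id) (snd c ` fst c) (\<lambda>u. u)"
    using open_chart[OF A c] by (auto simp: local_rep_def)
  then have "\<exists>T g. snd c x \<in> T \<and> local_rep S (snd c) c (UNIV, id) T g" if "x \<in> S" for x
    using S that by (intro exI conjI) auto
  then show "\<exists>c'\<in>A. \<exists>d\<in>euclid. x \<in> fst c' \<and> (\<exists>T g. snd c' x \<in> T \<and> local_rep S (snd c) c' d T g)" if "x \<in> S" for x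
    using c S that by (intro bexI[of _ "(UNIV, id)"] bexI[of _ c]) (auto simp: euclid_def)
qed (use c S in \<open>auto simp: points_def\<close>)

lemma smooth_map_on_chart_inv:
  assumes A: "smooth_atlas A" and c: "c \<in> A" and S: "S \<subseteq> snd c ` fst c"
  shows "smooth_map_on euclid S A (chart_inv c)"
proof (rule smooth_map_onI[OF smooth_atlas_euclid A])
  have "local_rep S (chart_inv c) (UNIV, id) c (snd c ` fst c) (\<lambda>u. u)"
    using open_chart[OF A c] by (auto simp: local_rep_def chart_inv_chart[OF A c])
  then have "\<exists>T g. x \<in> T \<and> local_rep S (chart_inv c) (UNIV, id) c T g" if "x \<in> S" for x
    using S that by (intro exI conjI) auto
  then show "\<exists>c'\<in>euclid. \<exists>d\<in>A. x \<in> fst c' \<and> (\<exists>T g. snd c' x \<in> T \<and> local_rep S (chart_inv c) c' d T g)" if "x \<in> S" for x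
    using c that by (intro bexI[of _ "(UNIV, id)"] bexI[of _ c]) (auto simp: euclid_def)
qed auto

lemma smooth_map_on_euclid:
  assumes S: "open T" "Cinf T g" "S \<subseteq> T" "\<And>x. x \<in> S \<Longrightarrow> g x = f x"
  shows "smooth_map_on euclid S euclid f"
proof (rule smooth_map_onI[OF smooth_atlas_euclid smooth_atlas_euclid])
  have "local_rep S f (UNIV, id) (UNIV, id) T g"
    using S by (auto simp: local_rep_def)
  then have "\<exists>T g. x \<in> T \<and> local_rep S f (UNIV, id) (UNIV, id) T g" if "x \<in> S" for x
    using S(3) that by (intro exI conjI) auto
  then show "\<exists>c'\<in>euclid. \<exists>d\<in>euclid. x \<in> fst c' \<and> (\<exists>T g. snd c' x \<in> T \<and> local_rep S f c' d T g)" if "x \<in> S" for x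
    using that unfolding euclid_def by simp
qed auto

lemma smooth_map_on_euclidD:
  assumes f: "smooth_map_on euclid S euclid f" and "open S"
  shows "Cinf S f"
proof -
  have "smooth_on S f"
    using f unfolding smooth_map_on_def euclid_def by simp
  then show ?thesis using assms(2) by (simp add: smooth_on_open)
qed

subsection \<open>The product with the real line\<close>

text \<open>Joint smoothness in time is smoothness on the subset
  \<open>{0..1} \<times> points A\<close> of the product with the whole line, so that manifolds with
  boundary are avoided.\<close>

definition rchart :: "('a, 'e) chart \<Rightarrow> (real \<times> 'a, real \<times> 'e) chart" where
  "rchart c = (UNIV \<times> fst c, \<lambda>(t, x). (t, snd c x))"

definition ratlas :: "('a, 'e) chart set \<Rightarrow> (real \<times> 'a, real \<times> 'e) chart set" where
  "ratlas A = rchart ` A"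

lemma fst_rchart [simp]: "fst (rchart c) = UNIV \<times> fst c"
  and snd_rchart [simp]: "snd (rchart c) (t, x) = (t, snd c x)"
  by (simp_all add: rchart_def)

lemma snd_rchart_image: "snd (rchart c) ` (T \<times> S) = T \<times> snd c ` S"
  by (force simp: rchart_def image_iff)

lemma points_ratlas [simp]: "points (ratlas A) = UNIV \<times> points A"
  by (auto simp: points_def ratlas_def)

lemma rchart_inj:
  assumes "smooth_atlas A" "c \<in> A"
  shows "inj_on (snd (rchart c)) (fst (rchart c))"
  using smooth_atlas_inj[OF assms] by (auto simp: inj_on_def)

lemma chart_inv_rchart:
  assumes A: "smooth_atlas A" "c \<in> A" and u: "u \<in> snd c ` fst c"
  shows "chart_inv (rchart c) (t, u) = (t, chart_inv c u)"
proof -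
  have "snd (rchart c) (t, chart_inv c u) = (t, u)" using chart_chart_inv[OF u] by simp
  moreover have "(t, chart_inv c u) \<in> fst (rchart c)" using chart_inv_in_dom[OF u] by simp
  ultimately show ?thesis unfolding chart_inv_def
    using inv_into_f_f[OF rchart_inj[OF A]] by metis
qed

lemma smooth_atlas_ratlas [simp]:
  assumes A: "smooth_atlas A"
  shows "smooth_atlas (ratlas A)"
  unfolding smooth_atlas_def
proof (intro conjI ballI)
  fix c' assume "c' \<in> ratlas A"
  then show "inj_on (snd c') (fst c')" using rchart_inj[OF A] by (auto simp: ratlas_def)
next
  fix c' d' assume "c' \<in> ratlas A" "d' \<in> ratlas A"
  then obtain c d where *: "c \<in> A" "d \<in> A" "c' = rchart c" "d' = rchart d" by (auto simp: ratlas_def)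
  note tr = smooth_atlas_transition[OF A *(1,2)]
  have eq: "snd c' ` (fst c' \<inter> fst d') = UNIV \<times> snd c ` (fst c \<inter> fst d)"
    unfolding * by (simp add: Times_Int_Times snd_rchart_image)
  show op: "open (snd c' ` (fst c' \<inter> fst d'))"
    unfolding eq by (intro open_Times tr(1)) auto
  have "Cinf (UNIV \<times> snd c ` (fst c \<inter> fst d)) (\<lambda>z. (fst z :: real, snd d (chart_inv c (snd z))))"
    using op unfolding eq
    by (intro Cinf_Pair Cinf_compose[OF _ tr(1) _ tr(2)] Cinf_fst Cinf_snd Cinf_id) auto
  moreover have "(fst z, snd d (chart_inv c (snd z))) = (snd d' \<circ> chart_inv c') z"
    if "z \<in> UNIV \<times> snd c ` (fst c \<inter> fst d)" for z
    using that chart_inv_rchart[OF A *(1), of "snd z" "fst z"] unfolding * by (cases z) auto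
  ultimately have "Cinf (UNIV \<times> snd c ` (fst c \<inter> fst d)) (snd d' \<circ> chart_inv c')"
    using op unfolding eq by (metis (no_types, lifting) Cinf_cong)
  then show "smooth_on (snd c' ` (fst c' \<inter> fst d')) (snd d' \<circ> chart_inv c')"
    using op unfolding eq by (simp add: smooth_on_open)
qed

text \<open>Matches the topology of the product atlas with the one in the continuity clause of
  \<open>is_isotopy\<close>.\<close>

lemma manifold_topology_ratlas:
  assumes A: "smooth_atlas A"
  shows "manifold_topology (ratlas A) = prod_topology euclideanreal (manifold_topology A)"
proof (rule topology_eq[THEN iffD2], rule allI, rule iffI)
  fix W assume W: "openin (manifold_topology (ratlas A)) W"
  then have WA: "W \<subseteq> UNIV \<times> points A" using openin_subset[OF W] A by simp
  show "openin (prod_topology euclideanreal (manifold_topology A)) W"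
    unfolding openin_prod_topology_alt
  proof (intro allI impI)
    fix t x assume tx: "(t, x) \<in> W"
    then obtain c where c: "c \<in> A" "x \<in> fst c" using WA tx pointsE[of x A] by blast
    have "rchart c \<in> ratlas A" using c by (simp add: ratlas_def)
    from open_chart_image[OF smooth_atlas_ratlas[OF A] this W]
    have op: "open (snd (rchart c) ` (W \<inter> fst (rchart c)))" .
    have txi: "(t, snd c x) \<in> snd (rchart c) ` (W \<inter> fst (rchart c))"
      using tx c by (intro image_eqI[of _ _ "(t, x)"]) auto
    obtain I T where IT0: "open I" "open T" "(t, snd c x) \<in> I \<times> T"
      "I \<times> T \<subseteq> snd (rchart c) ` (W \<inter> fst (rchart c))"
      by (rule open_prod_elim[OF op txi])
    then have IT: "open I" "open T" "t \<in> I" "snd c x \<in> T"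
      "I \<times> T \<subseteq> snd (rchart c) ` (W \<inter> fst (rchart c))" by simp_all
    have "I \<times> {y \<in> fst c. snd c y \<in> T} \<subseteq> W"
    proof
      fix z assume "z \<in> I \<times> {y \<in> fst c. snd c y \<in> T}"
      then obtain s y where z: "z = (s, y)" "s \<in> I" "y \<in> fst c" "snd c y \<in> T" by auto
      then have "snd (rchart c) (s, y) \<in> snd (rchart c) ` (W \<inter> fst (rchart c))"
        using IT(5) by auto
      then show "z \<in> W"
        using chart_image_iff[OF smooth_atlas_ratlas[OF A] \<open>rchart c \<in> ratlas A\<close>, of "(s, y)" "W \<inter> fst (rchart c)"] z
        by auto
    qed
    then show "\<exists>U V. openin euclideanreal U \<and> openin (manifold_topology A) V \<and> t \<in> U \<and> x \<in> V \<and> U \<times> V \<subseteq> W"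
      using IT openin_chart_vimage[OF A c(1) IT(2)] c(2)
      by (intro exI[of _ I] exI[of _ "{y \<in> fst c. snd c y \<in> T}"]) auto
  qed
next
  fix W assume W: "openin (prod_topology euclideanreal (manifold_topology A)) W"
  then have WA: "W \<subseteq> UNIV \<times> points A" using openin_subset[OF W] A by simp
  show "openin (manifold_topology (ratlas A)) W"
    unfolding openin_manifold[OF smooth_atlas_ratlas[OF A]]
  proof (intro conjI ballI)
    fix c' assume "c' \<in> ratlas A"
    then obtain c where c: "c \<in> A" "c' = rchart c" by (auto simp: ratlas_def)
    show "open (snd c' ` (W \<inter> fst c'))"
      unfolding open_prod_def
    proof (intro ballI)
      fix z assume "z \<in> snd c' ` (W \<inter> fst c')"
      then obtain t x where tx: "(t, x) \<in> W" "x \<in> fst c" "z = (t, snd c x)" unfolding c by auto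
      then obtain I V where IV: "open I" "openin (manifold_topology A) V" "t \<in> I" "x \<in> V" "I \<times> V \<subseteq> W"
        using W unfolding openin_prod_topology_alt by (metis open_openin)
      have "I \<times> snd c ` (V \<inter> fst c) \<subseteq> snd c' ` (W \<inter> fst c')"
        using IV(5) unfolding c snd_rchart_image[symmetric] by (intro image_mono) auto
      then show "\<exists>I T. open I \<and> open T \<and> z \<in> I \<times> T \<and> I \<times> T \<subseteq> snd c' ` (W \<inter> fst c')"
        using IV tx open_chart_image[OF A c(1) IV(2)] by blast
    qed
  qed (use WA in auto)
qed

lemma smooth_map_on_time:
  assumes A: "smooth_atlas A" and S: "S \<subseteq> UNIV \<times> points A"
  shows "smooth_map_on (ratlas A) S euclid fst"
proof (rule smooth_map_onI[OF smooth_atlas_ratlas[OF A] smooth_atlas_euclid])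
  fix z assume z: "z \<in> S"
  then have "snd z \<in> points A" using S by auto
  then obtain c where c: "c \<in> A" "snd z \<in> fst c" by (rule pointsE)
  have op: "open (UNIV \<times> snd c ` fst c :: (real \<times> 'b) set)" by (intro open_Times open_chart[OF A c(1)]) auto
  have "local_rep S fst (rchart c) (UNIV, id) (UNIV \<times> snd c ` fst c) (\<lambda>u. fst u)"
    unfolding local_rep_def using op Cinf_fst[OF op Cinf_id[OF op]] by (auto simp: snd_rchart_image)
  then have "\<exists>T g. snd (rchart c) z \<in> T \<and> local_rep S fst (rchart c) (UNIV, id) T g"
    using c by (intro exI conjI) (auto simp: rchart_def split: prod.split)
  then show "\<exists>c\<in>ratlas A. \<exists>d\<in>euclid. z \<in> fst c \<and> (\<exists>T g. snd c z \<in> T \<and> local_rep S fst c d T g)"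
    using c unfolding ratlas_def euclid_def by (cases z) auto
qed (use S in auto)

lemma smooth_map_on_space:
  assumes A: "smooth_atlas A" and S: "S \<subseteq> UNIV \<times> points A"
  shows "smooth_map_on (ratlas A) S A snd"
proof (rule smooth_map_onI[OF smooth_atlas_ratlas[OF A] A])
  fix z assume z: "z \<in> S"
  then have "snd z \<in> points A" using S by auto
  then obtain c where c: "c \<in> A" "snd z \<in> fst c" by (rule pointsE)
  have op: "open (UNIV \<times> snd c ` fst c :: (real \<times> 'b) set)" by (intro open_Times open_chart[OF A c(1)]) auto
  have "local_rep S snd (rchart c) c (UNIV \<times> snd c ` fst c) (\<lambda>u. snd u)"
    unfolding local_rep_def using op Cinf_snd[OF op Cinf_id[OF op]] by (auto simp: snd_rchart_image)
  then have "\<exists>T g. snd (rchart c) z \<in> T \<and> local_rep S snd (rchart c) c T g"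
    using c by (intro exI conjI) (auto simp: rchart_def split: prod.split)
  then show "\<exists>c\<in>ratlas A. \<exists>d\<in>A. z \<in> fst c \<and> (\<exists>T g. snd c z \<in> T \<and> local_rep S snd c d T g)"
    using c unfolding ratlas_def by (cases z) auto
qed (use S in auto)

lemma smooth_map_on_rpair:
  assumes C: "smooth_atlas C" and A: "smooth_atlas A" and S: "S \<subseteq> points C"
    and a: "smooth_map_on C S euclid a" and f: "smooth_map_on C S A f"
  shows "smooth_map_on C S (ratlas A) (\<lambda>z. (a z :: real, f z))"
proof (rule smooth_map_onI[OF C smooth_atlas_ratlas[OF A] S])
  fix x assume x: "x \<in> S"
  then have xC: "x \<in> points C" using S by auto
  obtain c where c: "c \<in> C" "x \<in> fst c" using xC by (rule pointsE)
  obtain d where d: "d \<in> A" "f x \<in> fst d" using smooth_map_on_points[OF f C A x xC] by (rule pointsE)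
  obtain T1 g1 where 1: "snd c x \<in> T1" "local_rep S a c (UNIV, id) T1 g1"
    using smooth_map_on_local[OF a C smooth_atlas_euclid x c, of "(UNIV, id)"] by (auto simp: euclid_def)
  obtain T2 g2 where 2: "snd c x \<in> T2" "local_rep S f c d T2 g2"
    using smooth_map_on_local[OF f C A x c d] .
  have o: "open T1" "open T2" "Cinf T1 g1" "Cinf T2 g2" using 1(2) 2(2) by (auto simp: local_rep_def)
  have "Cinf (T1 \<inter> T2) (\<lambda>u. (g1 u, g2 u))"
    using o by (intro Cinf_Pair open_Int) (auto intro: Cinf_mono)
  then have "local_rep S (\<lambda>z. (a z, f z)) c (rchart d) (T1 \<inter> T2) (\<lambda>u. (g1 u, g2 u))"
    using 1(2) 2(2) o unfolding local_rep_def by (auto simp: snd_rchart_image)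
  then have "\<exists>T g. snd c x \<in> T \<and> local_rep S (\<lambda>z. (a z, f z)) c (rchart d) T g"
    using 1(1) 2(1) by (intro exI conjI) auto
  then show "\<exists>c\<in>C. \<exists>d\<in>ratlas A. x \<in> fst c \<and> (\<exists>T g. snd c x \<in> T \<and> local_rep S (\<lambda>z. (a z, f z)) c d T g)"
    using c d unfolding ratlas_def by auto
qed

lemma smooth_on_cong:
  assumes "smooth_on S f" "\<And>x. x \<in> S \<Longrightarrow> f x = g x"
  shows "smooth_on S g"
proof (rule smooth_onI)
  fix x assume x: "x \<in> S"
  obtain T h where h: "open T" "x \<in> T" "Cinf T h" and eq: "\<And>y. y \<in> S \<Longrightarrow> y \<in> T \<Longrightarrow> h y = f y"
    using smooth_onD[OF assms(1) x] by metis
  have "\<forall>y\<in>S \<inter> T. h y = g y" using eq assms(2) by simp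
  with h show "\<exists>T h. open T \<and> x \<in> T \<and> Cinf T h \<and> (\<forall>y\<in>S \<inter> T. h y = g y)" by blast
qed

text \<open>Brings the coordinate conditions of an isotopy into the form
  \<open>smooth_map_on\<close>, to which the rules for composition and gluing apply.\<close>

lemma is_isotopy_iff:
  fixes A :: "('a, 'e::euclidean_space) chart set"
  assumes A: "smooth_atlas A"
  shows "is_isotopy A \<phi> \<longleftrightarrow> (\<forall>t\<in>{0..1}. diffeo A (\<phi> t)) \<and> (\<forall>x\<in>points A. \<phi> 0 x = x) \<and>
    smooth_map_on (ratlas A) ({0..1} \<times> points A) A (\<lambda>(t, x). \<phi> t x)"
proof -
  have top: "subtopology (manifold_topology (ratlas A)) ({0..1} \<times> points A) =
      prod_topology (top_of_set {0..1}) (manifold_topology A)"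
    unfolding manifold_topology_ratlas[OF A] subtopology_Times
    using subtopology_topspace[of "manifold_topology A"] A by simp
  have set_eq: "snd (rchart c) ` {z \<in> fst (rchart c) \<inter> {0..1} \<times> points A. (\<lambda>(t, x). \<phi> t x) z \<in> fst d} =
      {(t, u). t \<in> {0..1} \<and> u \<in> snd c ` {x \<in> fst c. \<phi> t x \<in> fst d}}" if "c \<in> A" for c d :: "('a, 'e) chart"
  proof (intro equalityI subsetI)
    fix z assume "z \<in> snd (rchart c) ` {z \<in> fst (rchart c) \<inter> {0..1} \<times> points A. (\<lambda>(t, x). \<phi> t x) z \<in> fst d}"
    then obtain t x where "z = (t, snd c x)" "t \<in> {0..1}" "x \<in> fst c" "\<phi> t x \<in> fst d" by auto
    then show "z \<in> {(t, u). t \<in> {0..1} \<and> u \<in> snd c ` {x \<in> fst c. \<phi> t x \<in> fst d}}" by auto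
  next
    fix z assume "z \<in> {(t, u). t \<in> {0..1} \<and> u \<in> snd c ` {x \<in> fst c. \<phi> t x \<in> fst d}}"
    then obtain t x where "z = (t, snd c x)" "t \<in> {0..1}" "x \<in> fst c" "\<phi> t x \<in> fst d" by auto
    then show "z \<in> snd (rchart c) ` {z \<in> fst (rchart c) \<inter> {0..1} \<times> points A. (\<lambda>(t, x). \<phi> t x) z \<in> fst d}"
      using in_points[OF that] by (intro image_eqI[of _ _ "(t, x)"]) auto
  qed
  have fun_eq: "(snd d \<circ> (\<lambda>(t, x). \<phi> t x) \<circ> chart_inv (rchart c)) z = (case z of (t, u) \<Rightarrow> snd d (\<phi> t (chart_inv c u)))"
    if c: "c \<in> A" and z': "z \<in> {(t, u). t \<in> {0..1} \<and> u \<in> snd c ` {x \<in> fst c. \<phi> t x \<in> fst d}}" for c d :: "('a, 'e) chart" and z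
  proof -
    obtain t u where z: "z = (t, u)" "u \<in> snd c ` fst c" using z' by auto
    show ?thesis using chart_inv_rchart[OF A c z(2)] by (simp add: z)
  qed
  have "smooth_on {(t, u). t \<in> {0..1} \<and> u \<in> snd c ` {x \<in> fst c. \<phi> t x \<in> fst d}} (\<lambda>(t, u). snd d (\<phi> t (chart_inv c u))) \<longleftrightarrow>
     smooth_on (snd (rchart c) ` {z \<in> fst (rchart c) \<inter> {0..1} \<times> points A. (\<lambda>(t, x). \<phi> t x) z \<in> fst d})
       (snd d \<circ> (\<lambda>(t, x). \<phi> t x) \<circ> chart_inv (rchart c))" if c: "c \<in> A" for c d :: "('a, 'e) chart"
    unfolding set_eq[OF c]
    by (rule iffI; erule smooth_on_cong) (simp_all only: fun_eq[OF c])
  then have "(\<forall>c\<in>A. \<forall>d\<in>A. smooth_on {(t, u). t \<in> {0..1} \<and> u \<in> snd c ` {x \<in> fst c. \<phi> t x \<in> fst d}} (\<lambda>(t, u). snd d (\<phi> t (chart_inv c u)))) \<longleftrightarrow>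
     (\<forall>c'\<in>ratlas A. \<forall>d\<in>A. smooth_on (snd c' ` {z \<in> fst c' \<inter> {0..1} \<times> points A. (\<lambda>(t, x). \<phi> t x) z \<in> fst d})
       (snd d \<circ> (\<lambda>(t, x). \<phi> t x) \<circ> chart_inv c'))"
    by (simp only: ratlas_def ball_simps cong: ball_cong)
  then show ?thesis
    unfolding is_isotopy_def smooth_map_on_def top by (simp only: conj_assoc)
qed

section \<open>Differentials and pullbacks of two-forms\<close>

definition rep_deriv :: "('a \<Rightarrow> 'b) \<Rightarrow> ('a, 'e::euclidean_space) chart \<Rightarrow> ('b, 'g::euclidean_space) chart \<Rightarrow> 'a \<Rightarrow> 'e \<Rightarrow> 'g" where
  "rep_deriv f c d x = frechet_derivative (snd d \<circ> f \<circ> chart_inv c) (at (snd c x))"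

text \<open>Smoothness on an open neighbourhood is the setting in which derivatives are unique and
  the chain rule holds; it covers maps such as \<open>\<psi>\<close> that are smooth only on an open
  part.\<close>

definition smooth_near :: "('a, 'e::euclidean_space) chart set \<Rightarrow> ('b, 'g::euclidean_space) chart set \<Rightarrow> ('a \<Rightarrow> 'b) \<Rightarrow> 'a \<Rightarrow> bool" where
  "smooth_near A B f x \<longleftrightarrow> smooth_atlas A \<and> smooth_atlas B \<and>
     (\<exists>W. openin (manifold_topology A) W \<and> x \<in> W \<and> smooth_map_on A W B f)"

lemma openin_preimage_chart:
  assumes A: "smooth_atlas A" and B: "smooth_atlas B" and W: "openin (manifold_topology A) W"
    and f: "smooth_map_on A W B f" and V: "openin (manifold_topology B) V"
  shows "openin (manifold_topology A) {x \<in> W. f x \<in> V}"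
proof -
  have "continuous_map (subtopology (manifold_topology A) W) (manifold_topology B) f"
    using f by (simp add: smooth_map_on_def)
  from openin_continuous_map_preimage[OF this V]
  have "openin (subtopology (manifold_topology A) W) {x \<in> W. f x \<in> V}"
    using openin_subset[OF W] A by (simp add: Int_absorb1 cong: conj_cong) (smt (verit) Collect_cong subsetD)
  then show ?thesis using openin_open_subtopology[OF W] by blast
qed

lemma rep_Cinf:
  assumes A: "smooth_atlas A" and B: "smooth_atlas B" and W: "openin (manifold_topology A) W"
    and f: "smooth_map_on A W B f" and c: "c \<in> A" and d: "d \<in> B"
  shows "open (snd c ` {x \<in> fst c \<inter> W. f x \<in> fst d})" (is ?op)
    and "Cinf (snd c ` {x \<in> fst c \<inter> W. f x \<in> fst d}) (snd d \<circ> f \<circ> chart_inv c)"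
proof -
  have "open (snd c ` ({x \<in> W. f x \<in> fst d} \<inter> fst c))"
    by (intro open_chart_image[OF A c] openin_preimage_chart[OF A B W f] openin_chart[OF B d])
  moreover have "{x \<in> W. f x \<in> fst d} \<inter> fst c = {x \<in> fst c \<inter> W. f x \<in> fst d}" by auto
  ultimately show op: ?op by simp
  have "smooth_on (snd c ` {x \<in> fst c \<inter> W. f x \<in> fst d}) (snd d \<circ> f \<circ> chart_inv c)"
    using f c d unfolding smooth_map_on_def by blast
  then show "Cinf (snd c ` {x \<in> fst c \<inter> W. f x \<in> fst d}) (snd d \<circ> f \<circ> chart_inv c)"
    using op by (simp add: smooth_on_open)
qed

lemma smooth_near_has_derivative:
  assumes "smooth_near A B f x" "c \<in> A" "x \<in> fst c" "d \<in> B" "f x \<in> fst d"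
  shows "((snd d \<circ> f \<circ> chart_inv c) has_derivative rep_deriv f c d x) (at (snd c x))"
proof -
  obtain W where W: "openin (manifold_topology A) W" "x \<in> W" "smooth_map_on A W B f"
    and A: "smooth_atlas A" and B: "smooth_atlas B"
    using assms(1) by (auto simp: smooth_near_def)
  show ?thesis unfolding rep_deriv_def
    using assms W by (intro Cinf_has_derivative[OF rep_Cinf(2)[OF A B W(1,3) assms(2,4)]]) auto
qed

lemma rep_deriv_linear:
  "smooth_near A B f x \<Longrightarrow> c \<in> A \<Longrightarrow> x \<in> fst c \<Longrightarrow> d \<in> B \<Longrightarrow> f x \<in> fst d \<Longrightarrow> linear (rep_deriv f c d x)"
  by (rule has_derivative_linear[OF smooth_near_has_derivative])

lemma smooth_near_open:
  assumes "smooth_near A B f x" "openin (manifold_topology B) V" "f x \<in> V"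
  obtains W where "openin (manifold_topology A) W" "x \<in> W" "smooth_map_on A W B f" "\<And>y. y \<in> W \<Longrightarrow> f y \<in> V"
proof -
  obtain W where W: "openin (manifold_topology A) W" "x \<in> W" "smooth_map_on A W B f"
    and A: "smooth_atlas A" and B: "smooth_atlas B"
    using assms(1) by (auto simp: smooth_near_def)
  have op: "openin (manifold_topology A) {x \<in> W. f x \<in> V}"
    by (rule openin_preimage_chart[OF A B W(1,3) assms(2)])
  moreover have "smooth_map_on A {x \<in> W. f x \<in> V} B f"
    using W(3) A B by (rule smooth_map_on_subset) (use openin_subset[OF op] A in auto)
  ultimately show thesis using W assms(3) by (intro that[of "{x \<in> W. f x \<in> V}"]) auto
qed

lemma smooth_nearI:
  "smooth_atlas A \<Longrightarrow> smooth_atlas B \<Longrightarrow> openin (manifold_topology A) W \<Longrightarrow> x \<in> W \<Longrightarrow> smooth_map_on A W B f \<Longrightarrow> smooth_near A B f x"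
  unfolding smooth_near_def by blast

lemma openin_points: "smooth_atlas A \<Longrightarrow> openin (manifold_topology A) (points A)"
  by (metis openin_topspace topspace_manifold)

lemma smooth_nearI_points:
  "smooth_atlas A \<Longrightarrow> smooth_atlas B \<Longrightarrow> x \<in> points A \<Longrightarrow> smooth_map_on A (points A) B f \<Longrightarrow> smooth_near A B f x"
  by (rule smooth_nearI[OF _ _ openin_points])

lemma smooth_near_points: "smooth_near A B f x \<Longrightarrow> x \<in> points A \<and> f x \<in> points B"
proof -
  assume "smooth_near A B f x"
  then obtain W where W: "openin (manifold_topology A) W" "x \<in> W" "smooth_map_on A W B f"
    and at: "smooth_atlas A" "smooth_atlas B"
    by (auto simp: smooth_near_def)
  have "x \<in> points A" using openin_subset[OF W(1)] W(2) at by auto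
  with smooth_map_on_points[OF W(3) at W(2)] show ?thesis by simp
qed

lemma smooth_near_id: "smooth_atlas A \<Longrightarrow> x \<in> points A \<Longrightarrow> smooth_near A A (\<lambda>x. x) x"
  by (intro smooth_nearI_points smooth_map_on_id) auto

lemma smooth_near_compose:
  assumes f: "smooth_near A B f x" and g: "smooth_near B C g (f x)"
  shows "smooth_near A C (\<lambda>x. g (f x)) x"
proof -
  obtain V where V: "openin (manifold_topology B) V" "f x \<in> V" "smooth_map_on B V C g"
    and at: "smooth_atlas A" "smooth_atlas B" "smooth_atlas C"
    using f g by (auto simp: smooth_near_def)
  obtain W where W: "openin (manifold_topology A) W" "x \<in> W" "smooth_map_on A W B f" "\<And>y. y \<in> W \<Longrightarrow> f y \<in> V"
    by (rule smooth_near_open[OF f V(1,2)]) blast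
  have "smooth_map_on A W C (\<lambda>x. g (f x))"
    using W V openin_subset[OF W(1)] at by (intro smooth_map_on_compose[OF at W(3) V(3)]) auto
  then show ?thesis using W at by (intro smooth_nearI)
qed

lemma smooth_near_cong:
  assumes f: "smooth_near A B f x" and W: "openin (manifold_topology A) W" "x \<in> W" "\<And>y. y \<in> W \<Longrightarrow> f y = g y"
  shows "smooth_near A B g x"
proof -
  obtain V where V: "openin (manifold_topology A) V" "x \<in> V" "smooth_map_on A V B f"
    and at: "smooth_atlas A" "smooth_atlas B"
    using f by (auto simp: smooth_near_def)
  have op: "openin (manifold_topology A) (V \<inter> W)" using V W by auto
  have sub: "V \<inter> W \<subseteq> points A" using openin_subset[OF op] at by simp
  have "smooth_map_on A (V \<inter> W) B f" using smooth_map_on_subset[OF V(3) at _ sub] by auto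
  then have "smooth_map_on A (V \<inter> W) B g"
    by (rule smooth_map_on_cong[OF _ at sub]) (use W in auto)
  then show ?thesis using V W op at by (intro smooth_nearI[of A B "V \<inter> W"]) auto
qed

lemma rep_deriv_cong:
  assumes f: "smooth_near A B f x" and W: "openin (manifold_topology A) W" "x \<in> W" "\<And>y. y \<in> W \<Longrightarrow> f y = g y"
    and c: "c \<in> A" "x \<in> fst c" "d \<in> B" "f x \<in> fst d"
  shows "rep_deriv g c d x = rep_deriv f c d x"
proof -
  have A: "smooth_atlas A" using f by (simp add: smooth_near_def)
  have "((snd d \<circ> g \<circ> chart_inv c) has_derivative rep_deriv f c d x) (at (snd c x))"
  proof (rule has_derivative_transform_within_open[OF smooth_near_has_derivative[OF f c]])
    show "open (snd c ` (W \<inter> fst c))" by (rule open_chart_image[OF A c(1) W(1)])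
    show "(snd d \<circ> f \<circ> chart_inv c) u = (snd d \<circ> g \<circ> chart_inv c) u" if "u \<in> snd c ` (W \<inter> fst c)" for u
      using that W by (auto simp: chart_inv_chart[OF A c(1)])
  qed (use W c in auto)
  from frechet_derivative_at[OF this] show ?thesis by (simp add: rep_deriv_def)
qed

lemma rep_deriv_compose:
  assumes f: "smooth_near A B f x" and g: "smooth_near B C g (f x)"
    and c: "c \<in> A" "x \<in> fst c" and d: "d \<in> B" "f x \<in> fst d" and e: "e \<in> C" "g (f x) \<in> fst e"
  shows "rep_deriv (\<lambda>x. g (f x)) c e x v = rep_deriv g d e (f x) (rep_deriv f c d x v)"
proof -
  have A: "smooth_atlas A" and B: "smooth_atlas B" using f by (auto simp: smooth_near_def)
  obtain W where W: "openin (manifold_topology A) W" "x \<in> W" "smooth_map_on A W B f" "\<And>y. y \<in> W \<Longrightarrow> f y \<in> fst d"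
    by (rule smooth_near_open[OF f openin_chart[OF B d(1)] d(2)]) blast
  have 1: "((snd d \<circ> f \<circ> chart_inv c) has_derivative rep_deriv f c d x) (at (snd c x))"
    by (rule smooth_near_has_derivative[OF f c d])
  have eq: "(snd d \<circ> f \<circ> chart_inv c) (snd c x) = snd d (f x)" by (simp add: chart_inv_chart[OF A c])
  have 2: "((snd e \<circ> g \<circ> chart_inv d) has_derivative rep_deriv g d e (f x)) (at ((snd d \<circ> f \<circ> chart_inv c) (snd c x)))"
    unfolding eq by (rule smooth_near_has_derivative[OF g d e])
  have "((snd e \<circ> (\<lambda>x. g (f x)) \<circ> chart_inv c) has_derivative (\<lambda>v. rep_deriv g d e (f x) (rep_deriv f c d x v))) (at (snd c x))"
  proof (rule has_derivative_transform_within_open[OF has_derivative_compose[OF 1 2]])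
    show "open (snd c ` (W \<inter> fst c))" by (rule open_chart_image[OF A c(1) W(1)])
    show "(snd e \<circ> g \<circ> chart_inv d) ((snd d \<circ> f \<circ> chart_inv c) u) = (snd e \<circ> (\<lambda>x. g (f x)) \<circ> chart_inv c) u"
      if "u \<in> snd c ` (W \<inter> fst c)" for u
      using that W by (auto simp: chart_inv_chart[OF A c(1)] chart_inv_chart[OF B d(1)])
  qed (use W c in auto)
  from frechet_derivative_at[OF this] show ?thesis unfolding rep_deriv_def by metis
qed

lemma rep_deriv_id:
  assumes A: "smooth_atlas A" and c: "c \<in> A" "x \<in> fst c"
  shows "rep_deriv (\<lambda>x. x) c c x v = v"
proof -
  have "((snd c \<circ> (\<lambda>x. x) \<circ> chart_inv c) has_derivative (\<lambda>v. v)) (at (snd c x))"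
  proof (rule has_derivative_transform_within_open[OF has_derivative_ident])
    show "open (snd c ` fst c)" by (rule open_chart[OF A c(1)])
  qed (use c in \<open>auto simp: chart_inv_chart[OF A c(1)]\<close>)
  from frechet_derivative_at[OF this] show ?thesis unfolding rep_deriv_def by metis
qed

lemma coord_vector_eq:
  "coord_vector A c x b = (\<lambda>d. if d \<in> A \<and> x \<in> fst d then rep_deriv (\<lambda>x. x) c d x b else 0)"
  unfolding coord_vector_def rep_deriv_def comp_def ..

lemma tangent_space_eq:
  "tangent_space A x = {v. (\<forall>c\<in>A. \<forall>d\<in>A. x \<in> fst c \<inter> fst d \<longrightarrow> v d = rep_deriv (\<lambda>x. x) c d x (v c)) \<and>
     (\<forall>c. c \<notin> A \<or> x \<notin> fst c \<longrightarrow> v c = 0)}"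
  unfolding tangent_space_def rep_deriv_def comp_def ..

lemma tangent_zero: "v \<in> tangent_space A x \<Longrightarrow> c \<notin> A \<or> x \<notin> fst c \<Longrightarrow> v c = 0"
  unfolding tangent_space_eq by blast

lemma tangent_change:
  "v \<in> tangent_space A x \<Longrightarrow> c \<in> A \<Longrightarrow> d \<in> A \<Longrightarrow> x \<in> fst c \<Longrightarrow> x \<in> fst d \<Longrightarrow> v d = rep_deriv (\<lambda>x. x) c d x (v c)"
  unfolding tangent_space_eq by blast

lemma tangent_eqI:
  assumes "v \<in> tangent_space A x" "w \<in> tangent_space A x" "c \<in> A" "x \<in> fst c" "v c = w c"
  shows "v = w"
proof
  fix d
  show "v d = w d"
  proof (cases "d \<in> A \<and> x \<in> fst d")
    case True
    then show ?thesis using tangent_change assms by metis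
  next
    case False
    then show ?thesis using tangent_zero[OF assms(1), of d] tangent_zero[OF assms(2), of d] by simp
  qed
qed

context
  fixes A :: "('a, 'e::euclidean_space) chart set" and c x
  assumes A: "smooth_atlas A" and c: "c \<in> A" "x \<in> fst c"
begin

lemma coord_vector_in: "coord_vector A c x b \<in> tangent_space A x"
  unfolding tangent_space_eq coord_vector_eq
proof (intro CollectI conjI ballI impI allI)
  fix d e assume d: "d \<in> A" and e: "e \<in> A" and x: "x \<in> fst d \<inter> fst e"
  have near: "smooth_near A A (\<lambda>x. x) x" using smooth_near_id[OF A in_points[OF c]] .
  show "(if e \<in> A \<and> x \<in> fst e then rep_deriv (\<lambda>x. x) c e x b else 0) =
       rep_deriv (\<lambda>x. x) d e x (if d \<in> A \<and> x \<in> fst d then rep_deriv (\<lambda>x. x) c d x b else 0)"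
    using rep_deriv_compose[OF near near c d _ e] x d e by auto
qed auto

lemma coord_vector_self: "coord_vector A c x b c = b"
  by (simp add: coord_vector_eq c rep_deriv_id[OF A c])

lemma coord_vector_tangent: "v \<in> tangent_space A x \<Longrightarrow> coord_vector A c x (v c) = v"
  by (rule tangent_eqI[OF coord_vector_in _ c]) (simp_all add: coord_vector_self)

lemma lincomb_in:
  assumes "v \<in> tangent_space A x" "w \<in> tangent_space A x"
  shows "lincomb a v b w \<in> tangent_space A x"
  unfolding tangent_space_eq
proof (intro CollectI conjI ballI impI allI)
  fix d e assume d: "d \<in> A" and e: "e \<in> A" and x: "x \<in> fst d \<inter> fst e"
  have "linear (rep_deriv (\<lambda>x. x) d e x)"
    using rep_deriv_linear[OF smooth_near_id[OF A in_points[OF c]] d _ e] x by auto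
  then show "lincomb a v b w e = rep_deriv (\<lambda>x. x) d e x (lincomb a v b w d)"
    using tangent_change[OF assms(1) d e] tangent_change[OF assms(2) d e] x
    by (simp add: lincomb_def linear_add linear_scale)
next
  fix d assume "d \<notin> A \<or> x \<notin> fst d"
  then show "lincomb a v b w d = 0" 
    using tangent_zero[OF assms(1), of d] tangent_zero[OF assms(2), of d] by (simp add: lincomb_def)
qed

lemma coord_vector_lincomb:
  "coord_vector A c x (a *\<^sub>R v + b *\<^sub>R w) = lincomb a (coord_vector A c x v) b (coord_vector A c x w)"
  by (rule tangent_eqI[OF coord_vector_in lincomb_in c])
     (simp_all add: coord_vector_in coord_vector_self lincomb_def)

end

lemma zero_in_tangent:
  assumes A: "smooth_atlas A" and x: "x \<in> points A"
  shows "(\<lambda>_. 0) \<in> tangent_space A x"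
proof -
  obtain c where c: "c \<in> A" "x \<in> fst c" using x by (rule pointsE)
  have "lincomb 0 (coord_vector A c x 0) 0 (coord_vector A c x 0) \<in> tangent_space A x"
    by (intro lincomb_in[OF A c] coord_vector_in[OF A c])
  then show ?thesis by (simp add: lincomb_def)
qed

text \<open>\<open>differential\<close> picks one chart by choice. The chain rule and the
  compatibility of the coordinates of a tangent vector make every chart around \<open>x\<close> give
  the same result.\<close>

lemma differential_apply:
  assumes f: "smooth_near A B f x" and v: "v \<in> tangent_space A x" and c: "c \<in> A" "x \<in> fst c"
  shows "differential A B f x v d = (if d \<in> B \<and> f x \<in> fst d then rep_deriv f c d x (v c) else 0)"
proof (cases "d \<in> B \<and> f x \<in> fst d")
  case True
  have A: "smooth_atlas A" using f by (simp add: smooth_near_def)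
  define c0 where "c0 = (SOME c. c \<in> A \<and> x \<in> fst c)"
  have c0: "c0 \<in> A" "x \<in> fst c0" using someI[of "\<lambda>c. c \<in> A \<and> x \<in> fst c" c] c by (auto simp: c0_def)
  have "rep_deriv f c d x (v c) = rep_deriv f c0 d x (rep_deriv (\<lambda>x. x) c c0 x (v c))"
    using rep_deriv_compose[OF smooth_near_id[OF A in_points[OF c]] f c c0] True by auto
  also have "rep_deriv (\<lambda>x. x) c c0 x (v c) = v c0"
    using tangent_change[OF v c(1) c0(1) c(2) c0(2)] by simp
  finally show ?thesis using True by (simp add: differential_def Let_def c0_def rep_deriv_def)
qed (auto simp: differential_def Let_def)

lemma differential_eq_coord:
  assumes f: "smooth_near A B f x" and v: "v \<in> tangent_space A x" and c: "c \<in> A" "x \<in> fst c" and d: "d \<in> B" "f x \<in> fst d"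
  shows "differential A B f x v = coord_vector B d (f x) (rep_deriv f c d x (v c))"
proof
  fix e
  have B: "smooth_atlas B" using f by (simp add: smooth_near_def)
  show "differential A B f x v e = coord_vector B d (f x) (rep_deriv f c d x (v c)) e"
    using rep_deriv_compose[OF f smooth_near_id[OF B in_points[OF d]] c d, of e]
    by (simp add: differential_apply[OF f v c] coord_vector_eq)
qed

lemma differential_in:
  assumes f: "smooth_near A B f x" and v: "v \<in> tangent_space A x"
  shows "differential A B f x v \<in> tangent_space B (f x)"
proof -
  have B: "smooth_atlas B" using f by (simp add: smooth_near_def)
  obtain c where c: "c \<in> A" "x \<in> fst c" using smooth_near_points[OF f] by (auto elim!: pointsE)
  obtain d where d: "d \<in> B" "f x \<in> fst d" using smooth_near_points[OF f] by (auto elim!: pointsE)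
  show ?thesis unfolding differential_eq_coord[OF f v c d] by (rule coord_vector_in[OF B d])
qed

lemma differential_compose:
  assumes f: "smooth_near A B f x" and g: "smooth_near B C g (f x)" and v: "v \<in> tangent_space A x"
  shows "differential A C (\<lambda>x. g (f x)) x v = differential B C g (f x) (differential A B f x v)"
proof
  fix e
  obtain c where c: "c \<in> A" "x \<in> fst c" using smooth_near_points[OF f] by (auto elim!: pointsE)
  obtain d where d: "d \<in> B" "f x \<in> fst d" using smooth_near_points[OF f] by (auto elim!: pointsE)
  show "differential A C (\<lambda>x. g (f x)) x v e = differential B C g (f x) (differential A B f x v) e"
    using rep_deriv_compose[OF f g c d, of e] d
    by (simp add: differential_apply[OF smooth_near_compose[OF f g] v c]
        differential_apply[OF g differential_in[OF f v] d] differential_apply[OF f v c])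
qed

lemma differential_id:
  assumes "smooth_atlas A" "x \<in> points A" "v \<in> tangent_space A x"
  shows "differential A A (\<lambda>x. x) x v = v"
proof -
  obtain c where c: "c \<in> A" "x \<in> fst c" using assms(2) by (rule pointsE)
  show ?thesis
    using differential_eq_coord[OF smooth_near_id[OF assms(1,2)] assms(3) c c]
    by (simp add: rep_deriv_id[OF assms(1) c] coord_vector_tangent[OF assms(1) c assms(3)])
qed

lemma differential_cong:
  assumes f: "smooth_near A B f x" and W: "openin (manifold_topology A) W" "x \<in> W" "\<And>y. y \<in> W \<Longrightarrow> f y = g y"
    and v: "v \<in> tangent_space A x"
  shows "differential A B g x v = differential A B f x v"
proof
  fix d
  obtain c where c: "c \<in> A" "x \<in> fst c" using smooth_near_points[OF f] by (auto elim!: pointsE)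
  have "rep_deriv g c d x = rep_deriv f c d x" if "d \<in> B" "f x \<in> fst d"
    using rep_deriv_cong[OF f W c that] .
  then show "differential A B g x v d = differential A B f x v d"
    using W(3)[OF W(2)]
    by (simp add: differential_apply[OF f v c] differential_apply[OF smooth_near_cong[OF f W] v c])
qed

lemma differential_lincomb:
  assumes f: "smooth_near A B f x" and v: "v \<in> tangent_space A x" and w: "w \<in> tangent_space A x"
  shows "differential A B f x (lincomb a v b w) = lincomb a (differential A B f x v) b (differential A B f x w)"
proof
  fix d
  have A: "smooth_atlas A" using f by (simp add: smooth_near_def)
  obtain c where c: "c \<in> A" "x \<in> fst c" using smooth_near_points[OF f] by (auto elim!: pointsE)
  have "linear (rep_deriv f c d x)" if "d \<in> B" "f x \<in> fst d" using rep_deriv_linear[OF f c that] .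
  moreover have "lincomb a v b w c = a *\<^sub>R v c + b *\<^sub>R w c" by (simp add: lincomb_def)
  ultimately have "differential A B f x (lincomb a v b w) d =
      a *\<^sub>R differential A B f x v d + b *\<^sub>R differential A B f x w d"
    unfolding differential_apply[OF f lincomb_in[OF A c v w] c] differential_apply[OF f v c] differential_apply[OF f w c]
    by (auto simp: linear_add linear_scale)
  then show "differential A B f x (lincomb a v b w) d = lincomb a (differential A B f x v) b (differential A B f x w) d"
    by (simp add: lincomb_def)
qed

lemma pullback_compose:
  assumes f: "smooth_map_on A (points A) B f" and g: "smooth_map_on B (points B) C g"
    and at: "smooth_atlas A" "smooth_atlas B" "smooth_atlas C"
  shows "pullback A C (\<lambda>x. g (f x)) \<omega> = pullback A B f (pullback B C g \<omega>)"
proof (intro ext)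
  fix x v w
  show "pullback A C (\<lambda>x. g (f x)) \<omega> x v w = pullback A B f (pullback B C g \<omega>) x v w"
  proof (cases "x \<in> points A \<and> v \<in> tangent_space A x \<and> w \<in> tangent_space A x")
    case True
    then have nf: "smooth_near A B f x" using smooth_nearI_points[OF at(1,2) _ f] by blast
    have ng: "smooth_near B C g (f x)"
      by (rule smooth_nearI_points[OF at(2,3) _ g]) (simp add: smooth_near_points[OF nf])
    show ?thesis
      using True differential_in[OF nf] smooth_near_points[OF nf] differential_compose[OF nf ng]
      by (simp add: pullback_def)
  qed (auto simp: pullback_def)
qed

lemma pullback_cong:
  assumes f: "smooth_map_on A (points A) B f" and at: "smooth_atlas A" "smooth_atlas B"
    and eq: "\<And>x. x \<in> points A \<Longrightarrow> f x = g x"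
  shows "pullback A B g \<omega> = pullback A B f \<omega>"
proof (intro ext)
  fix x v w
  have "differential A B g x v = differential A B f x v" if "x \<in> points A" "v \<in> tangent_space A x" for v
    by (rule differential_cong[OF smooth_nearI_points[OF at that(1) f] openin_points[OF at(1)] that(1) eq that(2)])
  then show "pullback A B g \<omega> x v w = pullback A B f \<omega> x v w"
    using eq by (simp add: pullback_def)
qed

lemma pullback_id:
  assumes "smooth_atlas A" "\<omega> \<in> two_forms A"
  shows "pullback A A (\<lambda>x. x) \<omega> = \<omega>"
proof (intro ext)
  fix x v w
  show "pullback A A (\<lambda>x. x) \<omega> x v w = \<omega> x v w"
    using assms differential_id[OF assms(1)] by (auto simp: pullback_def two_forms_def)
qed

text \<open>In coordinates: the terms containing second derivatives of \<open>F\<close> cancel by symmetry.\<close>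

lemma closed_pullback_coordinates:
  fixes F :: "'e::euclidean_space \<Rightarrow> 'g::euclidean_space" and \<Omega> :: "'g \<Rightarrow> 'g \<Rightarrow> 'g \<Rightarrow> real"
  assumes T: "open T" and F: "Cinf T F" and T': "open T'" and FT: "F ` T \<subseteq> T'"
    and \<Omega>: "\<And>p q. Cinf T' (\<Omega> p q)"
    and lin1: "\<And>a p b p' q z. z \<in> T' \<Longrightarrow> \<Omega> (a *\<^sub>R p + b *\<^sub>R p') q z = a * \<Omega> p q z + b * \<Omega> p' q z"
    and anti: "\<And>p q z. z \<in> T' \<Longrightarrow> \<Omega> p q z = - \<Omega> q p z"
    and closed: "\<And>z p q r. z \<in> T' \<Longrightarrow> frechet_derivative (\<Omega> q r) (at z) p +
        frechet_derivative (\<Omega> r p) (at z) q + frechet_derivative (\<Omega> p q) (at z) r = 0"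
    and u: "u \<in> T"
  defines "\<Phi> \<equiv> \<lambda>a b u. \<Omega> (frechet_derivative F (at u) a) (frechet_derivative F (at u) b) (F u)"
  shows "frechet_derivative (\<Phi> b c) (at u) a + frechet_derivative (\<Phi> c a) (at u) b +
    frechet_derivative (\<Phi> a b) (at u) c = 0"
proof -
  define DF where "DF a u = frechet_derivative F (at u) a" for a u
  define D2 where "D2 a b = frechet_derivative (DF a) (at u) b" for a b
  have D2sym: "D2 a b = D2 b a" for a b
    unfolding D2_def DF_def by (rule frechet_derivative_commute[OF T F u])
  have linp: "linear (\<lambda>p. \<Omega> p q z)" if "z \<in> T'" for q z
  proof (rule linearI)
    show "\<Omega> (x + y) q z = \<Omega> x q z + \<Omega> y q z" for x y using lin1[OF that, of 1 x 1 y q] by simp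
    show "\<Omega> (r *\<^sub>R x) q z = r *\<^sub>R \<Omega> x q z" for r x using lin1[OF that, of r x 0 x q] by simp
  qed
  have linq: "linear (\<lambda>q. \<Omega> p q z)" if "z \<in> T'" for p z
    using linear_compose_neg[OF linp[OF that, of p]] by (subst anti[OF that]) simp
  \<comment> \<open>Separates the dependence on the point from that on the two arguments, so that
    the product rule can be applied.\<close>
  have expand: "\<Omega> p q z = (\<Sum>i\<in>Basis. \<Sum>j\<in>Basis. (p \<bullet> i) * (q \<bullet> j) * \<Omega> i j z)" if "z \<in> T'" for p q z
  proof -
    have "\<Omega> p q z = (\<Sum>i\<in>Basis. (p \<bullet> i) * \<Omega> i q z)"
      using linear_sum[OF linp[OF that, of q], of "\<lambda>b. (p \<bullet> b) *\<^sub>R b" Basis]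
      by (simp only: euclidean_representation linear_scale[OF linp[OF that]] real_scaleR_def)
    also have "\<dots> = (\<Sum>i\<in>Basis. (p \<bullet> i) * (\<Sum>j\<in>Basis. (q \<bullet> j) * \<Omega> i j z))"
    proof (rule sum.cong[OF refl])
      fix i :: 'g
      have "\<Omega> i q z = (\<Sum>j\<in>Basis. (q \<bullet> j) * \<Omega> i j z)"
        using linear_sum[OF linq[OF that, of i], of "\<lambda>b. (q \<bullet> b) *\<^sub>R b" Basis]
        by (simp only: euclidean_representation linear_scale[OF linq[OF that]] real_scaleR_def)
      then show "(p \<bullet> i) * \<Omega> i q z = (p \<bullet> i) * (\<Sum>j\<in>Basis. (q \<bullet> j) * \<Omega> i j z)" by simp
    qed
    finally show ?thesis by (simp add: sum_distrib_left mult.assoc)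
  qed
  have Fu: "F u \<in> T'" using u FT by auto
  have Dexpand: "frechet_derivative (\<Omega> p q) (at (F u)) w =
      (\<Sum>i\<in>Basis. \<Sum>j\<in>Basis. (p \<bullet> i) * (q \<bullet> j) * frechet_derivative (\<Omega> i j) (at (F u)) w)" for p q w
  proof -
    have "((\<lambda>z. \<Sum>i\<in>Basis. \<Sum>j\<in>Basis. (p \<bullet> i) * (q \<bullet> j) * \<Omega> i j z) has_derivative
        (\<lambda>w. \<Sum>i\<in>Basis. \<Sum>j\<in>Basis. (p \<bullet> i) * (q \<bullet> j) * frechet_derivative (\<Omega> i j) (at (F u)) w)) (at (F u))"
      by (intro has_derivative_sum has_derivative_mult_right Cinf_has_derivative[OF \<Omega> Fu])
    then have "((\<Omega> p q) has_derivative
        (\<lambda>w. \<Sum>i\<in>Basis. \<Sum>j\<in>Basis. (p \<bullet> i) * (q \<bullet> j) * frechet_derivative (\<Omega> i j) (at (F u)) w)) (at (F u))"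
      by (rule has_derivative_transform_within_open[OF _ T' Fu]) (rule expand[symmetric])
    from fun_cong[OF frechet_derivative_at[OF this]] show ?thesis by simp
  qed
  have der: "frechet_derivative (\<Phi> a b) (at u) c =
      \<Omega> (D2 a c) (DF b u) (F u) + \<Omega> (DF a u) (D2 b c) (F u) +
      frechet_derivative (\<Omega> (DF a u) (DF b u)) (at (F u)) (DF c u)" for a b c
  proof -
    have dDF: "(DF a has_derivative D2 a) (at u)" for a
      unfolding D2_def using Cinf_has_derivative[OF Cinf_derivative[OF F] u] unfolding DF_def .
    have dO: "((\<lambda>u. \<Omega> i j (F u)) has_derivative (\<lambda>c. frechet_derivative (\<Omega> i j) (at (F u)) (DF c u))) (at u)" for i j
      unfolding DF_def by (rule has_derivative_compose[OF Cinf_has_derivative[OF F u] Cinf_has_derivative[OF \<Omega> Fu]])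
    have "((\<lambda>u. \<Sum>i\<in>Basis. \<Sum>j\<in>Basis. ((DF a u \<bullet> i) * (DF b u \<bullet> j)) * \<Omega> i j (F u)) has_derivative
        (\<lambda>c. \<Sum>i\<in>Basis. \<Sum>j\<in>Basis. ((DF a u \<bullet> i) * (DF b u \<bullet> j)) * frechet_derivative (\<Omega> i j) (at (F u)) (DF c u) +
            ((DF a u \<bullet> i) * (D2 b c \<bullet> j) + (D2 a c \<bullet> i) * (DF b u \<bullet> j)) * \<Omega> i j (F u))) (at u)"
      by (intro has_derivative_sum has_derivative_mult has_derivative_inner_left dDF dO)
    then have "((\<Phi> a b) has_derivative
        (\<lambda>c. \<Sum>i\<in>Basis. \<Sum>j\<in>Basis. ((DF a u \<bullet> i) * (DF b u \<bullet> j)) * frechet_derivative (\<Omega> i j) (at (F u)) (DF c u) +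
            ((DF a u \<bullet> i) * (D2 b c \<bullet> j) + (D2 a c \<bullet> i) * (DF b u \<bullet> j)) * \<Omega> i j (F u))) (at u)"
    proof (rule has_derivative_transform_within_open[OF _ T u])
      fix y assume "y \<in> T"
      then have "F y \<in> T'" using FT by auto
      from expand[OF this, of "DF a y" "DF b y"]
      show "(\<Sum>i\<in>Basis. \<Sum>j\<in>Basis. ((DF a y \<bullet> i) * (DF b y \<bullet> j)) * \<Omega> i j (F y)) = \<Phi> a b y"
        by (simp add: \<Phi>_def DF_def)
    qed
    from fun_cong[OF frechet_derivative_at[OF this], of c]
    have "frechet_derivative (\<Phi> a b) (at u) c = (\<Sum>i\<in>Basis. \<Sum>j\<in>Basis. ((DF a u \<bullet> i) * (DF b u \<bullet> j)) * frechet_derivative (\<Omega> i j) (at (F u)) (DF c u) +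
            ((DF a u \<bullet> i) * (D2 b c \<bullet> j) + (D2 a c \<bullet> i) * (DF b u \<bullet> j)) * \<Omega> i j (F u))" by simp
    also have "\<dots> = frechet_derivative (\<Omega> (DF a u) (DF b u)) (at (F u)) (DF c u) + (\<Omega> (DF a u) (D2 b c) (F u) + \<Omega> (D2 a c) (DF b u) (F u))"
      unfolding Dexpand[of "DF a u" "DF b u"] expand[OF Fu, of "DF a u" "D2 b c"] expand[OF Fu, of "D2 a c" "DF b u"]
      by (simp only: sum.distrib distrib_right)
    finally show ?thesis by simp
  qed
  show ?thesis
    using anti[OF Fu, of "D2 b a" "DF c u"] anti[OF Fu, of "D2 c b" "DF a u"] anti[OF Fu, of "D2 a c" "DF b u"]
      closed[OF Fu, of "DF b u" "DF c u" "DF a u"]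
    unfolding der D2sym[of a b] D2sym[of b c] D2sym[of c a] by (simp add: D2sym)
qed

lemma two_forms_lin:
  assumes "\<omega> \<in> two_forms A" "x \<in> points A" "v \<in> tangent_space A x" "v' \<in> tangent_space A x" "w \<in> tangent_space A x"
  shows "\<omega> x (lincomb a v b v') w = a * \<omega> x v w + b * \<omega> x v' w"
  using assms unfolding two_forms_def by blast

lemma two_forms_anti:
  assumes "\<omega> \<in> two_forms A" "x \<in> points A" "v \<in> tangent_space A x" "w \<in> tangent_space A x"
  shows "\<omega> x v w = - \<omega> x w v"
  using assms unfolding two_forms_def by blast

lemma two_forms_coeff:
  assumes "\<omega> \<in> two_forms A" "smooth_atlas A" "c \<in> A"
  shows "Cinf (snd c ` fst c) (form_coeff A \<omega> c a b)"
  using assms open_chart[OF assms(2,3)] smooth_on_open unfolding two_forms_def by blast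

lemma form_coeff_lin:
  assumes "\<omega> \<in> two_forms A" "smooth_atlas A" "c \<in> A" "u \<in> snd c ` fst c"
  shows "form_coeff A \<omega> c (a *\<^sub>R p + b *\<^sub>R p') q u = a * form_coeff A \<omega> c p q u + b * form_coeff A \<omega> c p' q u"
proof -
  have x: "chart_inv c u \<in> fst c" using chart_inv_in_dom[OF assms(4)] .
  show ?thesis unfolding form_coeff_def coord_vector_lincomb[OF assms(2,3) x]
    by (rule two_forms_lin[OF assms(1) in_points[OF assms(3) x]]) (rule coord_vector_in[OF assms(2,3) x])+
qed

lemma form_coeff_anti:
  assumes "\<omega> \<in> two_forms A" "smooth_atlas A" "c \<in> A" "u \<in> snd c ` fst c"
  shows "form_coeff A \<omega> c p q u = - form_coeff A \<omega> c q p u"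
proof -
  have x: "chart_inv c u \<in> fst c" using chart_inv_in_dom[OF assms(4)] .
  show ?thesis unfolding form_coeff_def
    by (rule two_forms_anti[OF assms(1) in_points[OF assms(3) x]]) (rule coord_vector_in[OF assms(2,3) x])+
qed

lemma form_coeff_pullback:
  assumes at: "smooth_atlas A" "smooth_atlas B" and f: "smooth_map_on A (points A) B f"
    and c: "c \<in> A" and d: "d \<in> B" and u: "u \<in> snd c ` {x \<in> fst c \<inter> points A. f x \<in> fst d}"
  shows "form_coeff A (pullback A B f \<omega>) c a b u =
    form_coeff B \<omega> d (frechet_derivative (snd d \<circ> f \<circ> chart_inv c) (at u) a)
      (frechet_derivative (snd d \<circ> f \<circ> chart_inv c) (at u) b) ((snd d \<circ> f \<circ> chart_inv c) u)"
proof -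
  obtain x where x: "x \<in> fst c" "x \<in> points A" "f x \<in> fst d" "u = snd c x" using u by auto
  have near: "smooth_near A B f x" by (rule smooth_nearI_points[OF at x(2) f])
  have "differential A B f x (coord_vector A c x a) = coord_vector B d (f x) (frechet_derivative (snd d \<circ> f \<circ> chart_inv c) (at u) a)" for a
    using differential_eq_coord[OF near coord_vector_in[OF at(1) c x(1)] c x(1) d x(3)]
    by (simp add: coord_vector_self[OF at(1) c x(1)] rep_deriv_def x(4))
  then show ?thesis
    using x coord_vector_in[OF at(1) c x(1)]
    by (simp add: form_coeff_def pullback_def chart_inv_chart[OF at(1) c x(1)] chart_inv_chart[OF at(2) d])
qed

lemma pullback_two_forms:
  assumes at: "smooth_atlas A" "smooth_atlas B" and f: "smooth_map_on A (points A) B f"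
    and \<omega>: "\<omega> \<in> two_forms B"
  shows "pullback A B f \<omega> \<in> two_forms A"
  unfolding two_forms_def
proof (intro CollectI conjI ballI allI impI)
  fix x v v' w a b
  assume x: "x \<in> points A" and v: "v \<in> tangent_space A x" and v': "v' \<in> tangent_space A x" and w: "w \<in> tangent_space A x"
  have near: "smooth_near A B f x" by (rule smooth_nearI_points[OF at x f])
  obtain c where c: "c \<in> A" "x \<in> fst c" using x by (rule pointsE)
  have fx: "f x \<in> points B" using smooth_near_points[OF near] by simp
  show "pullback A B f \<omega> x (lincomb a v b v') w = a * pullback A B f \<omega> x v w + b * pullback A B f \<omega> x v' w"
    using two_forms_lin[OF \<omega> fx differential_in[OF near v] differential_in[OF near v'] differential_in[OF near w]]
    by (simp add: pullback_def x v v' w lincomb_in[OF at(1) c v v'] differential_lincomb[OF near v v'])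
  show "pullback A B f \<omega> x v w = - pullback A B f \<omega> x w v"
    using two_forms_anti[OF \<omega> fx differential_in[OF near v] differential_in[OF near w]]
    by (simp add: pullback_def x v w)
next
  fix c a b assume c: "c \<in> A"
  show "smooth_on (snd c ` fst c) (form_coeff A (pullback A B f \<omega>) c a b)"
    unfolding smooth_on_open[OF open_chart[OF at(1) c]]
  proof (rule Cinf_local)
    fix u assume "u \<in> snd c ` fst c"
    then obtain x where x: "x \<in> fst c" "u = snd c x" by auto
    have xA: "x \<in> points A" using in_points[OF c x(1)] .
    obtain d where d: "d \<in> B" "f x \<in> fst d" using smooth_map_on_points[OF f at xA xA] by (rule pointsE)
    define T where "T = snd c ` {x \<in> fst c \<inter> points A. f x \<in> fst d}"
    define F where "F = snd d \<circ> f \<circ> chart_inv c"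
    have T: "open T" and F: "Cinf T F"
      unfolding T_def F_def using rep_Cinf[OF at openin_points[OF at(1)] f c d(1)] by blast+
    have FT: "F ` T \<subseteq> snd d ` fst d" by (auto simp: T_def F_def chart_inv_chart[OF at(1) c])
    \<comment> \<open>A two-form has smooth coefficients for constant arguments, while the arguments
      here vary with the point. Bilinear expansion reduces everything to coefficients with basis
      arguments.\<close>
    have "Cinf T (\<lambda>u. \<Sum>i\<in>Basis. \<Sum>j\<in>Basis. (frechet_derivative F (at u) a \<bullet> i) * (frechet_derivative F (at u) b \<bullet> j) *
        form_coeff B \<omega> d i j (F u))"
      by (intro Cinf_sum Cinf_mult Cinf_inner T Cinf_const Cinf_derivative[OF F]
          Cinf_compose[OF T open_chart[OF at(2) d(1)] F two_forms_coeff[OF \<omega> at(2) d(1)] FT])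
    moreover have "(\<Sum>i\<in>Basis. \<Sum>j\<in>Basis. (frechet_derivative F (at u) a \<bullet> i) * (frechet_derivative F (at u) b \<bullet> j) *
        form_coeff B \<omega> d i j (F u)) = form_coeff A (pullback A B f \<omega>) c a b u" if u: "u \<in> T" for u
    proof -
      have Fu: "F u \<in> snd d ` fst d" using FT u by auto
      note L = form_coeff_lin[OF \<omega> at(2) d(1) Fu] and N = form_coeff_anti[OF \<omega> at(2) d(1) Fu]
      have l1: "linear (\<lambda>p. form_coeff B \<omega> d p q (F u))" for q
      proof (rule linearI)
        show "form_coeff B \<omega> d (x + y) q (F u) = form_coeff B \<omega> d x q (F u) + form_coeff B \<omega> d y q (F u)" for x y
          using L[of 1 x 1 y q] by simp
        show "form_coeff B \<omega> d (r *\<^sub>R x) q (F u) = r *\<^sub>R form_coeff B \<omega> d x q (F u)" for r x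
          using L[of r x 0 x q] by simp
      qed
      have l2: "linear (\<lambda>q. form_coeff B \<omega> d p q (F u))" for p
        using linear_compose_neg[OF l1[of p]] by (subst N) simp
      have s1: "form_coeff B \<omega> d p q (F u) = (\<Sum>i\<in>Basis. (p \<bullet> i) * form_coeff B \<omega> d i q (F u))" for p q
        using linear_sum[OF l1[of q], of "\<lambda>b. (p \<bullet> b) *\<^sub>R b" Basis]
        by (simp only: euclidean_representation linear_scale[OF l1] real_scaleR_def)
      have s2: "form_coeff B \<omega> d p q (F u) = (\<Sum>i\<in>Basis. (q \<bullet> i) * form_coeff B \<omega> d p i (F u))" for p q
        using linear_sum[OF l2[of p], of "\<lambda>b. (q \<bullet> b) *\<^sub>R b" Basis]
        by (simp only: euclidean_representation linear_scale[OF l2] real_scaleR_def)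
      have eq: "form_coeff B \<omega> d p q (F u) = (\<Sum>i\<in>Basis. (p \<bullet> i) * (\<Sum>j\<in>Basis. (q \<bullet> j) * form_coeff B \<omega> d i j (F u)))" for p q
        by (rule trans[OF s1[of p q]], rule sum.cong[OF refl], rule arg_cong[OF s2])
      show ?thesis
        unfolding form_coeff_pullback[OF at f c d(1) u[unfolded T_def], folded F_def]
          eq[of "frechet_derivative F (at u) a" "frechet_derivative F (at u) b"]
        by (simp only: sum_distrib_left mult.assoc)
    qed
    ultimately have "Cinf T (form_coeff A (pullback A B f \<omega>) c a b)"
      by (rule Cinf_cong[OF T, rotated])
    moreover have "u \<in> T" using x xA d by (auto simp: T_def)
    ultimately show "\<exists>T. open T \<and> u \<in> T \<and> Cinf T (form_coeff A (pullback A B f \<omega>) c a b)" using T by blast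
  qed
qed (auto simp: pullback_def)

lemma pullback_closed:
  assumes at: "smooth_atlas A" "smooth_atlas B" and f: "smooth_map_on A (points A) B f"
    and \<omega>: "\<omega> \<in> two_forms B" and cl: "closed_form B \<omega>"
  shows "closed_form A (pullback A B f \<omega>)"
  unfolding closed_form_def
proof (intro ballI allI)
  fix c u a b e assume c: "c \<in> A" and "u \<in> snd c ` fst c"
  then obtain x where x: "x \<in> fst c" "u = snd c x" by auto
  have xA: "x \<in> points A" using in_points[OF c x(1)] .
  obtain d where d: "d \<in> B" "f x \<in> fst d" using smooth_map_on_points[OF f at xA xA] by (rule pointsE)
  define T where "T = snd c ` {x \<in> fst c \<inter> points A. f x \<in> fst d}"
  define F where "F = snd d \<circ> f \<circ> chart_inv c"
  have T: "open T" and F: "Cinf T F"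
    unfolding T_def F_def using rep_Cinf[OF at openin_points[OF at(1)] f c d(1)] by blast+
  have FT: "F ` T \<subseteq> snd d ` fst d" by (auto simp: T_def F_def chart_inv_chart[OF at(1) c])
  have uT: "u \<in> T" using x xA d by (auto simp: T_def)
  define \<Phi> where "\<Phi> a b u = form_coeff B \<omega> d (frechet_derivative F (at u) a) (frechet_derivative F (at u) b) (F u)" for a b u
  have eq: "frechet_derivative (form_coeff A (pullback A B f \<omega>) c a b) (at u) = frechet_derivative (\<Phi> a b) (at u)" for a b
  proof -
    have C: "Cinf (snd c ` fst c) (form_coeff A (pullback A B f \<omega>) c a b)"
      by (rule two_forms_coeff[OF pullback_two_forms[OF at f \<omega>] at(1) c])
    have "((\<Phi> a b) has_derivative frechet_derivative (form_coeff A (pullback A B f \<omega>) c a b) (at u)) (at u)"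
    proof (rule has_derivative_transform_within_open[OF Cinf_has_derivative[OF C] T uT])
      show "u \<in> snd c ` fst c" using x by auto
      show "form_coeff A (pullback A B f \<omega>) c a b y = \<Phi> a b y" if "y \<in> T" for y
        unfolding \<Phi>_def F_def by (rule form_coeff_pullback[OF at f c d(1) that[unfolded T_def]])
    qed
    from frechet_derivative_at[OF this] show ?thesis .
  qed
  show "frechet_derivative (form_coeff A (pullback A B f \<omega>) c b e) (at u) a +
    frechet_derivative (form_coeff A (pullback A B f \<omega>) c e a) (at u) b +
    frechet_derivative (form_coeff A (pullback A B f \<omega>) c a b) (at u) e = 0"
    unfolding eq \<Phi>_def[abs_def]
    by (rule closed_pullback_coordinates[OF T F open_chart[OF at(2) d(1)] FT two_forms_coeff[OF \<omega> at(2) d(1)]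
        form_coeff_lin[OF \<omega> at(2) d(1)] form_coeff_anti[OF \<omega> at(2) d(1)] _ uT])
      (use cl d(1) in \<open>auto simp: closed_form_def\<close>)
qed

lemma diffeoD:
  assumes "diffeo A h"
  shows "smooth_map_on A (points A) A h" "smooth_map_on A (points A) A (inv_into (points A) h)"
    "x \<in> points A \<Longrightarrow> h x \<in> points A" "x \<in> points A \<Longrightarrow> inv_into (points A) h x \<in> points A"
    "x \<in> points A \<Longrightarrow> inv_into (points A) h (h x) = x" "x \<in> points A \<Longrightarrow> h (inv_into (points A) h x) = x"
  using assms unfolding diffeo_def bij_betw_def by (auto intro: f_inv_into_f inv_into_into)

lemma diffeoI:
  assumes at: "smooth_atlas A" and "smooth_map_on A (points A) A h" "smooth_map_on A (points A) A k"
    and k: "\<And>x. x \<in> points A \<Longrightarrow> k (h x) = x" "\<And>x. x \<in> points A \<Longrightarrow> h (k x) = x"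
  shows "diffeo A h"
proof -
  have h: "h x \<in> points A" "k x \<in> points A" if "x \<in> points A" for x
    using smooth_map_on_points[OF _ at at that that] assms(2,3) by auto
  have bij: "bij_betw h (points A) (points A)"
    by (rule bij_betwI[of _ _ _ k]) (use h k in auto)
  have "k x = inv_into (points A) h x" if "x \<in> points A" for x
    using inv_into_f_f[of h "points A" "k x"] bij h[OF that] k(2)[OF that] by (auto simp: bij_betw_def)
  then have "smooth_map_on A (points A) A (inv_into (points A) h)"
    by (rule smooth_map_on_cong[OF assms(3) at at subset_refl])
  then show ?thesis using bij assms(2) by (simp add: diffeo_def)
qed

lemma diffeo_compose:
  assumes at: "smooth_atlas A" and g: "diffeo A g" and h: "diffeo A h"
  shows "diffeo A (\<lambda>x. g (h x))"
proof (rule diffeoI[OF at])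
  show "smooth_map_on A (points A) A (\<lambda>x. g (h x))"
    using diffeoD[OF h] by (intro smooth_map_on_compose[OF at at at diffeoD(1)[OF h] diffeoD(1)[OF g]]) auto
  show "smooth_map_on A (points A) A (\<lambda>x. inv_into (points A) h (inv_into (points A) g x))"
    using diffeoD[OF g] by (intro smooth_map_on_compose[OF at at at diffeoD(2)[OF g] diffeoD(2)[OF h]]) auto
qed (simp_all add: diffeoD[OF g] diffeoD[OF h])

lemma diffeo_inv:
  assumes at: "smooth_atlas A" and h: "diffeo A h"
  shows "diffeo A (inv_into (points A) h)"
  by (rule diffeoI[OF at diffeoD(2)[OF h] diffeoD(1)[OF h]]) (simp_all add: diffeoD[OF h])

lemma diffeo_id: "smooth_atlas A \<Longrightarrow> diffeo A (\<lambda>x. x)"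
  by (rule diffeoI) (auto intro: smooth_map_on_id)

lemma differential_inverse:
  assumes at: "smooth_atlas A" and h: "diffeo A h" and x: "x \<in> points A" and v: "v \<in> tangent_space A x"
  shows "differential A A (inv_into (points A) h) (h x) (differential A A h x v) = v"
proof -
  have nh: "smooth_near A A h x" by (rule smooth_nearI_points[OF at at x diffeoD(1)[OF h]])
  have nk: "smooth_near A A (inv_into (points A) h) (h x)"
    by (rule smooth_nearI_points[OF at at diffeoD(3)[OF h x] diffeoD(2)[OF h]])
  have "differential A A (inv_into (points A) h) (h x) (differential A A h x v) =
      differential A A (\<lambda>x. inv_into (points A) h (h x)) x v"
    by (rule differential_compose[OF nh nk v, symmetric])
  also have "\<dots> = differential A A (\<lambda>x. x) x v"
    by (rule differential_cong[OF smooth_near_id[OF at x] openin_points[OF at] x _ v]) (simp add: diffeoD[OF h])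
  finally show ?thesis by (simp add: differential_id[OF at x v])
qed

lemma pullback_symplectic:
  assumes at: "smooth_atlas A" and h: "diffeo A h" and \<omega>: "\<omega> \<in> symplectic_forms A"
  shows "pullback A A h \<omega> \<in> symplectic_forms A"
proof -
  have \<omega>': "\<omega> \<in> two_forms A" "closed_form A \<omega>" "nondegenerate A \<omega>" using \<omega> by (auto simp: symplectic_forms_def)
  have "nondegenerate A (pullback A A h \<omega>)"
    unfolding nondegenerate_def
  proof (intro ballI impI)
    fix x v assume x: "x \<in> points A" and v: "v \<in> tangent_space A x"
      and 0: "\<forall>w\<in>tangent_space A x. pullback A A h \<omega> x v w = 0"
    define k where "k = inv_into (points A) h"
    have k: "diffeo A k" "h x \<in> points A" "k (h x) = x" unfolding k_def
      using diffeo_inv[OF at h] diffeoD[OF h] x by auto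
    have nh: "smooth_near A A h x" by (rule smooth_nearI_points[OF at at x diffeoD(1)[OF h]])
    have nk: "smooth_near A A k (h x)" by (rule smooth_nearI_points[OF at at k(2) diffeoD(1)[OF k(1)]])
    \<comment> \<open>Every vector at \<open>h x\<close> is the image of a vector at
      \<open>x\<close> under the differential of \<open>h\<close>, so testing against the tangent
      space at \<open>x\<close> suffices.\<close>
    have "\<omega> (h x) (differential A A h x v) w = 0" if w: "w \<in> tangent_space A (h x)" for w
    proof -
      have kw: "differential A A k (h x) w \<in> tangent_space A x" using differential_in[OF nk w] k(3) by simp
      have "differential A A h x (differential A A k (h x) w) = differential A A (\<lambda>x. h (k x)) (h x) w"
        using differential_compose[OF nk _ w, of A h] nh by (simp add: k(3))
      also have "\<dots> = differential A A (\<lambda>x. x) (h x) w"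
        by (rule differential_cong[OF smooth_near_id[OF at k(2)] openin_points[OF at] k(2) _ w]) (simp add: k_def diffeoD[OF h])
      also have "\<dots> = w" by (rule differential_id[OF at k(2) w])
      finally show ?thesis using 0 kw x v by (auto simp: pullback_def)
    qed
    then have "differential A A h x v = (\<lambda>_. 0)"
      using \<omega>'(3) k(2) differential_in[OF nh v] unfolding nondegenerate_def by blast
    then have "v = differential A A k (h x) (\<lambda>_. 0)"
      using differential_inverse[OF at h x v] by (simp add: k_def)
    \<comment> \<open>Zero is written as a combination with zero coefficients, so that linearity of
      the differential shows its image to be zero.\<close>
    also have "\<dots> = lincomb 0 (differential A A k (h x) (\<lambda>_. 0)) 0 (differential A A k (h x) (\<lambda>_. 0))"
      using differential_lincomb[OF nk zero_in_tangent[OF at k(2)] zero_in_tangent[OF at k(2)], of 0 0]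
      by (simp add: lincomb_def)
    finally show "v = (\<lambda>_. 0)" by (simp add: lincomb_def)
  qed
  then show ?thesis
    using pullback_two_forms[OF at at diffeoD(1)[OF h] \<omega>'(1)] pullback_closed[OF at at diffeoD(1)[OF h] \<omega>'(1,2)]
    by (simp add: symplectic_forms_def)
qed

section \<open>Transport of Lagrangian submanifolds\<close>

lemma openin_diffeo_image:
  assumes at: "smooth_atlas A" and h: "diffeo A h" and V: "openin (manifold_topology A) V"
  shows "openin (manifold_topology A) (h ` V)"
proof -
  have V': "V \<subseteq> points A" using openin_subset[OF V] at by simp
  have "h ` V = {y \<in> points A. inv_into (points A) h y \<in> V}"
  proof (intro equalityI subsetI)
    fix y assume "y \<in> {y \<in> points A. inv_into (points A) h y \<in> V}"
    then show "y \<in> h ` V" using diffeoD(6)[OF h, of y] by (metis (no_types, lifting) image_eqI mem_Collect_eq)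
  qed (use V' diffeoD[OF h] in auto)
  then show ?thesis
    using openin_preimage_chart[OF at at openin_points[OF at] diffeoD(2)[OF h] V] by simp
qed

text \<open>\<open>lagrangian\<close> asks for an atlas of the image. The charts of \<open>S\<close>
  composed with the inverse \<open>k\<close> of \<open>h\<close> have the same transitions, and the
  topology is the induced one because \<open>h\<close> is a homeomorphism. Restricting the pullback
  along \<open>k\<close> to the image amounts to pulling back along \<open>k\<close> the restriction
  of the form to \<open>S\<close>, which is zero.\<close>

lemma lagrangian_image:
  fixes A :: "('a, 'e::euclidean_space) chart set"
  assumes at: "smooth_atlas A" and haus: "Hausdorff_space (manifold_topology A)"
    and sc: "second_countable (manifold_topology A)"
    and h: "diffeo A h" and lag: "lagrangian TYPE('n::euclidean_space) A \<omega> S"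
  shows "lagrangian TYPE('n) A (pullback A A (inv_into (points A) h) \<omega>) (h ` S)"
proof -
  obtain B :: "('a, 'n) chart set" where S: "points B = S" and emb: "embedded_submanifold A B"
    and dim: "DIM('e) = 2 * DIM('n)" and zero: "pullback B A id \<omega> = (\<lambda>x v w. 0)"
    using lag unfolding lagrangian_def lagrangian_atlas_def by blast
  have B: "smooth_atlas B" and SA: "points B \<subseteq> points A"
    and top: "manifold_topology B = subtopology (manifold_topology A) (points B)"
    and sm: "smooth_map_on B (points B) A (\<lambda>x. x)"
    and inj: "\<And>x. x \<in> points B \<Longrightarrow> inj_on (differential B A (\<lambda>x. x) x) (tangent_space B x)"
    using emb smooth_manifold_atlas unfolding embedded_submanifold_def id_def by blast+
  define k where "k = inv_into (points A) h"
  have kh: "k (h x) = x" if "x \<in> points A" for x unfolding k_def using diffeoD(5)[OF h that] .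
  have hk: "h (k x) = x" if "x \<in> points A" for x unfolding k_def using diffeoD(6)[OF h that] .
  have hA: "h x \<in> points A" and kA: "k x \<in> points A" if "x \<in> points A" for x
    using diffeoD[OF h] that by (auto simp: k_def)
  have smk: "smooth_map_on A (points A) A k" unfolding k_def by (rule diffeoD(2)[OF h])
  define ch where "ch c = (h ` fst c, \<lambda>x. snd c (k x))" for c :: "('a, 'n) chart"
  define C where "C = ch ` B"
  have fc: "fst c \<subseteq> points A" if "c \<in> B" for c using that SA by (auto simp: points_def)
  have ptsC: "points C = h ` S" by (auto simp: C_def ch_def points_def S[symmetric])
  have ptsCA: "points C \<subseteq> points A" using ptsC hA SA S by auto
  have kC: "k x \<in> points B" if "x \<in> points C" for x using that kh SA by (auto simp: ptsC S[symmetric])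
  have im: "snd (ch c) ` (h ` W) = snd c ` W" if "W \<subseteq> points A" for c W
    using that kh by (force simp: ch_def image_image)
  have Int: "fst (ch c) \<inter> fst (ch d) = h ` (fst c \<inter> fst d)" if "c \<in> B" "d \<in> B" for c d
  proof -
    have "inj_on h (points A)" using kh by (rule inj_on_inverseI)
    from inj_on_image_Int[OF this fc[OF that(1)] fc[OF that(2)]] show ?thesis by (simp add: ch_def)
  qed
  have injc: "inj_on (snd (ch c)) (fst (ch c))" if c: "c \<in> B" for c
  proof (rule inj_onI)
    fix x y assume "x \<in> fst (ch c)" "y \<in> fst (ch c)" and eq: "snd (ch c) x = snd (ch c) y"
    then obtain x' y' where *: "x' \<in> fst c" "y' \<in> fst c" "x = h x'" "y = h y'" by (auto simp: ch_def)
    then have "snd c x' = snd c y'" using eq kh fc[OF c] by (auto simp: ch_def subset_iff)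
    then show "x = y" using * smooth_atlas_inj[OF B c] by (auto dest: inj_onD)
  qed
  have cinv: "chart_inv (ch c) u = h (chart_inv c u)" if c: "c \<in> B" and u: "u \<in> snd c ` fst c" for c u
  proof -
    have 1: "chart_inv c u \<in> fst c" using chart_inv_in_dom[OF u] .
    have "snd (ch c) (h (chart_inv c u)) = u"
      using kh[of "chart_inv c u"] 1 fc[OF c] chart_chart_inv[OF u] by (auto simp: ch_def)
    moreover have "h (chart_inv c u) \<in> fst (ch c)" using 1 by (auto simp: ch_def)
    ultimately show ?thesis unfolding chart_inv_def[of "ch c"] using inv_into_f_f[OF injc[OF c]] by metis
  qed
  have Cat: "smooth_atlas C"
    unfolding smooth_atlas_def
  proof (intro conjI ballI)
    fix c' assume "c' \<in> C" then show "inj_on (snd c') (fst c')" using injc by (auto simp: C_def)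
  next
    fix c' d' assume "c' \<in> C" "d' \<in> C"
    then obtain c d where *: "c \<in> B" "d \<in> B" "c' = ch c" "d' = ch d" by (auto simp: C_def)
    have eq: "snd c' ` (fst c' \<inter> fst d') = snd c ` (fst c \<inter> fst d)"
      unfolding * Int[OF *(1,2)] by (rule im) (use fc[OF *(1)] in auto)
    note tr = smooth_atlas_transition[OF B *(1,2)]
    show "open (snd c' ` (fst c' \<inter> fst d'))" unfolding eq by (rule tr(1))
    have "Cinf (snd c ` (fst c \<inter> fst d)) (snd d' \<circ> chart_inv c')"
    proof (rule Cinf_cong[OF tr(1) _ tr(2)])
      fix u assume u: "u \<in> snd c ` (fst c \<inter> fst d)"
      then have "chart_inv c u \<in> fst c" by (intro chart_inv_in_dom) auto
      then show "snd d (chart_inv c u) = (snd d' \<circ> chart_inv c') u"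
        using u cinv[OF *(1), of u] kh[of "chart_inv c u"] fc[OF *(1)] unfolding * by (auto simp: ch_def)
    qed
    then show "smooth_on (snd c' ` (fst c' \<inter> fst d')) (snd d' \<circ> chart_inv c')"
      unfolding eq using tr(1) by (simp add: smooth_on_open)
  qed
  have topC: "manifold_topology C = subtopology (manifold_topology A) (points C)"
  proof (rule topology_eq[THEN iffD2], rule allI)
    fix W
    have "openin (manifold_topology C) W \<longleftrightarrow> W \<subseteq> points C \<and> openin (manifold_topology B) (k ` W)"
    proof (cases "W \<subseteq> points C")
      case True
      have kW: "k ` W \<subseteq> points B" using True kC by auto
      have "snd (ch c) ` (W \<inter> fst (ch c)) = snd c ` (k ` W \<inter> fst c)" if c: "c \<in> B" for c
      proof -
        have "W \<inter> fst (ch c) = h ` (k ` W \<inter> fst c)"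
        proof (intro equalityI subsetI)
          fix x assume x: "x \<in> W \<inter> fst (ch c)"
          then obtain x' where x': "x' \<in> fst c" "x = h x'" by (auto simp: ch_def)
          then have "x' = k x" using kh fc[OF c] by auto
          then show "x \<in> h ` (k ` W \<inter> fst c)" using x x' by auto
        next
          fix x assume "x \<in> h ` (k ` W \<inter> fst c)"
          then obtain w where w: "w \<in> W" "k w \<in> fst c" "x = h (k w)" by auto
          have "w \<in> points A" using w True ptsCA by auto
          then have "x = w" using w hk by auto
          moreover have "x \<in> h ` fst c" using w by blast
          ultimately show "x \<in> W \<inter> fst (ch c)" using w(1) by (simp add: ch_def)
        qed
        then show ?thesis using im[of "k ` W \<inter> fst c" c] fc[OF c] by auto
      qed
      then show ?thesis
        unfolding openin_manifold[OF Cat] openin_manifold[OF B] using True kW by (auto simp: C_def)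
    next
      case False
      then show ?thesis using openin_subset[of "manifold_topology C" W] Cat by auto
    qed
    also have "\<dots> \<longleftrightarrow> openin (subtopology (manifold_topology A) (points C)) W"
    proof
      assume W: "W \<subseteq> points C \<and> openin (manifold_topology B) (k ` W)"
      then obtain V where V: "openin (manifold_topology A) V" "k ` W = V \<inter> points B"
        unfolding top openin_subtopology by auto
      have "W = h ` V \<inter> points C"
      proof (intro equalityI subsetI)
        fix x assume x: "x \<in> W"
        then have "x = h (k x)" using W ptsCA hk by force
        moreover have "k x \<in> V" using x V(2) by auto
        ultimately show "x \<in> h ` V \<inter> points C" using x W by blast
      next
        fix x assume x: "x \<in> h ` V \<inter> points C"
        then obtain v where v: "v \<in> V" "x = h v" by auto
        have vA: "v \<in> points A" using v openin_subset[OF V(1)] at by auto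
        have "k x \<in> points B" using x kC by auto
        then have "v \<in> k ` W" using v V(2) kh[OF vA] by auto
        then obtain w where w: "w \<in> W" "v = k w" by auto
        then have "x = w" using v hk W ptsCA by auto
        then show "x \<in> W" using w by simp
      qed
      then show "openin (subtopology (manifold_topology A) (points C)) W"
        unfolding openin_subtopology using openin_diffeo_image[OF at h V(1)] by blast
    next
      assume "openin (subtopology (manifold_topology A) (points C)) W"
      then obtain V where V: "openin (manifold_topology A) V" "W = V \<inter> points C"
        unfolding openin_subtopology by auto
      have VA: "V \<subseteq> points A" using openin_subset[OF V(1)] at by simp
      have "k ` W = k ` V \<inter> points B"
      proof (intro equalityI subsetI)
        fix x assume "x \<in> k ` V \<inter> points B"
        then obtain v where v: "v \<in> V" "x = k v" "k v \<in> points B" by auto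
        then have "v = h (k v)" using hk VA by auto
        then have "v \<in> points C" using v(3) unfolding ptsC S[symmetric] by (rule image_eqI)
        then show "x \<in> k ` W" using v V(2) by auto
      qed (use V(2) kC in auto)
      moreover have "openin (manifold_topology A) (k ` V)"
        unfolding k_def by (rule openin_diffeo_image[OF at diffeo_inv[OF at h] V(1)])
      ultimately show "W \<subseteq> points C \<and> openin (manifold_topology B) (k ` W)"
        unfolding top openin_subtopology using V(2) by blast
    qed
    finally show "openin (manifold_topology C) W \<longleftrightarrow> openin (subtopology (manifold_topology A) (points C)) W" .
  qed
  have CM: "smooth_manifold C"
    unfolding smooth_manifold_def topC
    using Cat Hausdorff_space_subtopology[OF haus] second_countable_subtopology[OF sc]
    by (simp add: smooth_atlas_def)
  have repk: "local_rep (points C) k (ch c) c (snd c ` fst c) (\<lambda>u. u)" if c: "c \<in> B" for c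
    unfolding local_rep_def
  proof (intro conjI ballI impI)
    show "snd c ` fst c \<subseteq> snd (ch c) ` fst (ch c)" using im[OF fc[OF c], of c] by (simp add: ch_def)
    fix y assume "y \<in> points C \<inter> fst (ch c)"
    then show "k y \<in> fst c" using kh fc[OF c] by (auto simp: ch_def)
  qed (use open_chart[OF B c] in \<open>auto simp: ch_def\<close>)
  have smkC: "smooth_map_on C (points C) B k"
  proof (rule smooth_map_onI[OF Cat B subset_refl])
    fix x assume "x \<in> points C"
    then obtain c where c: "c \<in> B" "x \<in> fst (ch c)" by (auto simp: C_def points_def)
    have "snd (ch c) x \<in> snd c ` fst c" using c im[OF fc[OF c(1)], of c] by (auto simp: ch_def)
    then have "\<exists>T g. snd (ch c) x \<in> T \<and> local_rep (points C) k (ch c) c T g"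
      using repk[OF c(1)] by (intro exI conjI)
    then show "\<exists>c\<in>C. \<exists>d\<in>B. x \<in> fst c \<and> (\<exists>T g. snd c x \<in> T \<and> local_rep (points C) k c d T g)"
      using c unfolding C_def by blast
  qed
  have smAk: "smooth_map_on C (points C) A k"
    using smooth_map_on_compose[OF Cat B at smkC sm subset_refl] kC by (auto simp: image_subset_iff)
  have smC: "smooth_map_on C (points C) A (\<lambda>x. x)"
  proof (rule smooth_map_on_cong[OF _ Cat at subset_refl])
    show "smooth_map_on C (points C) A (\<lambda>x. h (k x))"
      using kC SA by (intro smooth_map_on_compose[OF Cat at at smAk diffeoD(1)[OF h] subset_refl]) auto
  qed (use hk ptsCA in auto)
  have injC: "inj_on (differential C A (\<lambda>x. x) x) (tangent_space C x)" if x: "x \<in> points C" for x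
  proof (rule inj_onI)
    fix v w assume v: "v \<in> tangent_space C x" and w: "w \<in> tangent_space C x"
      and eq: "differential C A (\<lambda>x. x) x v = differential C A (\<lambda>x. x) x w"
    have xA: "x \<in> points A" using x ptsCA by auto
    have nk: "smooth_near C B k x" by (rule smooth_nearI_points[OF Cat B x smkC])
    have ni: "smooth_near B A (\<lambda>x. x) (k x)" by (rule smooth_nearI_points[OF B at kC[OF x] sm])
    have nC: "smooth_near C A (\<lambda>x. x) x" by (rule smooth_nearI_points[OF Cat at x smC])
    have nkA: "smooth_near A A k x" by (rule smooth_nearI_points[OF at at xA smk])
    \<comment> \<open>The inclusions intertwine \<open>k\<close> between the submanifolds with
      \<open>k\<close> on the ambient manifold. Differentiating both composites transfers
      injectivity from \<open>B\<close> to \<open>C\<close>.\<close>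
    have "differential B A (\<lambda>x. x) (k x) (differential C B k x v) = differential A A k x (differential C A (\<lambda>x. x) x v)"
      if v: "v \<in> tangent_space C x" for v
      using differential_compose[OF nk ni v] differential_compose[OF nC nkA v] by simp
    then have "differential B A (\<lambda>x. x) (k x) (differential C B k x v) = differential B A (\<lambda>x. x) (k x) (differential C B k x w)"
      using eq v w by simp
    then have dk: "differential C B k x v = differential C B k x w"
      using inj[OF kC[OF x]] differential_in[OF nk v] differential_in[OF nk w] by (auto dest: inj_onD)
    obtain c where c: "c \<in> B" "x \<in> fst (ch c)" using x by (auto simp: C_def points_def)
    have chC: "ch c \<in> C" using c by (simp add: C_def)
    have kx: "k x \<in> fst c" using c kh fc[OF c(1)] by (auto simp: ch_def)
    \<comment> \<open>In the transported chart \<open>k\<close> reads as the identity, so its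
      differential loses no information.\<close>
    have "((snd c \<circ> k \<circ> chart_inv (ch c)) has_derivative (\<lambda>v. v)) (at (snd (ch c) x))"
    proof (rule has_derivative_transform_within_open[OF has_derivative_ident])
      show "open (snd c ` fst c)" by (rule open_chart[OF B c(1)])
      show "u = (snd c \<circ> k \<circ> chart_inv (ch c)) u" if u: "u \<in> snd c ` fst c" for u
      proof -
        have "chart_inv c u \<in> points A" using chart_inv_in_dom[OF u] fc[OF c(1)] by auto
        then show ?thesis using cinv[OF c(1) u] kh chart_chart_inv[OF u] by simp
      qed
    qed (use kx in \<open>auto simp: ch_def\<close>)
    from frechet_derivative_at[OF this] have "rep_deriv k (ch c) c x = (\<lambda>v. v)" by (simp add: rep_deriv_def)
    then have "v (ch c) = w (ch c)"
      using dk differential_apply[OF nk v chC c(2), of c] differential_apply[OF nk w chC c(2), of c] c kx by simp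
    then show "v = w" by (rule tangent_eqI[OF v w chC c(2)])
  qed
  have "pullback C A (\<lambda>x. x) (pullback A A k \<omega>) = pullback C A k \<omega>"
  proof -
    have "pullback C A (\<lambda>x. x) (pullback A A k \<omega>) = pullback C A (\<lambda>x. k x) \<omega>"
      by (rule pullback_compose[OF smC smk Cat at at, symmetric])
    then show ?thesis by simp
  qed
  also have "\<dots> = pullback C B k (pullback B A (\<lambda>x. x) \<omega>)"
    using pullback_compose[OF smkC sm Cat B at] .
  also have "\<dots> = (\<lambda>x v w. 0)" using zero by (auto simp: pullback_def id_def)
  finally have "lagrangian_atlas A (pullback A A k \<omega>) C"
    unfolding lagrangian_atlas_def embedded_submanifold_def id_def
    using CM ptsCA topC smC injC dim by simp
  then show ?thesis unfolding lagrangian_def k_def[symmetric] using ptsC by blast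
qed

section \<open>Cotangent bundles\<close>

text \<open>In a chart, the inverse of \<open>covector_coord\<close> on the fibre.\<close>

definition covector_of :: "('a, 'n::euclidean_space) chart set \<Rightarrow> ('a, 'n) chart \<Rightarrow> 'a \<Rightarrow> 'n \<Rightarrow> ('a, 'n) covector" where
  "covector_of B c x y = (\<lambda>v. if v \<in> tangent_space B x then y \<bullet> v c else 0)"

definition covector_coord :: "('a, 'n::euclidean_space) chart set \<Rightarrow> ('a, 'n) chart \<Rightarrow> 'a \<Rightarrow> ('a, 'n) covector \<Rightarrow> 'n" where
  "covector_coord B c x \<alpha> = (\<Sum>b\<in>Basis. \<alpha> (coord_vector B c x b) *\<^sub>R b)"

lemma cotangent_lincomb:
  "\<alpha> \<in> cotangent_space B x \<Longrightarrow> v \<in> tangent_space B x \<Longrightarrow> w \<in> tangent_space B x \<Longrightarrow>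
    \<alpha> (lincomb a v b w) = a * \<alpha> v + b * \<alpha> w"
  unfolding cotangent_space_def by blast

lemma cotangent_zero: "\<alpha> \<in> cotangent_space B x \<Longrightarrow> v \<notin> tangent_space B x \<Longrightarrow> \<alpha> v = 0"
  unfolding cotangent_space_def by blast

lemma lincomb_cotangent:
  assumes "\<alpha> \<in> cotangent_space B x" "\<beta> \<in> cotangent_space B x"
  shows "lincomb a \<alpha> b \<beta> \<in> cotangent_space B x"
  unfolding cotangent_space_def
proof (intro CollectI conjI ballI allI impI)
  fix v w a' b' assume v: "v \<in> tangent_space B x" and w: "w \<in> tangent_space B x"
  show "lincomb a \<alpha> b \<beta> (lincomb a' v b' w) = a' * lincomb a \<alpha> b \<beta> v + b' * lincomb a \<alpha> b \<beta> w"
    unfolding lincomb_def[of a \<alpha> b \<beta>] cotangent_lincomb[OF assms(1) v w] cotangent_lincomb[OF assms(2) v w]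
    by (simp add: algebra_simps)
next
  fix v assume "v \<notin> tangent_space B x"
  then show "lincomb a \<alpha> b \<beta> v = 0" using cotangent_zero[OF assms(1)] cotangent_zero[OF assms(2)] by (simp add: lincomb_def)
qed

lemma zero_cotangent: "(\<lambda>_. 0) \<in> cotangent_space B x"
  by (simp add: cotangent_space_def)

lemma covector_coord_lincomb:
  "covector_coord B c x (lincomb a \<alpha> b \<beta>) = a *\<^sub>R covector_coord B c x \<alpha> + b *\<^sub>R covector_coord B c x \<beta>"
  by (simp add: covector_coord_def lincomb_def sum.distrib scaleR_add_left scaleR_sum_right)

lemma covector_coord_zero [simp]: "covector_coord B c x (\<lambda>_. 0) = 0"
  by (simp add: covector_coord_def)

context
  fixes B :: "('a, 'n::euclidean_space) chart set" and c x
  assumes B: "smooth_atlas B" and c: "c \<in> B" "x \<in> fst c"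
begin

lemma cotangent_coord_vector:
  assumes \<alpha>: "\<alpha> \<in> cotangent_space B x"
  shows "\<alpha> (coord_vector B c x w) = covector_coord B c x \<alpha> \<bullet> w"
proof -
  note L = coord_vector_lincomb[OF B c] and I = coord_vector_in[OF B c]
  have lin: "linear (\<lambda>w. \<alpha> (coord_vector B c x w))"
  proof (rule linearI)
    show "\<alpha> (coord_vector B c x (v + w)) = \<alpha> (coord_vector B c x v) + \<alpha> (coord_vector B c x w)" for v w
      using L[of 1 v 1 w] cotangent_lincomb[OF \<alpha> I I, of 1 v 1 w] by simp
    show "\<alpha> (coord_vector B c x (r *\<^sub>R v)) = r *\<^sub>R \<alpha> (coord_vector B c x v)" for r v
      using L[of r v 0 v] cotangent_lincomb[OF \<alpha> I I, of r v 0 v] by simp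
  qed
  have "\<alpha> (coord_vector B c x w) = (\<Sum>b\<in>Basis. (w \<bullet> b) * \<alpha> (coord_vector B c x b))"
    using linear_sum[OF lin, of "\<lambda>b. (w \<bullet> b) *\<^sub>R b" Basis]
    by (simp only: euclidean_representation linear_scale[OF lin] real_scaleR_def)
  also have "\<dots> = covector_coord B c x \<alpha> \<bullet> w"
    by (simp add: covector_coord_def inner_sum_left inner_commute[of w] mult.commute)
  finally show ?thesis .
qed

lemma cotangent_apply:
  assumes \<alpha>: "\<alpha> \<in> cotangent_space B x" and v: "v \<in> tangent_space B x"
  shows "\<alpha> v = covector_coord B c x \<alpha> \<bullet> v c"
  using cotangent_coord_vector[OF \<alpha>, of "v c"] coord_vector_tangent[OF B c v] by simp

lemma covector_of_in: "covector_of B c x y \<in> cotangent_space B x"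
  unfolding cotangent_space_def covector_of_def
  using lincomb_in[OF B c] by (auto simp: lincomb_def inner_add_right)

lemma covector_coord_of [simp]: "covector_coord B c x (covector_of B c x y) = y"
  unfolding covector_coord_def covector_of_def
  using coord_vector_in[OF B c] coord_vector_self[OF B c] by (simp add: euclidean_representation)

lemma covector_of_coord:
  assumes \<alpha>: "\<alpha> \<in> cotangent_space B x"
  shows "covector_of B c x (covector_coord B c x \<alpha>) = \<alpha>"
  using cotangent_apply[OF \<alpha>] cotangent_zero[OF \<alpha>] by (auto simp: covector_of_def)

end

lemma covector_coord_inj:
  assumes "smooth_atlas B" "c \<in> B" "x \<in> fst c" "\<alpha> \<in> cotangent_space B x" "\<beta> \<in> cotangent_space B x"
    "covector_coord B c x \<alpha> = covector_coord B c x \<beta>"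
  shows "\<alpha> = \<beta>"
  using covector_of_coord[OF assms(1-3)] assms(4-6) by metis

lemma fst_cotangent_chart [simp]: "fst (cotangent_chart B c) = Sigma (fst c) (cotangent_space B)"
  and snd_cotangent_chart [simp]: "snd (cotangent_chart B c) (x, \<alpha>) = (snd c x, covector_coord B c x \<alpha>)"
  by (simp_all add: cotangent_chart_def covector_coord_def)

lemma points_cotangent [simp]: "points (cotangent_atlas B) = Sigma (points B) (cotangent_space B)"
  by (auto simp: points_def cotangent_atlas_def)

lemma cotangent_chart_in: "c \<in> B \<Longrightarrow> cotangent_chart B c \<in> cotangent_atlas B"
  by (simp add: cotangent_atlas_def)

lemma cotangent_chart_image:
  assumes B: "smooth_atlas B" "c \<in> B" and S: "S \<subseteq> fst c"
  shows "snd (cotangent_chart B c) ` Sigma S (cotangent_space B) = snd c ` S \<times> UNIV"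
proof (intro equalityI subsetI)
  fix z assume "z \<in> snd c ` S \<times> (UNIV :: 'b set)"
  then obtain x y where xy: "x \<in> S" "z = (snd c x, y)" by auto
  then have "z = snd (cotangent_chart B c) (x, covector_of B c x y)"
    using S covector_coord_of[OF B, of x y] by (simp add: subset_iff)
  then show "z \<in> snd (cotangent_chart B c) ` Sigma S (cotangent_space B)"
    using covector_of_in[OF B, of x y] S xy by blast
qed auto

lemma cotangent_chart_inj:
  assumes B: "smooth_atlas B" "c \<in> B"
  shows "inj_on (snd (cotangent_chart B c)) (fst (cotangent_chart B c))"
proof (rule inj_onI)
  fix z w assume z: "z \<in> fst (cotangent_chart B c)" and w: "w \<in> fst (cotangent_chart B c)"
    and eq: "snd (cotangent_chart B c) z = snd (cotangent_chart B c) w"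
  obtain x \<alpha> y \<beta> where zw: "z = (x, \<alpha>)" "w = (y, \<beta>)" by (cases z, cases w)
  have "x = y" using z w eq smooth_atlas_inj[OF B] by (auto simp: zw dest: inj_onD)
  moreover have "\<alpha> = \<beta>"
    using covector_coord_inj[OF B, of x \<alpha> \<beta>] z w eq \<open>x = y\<close> by (auto simp: zw)
  ultimately show "z = w" by (simp add: zw)
qed

lemma chart_inv_cotangent:
  assumes B: "smooth_atlas B" "c \<in> B" and u: "u \<in> snd c ` fst c"
  shows "chart_inv (cotangent_chart B c) (u, y) = (chart_inv c u, covector_of B c (chart_inv c u) y)"
proof -
  have x: "chart_inv c u \<in> fst c" by (rule chart_inv_in_dom[OF u])
  have "snd (cotangent_chart B c) (chart_inv c u, covector_of B c (chart_inv c u) y) = (u, y)"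
    using chart_chart_inv[OF u] covector_coord_of[OF B x] by simp
  moreover have "(chart_inv c u, covector_of B c (chart_inv c u) y) \<in> fst (cotangent_chart B c)"
    using x covector_of_in[OF B x] by simp
  ultimately show ?thesis
    unfolding chart_inv_def[of "cotangent_chart B c"] using inv_into_f_f[OF cotangent_chart_inj[OF B]] by metis
qed

text \<open>Covectors transform by the transposed derivative of the transition in the opposite
  direction. Chart changes are thus linear in the fibre, on which the computations with vertical
  vectors rest.\<close>

lemma covector_coord_change:
  assumes B: "smooth_atlas B" and c: "c \<in> B" "x \<in> fst c" and d: "d \<in> B" "x \<in> fst d"
    and \<alpha>: "\<alpha> \<in> cotangent_space B x"
  shows "covector_coord B d x \<alpha> = (\<Sum>b\<in>Basis. (covector_coord B c x \<alpha> \<bullet> rep_deriv (\<lambda>x. x) d c x b) *\<^sub>R b)"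
proof -
  have "\<alpha> (coord_vector B d x b) = covector_coord B c x \<alpha> \<bullet> rep_deriv (\<lambda>x. x) d c x b" for b
    using cotangent_apply[OF B c \<alpha> coord_vector_in[OF B d]] c by (simp add: coord_vector_eq)
  then show ?thesis by (simp add: covector_coord_def[of B d])
qed

lemma smooth_atlas_cotangent [simp]:
  assumes B: "smooth_atlas B"
  shows "smooth_atlas (cotangent_atlas B)"
  unfolding smooth_atlas_def
proof (intro conjI ballI)
  fix c' assume "c' \<in> cotangent_atlas B"
  then show "inj_on (snd c') (fst c')" using cotangent_chart_inj[OF B] by (auto simp: cotangent_atlas_def)
next
  fix c' d' assume "c' \<in> cotangent_atlas B" "d' \<in> cotangent_atlas B"
  then obtain c d where *: "c \<in> B" "d \<in> B" "c' = cotangent_chart B c" "d' = cotangent_chart B d"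
    by (auto simp: cotangent_atlas_def)
  note tr = smooth_atlas_transition[OF B *(1,2)] and rt = smooth_atlas_transition[OF B *(2,1)]
  define O1 where "O1 = snd c ` (fst c \<inter> fst d)"
  have "fst c' \<inter> fst d' = Sigma (fst c \<inter> fst d) (cotangent_space B)" unfolding * by auto
  then have eq: "snd c' ` (fst c' \<inter> fst d') = O1 \<times> UNIV"
    unfolding O1_def using cotangent_chart_image[OF B *(1), of "fst c \<inter> fst d"] by (simp add: *)
  show op: "open (snd c' ` (fst c' \<inter> fst d'))"
    unfolding eq O1_def by (intro open_Times tr(1)) auto
  define \<tau> where "\<tau> u = snd d (chart_inv c u)" for u
  have \<tau>: "Cinf O1 \<tau>" unfolding \<tau>_def O1_def by (rule tr(2))
  have o: "open (O1 \<times> (UNIV :: 'b set))" using op unfolding eq .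
  have \<tau>1: "Cinf (O1 \<times> UNIV) (\<lambda>z :: 'b \<times> 'b. \<tau> (fst z))"
    by (rule Cinf_compose[OF o _ Cinf_fst[OF o Cinf_id[OF o]] \<tau>]) (auto simp: O1_def tr(1))
  define \<rho> where "\<rho> b w = frechet_derivative (\<lambda>u. snd c (chart_inv d u)) (at w) b" for b w
  have "Cinf (O1 \<times> UNIV) (\<lambda>z :: 'b \<times> 'b. \<rho> b (\<tau> (fst z)))" for b
    unfolding \<rho>_def
    by (rule Cinf_compose[OF o rt(1) \<tau>1 Cinf_derivative[OF rt(2)]])
       (auto simp: O1_def \<tau>_def chart_inv_chart[OF B *(1)])
  then have "Cinf (O1 \<times> UNIV) (\<lambda>z. (\<tau> (fst z), \<Sum>b\<in>Basis. (snd z \<bullet> \<rho> b (\<tau> (fst z))) *\<^sub>R b))"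
    by (intro Cinf_Pair Cinf_sum Cinf_scaleR Cinf_inner Cinf_const Cinf_snd Cinf_id o \<tau>1) auto
  moreover have "(\<tau> (fst z), \<Sum>b\<in>Basis. (snd z \<bullet> \<rho> b (\<tau> (fst z))) *\<^sub>R b) = (snd d' \<circ> chart_inv c') z"
    if "z \<in> O1 \<times> UNIV" for z
  proof -
    obtain x y where x: "x \<in> fst c" "x \<in> fst d" "z = (snd c x, y)" using \<open>z \<in> O1 \<times> UNIV\<close> unfolding O1_def by auto
    have "chart_inv c' z = (x, covector_of B c x y)"
      unfolding *(3) x(3) using chart_inv_cotangent[OF B *(1), of "snd c x"] x(1) by (simp add: chart_inv_chart[OF B *(1)])
    then show ?thesis
      using covector_coord_change[OF B *(1) x(1) *(2) x(2) covector_of_in[OF B *(1) x(1)]]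
        covector_coord_of[OF B *(1) x(1)] unfolding *(4)
      by (simp add: x(3) \<tau>_def \<rho>_def rep_deriv_def comp_def chart_inv_chart[OF B *(1) x(1)])
  qed
  ultimately have "Cinf (O1 \<times> UNIV) (snd d' \<circ> chart_inv c')" by (rule Cinf_cong[OF o, rotated])
  then show "smooth_on (snd c' ` (fst c' \<inter> fst d')) (snd d' \<circ> chart_inv c')"
    using op unfolding eq by (simp add: smooth_on_open)
qed

lemma smooth_map_on_projection:
  assumes B: "smooth_atlas B" and S: "S \<subseteq> points (cotangent_atlas B)"
  shows "smooth_map_on (cotangent_atlas B) S B fst"
proof (rule smooth_map_onI[OF smooth_atlas_cotangent[OF B] B S])
  fix z assume z: "z \<in> S"
  then have "fst z \<in> points B" using S by auto
  then obtain c where c: "c \<in> B" "fst z \<in> fst c" by (rule pointsE)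
  have op: "open (snd c ` fst c \<times> (UNIV :: 'b set))" by (intro open_Times open_chart[OF B c(1)]) auto
  have "local_rep S fst (cotangent_chart B c) c (snd c ` fst c \<times> UNIV) (\<lambda>u. fst u)"
    unfolding local_rep_def using op Cinf_fst[OF op Cinf_id[OF op]] cotangent_chart_image[OF B c(1), of "fst c"] by auto
  moreover have "z \<in> fst (cotangent_chart B c)" using z S c by auto
  ultimately have "\<exists>T g. snd (cotangent_chart B c) z \<in> T \<and> local_rep S fst (cotangent_chart B c) c T g"
    by (intro exI conjI) auto
  with \<open>z \<in> fst (cotangent_chart B c)\<close> show "\<exists>c\<in>cotangent_atlas B. \<exists>d\<in>B. z \<in> fst c \<and> (\<exists>T g. snd c z \<in> T \<and> local_rep S fst c d T g)"
    using c cotangent_chart_in[OF c(1)] by blast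
qed

text \<open>Points over different base points are separated by preimages under the projection;
  points of one fibre lie in a common cotangent chart. The result makes compact sets in the bundle
  closed.\<close>

lemma Hausdorff_cotangent:
  assumes B: "smooth_atlas B" and haus: "Hausdorff_space (manifold_topology B)"
  shows "Hausdorff_space (manifold_topology (cotangent_atlas B))"
  unfolding Hausdorff_space_def
proof (intro allI impI)
  note C = smooth_atlas_cotangent[OF B]
  fix z w assume zw: "z \<in> topspace (manifold_topology (cotangent_atlas B)) \<and>
    w \<in> topspace (manifold_topology (cotangent_atlas B)) \<and> z \<noteq> w"
  then have zB: "fst z \<in> points B" "fst w \<in> points B" "z \<in> points (cotangent_atlas B)" "w \<in> points (cotangent_atlas B)"
    using C by auto
  show "\<exists>U V. openin (manifold_topology (cotangent_atlas B)) U \<and> openin (manifold_topology (cotangent_atlas B)) V \<and>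
      z \<in> U \<and> w \<in> V \<and> disjnt U V"
  proof (cases "fst z = fst w")
    case False
    then obtain U V where UV: "openin (manifold_topology B) U" "openin (manifold_topology B) V" "fst z \<in> U" "fst w \<in> V" "disjnt U V"
      using haus zB B unfolding Hausdorff_space_def by (metis topspace_manifold)
    note pre = openin_preimage_chart[OF C B openin_points[OF C] smooth_map_on_projection[OF B subset_refl]]
    show ?thesis
      using pre[OF UV(1)] pre[OF UV(2)] UV zB
      by (intro exI[of _ "{z \<in> points (cotangent_atlas B). fst z \<in> U}"] exI[of _ "{z \<in> points (cotangent_atlas B). fst z \<in> V}"])
         (auto simp: disjnt_iff)
  next
    case True
    obtain c where c: "c \<in> B" "fst z \<in> fst c" using zB(1) by (rule pointsE)
    let ?c = "cotangent_chart B c"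
    have in_c: "z \<in> fst ?c" "w \<in> fst ?c" using zB c True by auto
    have "snd ?c z \<noteq> snd ?c w" using zw in_c cotangent_chart_inj[OF B c(1)] by (auto dest: inj_onD)
    then obtain U V where UV: "open U" "open V" "snd ?c z \<in> U" "snd ?c w \<in> V" "U \<inter> V = {}"
      using hausdorff by metis
    then show ?thesis
      using openin_chart_vimage[OF C cotangent_chart_in[OF c(1)]] in_c
      by (intro exI[of _ "{z \<in> fst ?c. snd ?c z \<in> U}"] exI[of _ "{z \<in> fst ?c. snd ?c z \<in> V}"])
         (auto simp: disjnt_iff)
  qed
qed

text \<open>The fibre operations are linear in each cotangent chart. This covers the displacement by
  the flow, the opposite section and the segment between two sections.\<close>

lemma smooth_map_on_fibre_lincomb:
  assumes C: "smooth_atlas C" and B: "smooth_atlas B" and S: "S \<subseteq> points C"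
    and a: "smooth_map_on C S euclid a" and b: "smooth_map_on C S euclid b"
    and \<alpha>: "smooth_map_on C S (cotangent_atlas B) (\<lambda>z. (p z, \<alpha> z))"
    and \<beta>: "smooth_map_on C S (cotangent_atlas B) (\<lambda>z. (p z, \<beta> z))"
  shows "smooth_map_on C S (cotangent_atlas B) (\<lambda>z. (p z, lincomb (a z) (\<alpha> z) (b z) (\<beta> z)))"
proof (rule smooth_map_onI[OF C smooth_atlas_cotangent[OF B] S])
  note CB = smooth_atlas_cotangent[OF B]
  fix x assume x: "x \<in> S"
  then have xC: "x \<in> points C" using S by auto
  obtain c where c: "c \<in> C" "x \<in> fst c" using xC by (rule pointsE)
  have pts: "p z \<in> points B" "\<alpha> z \<in> cotangent_space B (p z)" "\<beta> z \<in> cotangent_space B (p z)" if "z \<in> S" for z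
    using smooth_map_on_points[OF \<alpha> C CB that] smooth_map_on_points[OF \<beta> C CB that] S that by auto
  obtain d where d: "d \<in> B" "p x \<in> fst d" using pts(1)[OF x] by (rule pointsE)
  let ?d = "cotangent_chart B d"
  obtain Ta ga where a': "snd c x \<in> Ta" "local_rep S a c (UNIV, id) Ta ga"
    using smooth_map_on_local[OF a C smooth_atlas_euclid x c, of "(UNIV, id)"] by (auto simp: euclid_def)
  obtain Tb gb where b': "snd c x \<in> Tb" "local_rep S b c (UNIV, id) Tb gb"
    using smooth_map_on_local[OF b C smooth_atlas_euclid x c, of "(UNIV, id)"] by (auto simp: euclid_def)
  obtain T1 g1 where 1: "snd c x \<in> T1" "local_rep S (\<lambda>z. (p z, \<alpha> z)) c ?d T1 g1"
    using smooth_map_on_local[OF \<alpha> C CB x c cotangent_chart_in[OF d(1)]] pts[OF x] d(2) by auto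
  obtain T2 g2 where 2: "snd c x \<in> T2" "local_rep S (\<lambda>z. (p z, \<beta> z)) c ?d T2 g2"
    using smooth_map_on_local[OF \<beta> C CB x c cotangent_chart_in[OF d(1)]] pts[OF x] d(2) by auto
  define T where "T = Ta \<inter> Tb \<inter> T1 \<inter> T2"
  define g where "g u = (fst (g1 u), ga u *\<^sub>R snd (g1 u) + gb u *\<^sub>R snd (g2 u))" for u
  have o: "open Ta" "open Tb" "open T1" "open T2" "Cinf Ta ga" "Cinf Tb gb" "Cinf T1 g1" "Cinf T2 g2"
    using a'(2) b'(2) 1(2) 2(2) by (auto simp: local_rep_def)
  have T: "open T" unfolding T_def using o by (intro open_Int)
  have TT: "T \<subseteq> Ta" "T \<subseteq> Tb" "T \<subseteq> T1" "T \<subseteq> T2" by (auto simp: T_def)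
  have g: "Cinf T g" unfolding g_def
    by (intro Cinf_Pair Cinf_add Cinf_scaleR Cinf_fst Cinf_snd T Cinf_mono[OF o(5) TT(1)] Cinf_mono[OF o(6) TT(2)]
        Cinf_mono[OF o(7) TT(3)] Cinf_mono[OF o(8) TT(4)])
  have "local_rep S (\<lambda>z. (p z, lincomb (a z) (\<alpha> z) (b z) (\<beta> z))) c ?d T g"
    unfolding local_rep_def
  proof (intro conjI ballI impI)
    show "T \<subseteq> snd c ` fst c" using TT 1(2) by (auto simp: local_rep_def)
    have "g1 u \<in> snd d ` fst d \<times> UNIV" if "u \<in> T" for u
      using that TT(3) 1(2) cotangent_chart_image[OF B d(1) subset_refl] by (fastforce simp: local_rep_def)
    then show "g ` T \<subseteq> snd ?d ` fst ?d"
      unfolding fst_cotangent_chart cotangent_chart_image[OF B d(1) subset_refl] by (force simp: g_def mem_Times_iff)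
    fix z assume z: "z \<in> S \<inter> fst c" "snd c z \<in> T"
    have 3: "p z \<in> fst d" "g1 (snd c z) = (snd d (p z), covector_coord B d (p z) (\<alpha> z))"
      "g2 (snd c z) = (snd d (p z), covector_coord B d (p z) (\<beta> z))" "ga (snd c z) = a z" "gb (snd c z) = b z"
      using 1(2) 2(2) a'(2) b'(2) z TT by (auto simp: local_rep_def)
    show "(p z, lincomb (a z) (\<alpha> z) (b z) (\<beta> z)) \<in> fst ?d"
      using 3(1) lincomb_cotangent[OF pts(2,3)] z by simp
    show "g (snd c z) = snd ?d (p z, lincomb (a z) (\<alpha> z) (b z) (\<beta> z))"
      by (simp add: g_def 3 covector_coord_lincomb)
  qed (use T g in auto)
  moreover have "snd c x \<in> T" using a' b' 1 2 by (auto simp: T_def)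
  ultimately have "\<exists>T g. snd c x \<in> T \<and> local_rep S (\<lambda>z. (p z, lincomb (a z) (\<alpha> z) (b z) (\<beta> z))) c ?d T g"
    by (intro exI conjI)
  then show "\<exists>c\<in>C. \<exists>d\<in>cotangent_atlas B. x \<in> fst c \<and>
      (\<exists>T g. snd c x \<in> T \<and> local_rep S (\<lambda>z. (p z, lincomb (a z) (\<alpha> z) (b z) (\<beta> z))) c d T g)"
    using c cotangent_chart_in[OF d(1)] by blast
qed

lemma smooth_map_on_zero_section:
  assumes C: "smooth_atlas C" and B: "smooth_atlas B" and S: "S \<subseteq> points C"
    and p: "smooth_map_on C S B p"
  shows "smooth_map_on C S (cotangent_atlas B) (\<lambda>z. (p z, \<lambda>_. 0))"
proof (rule smooth_map_onI[OF C smooth_atlas_cotangent[OF B] S])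
  fix x assume x: "x \<in> S"
  then have xC: "x \<in> points C" using S by auto
  obtain c d T g where *: "c \<in> C" "d \<in> B" "x \<in> fst c" "snd c x \<in> T" "local_rep S p c d T g"
    using smooth_map_on_localE[OF p C B x xC] .
  have T: "open T" "Cinf T g" using *(5) by (auto simp: local_rep_def)
  have "local_rep S (\<lambda>z. (p z, \<lambda>_. 0)) c (cotangent_chart B d) T (\<lambda>u. (g u, 0))"
    unfolding local_rep_def fst_cotangent_chart cotangent_chart_image[OF B *(2) subset_refl]
  proof (intro conjI ballI impI)
    show "Cinf T (\<lambda>u. (g u, 0 :: 'd))" by (intro Cinf_Pair T Cinf_const)
    show "(\<lambda>u. (g u, 0 :: 'd)) ` T \<subseteq> snd d ` fst d \<times> UNIV" using *(5) by (auto simp: local_rep_def)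
  qed (use *(5) in \<open>auto simp: local_rep_def zero_cotangent\<close>)
  then have "\<exists>T g. snd c x \<in> T \<and> local_rep S (\<lambda>z. (p z, \<lambda>_. 0)) c (cotangent_chart B d) T g"
    using *(4) by (intro exI conjI)
  then show "\<exists>c\<in>C. \<exists>d\<in>cotangent_atlas B. x \<in> fst c \<and> (\<exists>T g. snd c x \<in> T \<and> local_rep S (\<lambda>z. (p z, \<lambda>_. 0)) c d T g)"
    using * cotangent_chart_in[OF *(2)] by blast
qed

context
  fixes B :: "('a, 'n::euclidean_space) chart set" and x \<alpha> c
  assumes B: "smooth_atlas B" and \<alpha>: "\<alpha> \<in> cotangent_space B x" and c: "c \<in> B" "x \<in> fst c"
begin

lemma cotangent_point:
  shows "cotangent_chart B c \<in> cotangent_atlas B" "(x, \<alpha>) \<in> fst (cotangent_chart B c)" "(x, \<alpha>) \<in> points (cotangent_atlas B)"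
  using c \<alpha> in_points[OF c] by (auto intro: cotangent_chart_in)

lemma rep_deriv_projection: "rep_deriv fst (cotangent_chart B c) c (x, \<alpha>) w = fst w"
proof -
  have "((snd c \<circ> fst \<circ> chart_inv (cotangent_chart B c)) has_derivative fst) (at (snd (cotangent_chart B c) (x, \<alpha>)))"
  proof (rule has_derivative_transform_within_open[OF bounded_linear_imp_has_derivative[OF bounded_linear_fst]])
    show "open (snd c ` fst c \<times> (UNIV :: 'n set))" by (intro open_Times open_chart[OF B c(1)]) auto
    show "fst z = (snd c \<circ> fst \<circ> chart_inv (cotangent_chart B c)) z" if "z \<in> snd c ` fst c \<times> UNIV" for z
      using that chart_inv_cotangent[OF B c(1), of "fst z" "snd z"] by (auto simp: chart_inv_chart[OF B c(1)])
  qed (use c in auto)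
  from fun_cong[OF frechet_derivative_at[OF this]] show ?thesis by (simp add: rep_deriv_def)
qed

lemma differential_projection:
  assumes w: "w \<in> tangent_space (cotangent_atlas B) (x, \<alpha>)"
  shows "differential (cotangent_atlas B) B fst (x, \<alpha>) w = coord_vector B c x (fst (w (cotangent_chart B c)))"
proof -
  have n: "smooth_near (cotangent_atlas B) B fst (x, \<alpha>)"
    by (rule smooth_nearI_points[OF smooth_atlas_cotangent[OF B] B cotangent_point(3) smooth_map_on_projection[OF B subset_refl]])
  from differential_eq_coord[OF n w cotangent_point(1,2) c(1)] c(2)
  show ?thesis by (simp add: rep_deriv_projection)
qed

text \<open>A chart change is linear along a fibre, so its derivative there is the change of
  coordinates itself; it is read off along the curve \<open>y0 + s *\<^sub>R a\<close>.\<close>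

lemma rep_deriv_vertical:
  assumes d: "d \<in> B" "x \<in> fst d"
  shows "rep_deriv (\<lambda>z. z) (cotangent_chart B c) (cotangent_chart B d) (x, \<alpha>) (0, a) = (0, \<Sum>b\<in>Basis. (a \<bullet> rep_deriv (\<lambda>x. x) d c x b) *\<^sub>R b)"
proof -
  define G where "G = snd (cotangent_chart B d) \<circ> (\<lambda>z. z) \<circ> chart_inv (cotangent_chart B c)"
  define u0 where "u0 = snd c x"
  define y0 where "y0 = covector_coord B c x \<alpha>"
  have n: "smooth_near (cotangent_atlas B) (cotangent_atlas B) (\<lambda>z. z) (x, \<alpha>)"
    by (rule smooth_near_id[OF smooth_atlas_cotangent[OF B] cotangent_point(3)])
  have 1: "(G has_derivative rep_deriv (\<lambda>z. z) (cotangent_chart B c) (cotangent_chart B d) (x, \<alpha>)) (at (u0, y0 + 0 *\<^sub>R a))"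
    using smooth_near_has_derivative[OF n cotangent_point(1,2) cotangent_chart_in[OF d(1)]] d \<alpha>
    by (simp add: G_def u0_def y0_def)
  have "((\<lambda>s. (u0, y0 + s *\<^sub>R a)) has_derivative (\<lambda>s. (0, s *\<^sub>R a))) (at 0)"
    by (auto intro!: derivative_eq_intros)
  from has_derivative_compose[OF this 1]
  have 2: "((\<lambda>s. G (u0, y0 + s *\<^sub>R a)) has_derivative (\<lambda>s. rep_deriv (\<lambda>z. z) (cotangent_chart B c) (cotangent_chart B d) (x, \<alpha>) (0, s *\<^sub>R a))) (at 0)" .
  have eqG: "G (u0, y) = (snd d x, \<Sum>b\<in>Basis. (y \<bullet> rep_deriv (\<lambda>x. x) d c x b) *\<^sub>R b)" for y
    using chart_inv_cotangent[OF B c(1), of u0 y] c covector_coord_change[OF B c d covector_of_in[OF B c], of y]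
    by (simp add: G_def u0_def chart_inv_chart[OF B c] covector_coord_of[OF B c])
  have 3: "((\<lambda>s. (snd d x, \<Sum>b\<in>Basis. ((y0 + s *\<^sub>R a) \<bullet> rep_deriv (\<lambda>x. x) d c x b) *\<^sub>R b)) has_derivative
      (\<lambda>s. (0, \<Sum>b\<in>Basis. ((s *\<^sub>R a) \<bullet> rep_deriv (\<lambda>x. x) d c x b) *\<^sub>R b))) (at 0)"
    by (auto intro!: derivative_eq_intros simp: inner_add_left algebra_simps)
  have "(\<lambda>s. rep_deriv (\<lambda>z. z) (cotangent_chart B c) (cotangent_chart B d) (x, \<alpha>) (0, s *\<^sub>R a)) =
      (\<lambda>s. (0, \<Sum>b\<in>Basis. ((s *\<^sub>R a) \<bullet> rep_deriv (\<lambda>x. x) d c x b) *\<^sub>R b))"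
    by (rule has_derivative_unique[OF 2[unfolded eqG] 3])
  from fun_cong[OF this, of 1] show ?thesis by simp
qed

text \<open>The projection is differentiated in two ways, passing either through the two cotangent
  charts or through the two base charts.\<close>

lemma rep_deriv_base:
  assumes d: "d \<in> B" "x \<in> fst d"
  shows "fst (rep_deriv (\<lambda>z. z) (cotangent_chart B c) (cotangent_chart B d) (x, \<alpha>) w) = rep_deriv (\<lambda>x. x) c d x (fst w)"
proof -
  note C = smooth_atlas_cotangent[OF B]
  have n: "smooth_near (cotangent_atlas B) (cotangent_atlas B) (\<lambda>z. z) (x, \<alpha>)"
    by (rule smooth_near_id[OF C cotangent_point(3)])
  have nf: "smooth_near (cotangent_atlas B) B fst (x, \<alpha>)"
    by (rule smooth_nearI_points[OF C B cotangent_point(3) smooth_map_on_projection[OF B subset_refl]])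
  have nB: "smooth_near B B (\<lambda>x. x) (fst (x, \<alpha>))"
    using smooth_near_id[OF B in_points[OF c]] by simp
  have "rep_deriv fst (cotangent_chart B c) d (x, \<alpha>) w = rep_deriv fst (cotangent_chart B d) d (x, \<alpha>) (rep_deriv (\<lambda>z. z) (cotangent_chart B c) (cotangent_chart B d) (x, \<alpha>) w)"
    using rep_deriv_compose[OF n nf cotangent_point(1,2) cotangent_chart_in[OF d(1)] _ d(1)] d \<alpha> by simp
  moreover have "rep_deriv fst (cotangent_chart B c) d (x, \<alpha>) w = rep_deriv (\<lambda>x. x) c d x (rep_deriv fst (cotangent_chart B c) c (x, \<alpha>) w)"
    using rep_deriv_compose[OF nf nB cotangent_point(1,2) c(1) _ d(1)] c d by simp
  moreover have "rep_deriv fst (cotangent_chart B d) d (x, \<alpha>) v = fst v" for v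
  proof -
    have "((snd d \<circ> fst \<circ> chart_inv (cotangent_chart B d)) has_derivative fst) (at (snd (cotangent_chart B d) (x, \<alpha>)))"
    proof (rule has_derivative_transform_within_open[OF bounded_linear_imp_has_derivative[OF bounded_linear_fst]])
      show "open (snd d ` fst d \<times> (UNIV :: 'n set))" by (intro open_Times open_chart[OF B d(1)]) auto
      show "fst z = (snd d \<circ> fst \<circ> chart_inv (cotangent_chart B d)) z" if "z \<in> snd d ` fst d \<times> UNIV" for z
        using that chart_inv_cotangent[OF B d(1), of "fst z" "snd z"] by (auto simp: chart_inv_chart[OF B d(1)])
    qed (use d in auto)
    from fun_cong[OF frechet_derivative_at[OF this]] show ?thesis by (simp add: rep_deriv_def)
  qed
  ultimately show ?thesis by (simp add: rep_deriv_projection)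
qed

end

text \<open>The invariance of \<open>\<Sum> dx\<^sub>i \<and> dy\<^sub>i\<close> is only needed when one argument is vertical; then it does not
  involve second derivatives of the transition maps.\<close>

lemma omega_can_vertical:
  assumes B: "smooth_atlas B" and \<alpha>: "\<alpha> \<in> cotangent_space B x" and c: "c \<in> B" "x \<in> fst c"
    and v: "v \<in> tangent_space (cotangent_atlas B) (x, \<alpha>)" and w: "w \<in> tangent_space (cotangent_atlas B) (x, \<alpha>)"
    and v0: "fst (v (cotangent_chart B c)) = 0"
  shows "omega_can B (x, \<alpha>) v w = - (snd (v (cotangent_chart B c)) \<bullet> fst (w (cotangent_chart B c)))" (is "_ = ?r")
    and "omega_can B (x, \<alpha>) w v = snd (v (cotangent_chart B c)) \<bullet> fst (w (cotangent_chart B c))"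
proof -
  \<comment> \<open>Vertical components transform by the transpose of \<open>R\<close> and base
    components by its inverse, so their pairing has the same value in every chart.\<close>
  have key: "fst (v (cotangent_chart B d)) = 0 \<and>
      snd (v (cotangent_chart B d)) \<bullet> fst (w (cotangent_chart B d)) = snd (v (cotangent_chart B c)) \<bullet> fst (w (cotangent_chart B c))"
    if d: "d \<in> B" "x \<in> fst d" for d
  proof -
    define R where "R = rep_deriv (\<lambda>x. x) d c x"
    have nB: "smooth_near B B (\<lambda>x. x) x" by (rule smooth_near_id[OF B in_points[OF c]])
    have R: "linear R" unfolding R_def using rep_deriv_linear[OF nB d c(1)] c(2) by simp
    obtain a where a: "v (cotangent_chart B c) = (0, a)" using v0 by (metis prod.collapse)
    note pts = cotangent_point[OF B \<alpha> c] cotangent_point[OF B \<alpha> d]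
    have vd: "v (cotangent_chart B d) = (0, \<Sum>b\<in>Basis. (a \<bullet> R b) *\<^sub>R b)"
      using tangent_change[OF v pts(1,4,2,5)] rep_deriv_vertical[OF B \<alpha> c d] by (simp add: a R_def)
    define p where "p = fst (w (cotangent_chart B c))"
    have wd: "fst (w (cotangent_chart B d)) = rep_deriv (\<lambda>x. x) c d x p"
      using tangent_change[OF w pts(1,4,2,5)] rep_deriv_base[OF B \<alpha> c d] by (simp add: p_def)
    have "R (rep_deriv (\<lambda>x. x) c d x p) = p"
      using rep_deriv_compose[OF nB nB c d c] rep_deriv_id[OF B c] by (simp add: R_def)
    moreover have "(\<Sum>b\<in>Basis. (a \<bullet> R b) *\<^sub>R b) \<bullet> q = a \<bullet> R q" for q
    proof -
      have "R q = (\<Sum>b\<in>Basis. (q \<bullet> b) *\<^sub>R R b)"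
        using linear_sum[OF R, of "\<lambda>b. (q \<bullet> b) *\<^sub>R b" Basis]
        by (simp only: euclidean_representation linear_scale[OF R])
      then have "a \<bullet> R q = (\<Sum>b\<in>Basis. (q \<bullet> b) * (a \<bullet> R b))" by (simp add: inner_sum_right)
      moreover have "(\<Sum>b\<in>Basis. (a \<bullet> R b) *\<^sub>R b) \<bullet> q = (\<Sum>b\<in>Basis. (a \<bullet> R b) * (b \<bullet> q))"
        by (simp add: inner_sum_left)
      ultimately show ?thesis by (simp add: inner_commute[of q] mult.commute)
    qed
    ultimately show ?thesis by (simp add: vd wd a p_def[symmetric])
  qed
  have sm: "(\<Sum>b\<in>Basis. (fst v' \<bullet> b) * (snd w' \<bullet> b) - (snd v' \<bullet> b) * (fst w' \<bullet> b)) = fst v' \<bullet> snd w' - snd v' \<bullet> fst w'"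
    for v' w' :: "'b \<times> 'b"
    using euclidean_inner[of "fst v'" "snd w'"] euclidean_inner[of "snd v'" "fst w'"] by (simp only: sum_subtractf)
  show "omega_can B (x, \<alpha>) v w = ?r"
    unfolding omega_can_def Let_def fst_conv sm
  proof (rule the_equality)
    show "\<forall>d\<in>B. x \<in> fst d \<longrightarrow> ?r =
        fst (v (cotangent_chart B d)) \<bullet> snd (w (cotangent_chart B d)) - snd (v (cotangent_chart B d)) \<bullet> fst (w (cotangent_chart B d))"
    proof (intro ballI impI)
      fix d assume "d \<in> B" "x \<in> fst d"
      from key[OF this] show "?r =
        fst (v (cotangent_chart B d)) \<bullet> snd (w (cotangent_chart B d)) - snd (v (cotangent_chart B d)) \<bullet> fst (w (cotangent_chart B d))"
        by simp
    qed
    fix r assume "\<forall>d\<in>B. x \<in> fst d \<longrightarrow> r =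
        fst (v (cotangent_chart B d)) \<bullet> snd (w (cotangent_chart B d)) - snd (v (cotangent_chart B d)) \<bullet> fst (w (cotangent_chart B d))"
    from bspec[OF this c(1)] show "r = ?r" using c(2) v0 by simp
  qed
  show "omega_can B (x, \<alpha>) w v = snd (v (cotangent_chart B c)) \<bullet> fst (w (cotangent_chart B c))" (is "_ = ?s")
    unfolding omega_can_def Let_def fst_conv sm
  proof (rule the_equality)
    show "\<forall>d\<in>B. x \<in> fst d \<longrightarrow> ?s =
        fst (w (cotangent_chart B d)) \<bullet> snd (v (cotangent_chart B d)) - snd (w (cotangent_chart B d)) \<bullet> fst (v (cotangent_chart B d))"
    proof (intro ballI impI)
      fix d assume "d \<in> B" "x \<in> fst d"
      from key[OF this] show "?s =
        fst (w (cotangent_chart B d)) \<bullet> snd (v (cotangent_chart B d)) - snd (w (cotangent_chart B d)) \<bullet> fst (v (cotangent_chart B d))"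
        by (simp add: inner_commute[of "snd (v (cotangent_chart B d))"])
    qed
    fix r assume "\<forall>d\<in>B. x \<in> fst d \<longrightarrow> r =
        fst (w (cotangent_chart B d)) \<bullet> snd (v (cotangent_chart B d)) - snd (w (cotangent_chart B d)) \<bullet> fst (v (cotangent_chart B d))"
    from bspec[OF this c(1)] show "r = ?s" using c(2) v0 by (simp add: inner_commute)
  qed
qed

text \<open>The vector whose fibre part consists of the coordinates of the section satisfies the
  equation. Conversely, testing a solution against the vertical vector built from its own base part
  \<open>p\<close> gives \<open>p \<bullet> p = 0\<close>; the solution is then vertical, and the
  arguments \<open>(r, 0)\<close> determine its fibre part.\<close>

lemma vertical_field_eq:
  assumes B: "smooth_atlas B" and \<alpha>: "\<alpha> \<in> cotangent_space B x" and c: "c \<in> B" "x \<in> fst c"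
    and \<sigma>: "\<sigma> x \<in> cotangent_space B x"
  shows "vertical_field B \<sigma> (x, \<alpha>) =
    coord_vector (cotangent_atlas B) (cotangent_chart B c) (x, \<alpha>) (0, covector_coord B c x (\<sigma> x))"
proof -
  note C = smooth_atlas_cotangent[OF B] and pt = cotangent_point[OF B \<alpha> c]
  define X where "X a = coord_vector (cotangent_atlas B) (cotangent_chart B c) (x, \<alpha>) a" for a
  have X: "X a \<in> tangent_space (cotangent_atlas B) (x, \<alpha>)" "X a (cotangent_chart B c) = a" for a
    unfolding X_def by (rule coord_vector_in[OF C pt(1,2)], rule coord_vector_self[OF C pt(1,2)])
  have rhs: "\<sigma> x (differential (cotangent_atlas B) B fst (x, \<alpha>) w) = covector_coord B c x (\<sigma> x) \<bullet> fst (w (cotangent_chart B c))"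
    if w: "w \<in> tangent_space (cotangent_atlas B) (x, \<alpha>)" for w
    unfolding differential_projection[OF B \<alpha> c w] by (rule cotangent_coord_vector[OF B c \<sigma>])
  show ?thesis
    unfolding vertical_field_def fst_conv X_def[symmetric]
  proof (rule the_equality)
    show "X (0, covector_coord B c x (\<sigma> x)) \<in> tangent_space (cotangent_atlas B) (x, \<alpha>) \<and>
      (\<forall>w\<in>tangent_space (cotangent_atlas B) (x, \<alpha>). omega_can B (x, \<alpha>) (X (0, covector_coord B c x (\<sigma> x))) w =
        - \<sigma> x (differential (cotangent_atlas B) B fst (x, \<alpha>) w))"
      using omega_can_vertical(1)[OF B \<alpha> c X(1)] by (simp add: X rhs)
  next
    fix v assume "v \<in> tangent_space (cotangent_atlas B) (x, \<alpha>) \<and>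
      (\<forall>w\<in>tangent_space (cotangent_atlas B) (x, \<alpha>). omega_can B (x, \<alpha>) v w =
        - \<sigma> x (differential (cotangent_atlas B) B fst (x, \<alpha>) w))"
    then have v: "v \<in> tangent_space (cotangent_atlas B) (x, \<alpha>)"
      and *: "\<And>w. w \<in> tangent_space (cotangent_atlas B) (x, \<alpha>) \<Longrightarrow> omega_can B (x, \<alpha>) v w =
        - (covector_coord B c x (\<sigma> x) \<bullet> fst (w (cotangent_chart B c)))" using rhs by auto
    define p where "p = fst (v (cotangent_chart B c))"
    define q where "q = snd (v (cotangent_chart B c))"
    have "omega_can B (x, \<alpha>) v (X (0, p)) = p \<bullet> p"
      using omega_can_vertical(2)[OF B \<alpha> c X(1) v, of "(0, p)"] by (simp add: X p_def)
    then have p0: "p = 0" using *[OF X(1), of "(0, p)"] by (simp add: X)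
    have "- (q \<bullet> r) = - (covector_coord B c x (\<sigma> x) \<bullet> r)" for r
      using omega_can_vertical(1)[OF B \<alpha> c v X(1), of "(r, 0)"] *[OF X(1), of "(r, 0)"] p0
      by (simp add: X p_def q_def)
    then have "\<forall>r. q \<bullet> r = covector_coord B c x (\<sigma> x) \<bullet> r" by simp
    then have "q = covector_coord B c x (\<sigma> x)" by (rule vector_eq_rdot[THEN iffD1])
    then have "v (cotangent_chart B c) = X (0, covector_coord B c x (\<sigma> x)) (cotangent_chart B c)"
      using p0 by (simp add: X p_def q_def prod_eq_iff)
    then show "v = X (0, covector_coord B c x (\<sigma> x))" by (rule tangent_eqI[OF v X(1) pt(1,2)])
  qed
qed

section \<open>The fibrewise flow\<close>

definition ode_sol :: "(real \<Rightarrow> real) \<Rightarrow> real \<Rightarrow> real" where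
  "ode_sol h = (THE u. u 0 = 0 \<and> (\<forall>t. (u has_real_derivative h (u t)) (at t)))"

context
  fixes h :: "real \<Rightarrow> real" and K
  assumes lip: "\<And>a b. \<bar>h a - h b\<bar> \<le> K * \<bar>a - b\<bar>"
begin

text \<open>Rescaling time by \<open>t\<close> reduces a time of either sign to uniqueness on
  \<open>{0..1}\<close>. The equation enters only on the segment from 0 to \<open>t\<close>.\<close>

lemma ode_unique_time:
  assumes "u 0 = v 0" and u: "\<And>r. r \<in> {0..1} \<Longrightarrow> (u has_real_derivative h (u (r * t))) (at (r * t))"
    and v: "\<And>r. r \<in> {0..1} \<Longrightarrow> (v has_real_derivative h (v (r * t))) (at (r * t))"
  shows "u t = v t"
proof -
  have s: "((\<lambda>r. r * t) has_real_derivative t) (at r)" for r by (auto intro!: derivative_eq_intros)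
  have "u (1 * t) = v (1 * t)"
  proof (rule scalar_ode_unique[of "\<lambda>s. t * h s" "\<bar>t\<bar> * K" "\<lambda>r. u (r * t)" "\<lambda>r. v (r * t)" 1])
    show "\<bar>t * h a - t * h b\<bar> \<le> \<bar>t\<bar> * K * \<bar>a - b\<bar>" for a b
      using mult_left_mono[OF lip[of a b], of "\<bar>t\<bar>"] by (simp add: right_diff_distrib[symmetric] abs_mult mult.assoc)
    show "((\<lambda>r. u (r * t)) has_real_derivative t * h (u (r * t))) (at r)" if "r \<in> {0..1}" for r
      using DERIV_chain2[OF u[OF that] s] by (simp add: mult.commute)
    show "((\<lambda>r. v (r * t)) has_real_derivative t * h (v (r * t))) (at r)" if "r \<in> {0..1}" for r
      using DERIV_chain2[OF v[OF that] s] by (simp add: mult.commute)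
  qed (use assms(1) in auto)
  then show ?thesis by simp
qed

lemma ode_sol:
  shows "ode_sol h 0 = 0" "(ode_sol h has_real_derivative h (ode_sol h t)) (at t)"
proof -
  obtain u where u: "u 0 = 0" "\<And>t. (u has_real_derivative h (u t)) (at t)"
    using scalar_ode_exists[OF lip] by blast
  have "ode_sol h 0 = 0 \<and> (\<forall>t. (ode_sol h has_real_derivative h (ode_sol h t)) (at t))"
    unfolding ode_sol_def
  proof (rule theI[of _ u])
    fix v assume v: "v 0 = 0 \<and> (\<forall>t. (v has_real_derivative h (v t)) (at t))"
    show "v = u"
      by (rule ext, rule ode_unique_time[of v u]) (use u v in auto)
  qed (use u in auto)
  then show "ode_sol h 0 = 0" "(ode_sol h has_real_derivative h (ode_sol h t)) (at t)" by auto
qed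

text \<open>Recognises the solution from a function that satisfies the equation just between times 0
  and \<open>t\<close>. In \<open>Phi_base\<close> the comparison function is known to solve the
  equation only while the cut-off is 1.\<close>

lemma ode_sol_eq:
  assumes "u 0 = 0" "\<And>r. r \<in> {0..1} \<Longrightarrow> (u has_real_derivative h (u (r * t))) (at (r * t))"
  shows "ode_sol h t = u t"
  by (rule ode_unique_time[of "ode_sol h" u t, OF _ ode_sol(2) assms(2)]) (simp_all add: ode_sol(1) assms(1))

text \<open>If the solution reaches a zero of \<open>h\<close> at time \<open>t\<close>, a constant
  solution passes through the same value. Running time backwards from \<open>t\<close> to 0,
  uniqueness identifies this value with the initial one, which is 0.\<close>

lemma ode_sol_stationary:
  assumes "h (ode_sol h t) = 0"
  shows "ode_sol h t = 0"
proof -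
  let ?s = "ode_sol h t"
  have s: "((\<lambda>r. t - r * t) has_real_derivative - t) (at r)" for r
    by (auto intro!: derivative_eq_intros)
  have "(\<lambda>r. ode_sol h (t - r * t)) 1 = (\<lambda>r. ?s) 1"
  proof (rule scalar_ode_unique[where h = "\<lambda>s. - t * h s" and K = "\<bar>t\<bar> * K" and u = "\<lambda>r. ode_sol h (t - r * t)" and v = "\<lambda>r. ?s" and r = 1])
    show "\<bar>- t * h a - - t * h b\<bar> \<le> \<bar>t\<bar> * K * \<bar>a - b\<bar>" for a b
      using mult_left_mono[OF lip[of b a], of "\<bar>t\<bar>"]
      by (simp add: right_diff_distrib[symmetric] abs_mult mult.assoc abs_minus_commute)
    show "((\<lambda>r. ode_sol h (t - r * t)) has_real_derivative - t * h (ode_sol h (t - r * t))) (at r)" for r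
      using DERIV_chain2[OF ode_sol(2) s] by (simp add: mult.commute)
    show "((\<lambda>r. ?s) has_real_derivative - t * h ?s) (at r)" for r using assms by simp
  qed auto
  then show ?thesis by (simp add: ode_sol)
qed

end

lemma smooth_map_on_continuous:
  assumes f: "smooth_map_on A (points A) B f" and A: "smooth_atlas A"
  shows "continuous_map (manifold_topology A) (manifold_topology B) f"
proof -
  have "subtopology (manifold_topology A) (points A) = manifold_topology A"
    using subtopology_topspace[of "manifold_topology A"] topspace_manifold[OF A] by (simp only:)
  then show ?thesis using f by (simp add: smooth_map_on_def)
qed

section \<open>The cut-off function on the cotangent bundle and the flow in its fibres\<close>

locale cutoff_setup =
  fixes A :: "('a, 'e::euclidean_space) chart set" and B :: "('a, 'n::euclidean_space) chart set"
    and V :: "('a, 'n) cotangent set" and U :: "'a set" and \<psi> :: "('a, 'n) cotangent \<Rightarrow> 'a" and f :: "'a \<Rightarrow> real"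
  assumes A: "smooth_atlas A" and hausA: "Hausdorff_space (manifold_topology A)"
    and compA: "compact_space (manifold_topology A)"
    and B: "smooth_atlas B" and hausB: "Hausdorff_space (manifold_topology B)"
    and V: "openin (manifold_topology (cotangent_atlas B)) V" and U: "openin (manifold_topology A) U"
    and bij: "bij_betw \<psi> V U" and \<psi>: "smooth_map_on (cotangent_atlas B) V A \<psi>"
    and \<psi>i: "smooth_map_on A U (cotangent_atlas B) (inv_into V \<psi>)"
    and f: "smooth_map_on A (points A) euclid f"
    and supp: "manifold_topology A closure_of {x \<in> points A. f x \<noteq> 0} \<subseteq> U"
begin

abbreviation "C \<equiv> cotangent_atlas B"
abbreviation "cc \<equiv> cotangent_chart B"
abbreviation "\<psi>i \<equiv> inv_into V \<psi>"

text \<open>Extended by zero to the whole bundle, because the line through a point of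
  \<open>V\<close> in the direction of a section may leave \<open>V\<close>.\<close>

definition F :: "('a, 'n) cotangent \<Rightarrow> real" where "F z = (if z \<in> V then f (\<psi> z) else 0)"
definition spt :: "'a set" where "spt = manifold_topology A closure_of {x \<in> points A. f x \<noteq> 0}"
definition K :: "('a, 'n) cotangent set" where "K = {z \<in> V. \<psi> z \<in> spt}"

lemmas C = smooth_atlas_cotangent[OF B]

lemma VC: "V \<subseteq> points C" using openin_subset[OF V] C by simp
lemma UA: "U \<subseteq> points A" using openin_subset[OF U] A by simp
lemma \<psi>_in: "z \<in> V \<Longrightarrow> \<psi> z \<in> U" using bij by (auto simp: bij_betw_def)
lemma \<psi>i_in: "y \<in> U \<Longrightarrow> \<psi>i y \<in> V" using bij by (auto simp: bij_betw_def inv_into_into)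
lemma \<psi>i_\<psi>: "z \<in> V \<Longrightarrow> \<psi>i (\<psi> z) = z" using bij by (auto simp: bij_betw_def)
lemma \<psi>_\<psi>i: "y \<in> U \<Longrightarrow> \<psi> (\<psi>i y) = y" using bij by (auto simp: bij_betw_def f_inv_into_f)

lemma spt_compact: "compactin (manifold_topology A) spt"
  unfolding spt_def by (rule closedin_compact_space[OF compA closedin_closure_of])

lemma spt_closed: "closedin (manifold_topology A) spt" by (simp add: spt_def)

lemma f_zero: "y \<in> points A \<Longrightarrow> y \<notin> spt \<Longrightarrow> f y = 0"
  using closure_of_subset[of "{x \<in> points A. f x \<noteq> 0}" "manifold_topology A"] A by (auto simp: spt_def)

text \<open>The support of the cut-off is compact because the ambient manifold is, and
  \<open>K\<close> is its image under the continuous inverse of \<open>\<psi>\<close>.\<close>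

lemma K_compact: "compactin (manifold_topology C) K"
proof -
  have "K = \<psi>i ` spt"
  proof (intro equalityI subsetI)
    fix z assume "z \<in> K" then show "z \<in> \<psi>i ` spt" using \<psi>i_\<psi>[of z] by (auto simp: K_def image_iff intro!: bexI[of _ "\<psi> z"])
  next
    fix z assume "z \<in> \<psi>i ` spt" then show "z \<in> K" using supp \<psi>_\<psi>i \<psi>i_in by (auto simp: K_def spt_def)
  qed
  moreover have "compactin (subtopology (manifold_topology A) U) spt"
    using spt_compact supp by (simp add: compactin_subtopology spt_def)
  moreover have "continuous_map (subtopology (manifold_topology A) U) (manifold_topology C) \<psi>i"
    using \<psi>i by (simp add: smooth_map_on_def)
  ultimately show ?thesis using image_compactin by metis
qed

lemma K_closed: "closedin (manifold_topology C) K"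
  by (rule compactin_imp_closedin[OF Hausdorff_cotangent[OF B hausB] K_compact])

lemma F_zero: "z \<notin> K \<Longrightarrow> F z = 0"
  using f_zero[of "\<psi> z"] \<psi>_in[of z] UA by (auto simp: F_def K_def)

text \<open>The bundle is covered by \<open>V\<close>, where the function is a composite, and by the
  complement of \<open>K\<close>, where it is zero. Compactness makes \<open>K\<close> closed in the
  entire bundle, which takes care of the boundary points of \<open>V\<close>.\<close>

lemma F_smooth: "smooth_map_on C (points C) euclid F"
proof (rule smooth_map_on_open_cover[OF C smooth_atlas_euclid subset_refl])
  fix z assume z: "z \<in> points C"
  show "\<exists>W. openin (manifold_topology C) W \<and> z \<in> W \<and> smooth_map_on C (points C \<inter> W) euclid F"
  proof (cases "z \<in> V")
    case True
    have "smooth_map_on C V euclid (\<lambda>z. f (\<psi> z))"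
      using \<psi>_in UA by (intro smooth_map_on_compose[OF C A smooth_atlas_euclid \<psi> f VC]) auto
    then have "smooth_map_on C V euclid F"
      by (rule smooth_map_on_cong[OF _ C smooth_atlas_euclid VC]) (simp add: F_def)
    then show ?thesis using True V VC by (intro exI[of _ V]) (simp add: Int_absorb1)
  next
    case False
    define W where "W = points C - K"
    have W: "openin (manifold_topology C) W"
      using openin_diff[OF openin_points[OF C] K_closed] by (simp add: W_def)
    have "smooth_map_on C W euclid (\<lambda>z. 0 :: real)"
      by (rule smooth_map_on_const[OF C smooth_atlas_euclid]) (auto simp: W_def)
    then have "smooth_map_on C W euclid F"
      by (rule smooth_map_on_cong[OF _ C smooth_atlas_euclid]) (auto simp: W_def F_zero)
    moreover have "z \<in> W" using False z by (auto simp: W_def K_def)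
    ultimately show ?thesis using W by (intro exI[of _ W]) (auto simp: W_def Int_absorb1)
  qed
qed

definition Fc :: "('a, 'n) chart \<Rightarrow> 'n \<times> 'n \<Rightarrow> real" where "Fc c = (\<lambda>w. F (chart_inv (cc c) w))"

lemma Fc_eq: "c \<in> B \<Longrightarrow> x \<in> fst c \<Longrightarrow> \<alpha> \<in> cotangent_space B x \<Longrightarrow> Fc c (snd c x, covector_coord B c x \<alpha>) = F (x, \<alpha>)"
  using chart_inv_cotangent[OF B, of c "snd c x"] by (simp add: Fc_def chart_inv_chart[OF B] covector_of_coord[OF B])

lemma Fc_smooth: "c \<in> B \<Longrightarrow> Cinf (snd c ` fst c \<times> UNIV) (Fc c)"
proof -
  assume c: "c \<in> B"
  have im: "snd (cc c) ` fst (cc c) = snd c ` fst c \<times> UNIV"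
    using cotangent_chart_image[OF B c subset_refl] by simp
  have "smooth_map_on euclid (snd (cc c) ` fst (cc c)) euclid (Fc c)"
    unfolding Fc_def
  proof (rule smooth_map_on_compose[OF smooth_atlas_euclid C smooth_atlas_euclid
        smooth_map_on_chart_inv[OF C cotangent_chart_in[OF c] subset_refl] F_smooth])
    show "chart_inv (cc c) ` (snd (cc c) ` fst (cc c)) \<subseteq> points C"
      using chart_inv_in_dom[of _ "cc c"] in_points[OF cotangent_chart_in[OF c]] by blast
  qed auto
  from smooth_map_on_euclidD[OF this open_chart[OF C cotangent_chart_in[OF c]]]
  show ?thesis unfolding im .
qed

text \<open>Over a closed ball of base points the set \<open>K\<close> is compact, so the fibre
  derivatives are bounded on it and vanish off it. The constant is uniform in the base point and
  valid on entire fibres, which makes the solutions global.\<close>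

lemma Fc_lipschitz:
  assumes c: "c \<in> B" and u0: "u0 \<in> snd c ` fst c"
  obtains r M where "r > 0" "M \<ge> 0" "ball u0 r \<subseteq> snd c ` fst c"
    "\<And>u y y'. u \<in> ball u0 r \<Longrightarrow> \<bar>Fc c (u, y) - Fc c (u, y')\<bar> \<le> M * norm (y - y')"
proof -
  note oc = open_chart[OF B c]
  obtain r where r: "r > 0" "cball u0 r \<subseteq> snd c ` fst c" using oc u0 open_contains_cball by blast
  define N where "N = chart_inv c ` cball u0 r"
  have Nc: "N \<subseteq> fst c" unfolding N_def using r(2) chart_inv_in_dom[of _ c] by (auto simp: subset_iff)
  have "continuous_map (subtopology (manifold_topology euclid) (snd c ` fst c)) (manifold_topology B) (chart_inv c)"
    using smooth_map_on_chart_inv[OF B c subset_refl] by (simp add: smooth_map_on_def)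
  moreover have "compactin (subtopology (manifold_topology euclid) (snd c ` fst c)) (cball u0 r)"
    using r(2) by (simp add: compactin_subtopology manifold_topology_euclid)
  ultimately have "compactin (manifold_topology B) N" unfolding N_def by (rule image_compactin[rotated])
  then have "closedin (manifold_topology B) N" by (rule compactin_imp_closedin[OF hausB])
  moreover have "continuous_map (manifold_topology C) (manifold_topology B) fst"
    by (rule smooth_map_on_continuous[OF smooth_map_on_projection[OF B subset_refl] C])
  ultimately have "closedin (manifold_topology C) {z \<in> topspace (manifold_topology C). fst z \<in> N}"
    by (rule closedin_continuous_map_preimage[rotated])
  from closed_Int_compactin[OF this K_compact]
  have KN: "compactin (manifold_topology C) ({z \<in> topspace (manifold_topology C). fst z \<in> N} \<inter> K)" .
  define KN' where "KN' = {z \<in> topspace (manifold_topology C). fst z \<in> N} \<inter> K"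
  have KNsub: "KN' \<subseteq> fst (cc c)" using Nc C by (auto simp: KN'_def)
  have "continuous_map (subtopology (manifold_topology C) (fst (cc c))) (manifold_topology euclid) (snd (cc c))"
    using smooth_map_on_chart[OF C cotangent_chart_in[OF c] subset_refl] by (simp add: smooth_map_on_def)
  moreover have "compactin (subtopology (manifold_topology C) (fst (cc c))) KN'"
    using KN KNsub by (simp add: compactin_subtopology KN'_def)
  ultimately have "compactin (manifold_topology euclid) (snd (cc c) ` KN')" by (rule image_compactin[rotated])
  then have Q: "compact (snd (cc c) ` KN')" by (simp add: manifold_topology_euclid)
  define Q where "Q = snd (cc c) ` KN'"
  have Qsub: "Q \<subseteq> snd c ` fst c \<times> UNIV"
    using KNsub cotangent_chart_image[OF B c subset_refl] unfolding Q_def by auto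
  have Fc0: "Fc c (u, y) = 0" if u: "u \<in> ball u0 r" and n: "(u, y) \<notin> Q" for u y
  proof -
    have uc: "u \<in> snd c ` fst c" using u r(2) by (auto simp: less_imp_le)
    define x where "x = chart_inv c u"
    have x: "x \<in> fst c" "snd c x = u" "x \<in> N"
      using chart_inv_in_dom[OF uc] chart_chart_inv[OF uc] u by (auto simp: x_def N_def)
    define \<alpha> where "\<alpha> = covector_of B c x y"
    have \<alpha>: "\<alpha> \<in> cotangent_space B x" "covector_coord B c x \<alpha> = y"
      unfolding \<alpha>_def using covector_of_in[OF B c x(1)] covector_coord_of[OF B c x(1)] by auto
    have "(x, \<alpha>) \<notin> K"
    proof
      assume k: "(x, \<alpha>) \<in> K"
      then have "(x, \<alpha>) \<in> KN'" using x(3) in_points[OF c x(1)] \<alpha>(1) C by (simp add: KN'_def)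
      then have "snd (cc c) (x, \<alpha>) \<in> Q" unfolding Q_def by (rule imageI)
      then show False using n x \<alpha> by simp
    qed
    then show ?thesis using F_zero Fc_eq[OF c x(1) \<alpha>(1)] x(2) \<alpha>(2) by simp
  qed
  have FcC: "Cinf (snd c ` fst c \<times> UNIV) (Fc c)" by (rule Fc_smooth[OF c])
  define D where "D w = (\<Sum>b\<in>Basis. \<bar>frechet_derivative (Fc c) (at w) (0, b)\<bar>)" for w
  have "continuous_on Q D"
    unfolding D_def
    by (intro continuous_intros continuous_on_subset[OF Cinf_continuous[OF Cinf_derivative[OF FcC]] Qsub])
  then have "bounded (D ` Q)" using Q unfolding Q_def[symmetric] by (intro compact_imp_bounded compact_continuous_image)
  then obtain M0 where M0: "\<And>w. w \<in> Q \<Longrightarrow> \<bar>D w\<bar> \<le> M0" unfolding bounded_iff by auto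
  \<comment> \<open>The maximum with 0 covers an empty \<open>Q\<close>, for which \<open>M0\<close>
    is unrestricted.\<close>
  define M where "M = max M0 0"
  have bound: "D (u, y) \<le> M" if u: "u \<in> ball u0 r" for u y
  proof (cases "(u, y) \<in> Q")
    case True
    then show ?thesis using M0[OF True] by (auto simp: M_def)
  next
    case False
    \<comment> \<open>Off the compact set \<open>Q\<close> the function vanishes on a neighbourhood,
      so its derivative vanishes as well.\<close>
    have "open (ball u0 r \<times> UNIV - Q)" using Q unfolding Q_def[symmetric]
      by (intro open_Diff open_Times compact_imp_closed) auto
    moreover have "(u, y) \<in> ball u0 r \<times> UNIV - Q" using u False by simp
    ultimately have "(Fc c has_derivative (\<lambda>_. 0)) (at (u, y))"
      by (rule has_derivative_transform_within_open[OF has_derivative_const[of 0]]) (auto simp: Fc0)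
    from frechet_derivative_at[OF this] have "frechet_derivative (Fc c) (at (u, y)) = (\<lambda>_. 0)" by simp
    then show ?thesis by (simp add: D_def M_def)
  qed
  have "\<bar>Fc c (u, y) - Fc c (u, y')\<bar> \<le> M * norm (y - y')" if u: "u \<in> ball u0 r" for u y y'
  proof -
    have uc: "(u, y) \<in> snd c ` fst c \<times> UNIV" for y using u r(2) by (auto simp: less_imp_le)
    have "norm (Fc c (u, y) - Fc c (u, y')) \<le> M * norm (y - y')"
    proof (rule differentiable_bound[of UNIV "\<lambda>y. Fc c (u, y)" "\<lambda>y v. frechet_derivative (Fc c) (at (u, y)) (0, v)"])
      fix y :: 'n
      show "((\<lambda>y. Fc c (u, y)) has_derivative (\<lambda>v. frechet_derivative (Fc c) (at (u, y)) (0, v))) (at y)"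
        by (rule partial_has_derivative[OF Cinf_has_derivative[OF FcC uc]])
      then have lin: "linear (\<lambda>v. frechet_derivative (Fc c) (at (u, y)) (0, v))" by (rule has_derivative_linear)
      show "onorm (\<lambda>v. frechet_derivative (Fc c) (at (u, y)) (0, v)) \<le> M"
      proof (rule onorm_bound)
        fix v :: 'n
        have "frechet_derivative (Fc c) (at (u, y)) (0, v) = (\<Sum>b\<in>Basis. (v \<bullet> b) * frechet_derivative (Fc c) (at (u, y)) (0, b))"
          using linear_sum[OF lin, of "\<lambda>b. (v \<bullet> b) *\<^sub>R b" Basis]
          by (simp only: euclidean_representation linear_scale[OF lin] real_scaleR_def)
        also have "norm \<dots> \<le> (\<Sum>b\<in>Basis. norm v * \<bar>frechet_derivative (Fc c) (at (u, y)) (0, b)\<bar>)"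
        proof (rule order_trans[OF norm_sum], rule sum_mono)
          fix b :: 'n assume "b \<in> Basis"
          then show "norm ((v \<bullet> b) * frechet_derivative (Fc c) (at (u, y)) (0, b)) \<le> norm v * \<bar>frechet_derivative (Fc c) (at (u, y)) (0, b)\<bar>"
            using Basis_le_norm[of b v] by (simp add: abs_mult mult_right_mono)
        qed
        also have "\<dots> = norm v * D (u, y)" by (simp add: D_def sum_distrib_left)
        also have "\<dots> \<le> norm v * M" using bound[OF u] by (intro mult_left_mono) auto
        finally show "norm (frechet_derivative (Fc c) (at (u, y)) (0, v)) \<le> M * norm v" by (simp add: mult.commute)
      qed (simp add: M_def)
    qed auto
    then show ?thesis by simp
  qed
  moreover have "ball u0 r \<subseteq> snd c ` fst c" using r(2) ball_subset_cball[of u0 r] by blast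
  moreover have "M \<ge> 0" by (simp add: M_def)
  ultimately show thesis using that[of r M] r(1) by blast
qed

definition fibre_rhs :: "('a \<Rightarrow> ('a, 'n) covector) \<Rightarrow> ('a, 'n) cotangent \<Rightarrow> real \<Rightarrow> real" where
  "fibre_rhs \<sigma> z s = F (fst z, lincomb 1 (snd z) s (\<sigma> (fst z)))"

definition fibre_flow :: "('a \<Rightarrow> ('a, 'n) covector) \<Rightarrow> real \<Rightarrow> ('a, 'n) cotangent \<Rightarrow> ('a, 'n) cotangent" where
  "fibre_flow \<sigma> t z = (fst z, lincomb 1 (snd z) (ode_sol (fibre_rhs \<sigma> z) t) (\<sigma> (fst z)))"

text \<open>The equation in a fibre sees only the value of the section at the base point, so its
  existence and uniqueness theory is stated for this pointwise condition.\<close>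

definition sec :: "('a \<Rightarrow> ('a, 'n) covector) \<Rightarrow> bool" where
  "sec \<sigma> \<longleftrightarrow> (\<forall>x\<in>points B. \<sigma> x \<in> cotangent_space B x)"

lemma secD: "sec \<sigma> \<Longrightarrow> x \<in> points B \<Longrightarrow> \<sigma> x \<in> cotangent_space B x"
  by (simp add: sec_def)

lemma fibre_rhs_Fc:
  assumes c: "c \<in> B" "x \<in> fst c" and \<alpha>: "\<alpha> \<in> cotangent_space B x" and \<sigma>: "sec \<sigma>"
  shows "fibre_rhs \<sigma> (x, \<alpha>) s = Fc c (snd c x, covector_coord B c x \<alpha> + s *\<^sub>R covector_coord B c x (\<sigma> x))"
  using Fc_eq[OF c lincomb_cotangent[OF \<alpha> secD[OF \<sigma> in_points[OF c]]], of 1 s]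
  by (simp add: fibre_rhs_def covector_coord_lincomb)

lemma fibre_rhs_lipschitz:
  assumes z: "z \<in> points C" and \<sigma>: "sec \<sigma>"
  shows "\<exists>L. \<forall>a b. \<bar>fibre_rhs \<sigma> z a - fibre_rhs \<sigma> z b\<bar> \<le> L * \<bar>a - b\<bar>"
proof -
  obtain x \<alpha> where z': "z = (x, \<alpha>)" "x \<in> points B" "\<alpha> \<in> cotangent_space B x" using z by auto
  obtain c where c: "c \<in> B" "x \<in> fst c" using z'(2) by (rule pointsE)
  have u0: "snd c x \<in> snd c ` fst c" using c by simp
  obtain r M where rM: "r > 0" "M \<ge> 0" "ball (snd c x) r \<subseteq> snd c ` fst c"
    "\<And>u y y'. u \<in> ball (snd c x) r \<Longrightarrow> \<bar>Fc c (u, y) - Fc c (u, y')\<bar> \<le> M * norm (y - y')"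
    by (rule Fc_lipschitz[OF c(1) u0]) blast
  define q where "q = covector_coord B c x (\<sigma> x)"
  have "\<bar>fibre_rhs \<sigma> z a - fibre_rhs \<sigma> z b\<bar> \<le> (M * norm q) * \<bar>a - b\<bar>" for a b
    using rM(4)[of "snd c x" "covector_coord B c x \<alpha> + a *\<^sub>R q" "covector_coord B c x \<alpha> + b *\<^sub>R q"] rM(1)
    unfolding z'(1) fibre_rhs_Fc[OF c z'(3) \<sigma>] q_def[symmetric]
    by (simp add: scaleR_diff_left[symmetric] mult_ac)
  then show ?thesis by blast
qed

lemma fst_fibre_flow [simp]: "fst (fibre_flow \<sigma> t z) = fst z"
  by (simp add: fibre_flow_def)

lemma fibre_flow_cotangent:
  assumes "z \<in> points C" "sec \<sigma>"
  shows "fibre_flow \<sigma> t z \<in> points C"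
proof -
  have "fst z \<in> points B" "snd z \<in> cotangent_space B (fst z)" using assms(1) by auto
  then show ?thesis using lincomb_cotangent[OF _ secD[OF assms(2)]] by (simp add: fibre_flow_def)
qed

lemma F_fibre_flow: "F (fibre_flow \<sigma> t z) = fibre_rhs \<sigma> z (ode_sol (fibre_rhs \<sigma> z) t)"
  unfolding fibre_flow_def fibre_rhs_def[of \<sigma> z "ode_sol (fibre_rhs \<sigma> z) t"] ..

lemma fibre_sol:
  assumes z: "z \<in> points C" and \<sigma>: "sec \<sigma>"
  shows "ode_sol (fibre_rhs \<sigma> z) 0 = 0"
    "(ode_sol (fibre_rhs \<sigma> z) has_real_derivative F (fibre_flow \<sigma> t z)) (at t)"
proof -
  obtain L where L: "\<And>a b. \<bar>fibre_rhs \<sigma> z a - fibre_rhs \<sigma> z b\<bar> \<le> L * \<bar>a - b\<bar>"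
    using fibre_rhs_lipschitz[OF z \<sigma>] by blast
  show "ode_sol (fibre_rhs \<sigma> z) 0 = 0" by (rule ode_sol(1)[OF L])
  show "(ode_sol (fibre_rhs \<sigma> z) has_real_derivative F (fibre_flow \<sigma> t z)) (at t)"
    unfolding F_fibre_flow by (rule ode_sol(2)[OF L])
qed

lemma fibre_flow_0: "z \<in> points C \<Longrightarrow> sec \<sigma> \<Longrightarrow> fibre_flow \<sigma> 0 z = z"
  by (simp add: fibre_flow_def fibre_sol lincomb_def)

text \<open>At a point outside \<open>V\<close> the right-hand side is zero. By
  \<open>ode_sol_stationary\<close> the trajectory would not have moved, so its starting point would
  lie outside \<open>V\<close> too.\<close>

lemma fibre_flow_V:
  assumes z: "z \<in> V" and \<sigma>: "sec \<sigma>"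
  shows "fibre_flow \<sigma> t z \<in> V"
proof (rule ccontr)
  assume n: "fibre_flow \<sigma> t z \<notin> V"
  have zC: "z \<in> points C" using z VC by auto
  obtain L where L: "\<And>a b. \<bar>fibre_rhs \<sigma> z a - fibre_rhs \<sigma> z b\<bar> \<le> L * \<bar>a - b\<bar>"
    using fibre_rhs_lipschitz[OF zC \<sigma>] by blast
  have "fibre_rhs \<sigma> z (ode_sol (fibre_rhs \<sigma> z) t) = 0"
    unfolding F_fibre_flow[symmetric] using n by (simp add: F_def)
  from ode_sol_stationary[OF L this] have "fibre_flow \<sigma> t z = z"
    by (simp add: fibre_flow_def lincomb_def)
  then show False using n z by simp
qed

lemma fibre_flow_outside:
  assumes z: "z \<in> points C" "F z = 0" and \<sigma>: "sec \<sigma>"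
  shows "fibre_flow \<sigma> t z = z"
proof -
  obtain L where L: "\<And>a b. \<bar>fibre_rhs \<sigma> z a - fibre_rhs \<sigma> z b\<bar> \<le> L * \<bar>a - b\<bar>"
    using fibre_rhs_lipschitz[OF z(1) \<sigma>] by blast
  have "ode_sol (fibre_rhs \<sigma> z) t = 0"
    using z(2) by (intro ode_sol_eq[OF L, of "\<lambda>_. 0"]) (auto simp: fibre_rhs_def lincomb_def)
  then show ?thesis by (simp add: fibre_flow_def lincomb_def)
qed

text \<open>The negative section, written as a \<open>lincomb\<close> so that the rules for fibre
  combinations apply to it.\<close>

definition opposite :: "('a \<Rightarrow> ('a, 'n) covector) \<Rightarrow> 'a \<Rightarrow> ('a, 'n) covector" where
  "opposite \<sigma> x = lincomb (-1) (\<sigma> x) 0 (\<sigma> x)"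

lemma sec_opposite: "sec \<sigma> \<Longrightarrow> sec (opposite \<sigma>)"
  unfolding sec_def opposite_def by (blast intro: lincomb_cotangent)

lemma opposite_opposite: "opposite (opposite \<sigma>) = \<sigma>"
  by (auto simp: opposite_def lincomb_def)

text \<open>The scalar equation is autonomous, so with the opposite section the trajectory is run
  backwards: if \<open>u\<close> is the original solution, the new one is
  \<open>u 1 - u (1 - r)\<close>.\<close>

lemma fibre_flow_opposite:
  assumes z: "z \<in> points C" and \<sigma>: "sec \<sigma>"
  shows "fibre_flow (opposite \<sigma>) 1 (fibre_flow \<sigma> 1 z) = z"
proof -
  let ?u = "ode_sol (fibre_rhs \<sigma> z)" and ?w = "fibre_flow \<sigma> 1 z"
  have w: "?w \<in> points C" by (rule fibre_flow_cotangent[OF z \<sigma>])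
  have \<sigma>': "sec (opposite \<sigma>)" by (rule sec_opposite[OF \<sigma>])
  obtain L where L: "\<And>a b. \<bar>fibre_rhs (opposite \<sigma>) ?w a - fibre_rhs (opposite \<sigma>) ?w b\<bar> \<le> L * \<bar>a - b\<bar>"
    using fibre_rhs_lipschitz[OF w \<sigma>'] by blast
  have rhs: "fibre_rhs (opposite \<sigma>) ?w s = F (fst z, lincomb 1 (snd z) (?u 1 - s) (\<sigma> (fst z)))" for s
    by (simp add: fibre_rhs_def fibre_flow_def opposite_def lincomb_def algebra_simps)
  have "ode_sol (fibre_rhs (opposite \<sigma>) ?w) 1 = (\<lambda>r. ?u 1 - ?u (1 - r)) 1"
  proof (rule ode_sol_eq[where u = "\<lambda>r. ?u 1 - ?u (1 - r)", OF L])
    fix r :: real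
    have s: "((\<lambda>r. 1 - r) has_real_derivative -1) (at (r * 1))" by (auto intro!: derivative_eq_intros)
    have "((\<lambda>r. ?u (1 - r)) has_real_derivative F (fibre_flow \<sigma> (1 - r * 1) z) * -1) (at (r * 1))"
      by (rule DERIV_chain2[OF fibre_sol(2)[OF z \<sigma>] s])
    from DERIV_diff[OF DERIV_const this, of "?u 1"]
    show "((\<lambda>r. ?u 1 - ?u (1 - r)) has_real_derivative fibre_rhs (opposite \<sigma>) ?w (?u 1 - ?u (1 - r * 1))) (at (r * 1))"
      unfolding rhs by (simp add: fibre_flow_def)
  qed simp
  then have "ode_sol (fibre_rhs (opposite \<sigma>) ?w) 1 = ?u 1" using fibre_sol(1)[OF z \<sigma>] by simp
  then have "fibre_flow (opposite \<sigma>) 1 ?w = (fst z, lincomb 1 (snd ?w) (?u 1) (opposite \<sigma> (fst z)))"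
    by (simp add: fibre_flow_def[of "opposite \<sigma>"])
  also have "\<dots> = z" by (simp add: fibre_flow_def opposite_def lincomb_def)
  finally show ?thesis .
qed

end

lemma local_repD:
  assumes "local_rep S f c d T g" "y \<in> S" "y \<in> fst c" "snd c y \<in> T"
  shows "f y \<in> fst d" "g (snd c y) = snd d (f y)"
  using assms unfolding local_rep_def by blast+

context cutoff_setup
begin

definition smooth_family :: "(real \<Rightarrow> 'a \<Rightarrow> ('a, 'n) covector) \<Rightarrow> bool" where
  "smooth_family \<sigma> \<longleftrightarrow> smooth_map_on (ratlas B) ({0..1} \<times> points B) C (\<lambda>z. (snd z, \<sigma> (fst z) (snd z)))"

lemma ratB: "smooth_atlas (ratlas B)" and ratC: "smooth_atlas (ratlas C)" and ratA: "smooth_atlas (ratlas A)"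
  using A B C by auto

lemma smooth_family_sec:
  assumes \<sigma>: "smooth_family \<sigma>" and t: "t \<in> {0..1}"
  shows "sec (\<sigma> t)"
  unfolding sec_def
proof
  fix x assume "x \<in> points B"
  then show "\<sigma> t x \<in> cotangent_space B x"
    using smooth_map_on_points[OF \<sigma>[unfolded smooth_family_def] ratB C, of "(t, x)"] t by simp
qed

text \<open>In a chart the parameters are the time and the base and fibre coordinates; the section
  contributes a coefficient with a smooth extension past the ends of \<open>{0..1}\<close>.
  \<open>scalar_ode_family\<close> applies to the extended equation, whose solution agrees with the
  true one on \<open>{0..1} \<times> points C\<close>.\<close>

lemma fibre_time_smooth:
  assumes \<sigma>: "smooth_family \<sigma>"
  shows "smooth_map_on (ratlas C) ({0..1} \<times> points C) euclid (\<lambda>w. ode_sol (fibre_rhs (\<sigma> (fst w)) (snd w)) 1)"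
proof (rule smooth_map_onI[OF ratC smooth_atlas_euclid])
  show "{0..1} \<times> points C \<subseteq> points (ratlas C)" by auto
  fix w0 :: "real \<times> ('a, 'n) cotangent" assume w0: "w0 \<in> {0..1} \<times> points C"
  obtain t0 x0 \<alpha>0 where w0': "w0 = (t0, (x0, \<alpha>0))" by (metis prod.collapse)
  have t0: "t0 \<in> {0..1}" and x0: "x0 \<in> points B" and \<alpha>0: "\<alpha>0 \<in> cotangent_space B x0"
    using w0 w0' by auto
  obtain c where c: "c \<in> B" "x0 \<in> fst c" using x0 by (rule pointsE)
  define u0 where "u0 = snd c x0"
  have u0: "u0 \<in> snd c ` fst c" using c by (simp add: u0_def)
  obtain r M where rM: "r > 0" "M \<ge> 0" "ball u0 r \<subseteq> snd c ` fst c"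
    "\<And>u y y'. u \<in> ball u0 r \<Longrightarrow> \<bar>Fc c (u, y) - Fc c (u, y')\<bar> \<le> M * norm (y - y')"
    by (rule Fc_lipschitz[OF c(1) u0]) blast
  have sec: "sec (\<sigma> t)" if "t \<in> {0..1}" for t by (rule smooth_family_sec[OF \<sigma> that])
  have in1: "(t0, x0) \<in> fst (rchart c)" "rchart c \<in> ratlas B" "(t0, x0) \<in> {0..1} \<times> points B"
    using c t0 x0 by (auto simp: ratlas_def)
  have in2: "(snd (t0, x0), \<sigma> (fst (t0, x0)) (snd (t0, x0))) \<in> fst (cc c)"
    using c secD[OF sec[OF t0] x0] by simp
  obtain T g where Tg: "snd (rchart c) (t0, x0) \<in> T"
    "local_rep ({0..1} \<times> points B) (\<lambda>z. (snd z, \<sigma> (fst z) (snd z))) (rchart c) (cc c) T g"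
    using smooth_map_on_local[OF \<sigma>[unfolded smooth_family_def] ratB C in1(3,2,1) cotangent_chart_in[OF c(1)] in2] .
  have T: "open T" "Cinf T g" "(t0, u0) \<in> T" using Tg by (auto simp: local_rep_def u0_def)
  have g: "g (t, snd c x) = (snd c x, covector_coord B c x (\<sigma> t x))"
    if "t \<in> {0..1}" "x \<in> fst c" "(t, snd c x) \<in> T" for t x
    using local_repD(2)[OF Tg(2), of "(t, x)"] that in_points[OF c(1) that(2)] by simp
  have "open (T \<inter> UNIV \<times> ball u0 r)" using T by (intro open_Int open_Times) auto
  moreover have "(t0, u0) \<in> T \<inter> UNIV \<times> ball u0 r" using T rM by simp
  \<comment> \<open>The closed ball is compact, so the extended section is bounded on it; this
    yields one Lipschitz constant \<open>M * G\<close> for all parameters.\<close>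
  ultimately obtain e where e: "e > 0" "cball (t0, u0) e \<subseteq> T \<inter> UNIV \<times> ball u0 r"
    using open_contains_cball by blast
  define N where "N = ball (t0, u0) e"
  have N: "open N" "N \<subseteq> T" "\<And>t u. (t, u) \<in> N \<Longrightarrow> u \<in> ball u0 r" "(t0, u0) \<in> N"
    using e by (auto simp: N_def subset_iff less_imp_le simp del: mem_ball)
      (metis dist_commute less_imp_le mem_ball)+
  have "bounded ((\<lambda>z. snd (g z)) ` cball (t0, u0) e)"
    using e(2) by (intro compact_imp_bounded compact_continuous_image continuous_on_subset[OF Cinf_continuous[OF Cinf_snd[OF T(1,2)]]]) auto
  then obtain G where G: "\<And>z. z \<in> cball (t0, u0) e \<Longrightarrow> norm (snd (g z)) \<le> G"
    unfolding bounded_iff by (auto simp del: mem_cball)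
  \<comment> \<open>Only the time and the base coordinate are restricted; the initial fibre
    coordinate is arbitrary.\<close>
  define P :: "(real \<times> ('n \<times> 'n)) set" where "P = (\<lambda>p. (fst p, fst (snd p))) -` N"
  have P: "open P" unfolding P_def by (intro open_vimage N(1)) (auto intro!: continuous_intros)
  define q where "q p = snd (g (fst p, fst (snd p)))" for p :: "real \<times> ('n \<times> 'n)"
  define h where "h = (\<lambda>z :: real \<times> (real \<times> ('n \<times> 'n)). Fc c (fst (snd (snd z)), snd (snd (snd z)) + fst z *\<^sub>R q (snd z)))"
  define u where "u = (\<lambda>z. ode_sol (\<lambda>s. h (s, snd z)) (fst z))"
  have q: "Cinf P q" unfolding q_def
    by (intro Cinf_snd P Cinf_compose[OF P T(1) _ T(2)] Cinf_Pair Cinf_fst Cinf_id) (use N(2) in \<open>auto simp: P_def\<close>)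
  have lip: "\<bar>h (a, p) - h (b, p)\<bar> \<le> (M * G) * \<bar>a - b\<bar>" if p: "p \<in> P" for p a b
  proof -
    have pN: "(fst p, fst (snd p)) \<in> N" using p by (simp add: P_def)
    have "\<bar>h (a, p) - h (b, p)\<bar> \<le> M * norm ((a - b) *\<^sub>R q p)"
      using rM(4)[OF N(3)[OF pN], of "snd (snd p) + a *\<^sub>R q p" "snd (snd p) + b *\<^sub>R q p"]
      by (simp add: h_def scaleR_diff_left)
    also have "\<dots> \<le> M * (\<bar>a - b\<bar> * G)"
      using G[of "(fst p, fst (snd p))"] pN rM(2) unfolding q_def N_def
      by (intro mult_left_mono) (auto intro!: mult_left_mono simp: less_imp_le)
    finally show ?thesis by (simp add: mult_ac)
  qed
  have op: "open (UNIV \<times> P :: (real \<times> (real \<times> ('n \<times> 'n))) set)" by (intro open_Times P) auto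
  interpret scalar_ode_family P h u "M * G"
  proof
    have "Cinf (UNIV \<times> P) (\<lambda>z :: real \<times> (real \<times> ('n \<times> 'n)). q (snd z))"
      by (rule Cinf_compose[OF op P Cinf_snd[OF op Cinf_id[OF op]] q]) auto
    then have "Cinf (UNIV \<times> P) (\<lambda>z :: real \<times> (real \<times> ('n \<times> 'n)). (fst (snd (snd z)), snd (snd (snd z)) + fst z *\<^sub>R q (snd z)))"
      by (intro Cinf_Pair Cinf_add Cinf_scaleR Cinf_fst Cinf_snd Cinf_id op)
    moreover have "open (snd c ` fst c \<times> (UNIV :: 'n set))" by (intro open_Times open_chart[OF B c(1)]) auto
    moreover have "fst (snd (snd z)) \<in> snd c ` fst c" if "z \<in> UNIV \<times> P" for z :: "real \<times> (real \<times> ('n \<times> 'n))"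
      using that N(3)[of "fst (snd z)" "fst (snd (snd z))"] rM(3) by (auto simp: P_def simp del: mem_ball)
    ultimately show "Cinf (UNIV \<times> P) h" unfolding h_def
      by (intro Cinf_compose[OF op _ _ Fc_smooth[OF c(1)]]) (auto simp del: mem_ball)
    show "open P" by (rule P)
    show "\<bar>h (a, p) - h (b, p)\<bar> \<le> M * G * \<bar>a - b\<bar>" if "p \<in> P" for p a b by (rule lip[OF that])
    show "u (0, p) = 0" if "p \<in> P" for p
      using ode_sol(1)[of "\<lambda>s. h (s, p)", OF lip[OF that]] by (simp add: u_def)
    show "((\<lambda>t. u (t, p)) has_real_derivative h (u (t, p), p)) (at t)" if "p \<in> P" for p t
      using ode_sol(2)[of "\<lambda>s. h (s, p)", OF lip[OF that], of t] by (simp add: u_def)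
  qed
  have u1: "Cinf P (\<lambda>p. u (1, p))"
    by (rule Cinf_compose[OF P op _ Cinf_u]) (auto intro!: Cinf_Pair Cinf_const Cinf_id P)
  have im: "snd (rchart (cc c)) ` fst (rchart (cc c)) = UNIV \<times> (snd c ` fst c \<times> UNIV)"
    using snd_rchart_image[of "cc c" UNIV "fst (cc c)"] cotangent_chart_image[OF B c(1) subset_refl] by simp
  have "local_rep ({0..1} \<times> points C) (\<lambda>w. ode_sol (fibre_rhs (\<sigma> (fst w)) (snd w)) 1) (rchart (cc c)) (UNIV, id) P (\<lambda>p. u (1, p))"
    unfolding local_rep_def im
  proof (intro conjI ballI impI)
    show "P \<subseteq> UNIV \<times> (snd c ` fst c \<times> UNIV)"
    proof
      fix p assume "p \<in> P"
      then have "fst (snd p) \<in> snd c ` fst c" using N(3)[of "fst p" "fst (snd p)"] rM(3) by (auto simp: P_def simp del: mem_ball)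
      then show "p \<in> UNIV \<times> (snd c ` fst c \<times> UNIV)" by (simp add: mem_Times_iff)
    qed
    fix w assume w: "w \<in> {0..1} \<times> points C \<inter> fst (rchart (cc c))" "snd (rchart (cc c)) w \<in> P"
    obtain t x \<alpha> where w': "w = (t, (x, \<alpha>))" by (metis prod.collapse)
    have *: "t \<in> {0..1}" "x \<in> fst c" "\<alpha> \<in> cotangent_space B x" "(t, snd c x) \<in> N"
      using w by (auto simp: w' P_def)
    have "q (t, (snd c x, covector_coord B c x \<alpha>)) = covector_coord B c x (\<sigma> t x)"
      using g[OF *(1,2)] *(4) N(2) by (auto simp: q_def)
    then have "(\<lambda>s. h (s, snd (rchart (cc c)) w)) = fibre_rhs (\<sigma> t) (x, \<alpha>)"
      by (intro ext) (simp add: fibre_rhs_Fc[OF c(1) *(2,3) sec[OF *(1)]] h_def w')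
    then show "u (1, snd (rchart (cc c)) w) = snd (UNIV, id) (ode_sol (fibre_rhs (\<sigma> (fst w)) (snd w)) 1)"
      by (simp add: u_def w')
  qed (use P u1 in auto)
  moreover have "snd (rchart (cc c)) w0 \<in> P" using N(4) by (simp add: w0' P_def u0_def)
  ultimately have "\<exists>T g. snd (rchart (cc c)) w0 \<in> T \<and> local_rep ({0..1} \<times> points C) (\<lambda>w. ode_sol (fibre_rhs (\<sigma> (fst w)) (snd w)) 1) (rchart (cc c)) (UNIV, id) T g"
    by (intro exI conjI)
  moreover have "rchart (cc c) \<in> ratlas C" "w0 \<in> fst (rchart (cc c))"
    using c \<alpha>0 cotangent_chart_in[OF c(1)] by (auto simp: ratlas_def w0')
  ultimately show "\<exists>c\<in>ratlas C. \<exists>d\<in>euclid. w0 \<in> fst c \<and> (\<exists>T g. snd c w0 \<in> T \<and>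
      local_rep ({0..1} \<times> points C) (\<lambda>w. ode_sol (fibre_rhs (\<sigma> (fst w)) (snd w)) 1) c d T g)"
    by (intro bexI[of _ "rchart (cc c)"] bexI[of _ "(UNIV, id)"] conjI) (auto simp: euclid_def)
qed

lemma fibre_flow_smooth:
  assumes \<sigma>: "smooth_family \<sigma>"
  shows "smooth_map_on (ratlas C) ({0..1} \<times> points C) C (\<lambda>w. fibre_flow (\<sigma> (fst w)) 1 (snd w))"
proof -
  have S: "{0..1} \<times> points C \<subseteq> points (ratlas C)" by auto
  have S': "{0..1} \<times> points C \<subseteq> UNIV \<times> points C" by auto
  have "smooth_map_on (ratlas C) ({0..1} \<times> points C) B (\<lambda>w. fst (snd w))"
    by (rule smooth_map_on_compose[OF ratC C B smooth_map_on_space[OF C S'] smooth_map_on_projection[OF B subset_refl] S]) auto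
  from smooth_map_on_rpair[OF ratC B S smooth_map_on_time[OF C S'] this]
  have "smooth_map_on (ratlas C) ({0..1} \<times> points C) (ratlas B) (\<lambda>w. (fst w, fst (snd w)))" .
  from smooth_map_on_compose[OF ratC ratB C this \<sigma>[unfolded smooth_family_def] S]
  have 1: "smooth_map_on (ratlas C) ({0..1} \<times> points C) C (\<lambda>w. (fst (snd w), \<sigma> (fst w) (fst (snd w))))" by force
  have 2: "smooth_map_on (ratlas C) ({0..1} \<times> points C) C (\<lambda>w. (fst (snd w), snd (snd w)))"
    using smooth_map_on_space[OF C S'] by simp
  have 3: "smooth_map_on (ratlas C) ({0..1} \<times> points C) euclid (\<lambda>w. 1 :: real)"
    by (rule smooth_map_on_const[OF ratC smooth_atlas_euclid S]) simp
  show ?thesis unfolding fibre_flow_def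
    by (rule smooth_map_on_fibre_lincomb[OF ratC B S 3 fibre_time_smooth[OF \<sigma>] 2 1])
qed

text \<open>Explicit candidate for the time-one flow; \<open>time_one_flow_eq\<close> identifies the
  two on the manifold.\<close>

definition Phi :: "('a \<Rightarrow> ('a, 'n) covector) \<Rightarrow> 'a \<Rightarrow> 'a" where
  "Phi \<sigma> y = (if y \<in> U then \<psi> (fibre_flow \<sigma> 1 (\<psi>i y)) else y)"

lemma \<psi>i_C: "y \<in> U \<Longrightarrow> \<psi>i y \<in> points C" using \<psi>i_in VC by auto

lemma Phi_in: "sec \<sigma> \<Longrightarrow> y \<in> points A \<Longrightarrow> Phi \<sigma> y \<in> points A"
  using \<psi>_in[OF fibre_flow_V[OF \<psi>i_in], of y \<sigma> 1] UA by (auto simp: Phi_def)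

lemma Phi_opposite:
  assumes "sec \<sigma>" "y \<in> points A"
  shows "Phi (opposite \<sigma>) (Phi \<sigma> y) = y"
proof (cases "y \<in> U")
  case True
  have v: "fibre_flow \<sigma> 1 (\<psi>i y) \<in> V" by (rule fibre_flow_V[OF \<psi>i_in[OF True] assms(1)])
  show ?thesis
    using True \<psi>_in[OF v] by (simp add: Phi_def \<psi>i_\<psi>[OF v] fibre_flow_opposite[OF \<psi>i_C[OF True] assms(1)] \<psi>_\<psi>i)
qed (simp add: Phi_def)

lemma Phi_opposite':
  "sec \<sigma> \<Longrightarrow> y \<in> points A \<Longrightarrow> Phi \<sigma> (Phi (opposite \<sigma>) y) = y"
  using Phi_opposite[OF sec_opposite, of \<sigma> y] by (simp add: opposite_opposite)

lemma Phi_outside: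
  assumes "sec \<sigma>" "y \<in> points A" "y \<notin> spt"
  shows "Phi \<sigma> y = y"
proof (cases "y \<in> U")
  case True
  have "F (\<psi>i y) = 0" using f_zero[OF assms(2,3)] by (simp add: F_def \<psi>_\<psi>i[OF True])
  from fibre_flow_outside[OF \<psi>i_C[OF True] this assms(1)] show ?thesis by (simp add: Phi_def \<psi>_\<psi>i True)
qed (simp add: Phi_def)

text \<open>The open set \<open>U\<close> and the complement of the support cover the manifold; on
  the latter every map of the family is the identity.\<close>

lemma Phi_smooth:
  assumes \<sigma>: "smooth_family \<sigma>"
  shows "smooth_map_on (ratlas A) ({0..1} \<times> points A) A (\<lambda>w. Phi (\<sigma> (fst w)) (snd w))"
proof (rule smooth_map_on_open_cover[OF ratA A])
  show "{0..1} \<times> points A \<subseteq> points (ratlas A)" by auto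
  have sec: "sec (\<sigma> t)" if "t \<in> {0..1}" for t by (rule smooth_family_sec[OF \<sigma> that])
  have opn: "openin (manifold_topology (ratlas A)) (UNIV \<times> W)" if "openin (manifold_topology A) W" for W
    using that by (simp add: manifold_topology_ratlas[OF A] openin_prod_Times_iff)
  fix w :: "real \<times> 'a" assume w: "w \<in> {0..1} \<times> points A"
  show "\<exists>W. openin (manifold_topology (ratlas A)) W \<and> w \<in> W \<and>
      smooth_map_on (ratlas A) ({0..1} \<times> points A \<inter> W) A (\<lambda>w. Phi (\<sigma> (fst w)) (snd w))"
  proof (cases "snd w \<in> U")
    case True
    let ?S = "{0..1} \<times> points A \<inter> UNIV \<times> U"
    have S: "?S \<subseteq> points (ratlas A)" "?S \<subseteq> UNIV \<times> points A" by auto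
    have "smooth_map_on (ratlas A) ?S C (\<lambda>w. \<psi>i (snd w))"
      by (rule smooth_map_on_compose[OF ratA A C smooth_map_on_space[OF A S(2)] \<psi>i S(1)]) auto
    from smooth_map_on_rpair[OF ratA C S(1) smooth_map_on_time[OF A S(2)] this]
    have "smooth_map_on (ratlas A) ?S (ratlas C) (\<lambda>w. (fst w, \<psi>i (snd w)))" .
    from smooth_map_on_compose[OF ratA ratC C this fibre_flow_smooth[OF \<sigma>] S(1)]
    have "smooth_map_on (ratlas A) ?S C (\<lambda>w. fibre_flow (\<sigma> (fst w)) 1 (\<psi>i (snd w)))"
      using \<psi>i_C by force
    from smooth_map_on_compose[OF ratA C A this \<psi> S(1)]
    have "smooth_map_on (ratlas A) ?S A (\<lambda>w. \<psi> (fibre_flow (\<sigma> (fst w)) 1 (\<psi>i (snd w))))"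
      using fibre_flow_V[OF \<psi>i_in sec] by force
    then have "smooth_map_on (ratlas A) ?S A (\<lambda>w. Phi (\<sigma> (fst w)) (snd w))"
      by (rule smooth_map_on_cong[OF _ ratA A S(1)]) (auto simp: Phi_def)
    then show ?thesis using opn[OF U] True by (intro exI[of _ "UNIV \<times> U"]) (auto simp: mem_Times_iff)
  next
    case False
    define W where "W = points A - spt"
    have W: "openin (manifold_topology A) W"
      using openin_diff[OF openin_points[OF A] spt_closed] by (simp add: W_def)
    let ?S = "{0..1} \<times> points A \<inter> UNIV \<times> W"
    have S: "?S \<subseteq> points (ratlas A)" "?S \<subseteq> UNIV \<times> points A" by auto
    have "smooth_map_on (ratlas A) ?S A (\<lambda>w. Phi (\<sigma> (fst w)) (snd w))"
      by (rule smooth_map_on_cong[OF smooth_map_on_space[OF A S(2)] ratA A S(1)])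
         (auto simp: W_def Phi_outside[OF sec])
    moreover have "w \<in> UNIV \<times> W" using w False supp by (auto simp: W_def spt_def mem_Times_iff)
    ultimately show ?thesis using opn[OF W] by blast
  qed
qed

lemma smooth_family_const:
  assumes "smooth_map_on B (points B) C (\<lambda>x. (x, \<sigma> x))"
  shows "smooth_family (\<lambda>_. \<sigma>)"
  unfolding smooth_family_def
  by (rule smooth_map_on_compose[OF ratB B C smooth_map_on_space[OF B] assms]) auto

lemma smooth_family_opposite:
  assumes \<sigma>: "smooth_family \<sigma>"
  shows "smooth_family (\<lambda>t. opposite (\<sigma> t))"
  unfolding smooth_family_def opposite_def
proof (rule smooth_map_on_fibre_lincomb[OF ratB B])
  show "smooth_map_on (ratlas B) ({0..1} \<times> points B) euclid (\<lambda>z. -1 :: real)"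
    "smooth_map_on (ratlas B) ({0..1} \<times> points B) euclid (\<lambda>z. 0 :: real)"
    by (rule smooth_map_on_const[OF ratB smooth_atlas_euclid]; auto)+
qed (use \<sigma> in \<open>auto simp: smooth_family_def\<close>)

lemma Phi_slice_smooth:
  assumes \<sigma>: "smooth_family \<sigma>" and t: "t \<in> {0..1}"
  shows "smooth_map_on A (points A) A (Phi (\<sigma> t))"
proof -
  have "smooth_map_on A (points A) (ratlas A) (\<lambda>y. (t, y))"
    by (rule smooth_map_on_rpair[OF A A subset_refl smooth_map_on_const[OF A smooth_atlas_euclid subset_refl] smooth_map_on_id[OF A subset_refl]]) simp
  from smooth_map_on_compose[OF A ratA A this Phi_smooth[OF \<sigma>] subset_refl] t
  show ?thesis by (simp add: image_subset_iff)
qed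

lemma Phi_diffeo:
  assumes \<sigma>: "smooth_family \<sigma>" and t: "t \<in> {0..1}"
  shows "diffeo A (Phi (\<sigma> t))" "x \<in> points A \<Longrightarrow> inv_into (points A) (Phi (\<sigma> t)) x = Phi (opposite (\<sigma> t)) x"
proof -
  note s = smooth_family_sec[OF \<sigma> t]
  show d: "diffeo A (Phi (\<sigma> t))"
    by (rule diffeoI[OF A Phi_slice_smooth[OF \<sigma> t] Phi_slice_smooth[OF smooth_family_opposite[OF \<sigma>] t]])
      (simp_all add: Phi_opposite[OF s] Phi_opposite'[OF s])
  assume x: "x \<in> points A"
  have "inv_into (points A) (Phi (\<sigma> t)) (Phi (\<sigma> t) (Phi (opposite (\<sigma> t)) x)) = Phi (opposite (\<sigma> t)) x"
    by (rule diffeoD(5)[OF d Phi_in[OF sec_opposite[OF s] x]])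
  then show "inv_into (points A) (Phi (\<sigma> t)) x = Phi (opposite (\<sigma> t)) x" by (simp add: Phi_opposite'[OF s x])
qed

end

section \<open>Uniqueness of integral curves and the identification of the time-one flow\<close>

lemma vanishing_of_linear_bound:
  fixes \<Delta> \<Delta>' :: "real \<Rightarrow> 'v::real_inner"
  assumes d: "\<And>s. \<bar>s - t0\<bar> < \<delta> \<Longrightarrow> (\<Delta> has_vector_derivative \<Delta>' s) (at s)"
    and bd: "\<And>s. \<bar>s - t0\<bar> < \<delta> \<Longrightarrow> norm (\<Delta>' s) \<le> L * norm (\<Delta> s)"
    and 0: "\<Delta> t0 = 0" and L: "L \<ge> 0" and t: "\<bar>t - t0\<bar> < \<delta>"
  shows "\<Delta> t = 0"
proof -
  define p where "p r = t0 + r * (t - t0)" for r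
  have p: "\<bar>p r - t0\<bar> < \<delta>" if "r \<in> {0..1}" for r
  proof -
    have "\<bar>p r - t0\<bar> \<le> \<bar>t - t0\<bar>" using that by (simp add: p_def abs_mult mult_left_le_one_le)
    then show ?thesis using t by simp
  qed
  \<comment> \<open>The squared norm is a differentiable scalar whose derivative is bounded by
    \<open>2 * L\<close> times itself, up to the factor from rescaling time to
    \<open>{0..1}\<close>; \<open>gronwall_square\<close> then applies with
    \<open>e = 0\<close>.\<close>
  define w where "w r = \<Delta> (p r) \<bullet> \<Delta> (p r)" for r
  have "(w 1)\<^sup>2 \<le> 0\<^sup>2 * exp (2 * (2 * L * \<bar>t - t0\<bar>) + 1)"
  proof (rule gronwall_square[where w = w and r = 1 and w' = "\<lambda>r. (t - t0) * (2 * (\<Delta> (p r) \<bullet> \<Delta>' (p r)))"])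
    fix r :: real assume r: "r \<in> {0..1}"
    have 1: "((\<lambda>s. \<Delta> s \<bullet> \<Delta> s) has_real_derivative 2 * (\<Delta> (p r) \<bullet> \<Delta>' (p r))) (at (p r))"
      unfolding has_field_derivative_def
      by (rule has_derivative_eq_rhs[OF has_derivative_inner[OF d[OF p[OF r], unfolded has_vector_derivative_def] d[OF p[OF r], unfolded has_vector_derivative_def]]])
         (auto simp: inner_commute)
    have 2: "(p has_real_derivative (t - t0)) (at r)"
      unfolding p_def by (auto intro!: derivative_eq_intros)
    show "(w has_real_derivative (t - t0) * (2 * (\<Delta> (p r) \<bullet> \<Delta>' (p r)))) (at r)"
      using DERIV_chain2[OF 1 2] unfolding w_def by (simp only: mult.commute)
    have "\<bar>\<Delta> (p r) \<bullet> \<Delta>' (p r)\<bar> \<le> norm (\<Delta> (p r)) * norm (\<Delta>' (p r))" by (rule Cauchy_Schwarz_ineq2)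
    also have "\<dots> \<le> norm (\<Delta> (p r)) * (L * norm (\<Delta> (p r)))" by (intro mult_left_mono bd[OF p[OF r]]) auto
    also have "\<dots> = L * w r" by (simp add: w_def power2_norm_eq_inner[symmetric] power2_eq_square)
    finally have "\<bar>t - t0\<bar> * (2 * \<bar>\<Delta> (p r) \<bullet> \<Delta>' (p r)\<bar>) \<le> \<bar>t - t0\<bar> * (2 * (L * w r))"
      by (intro mult_left_mono) auto
    moreover have "w r \<ge> 0" by (simp add: w_def)
    ultimately show "\<bar>(t - t0) * (2 * (\<Delta> (p r) \<bullet> \<Delta>' (p r)))\<bar> \<le> 2 * L * \<bar>t - t0\<bar> * \<bar>w r\<bar> + 0"
      by (simp add: abs_mult mult_ac)
  qed (use 0 L in \<open>auto simp: w_def p_def\<close>)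
  then show ?thesis by (simp add: w_def p_def)
qed

lemma continuous_map_real_nbhd:
  assumes \<gamma>: "continuous_map euclideanreal T \<gamma>" and W: "openin T W" "\<gamma> t0 \<in> W"
  obtains \<delta> where "\<delta> > 0" "\<And>s. \<bar>s - t0\<bar> < \<delta> \<Longrightarrow> \<gamma> s \<in> W"
proof -
  have "open {s. \<gamma> s \<in> W}" using openin_continuous_map_preimage[OF \<gamma> W(1)] by simp
  moreover have "t0 \<in> {s. \<gamma> s \<in> W}" using W(2) by simp
  ultimately obtain \<delta> where "\<delta> > 0" "ball t0 \<delta> \<subseteq> {s. \<gamma> s \<in> W}" using open_contains_ball by blast
  then show thesis using that[of \<delta>] by (auto simp: subset_iff dist_real_def abs_minus_commute)
qed

context cutoff_setup
begin

abbreviation "X \<equiv> cutoff_field A B V U \<psi> f"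

lemma near_\<psi>: "z \<in> V \<Longrightarrow> smooth_near C A \<psi> z" by (rule smooth_nearI[OF C A V _ \<psi>])
lemma near_\<psi>i: "y \<in> U \<Longrightarrow> smooth_near A C \<psi>i y" by (rule smooth_nearI[OF A C U _ \<psi>i])

lemma X_eq:
  assumes \<sigma>: "sec \<sigma>" and y: "y \<in> U" and c: "c \<in> B" "fst (\<psi>i y) \<in> fst c" and d: "d \<in> A" "y \<in> fst d"
  shows "X \<sigma> y d = f y *\<^sub>R rep_deriv \<psi> (cc c) d (\<psi>i y) (0, covector_coord B c (fst (\<psi>i y)) (\<sigma> (fst (\<psi>i y))))"
proof -
  obtain x \<alpha> where z: "\<psi>i y = (x, \<alpha>)" by fastforce
  have \<alpha>: "\<alpha> \<in> cotangent_space B x" "x \<in> points B" using \<psi>i_C[OF y] z by auto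
  have cx: "c \<in> B" "x \<in> fst c" using c z by auto
  note pt = cotangent_point[OF B \<alpha>(1) cx]
  have n: "smooth_near C A \<psi> (x, \<alpha>)" using near_\<psi>[OF \<psi>i_in[OF y]] z by simp
  have "differential C A \<psi> (x, \<alpha>) (vertical_field B \<sigma> (x, \<alpha>)) d =
      rep_deriv \<psi> (cc c) d (x, \<alpha>) (0, covector_coord B c x (\<sigma> x))"
    unfolding vertical_field_eq[where \<sigma> = \<sigma>, OF B \<alpha>(1) cx secD[OF \<sigma> \<alpha>(2)]]
      differential_apply[OF n coord_vector_in[OF C pt(1,2)] pt(1,2)] coord_vector_self[OF C pt(1,2)]
    using d \<psi>_\<psi>i[OF y] z by simp
  then show ?thesis using y by (simp add: cutoff_field_def Let_def z)
qed

lemma X_zero: "y \<in> points A \<Longrightarrow> y \<notin> spt \<Longrightarrow> X \<sigma> y d = 0"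
  using f_zero[of y] by (simp add: cutoff_field_def Let_def)

text \<open>The differential of the inverse of \<open>\<psi>\<close> cancels that of
  \<open>\<psi>\<close> in the field. What remains is vertical: the base coordinate has derivative
  zero, and the fibre coordinate moves along the section.\<close>

lemma integral_curve_coordinates:
  assumes \<sigma>: "sec \<sigma>" and \<gamma>: "integral_curve A (X \<sigma>) \<gamma>" and s: "\<gamma> s \<in> U"
    and c: "c \<in> B" "fst (\<psi>i (\<gamma> s)) \<in> fst c"
  shows "((\<lambda>s. snd (cc c) (\<psi>i (\<gamma> s))) has_vector_derivative
    (0, F (\<psi>i (\<gamma> s)) *\<^sub>R covector_coord B c (fst (\<psi>i (\<gamma> s))) (\<sigma> (fst (\<psi>i (\<gamma> s)))))) (at s)"
proof -
  let ?y = "\<gamma> s" and ?z = "\<psi>i (\<gamma> s)"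
  define v where "v = (0 :: 'n, covector_coord B c (fst ?z) (\<sigma> (fst ?z)))"
  have yA: "?y \<in> points A" using s UA by auto
  obtain d where d: "d \<in> A" "?y \<in> fst d" using yA by (rule pointsE)
  have zV: "?z \<in> V" by (rule \<psi>i_in[OF s])
  have zc: "cc c \<in> C" "?z \<in> fst (cc c)" using cotangent_chart_in[OF c(1)] \<psi>i_C[OF s] c(2) by (auto simp: mem_Sigma_iff split: prod.splits)
  have cont: "continuous_map euclideanreal (manifold_topology A) \<gamma>"
    and der: "((snd d \<circ> \<gamma>) has_vector_derivative X \<sigma> ?y d) (at s)"
    using \<gamma> d unfolding integral_curve_def by auto
  have "((snd (cc c) \<circ> \<psi>i \<circ> chart_inv d) has_derivative rep_deriv \<psi>i d (cc c) ?y) (at ((snd d \<circ> \<gamma>) s))"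
    using smooth_near_has_derivative[OF near_\<psi>i[OF s] d zc] by simp
  from has_derivative_compose[OF der[unfolded has_vector_derivative_def] this]
  have 1: "((\<lambda>s. (snd (cc c) \<circ> \<psi>i \<circ> chart_inv d) ((snd d \<circ> \<gamma>) s)) has_derivative (\<lambda>h. rep_deriv \<psi>i d (cc c) ?y (h *\<^sub>R X \<sigma> ?y d))) (at s)" .
  have op: "open {s. \<gamma> s \<in> fst d}" using openin_continuous_map_preimage[OF cont openin_chart[OF A d(1)]] by simp
  have 2: "((\<lambda>s. snd (cc c) (\<psi>i (\<gamma> s))) has_derivative (\<lambda>h. rep_deriv \<psi>i d (cc c) ?y (h *\<^sub>R X \<sigma> ?y d))) (at s)"
    by (rule has_derivative_transform_within_open[OF 1 op]) (use d in \<open>auto simp: chart_inv_chart[OF A d(1)]\<close>)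
  have lin: "linear (rep_deriv \<psi>i d (cc c) ?y)" by (rule rep_deriv_linear[OF near_\<psi>i[OF s] d zc])
  have fy: "smooth_near A C \<psi>i (\<psi> ?z)" using near_\<psi>i[OF s] \<psi>_\<psi>i[OF s] by simp
  have "rep_deriv \<psi>i d (cc c) ?y (rep_deriv \<psi> (cc c) d ?z v) = rep_deriv (\<lambda>z. \<psi>i (\<psi> z)) (cc c) (cc c) ?z v"
    using rep_deriv_compose[OF near_\<psi>[OF zV] fy zc d(1) _ zc(1)] d(2) zc(2) \<psi>_\<psi>i[OF s] by simp
  also have "\<dots> = rep_deriv (\<lambda>z. z) (cc c) (cc c) ?z v"
    using rep_deriv_cong[OF smooth_near_id[OF C \<psi>i_C[OF s]] V zV _ zc zc, of "\<lambda>z. \<psi>i (\<psi> z)"] \<psi>i_\<psi> by simp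
  also have "\<dots> = v" by (rule rep_deriv_id[OF C zc])
  finally have "rep_deriv \<psi>i d (cc c) ?y (X \<sigma> ?y d) = f ?y *\<^sub>R v"
    unfolding X_eq[OF \<sigma> s c d] v_def[symmetric] by (simp add: linear_scale[OF lin])
  moreover have "F ?z = f ?y" using zV by (simp add: F_def \<psi>_\<psi>i[OF s])
  ultimately have "(\<lambda>h. rep_deriv \<psi>i d (cc c) ?y (h *\<^sub>R X \<sigma> ?y d)) = (\<lambda>h. h *\<^sub>R (0, F ?z *\<^sub>R covector_coord B c (fst ?z) (\<sigma> (fst ?z))))"
    by (intro ext) (simp add: linear_scale[OF lin] v_def)
  with 2 show ?thesis unfolding has_vector_derivative_def by simp
qed

text \<open>At a point outside \<open>U\<close> the curves are in the open complement of the
  support, where the field vanishes. Inside \<open>U\<close> the base point is locally constant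
  along both curves, and the fibre coordinates obey one equation with a Lipschitz constant from
  \<open>Fc_lipschitz\<close>.\<close>

lemma integral_curve_local_unique:
  assumes \<sigma>: "sec \<sigma>" and \<gamma>1: "integral_curve A (X \<sigma>) \<gamma>1" and \<gamma>2: "integral_curve A (X \<sigma>) \<gamma>2"
    and eq: "\<gamma>1 t0 = \<gamma>2 t0"
  obtains \<delta> where "\<delta> > 0" "\<And>s. \<bar>s - t0\<bar> < \<delta> \<Longrightarrow> \<gamma>1 s = \<gamma>2 s"
proof -
  have c1: "continuous_map euclideanreal (manifold_topology A) \<gamma>1" and c2: "continuous_map euclideanreal (manifold_topology A) \<gamma>2"
    using \<gamma>1 \<gamma>2 by (auto simp: integral_curve_def)
  have y0A: "\<gamma>1 t0 \<in> points A" using c1 A by (auto simp: continuous_map_def)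
  show thesis
  proof (cases "\<gamma>1 t0 \<in> U")
    case False
    obtain d where d: "d \<in> A" "\<gamma>1 t0 \<in> fst d" using y0A by (rule pointsE)
    define W where "W = (points A - spt) \<inter> fst d"
    have W: "openin (manifold_topology A) W" unfolding W_def
      by (intro openin_Int openin_diff openin_points[OF A] spt_closed openin_chart[OF A d(1)])
    have in_W: "\<gamma>1 t0 \<in> W" using False supp d y0A by (auto simp: W_def spt_def)
    obtain \<delta>1 where \<delta>1: "\<delta>1 > 0" "\<And>s. \<bar>s - t0\<bar> < \<delta>1 \<Longrightarrow> \<gamma>1 s \<in> W"
      by (rule continuous_map_real_nbhd[OF c1 W in_W]) blast
    obtain \<delta>2 where \<delta>2: "\<delta>2 > 0" "\<And>s. \<bar>s - t0\<bar> < \<delta>2 \<Longrightarrow> \<gamma>2 s \<in> W"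
      by (rule continuous_map_real_nbhd[OF c2 W]) (use in_W eq in auto)
    define \<delta> where "\<delta> = min \<delta>1 \<delta>2"
    have "\<gamma>1 s = \<gamma>2 s" if s: "\<bar>s - t0\<bar> < \<delta>" for s
    proof -
      have "snd d (\<gamma>1 s) - snd d (\<gamma>2 s) = 0"
      proof (rule vanishing_of_linear_bound[where \<Delta> = "\<lambda>s. snd d (\<gamma>1 s) - snd d (\<gamma>2 s)" and \<Delta>' = "\<lambda>s. 0" and L = 0])
        fix s assume s: "\<bar>s - t0\<bar> < \<delta>"
        have w: "\<gamma>1 s \<in> W" "\<gamma>2 s \<in> W" using s \<delta>1 \<delta>2 by (auto simp: \<delta>_def)
        have "((snd d \<circ> \<gamma>1) has_vector_derivative X \<sigma> (\<gamma>1 s) d) (at s)" "((snd d \<circ> \<gamma>2) has_vector_derivative X \<sigma> (\<gamma>2 s) d) (at s)"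
          using \<gamma>1 \<gamma>2 w d unfolding integral_curve_def W_def by auto
        from has_vector_derivative_diff[OF this]
        show "((\<lambda>s. snd d (\<gamma>1 s) - snd d (\<gamma>2 s)) has_vector_derivative 0) (at s)"
          using w by (simp add: X_zero W_def)
      qed (use eq s in auto)
      then show ?thesis using \<delta>1 \<delta>2 s smooth_atlas_inj[OF A d(1)] by (auto simp: W_def \<delta>_def dest: inj_onD)
    qed
    then show thesis using that[of \<delta>] \<delta>1 \<delta>2 by (auto simp: \<delta>_def)
  next
    case True
    define x0 where "x0 = fst (\<psi>i (\<gamma>1 t0))"
    have x0: "x0 \<in> points B" using \<psi>i_C[OF True] by (auto simp: x0_def)
    obtain c where c: "c \<in> B" "x0 \<in> fst c" using x0 by (rule pointsE)
    have u0: "snd c x0 \<in> snd c ` fst c" using c by simp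
    obtain r M where rM: "r > 0" "M \<ge> 0" "ball (snd c x0) r \<subseteq> snd c ` fst c"
      "\<And>u y y'. u \<in> ball (snd c x0) r \<Longrightarrow> \<bar>Fc c (u, y) - Fc c (u, y')\<bar> \<le> M * norm (y - y')"
      by (rule Fc_lipschitz[OF c(1) u0]) blast
    define W where "W = {y \<in> U. \<psi>i y \<in> fst (cc c)}"
    have W: "openin (manifold_topology A) W" unfolding W_def
      by (rule openin_preimage_chart[OF A C U \<psi>i openin_chart[OF C cotangent_chart_in[OF c(1)]]])
    have in_W: "\<gamma>1 t0 \<in> W" using True \<psi>i_C[OF True] c(2) by (auto simp: W_def x0_def split: prod.splits)
    obtain \<delta>1 where \<delta>1: "\<delta>1 > 0" "\<And>s. \<bar>s - t0\<bar> < \<delta>1 \<Longrightarrow> \<gamma>1 s \<in> W"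
      by (rule continuous_map_real_nbhd[OF c1 W in_W]) blast
    obtain \<delta>2 where \<delta>2: "\<delta>2 > 0" "\<And>s. \<bar>s - t0\<bar> < \<delta>2 \<Longrightarrow> \<gamma>2 s \<in> W"
      by (rule continuous_map_real_nbhd[OF c2 W]) (use in_W eq in auto)
    define \<delta> where "\<delta> = min \<delta>1 \<delta>2"
    define q where "q = covector_coord B c x0 (\<sigma> x0)"
    have Wc: "\<gamma> s \<in> U \<and> c \<in> B \<and> fst (\<psi>i (\<gamma> s)) \<in> fst c" if "\<gamma> s \<in> W" for \<gamma> :: "real \<Rightarrow> 'a" and s
      using that c by (auto simp: W_def)
    have base: "fst (\<psi>i (\<gamma> s)) = x0" and
      fib: "((\<lambda>s. snd (snd (cc c) (\<psi>i (\<gamma> s)))) has_vector_derivative F (\<psi>i (\<gamma> s)) *\<^sub>R q) (at s)"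
      if \<gamma>: "integral_curve A (X \<sigma>) \<gamma>" "\<gamma> t0 = \<gamma>1 t0" "\<And>s. \<bar>s - t0\<bar> < \<delta> \<Longrightarrow> \<gamma> s \<in> W" and s: "\<bar>s - t0\<bar> < \<delta>" for \<gamma> s
    proof -
      have der: "((\<lambda>s. snd (cc c) (\<psi>i (\<gamma> s))) has_vector_derivative
          (0, F (\<psi>i (\<gamma> s)) *\<^sub>R covector_coord B c (fst (\<psi>i (\<gamma> s))) (\<sigma> (fst (\<psi>i (\<gamma> s)))))) (at s)" if "\<bar>s - t0\<bar> < \<delta>" for s
        using integral_curve_coordinates[OF \<sigma> \<gamma>(1)] Wc[of \<gamma>, OF \<gamma>(3)[OF that]] by blast
      have sc: "fst (snd (cc c) z) = snd c (fst z)" for z by (cases z) simp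
      have "snd c (fst (\<psi>i (\<gamma> s))) - snd c x0 = 0"
      proof (rule vanishing_of_linear_bound[where \<Delta> = "\<lambda>s. snd c (fst (\<psi>i (\<gamma> s))) - snd c x0" and \<Delta>' = "\<lambda>s. 0" and L = 0])
        fix s assume s: "\<bar>s - t0\<bar> < \<delta>"
        have "((\<lambda>s. fst (snd (cc c) (\<psi>i (\<gamma> s)))) has_vector_derivative 0) (at s)"
          using bounded_linear.has_vector_derivative[OF bounded_linear_fst der[OF s]] by simp
        from has_vector_derivative_diff[OF this has_vector_derivative_const]
        show "((\<lambda>s. snd c (fst (\<psi>i (\<gamma> s))) - snd c x0) has_vector_derivative 0) (at s)" by (simp add: sc)
      qed (use \<gamma>(2) s in \<open>auto simp: x0_def\<close>)
      then show b: "fst (\<psi>i (\<gamma> s)) = x0"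
        using Wc[of \<gamma>, OF \<gamma>(3)[OF s]] c(2) smooth_atlas_inj[OF B c(1)] by (auto dest: inj_onD)
      show "((\<lambda>s. snd (snd (cc c) (\<psi>i (\<gamma> s)))) has_vector_derivative F (\<psi>i (\<gamma> s)) *\<^sub>R q) (at s)"
        using bounded_linear.has_vector_derivative[OF bounded_linear_snd der[OF s]] b by (simp add: q_def)
    qed
    have W1: "\<gamma>1 s \<in> W" and W2: "\<gamma>2 s \<in> W" if "\<bar>s - t0\<bar> < \<delta>" for s using that \<delta>1 \<delta>2 by (auto simp: \<delta>_def)
    have Fv: "F (\<psi>i y) = Fc c (snd c x0, snd (snd (cc c) (\<psi>i y)))" if y1: "y \<in> W" and y2: "fst (\<psi>i y) = x0" for y
    proof -
      obtain \<alpha> where z: "\<psi>i y = (x0, \<alpha>)" using y2 by (metis prod.collapse)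
      then show ?thesis using y1 Fc_eq[OF c, of \<alpha>] by (auto simp: W_def)
    qed
    have "\<gamma>1 s = \<gamma>2 s" if s: "\<bar>s - t0\<bar> < \<delta>" for s
    proof -
      note f1 = fib[OF \<gamma>1 refl W1] and f2 = fib[OF \<gamma>2 eq[symmetric] W2]
      note b1 = base[OF \<gamma>1 refl W1] and b2 = base[OF \<gamma>2 eq[symmetric] W2]
      have "snd (snd (cc c) (\<psi>i (\<gamma>1 s))) - snd (snd (cc c) (\<psi>i (\<gamma>2 s))) = 0"
      proof (rule vanishing_of_linear_bound[where \<Delta> = "\<lambda>s. snd (snd (cc c) (\<psi>i (\<gamma>1 s))) - snd (snd (cc c) (\<psi>i (\<gamma>2 s)))"
            and \<Delta>' = "\<lambda>s. F (\<psi>i (\<gamma>1 s)) *\<^sub>R q - F (\<psi>i (\<gamma>2 s)) *\<^sub>R q" and L = "M * norm q"])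
        fix s assume s: "\<bar>s - t0\<bar> < \<delta>"
        show "((\<lambda>s. snd (snd (cc c) (\<psi>i (\<gamma>1 s))) - snd (snd (cc c) (\<psi>i (\<gamma>2 s)))) has_vector_derivative
            F (\<psi>i (\<gamma>1 s)) *\<^sub>R q - F (\<psi>i (\<gamma>2 s)) *\<^sub>R q) (at s)"
          by (rule has_vector_derivative_diff[OF f1[OF _ s] f2[OF _ s]]) simp_all
        have "\<bar>F (\<psi>i (\<gamma>1 s)) - F (\<psi>i (\<gamma>2 s))\<bar> \<le> M * norm (snd (snd (cc c) (\<psi>i (\<gamma>1 s))) - snd (snd (cc c) (\<psi>i (\<gamma>2 s))))"
          unfolding Fv[OF W1[OF s] b1[OF _ s], simplified] Fv[OF W2[OF s] b2[OF _ s], simplified] by (rule rM(4)) (simp add: rM(1))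
        from mult_right_mono[OF this norm_ge_zero[of q]]
        show "norm (F (\<psi>i (\<gamma>1 s)) *\<^sub>R q - F (\<psi>i (\<gamma>2 s)) *\<^sub>R q) \<le> M * norm q * norm (snd (snd (cc c) (\<psi>i (\<gamma>1 s))) - snd (snd (cc c) (\<psi>i (\<gamma>2 s))))"
          by (simp add: scaleR_diff_left[symmetric] mult_ac)
      qed (use eq s rM(2) in auto)
      moreover have "fst (\<psi>i (\<gamma>1 s)) = fst (\<psi>i (\<gamma>2 s))" using b1[OF _ s] b2[OF _ s] by simp
      ultimately have "snd (cc c) (\<psi>i (\<gamma>1 s)) = snd (cc c) (\<psi>i (\<gamma>2 s))"
        by (cases "\<psi>i (\<gamma>1 s)", cases "\<psi>i (\<gamma>2 s)") simp
      then have "\<psi>i (\<gamma>1 s) = \<psi>i (\<gamma>2 s)"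
        by (rule inj_onD[OF cotangent_chart_inj[OF B c(1)]])
           (use W1[OF s] W2[OF s] in \<open>simp_all add: W_def del: fst_cotangent_chart\<close>)
      then have "\<psi> (\<psi>i (\<gamma>1 s)) = \<psi> (\<psi>i (\<gamma>2 s))" by (rule arg_cong)
      moreover have "\<gamma>1 s \<in> U" "\<gamma>2 s \<in> U" using W1[OF s] W2[OF s] by (simp_all add: W_def)
      ultimately show ?thesis by (simp only: \<psi>_\<psi>i)
    qed
    then show thesis using that[of \<delta>] \<delta>1 \<delta>2 by (auto simp: \<delta>_def)
  qed
qed

text \<open>The set of times at which the curves agree is open by local uniqueness and closed by the
  Hausdorff property, and the line is connected.\<close>

lemma integral_curve_unique:
  assumes \<sigma>: "sec \<sigma>" and \<gamma>1: "integral_curve A (X \<sigma>) \<gamma>1" and \<gamma>2: "integral_curve A (X \<sigma>) \<gamma>2"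
    and eq: "\<gamma>1 0 = \<gamma>2 0"
  shows "\<gamma>1 t = \<gamma>2 t"
proof -
  have c1: "continuous_map euclideanreal (manifold_topology A) \<gamma>1" and c2: "continuous_map euclideanreal (manifold_topology A) \<gamma>2"
    using \<gamma>1 \<gamma>2 by (auto simp: integral_curve_def)
  define E where "E = {s. \<gamma>1 s = \<gamma>2 s}"
  have "open E"
    unfolding open_dist
  proof
    fix t0 assume "t0 \<in> E"
    then have "\<gamma>1 t0 = \<gamma>2 t0" by (simp add: E_def)
    from integral_curve_local_unique[OF \<sigma> \<gamma>1 \<gamma>2 this]
    obtain \<delta> where "\<delta> > 0" "\<And>s. \<bar>s - t0\<bar> < \<delta> \<Longrightarrow> \<gamma>1 s = \<gamma>2 s" by metis
    then show "\<exists>e>0. \<forall>y. dist y t0 < e \<longrightarrow> y \<in> E" by (intro exI[of _ \<delta>]) (auto simp: E_def dist_real_def)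
  qed
  moreover have "open (- E)"
    unfolding open_dist
  proof
    fix t0 assume "t0 \<in> - E"
    then have ne: "\<gamma>1 t0 \<noteq> \<gamma>2 t0" by (simp add: E_def)
    have "\<gamma>1 t0 \<in> topspace (manifold_topology A)" "\<gamma>2 t0 \<in> topspace (manifold_topology A)"
      using c1 c2 by (auto simp: continuous_map_def)
    then obtain W1 W2 where W: "openin (manifold_topology A) W1" "openin (manifold_topology A) W2" "\<gamma>1 t0 \<in> W1" "\<gamma>2 t0 \<in> W2" "disjnt W1 W2"
      using hausA ne unfolding Hausdorff_space_def by metis
    obtain \<delta>1 where \<delta>1: "\<delta>1 > 0" "\<And>s. \<bar>s - t0\<bar> < \<delta>1 \<Longrightarrow> \<gamma>1 s \<in> W1"
      by (rule continuous_map_real_nbhd[OF c1 W(1,3)]) blast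
    obtain \<delta>2 where \<delta>2: "\<delta>2 > 0" "\<And>s. \<bar>s - t0\<bar> < \<delta>2 \<Longrightarrow> \<gamma>2 s \<in> W2"
      by (rule continuous_map_real_nbhd[OF c2 W(2,4)]) blast
    have "s \<in> - E" if "dist s t0 < min \<delta>1 \<delta>2" for s
      using \<delta>1(2)[of s] \<delta>2(2)[of s] W(5) that by (auto simp: E_def dist_real_def disjnt_iff)
    then show "\<exists>e>0. \<forall>y. dist y t0 < e \<longrightarrow> y \<in> - E" using \<delta>1(1) \<delta>2(1) by (intro exI[of _ "min \<delta>1 \<delta>2"]) auto
  qed
  then have "closed E" by (simp add: closed_def)
  ultimately have "E = UNIV" using eq clopen[of E] by (auto simp: E_def)
  then show ?thesis by (auto simp: E_def)
qed

text \<open>Integral curves are defined for all times, so the global solution in the fibre is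
  carried over by \<open>\<psi>\<close>. Off \<open>U\<close> the field vanishes and the constant
  curve serves.\<close>

lemma integral_curve_exists:
  assumes \<sigma>: "sec \<sigma>" and y: "y \<in> points A"
  shows "\<exists>\<gamma>. integral_curve A (X \<sigma>) \<gamma> \<and> \<gamma> 0 = y \<and> \<gamma> 1 = Phi \<sigma> y"
proof (cases "y \<in> U")
  case False
  have "y \<notin> spt" using False supp by (auto simp: spt_def)
  then have "integral_curve A (X \<sigma>) (\<lambda>_. y)"
    using y A by (simp add: integral_curve_def X_zero comp_def)
  then show ?thesis using False by (intro exI[of _ "\<lambda>_. y"]) (simp add: Phi_def)
next
  case True
  obtain x \<alpha> where z: "\<psi>i y = (x, \<alpha>)" by fastforce
  have zC: "(x, \<alpha>) \<in> points C" "(x, \<alpha>) \<in> V" using \<psi>i_C[OF True] \<psi>i_in[OF True] z by auto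
  then have x: "x \<in> points B" "\<alpha> \<in> cotangent_space B x" by auto
  obtain c where c: "c \<in> B" "x \<in> fst c" using x(1) by (rule pointsE)
  define u where "u = ode_sol (fibre_rhs \<sigma> (x, \<alpha>))"
  define q where "q = covector_coord B c x (\<sigma> x)"
  define w where "w t = (snd c x, covector_coord B c x \<alpha> + u t *\<^sub>R q)" for t
  define \<zeta> where "\<zeta> t = fibre_flow \<sigma> t (x, \<alpha>)" for t
  have \<zeta>V: "\<zeta> t \<in> V" for t unfolding \<zeta>_def by (rule fibre_flow_V[OF zC(2) \<sigma>])
  have \<zeta>C: "\<zeta> t \<in> points C" for t using \<zeta>V VC by auto
  have f\<zeta>: "fst (\<zeta> t) = x" for t by (simp add: \<zeta>_def)
  have \<zeta>c: "\<zeta> t \<in> fst (cc c)" for t using \<zeta>C[of t] f\<zeta>[of t] c by (cases "\<zeta> t") auto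
  have w\<zeta>: "snd (cc c) (\<zeta> t) = w t" for t
    by (simp add: \<zeta>_def fibre_flow_def w_def u_def q_def covector_coord_lincomb)
  have inv: "chart_inv (cc c) (w t) = \<zeta> t" for t
    using chart_inv_chart[OF C cotangent_chart_in[OF c(1)] \<zeta>c[of t]] w\<zeta> by simp
  have du: "(u has_real_derivative F (\<zeta> t)) (at t)" for t
    unfolding u_def \<zeta>_def by (rule fibre_sol(2)[OF zC(1) \<sigma>])
  have dw: "(w has_vector_derivative (0, F (\<zeta> t) *\<^sub>R q)) (at t)" for t
  proof -
    have "(u has_derivative (\<lambda>h. h * F (\<zeta> t))) (at t)"
      using du[of t] by (simp add: has_field_derivative_def mult_commute_abs)
    then show ?thesis unfolding has_vector_derivative_def w_def
      by (auto intro!: derivative_eq_intros)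
  qed
  define \<gamma> where "\<gamma> t = \<psi> (\<zeta> t)" for t
  have win: "w t \<in> snd (cc c) ` fst (cc c)" for t
    by (subst w\<zeta>[symmetric]) (rule imageI[OF \<zeta>c])
  have cw: "continuous_on UNIV w"
    using dw by (intro continuous_at_imp_continuous_on ballI has_vector_derivative_continuous)
  have cont: "continuous_map euclideanreal (manifold_topology A) \<gamma>"
  proof -
    have "continuous_map euclideanreal (subtopology (manifold_topology euclid) (snd (cc c) ` fst (cc c))) w"
      unfolding continuous_map_in_subtopology using cw win
      by (auto simp: manifold_topology_euclid simp del: fst_cotangent_chart)
    moreover have "continuous_map (subtopology (manifold_topology euclid) (snd (cc c) ` fst (cc c))) (manifold_topology C) (chart_inv (cc c))"
      using smooth_map_on_chart_inv[OF C cotangent_chart_in[OF c(1)] subset_refl] by (simp only: smooth_map_on_def)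
    ultimately have "continuous_map euclideanreal (manifold_topology C) (chart_inv (cc c) \<circ> w)"
      by (rule continuous_map_compose)
    then have "continuous_map euclideanreal (manifold_topology C) \<zeta>" by (simp add: comp_def inv)
    then have "continuous_map euclideanreal (subtopology (manifold_topology C) V) \<zeta>"
      using \<zeta>V by (simp add: continuous_map_in_subtopology image_subset_iff)
    moreover have "continuous_map (subtopology (manifold_topology C) V) (manifold_topology A) \<psi>"
      using \<psi> by (simp add: smooth_map_on_def)
    ultimately have "continuous_map euclideanreal (manifold_topology A) (\<psi> \<circ> \<zeta>)" by (rule continuous_map_compose)
    then show ?thesis by (simp add: comp_def \<gamma>_def[abs_def])
  qed
  have "integral_curve A (X \<sigma>) \<gamma>"
    unfolding integral_curve_def
  proof (intro conjI allI ballI impI cont)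
    fix t d assume d: "d \<in> A" "\<gamma> t \<in> fst d"
    have n: "smooth_near C A \<psi> (\<zeta> t)" by (rule near_\<psi>[OF \<zeta>V])
    have d': "\<psi> (\<zeta> t) \<in> fst d" using d by (simp add: \<gamma>_def)
    have "((snd d \<circ> \<psi> \<circ> chart_inv (cc c)) has_derivative rep_deriv \<psi> (cc c) d (\<zeta> t)) (at (w t))"
      using smooth_near_has_derivative[OF n cotangent_chart_in[OF c(1)] \<zeta>c d(1) d'] w\<zeta> by simp
    from has_derivative_compose[OF dw[unfolded has_vector_derivative_def] this]
    have "((\<lambda>t. (snd d \<circ> \<psi> \<circ> chart_inv (cc c)) (w t)) has_derivative (\<lambda>h. rep_deriv \<psi> (cc c) d (\<zeta> t) (h *\<^sub>R (0, F (\<zeta> t) *\<^sub>R q)))) (at t)" .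
    moreover have "(\<lambda>t. (snd d \<circ> \<psi> \<circ> chart_inv (cc c)) (w t)) = snd d \<circ> \<gamma>" by (auto simp: inv \<gamma>_def)
    moreover have lin: "linear (rep_deriv \<psi> (cc c) d (\<zeta> t))"
      by (rule rep_deriv_linear[OF n cotangent_chart_in[OF c(1)] \<zeta>c d(1) d'])
    moreover have "X \<sigma> (\<gamma> t) d = F (\<zeta> t) *\<^sub>R rep_deriv \<psi> (cc c) d (\<zeta> t) (0, q)"
    proof -
      have g: "\<gamma> t \<in> U" "\<psi>i (\<gamma> t) = \<zeta> t" "F (\<zeta> t) = f (\<gamma> t)"
        using \<psi>_in[OF \<zeta>V] \<psi>i_\<psi>[OF \<zeta>V] \<zeta>V by (simp_all add: \<gamma>_def F_def)
      show ?thesis using X_eq[OF \<sigma> g(1) c(1) _ d] c(2) by (simp add: g f\<zeta> q_def)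
    qed
    moreover have "h *\<^sub>R (0, F (\<zeta> t) *\<^sub>R q) = (h * F (\<zeta> t)) *\<^sub>R (0 :: 'n, q)" for h by simp
    ultimately show "((snd d \<circ> \<gamma>) has_vector_derivative X \<sigma> (\<gamma> t) d) (at t)"
      unfolding has_vector_derivative_def by (simp only: linear_scale[OF lin] scaleR_scaleR)
  qed
  moreover have "\<gamma> 0 = y" using fibre_flow_0[OF zC(1) \<sigma>] z \<psi>_\<psi>i[OF True] by (simp add: \<gamma>_def \<zeta>_def)
  moreover have "\<gamma> 1 = Phi \<sigma> y" using True z by (simp add: \<gamma>_def \<zeta>_def Phi_def)
  ultimately show ?thesis by blast
qed

lemma time_one_flow_eq:
  assumes \<sigma>: "sec \<sigma>" and y: "y \<in> points A"
  shows "time_one_flow A (X \<sigma>) y = Phi \<sigma> y"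
  unfolding time_one_flow_def
proof (rule the_equality)
  show "\<exists>\<gamma>. integral_curve A (X \<sigma>) \<gamma> \<and> \<gamma> 0 = y \<and> \<gamma> 1 = Phi \<sigma> y" by (rule integral_curve_exists[OF \<sigma> y])
  then obtain \<gamma>0 where \<gamma>0: "integral_curve A (X \<sigma>) \<gamma>0" "\<gamma>0 0 = y" "\<gamma>0 1 = Phi \<sigma> y" by blast
  fix y' assume "\<exists>\<gamma>. integral_curve A (X \<sigma>) \<gamma> \<and> \<gamma> 0 = y \<and> \<gamma> 1 = y'"
  then obtain \<gamma> where \<gamma>: "integral_curve A (X \<sigma>) \<gamma>" "\<gamma> 0 = y" "\<gamma> 1 = y'" by blast
  show "y' = Phi \<sigma> y" using integral_curve_unique[OF \<sigma> \<gamma>(1) \<gamma>0(1), of 1] \<gamma> \<gamma>0 by simp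
qed

end

section \<open>Families of diffeomorphisms\<close>

text \<open>The inverse is continuous by compactness; near each point it then coincides with a local inverse of
  a smooth extension of \<open>(t, x) \<mapsto> (t, g\<^sub>t x)\<close> beyond the endpoints of the time interval.\<close>

lemma smooth_inverse_family:
  fixes B :: "('a, 'n::euclidean_space) chart set" and g k :: "real \<Rightarrow> 'a \<Rightarrow> 'a"
  assumes B: "smooth_atlas B" and haus: "Hausdorff_space (manifold_topology B)" and comp: "compact_space (manifold_topology B)"
    and g: "smooth_map_on (ratlas B) ({0..1} \<times> points B) B (\<lambda>w. g (fst w) (snd w))"
    and k: "\<And>t. t \<in> {0..1} \<Longrightarrow> smooth_map_on B (points B) B (k t)"
    and kg: "\<And>t x. t \<in> {0..1} \<Longrightarrow> x \<in> points B \<Longrightarrow> k t (g t x) = x"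
    and gk: "\<And>t x. t \<in> {0..1} \<Longrightarrow> x \<in> points B \<Longrightarrow> g t (k t x) = x"
  shows "smooth_map_on (ratlas B) ({0..1} \<times> points B) B (\<lambda>w. k (fst w) (snd w))"
proof -
  note R = smooth_atlas_ratlas[OF B]
  define S where "S = {0..1::real} \<times> points B"
  have S: "S \<subseteq> points (ratlas B)" "S \<subseteq> UNIV \<times> points B" by (auto simp: S_def)
  have gB: "g t x \<in> points B" if "t \<in> {0..1}" "x \<in> points B" for t x
    using smooth_map_on_points[OF g R B, of "(t, x)"] that by simp
  have kB: "k t x \<in> points B" if "t \<in> {0..1}" "x \<in> points B" for t x
    using smooth_map_on_points[OF k[OF that(1)] B B that(2,2)] .
  define T where "T = subtopology (manifold_topology (ratlas B)) S"
  have T: "T = prod_topology (top_of_set {0..1}) (manifold_topology B)"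
    unfolding T_def S_def manifold_topology_ratlas[OF B] subtopology_Times
    using subtopology_topspace[of "manifold_topology B"] B by simp
  have topT: "topspace T = S" unfolding T using B by (simp add: S_def)
  have compT: "compact_space T" unfolding T
    using comp by (simp add: compact_space_prod_topology compact_space_subtopology)
  have hausT: "Hausdorff_space T" unfolding T
    using haus by (simp add: Hausdorff_space_prod_topology Hausdorff_space_subtopology)
  define H where "H w = (fst w, g (fst w) (snd w))" for w :: "real \<times> 'a"
  have "smooth_map_on (ratlas B) S (ratlas B) H"
    unfolding H_def using smooth_map_on_rpair[OF R B S(1) smooth_map_on_time[OF B S(2)] g[folded S_def]] .
  then have "continuous_map T (manifold_topology (ratlas B)) H" by (simp add: smooth_map_on_def T_def)
  moreover have HS: "H ` S = S"
  proof (intro equalityI subsetI)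
    fix w assume "w \<in> S"
    then obtain t y where w: "w = (t, y)" "t \<in> {0..1}" "y \<in> points B" by (auto simp: S_def)
    then have "w = H (t, k t y)" "(t, k t y) \<in> S" using gk kB by (auto simp: H_def S_def)
    then show "w \<in> H ` S" by blast
  qed (auto simp: H_def S_def gB)
  ultimately have cH: "continuous_map T T H"
    using topT by (auto simp: T_def continuous_map_in_subtopology)
  have "inj_on H S" using kg by (auto simp: inj_on_def H_def S_def) metis
  then have "homeomorphic_map T T H"
    using continuous_imp_homeomorphic_map[OF cH compT hausT] HS topT by simp
  then have open_H: "openin T (H ` N)" if "openin T N" for N
    using that homeomorphic_imp_open_map unfolding open_map_def by blast
  show ?thesis
    unfolding S_def[symmetric]
  proof (rule smooth_map_onI[OF R B S(1)])
    fix w0 assume "w0 \<in> S"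
    then obtain t0 y0 where w0: "w0 = (t0, y0)" "t0 \<in> {0..1}" "y0 \<in> points B" by (auto simp: S_def)
    define x0 where "x0 = k t0 y0"
    have x0: "x0 \<in> points B" "g t0 x0 = y0" unfolding x0_def using kB gk w0 by auto
    obtain c where c: "c \<in> B" "x0 \<in> fst c" using x0(1) by (rule pointsE)
    obtain d where d: "d \<in> B" "y0 \<in> fst d" using w0(3) by (rule pointsE)
    have rc: "rchart c \<in> ratlas B" and rd: "rchart d \<in> ratlas B" using c d by (auto simp: ratlas_def)
    have tx: "(t0, x0) \<in> S" "(t0, x0) \<in> fst (rchart c)" "g (fst (t0, x0)) (snd (t0, x0)) \<in> fst d"
      using w0 x0 c d by (auto simp: S_def)
    obtain T1 g1 where 1: "snd (rchart c) (t0, x0) \<in> T1"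
      "local_rep S (\<lambda>w. g (fst w) (snd w)) (rchart c) d T1 g1"
      using smooth_map_on_local[OF g[folded S_def] R B tx(1) rc tx(2) d(1) tx(3)] .
    have T1: "open T1" "Cinf T1 g1" "(t0, snd c x0) \<in> T1" "T1 \<subseteq> UNIV \<times> snd c ` fst c"
      using 1 snd_rchart_image[of c UNIV "fst c"] by (auto simp: local_rep_def)
    have g1: "g t x \<in> fst d \<and> g1 (t, snd c x) = snd d (g t x)"
      if "t \<in> {0..1}" "x \<in> fst c" "(t, snd c x) \<in> T1" for t x
      using local_repD[OF 1(2), of "(t, x)"] that in_points[OF c(1) that(2)] by (simp add: S_def)
    \<comment> \<open>Adding time as a component gives a map between spaces of equal dimension, as
      the inverse function theorem requires.\<close>
    define G1 where "G1 p = (fst p, g1 p)" for p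
    have G1: "Cinf T1 G1" unfolding G1_def by (intro Cinf_Pair Cinf_fst Cinf_id T1)
    \<comment> \<open>The derivative is block triangular: it preserves the time component, and on
      vectors with time component 0 it is the derivative of \<open>g t0\<close>, which that of
      \<open>k t0\<close> inverts.\<close>
    have inj: "inj (frechet_derivative G1 (at (t0, snd c x0)))"
    proof -
      have dg1: "(g1 has_derivative frechet_derivative g1 (at (t0, snd c x0))) (at (t0, snd c x0))"
        by (rule Cinf_has_derivative[OF T1(2,3)])
      have "(G1 has_derivative (\<lambda>h. (fst h, frechet_derivative g1 (at (t0, snd c x0)) h))) (at (t0, snd c x0))"
        unfolding G1_def by (intro has_derivative_Pair dg1 bounded_linear_imp_has_derivative bounded_linear_fst)
      from frechet_derivative_at[OF this, symmetric]
      have DG: "frechet_derivative G1 (at (t0, snd c x0)) = (\<lambda>h. (fst h, frechet_derivative g1 (at (t0, snd c x0)) h))" .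
      have near_g: "smooth_near B B (g t0) x0"
      proof -
        have "smooth_map_on B (points B) (ratlas B) (\<lambda>x. (t0, x))"
          by (rule smooth_map_on_rpair[OF B B subset_refl smooth_map_on_const[OF B smooth_atlas_euclid subset_refl] smooth_map_on_id[OF B subset_refl]]) simp
        from smooth_map_on_compose[OF B R B this g subset_refl] w0(2)
        have "smooth_map_on B (points B) B (g t0)" by (simp add: image_subset_iff)
        then show ?thesis by (rule smooth_nearI_points[OF B B x0(1)])
      qed
      have near_k: "smooth_near B B (k t0) (g t0 x0)"
        using smooth_nearI_points[OF B B _ k[OF w0(2)], of y0] w0(3) x0(2) by simp
      have part: "rep_deriv (g t0) c d x0 v = frechet_derivative g1 (at (t0, snd c x0)) (0, v)" for v
      proof -
        have op: "open ((\<lambda>u. (t0, u)) -` T1)" by (intro open_vimage T1) (auto intro!: continuous_intros)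
        have "((snd d \<circ> g t0 \<circ> chart_inv c) has_derivative (\<lambda>v. frechet_derivative g1 (at (t0, snd c x0)) (0, v))) (at (snd c x0))"
        proof (rule has_derivative_transform_within_open[OF partial_has_derivative[OF dg1] op])
          fix u assume u: "u \<in> (\<lambda>u. (t0, u)) -` T1"
          then have "u \<in> snd c ` fst c" using T1(4) by auto
          then obtain x where x: "x \<in> fst c" "u = snd c x" by auto
          then show "g1 (t0, u) = (snd d \<circ> g t0 \<circ> chart_inv c) u"
            using g1[OF w0(2) x(1)] u by (simp add: chart_inv_chart[OF B c(1)])
        qed (use T1 in simp)
        from fun_cong[OF frechet_derivative_at[OF this]] show ?thesis by (simp add: rep_deriv_def)
      qed
      have kgd: "rep_deriv (k t0) d c (g t0 x0) (rep_deriv (g t0) c d x0 v) = v" for v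
      proof -
        have "rep_deriv (k t0) d c (g t0 x0) (rep_deriv (g t0) c d x0 v) = rep_deriv (\<lambda>x. k t0 (g t0 x)) c c x0 v"
          using rep_deriv_compose[OF near_g near_k c d(1) _ c(1)] d(2) c(2) x0 kg[OF w0(2) x0(1)] by simp
        also have "\<dots> = rep_deriv (\<lambda>x. x) c c x0 v"
          using rep_deriv_cong[OF smooth_near_id[OF B x0(1)] openin_points[OF B] x0(1) _ c c, of "\<lambda>x. k t0 (g t0 x)"] kg[OF w0(2)] by simp
        finally show ?thesis by (simp add: rep_deriv_id[OF B c])
      qed
      have lin: "linear (frechet_derivative G1 (at (t0, snd c x0)))" by (rule Cinf_frechet_linear[OF G1 T1(3)])
      have lk: "linear (rep_deriv (k t0) d c (g t0 x0))"
        using rep_deriv_linear[OF near_k d(1) _ c(1)] d(2) c(2) x0 kg[OF w0(2) x0(1)] by simp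
      have "h = 0" if h: "frechet_derivative G1 (at (t0, snd c x0)) h = 0" for h
      proof -
        have f: "fst h = 0" "frechet_derivative g1 (at (t0, snd c x0)) h = 0"
          using h unfolding DG by (auto simp: zero_prod_def)
        have h': "h = (0, snd h)" using f(1) by (simp add: prod_eq_iff)
        then have "rep_deriv (g t0) c d x0 (snd h) = 0" unfolding part using f(2) by simp
        then have "snd h = 0" using kgd[of "snd h"] linear_0[OF lk] by simp
        then show ?thesis using h' by (simp add: zero_prod_def)
      qed
      then show ?thesis using linear_injective_0[OF lin] by simp
    qed
    obtain U' V1 G2 where loc: "open U'" "U' \<subseteq> T1" "(t0, snd c x0) \<in> U'" "open V1" "G1 (t0, snd c x0) \<in> V1"
      "homeomorphism U' V1 G1 G2" "Cinf V1 G2"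
      by (rule Cinf_inverse_function[OF T1(1) G1 T1(3) inj])
    define N where "N = {w \<in> fst (rchart c). snd (rchart c) w \<in> U'} \<inter> S"
    have "openin T N" unfolding N_def T_def openin_subtopology
      using openin_chart_vimage[OF R rc loc(1)] by blast
    from open_H[OF this] obtain W where W: "openin (manifold_topology (ratlas B)) W" "H ` N = W \<inter> S"
      unfolding T_def openin_subtopology by auto
    \<comment> \<open>The intersection with \<open>W\<close> forces the true preimage under
      \<open>H\<close> to lie in \<open>N\<close>, near \<open>(t0, x0)\<close>, so that it is the
      one found by the local inverse.\<close>
    define T3 where "T3 = V1 \<inter> snd (rchart d) ` (W \<inter> fst (rchart d))"
    have T3: "open T3" unfolding T3_def by (rule open_Int[OF loc(4) open_chart_image[OF R rd W(1)]])
    have "local_rep S (\<lambda>w. k (fst w) (snd w)) (rchart d) c T3 (\<lambda>p. snd (G2 p))"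
      unfolding local_rep_def
    proof (intro conjI ballI impI)
      show "open T3" by (rule T3)
      show "T3 \<subseteq> snd (rchart d) ` fst (rchart d)" by (auto simp: T3_def)
      show "Cinf T3 (\<lambda>p. snd (G2 p))" by (intro Cinf_snd T3 Cinf_mono[OF loc(7)]) (auto simp: T3_def)
      show "(\<lambda>p. snd (G2 p)) ` T3 \<subseteq> snd c ` fst c"
      proof
        fix u assume "u \<in> (\<lambda>p. snd (G2 p)) ` T3"
        then obtain p where p: "p \<in> V1" "u = snd (G2 p)" by (auto simp: T3_def)
        then have "G2 p \<in> U'" using loc(6) by (auto simp: homeomorphism_def)
        then have "G2 p \<in> UNIV \<times> snd c ` fst c" using loc(2) T1(4) by blast
        then show "u \<in> snd c ` fst c" using p(2) by (simp add: mem_Times_iff)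
      qed
      fix w assume w: "w \<in> S \<inter> fst (rchart d)" "snd (rchart d) w \<in> T3"
      have "snd (rchart d) w \<in> snd (rchart d) ` (W \<inter> fst (rchart d))" using w(2) by (simp add: T3_def)
      then have "w \<in> W" using chart_image_iff[OF R rd, of w "W \<inter> fst (rchart d)"] w(1) by blast
      then have "w \<in> H ` N" using W(2) w(1) by blast
      then obtain t x where x: "(t, x) \<in> N" "w = (t, g t x)" by (auto simp: H_def)
      have x': "t \<in> {0..1}" "x \<in> fst c" "(t, snd c x) \<in> U'" "x \<in> points B"
        using x(1) by (auto simp: N_def S_def)
      have kx: "k t (g t x) = x" by (rule kg[OF x'(1,4)])
      show "k (fst w) (snd w) \<in> fst c" using kx x' by (simp add: x(2))
      have "G1 (t, snd c x) = snd (rchart d) w"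
        using g1[OF x'(1,2)] x'(3) loc(2) by (auto simp: G1_def x(2))
      then have "G2 (snd (rchart d) w) = (t, snd c x)"
        using loc(6) x'(3) by (auto simp: homeomorphism_def)
      then show "snd (G2 (snd (rchart d) w)) = snd c (k (fst w) (snd w))" using kx by (simp add: x(2))
    qed
    moreover have "snd (rchart d) w0 \<in> T3"
    proof -
      have "G1 (t0, snd c x0) = snd (rchart d) w0"
        using g1[OF w0(2) c(2) T1(3)] x0(2) by (simp add: G1_def w0(1))
      moreover have "(t0, x0) \<in> N" using c loc(3) w0(2) x0 by (auto simp: N_def S_def)
      then have "H (t0, x0) \<in> W" using W(2) by blast
      then have "w0 \<in> W" using x0(2) by (simp add: H_def w0(1))
      moreover have "w0 \<in> fst (rchart d)" using d(2) by (simp add: w0(1))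
      ultimately show ?thesis using loc(5) by (simp add: T3_def del: fst_rchart)
    qed
    ultimately have "\<exists>T g'. snd (rchart d) w0 \<in> T \<and> local_rep S (\<lambda>w. k (fst w) (snd w)) (rchart d) c T g'"
      by (intro exI conjI)
    moreover have "w0 \<in> fst (rchart d)" using d by (simp add: w0(1))
    ultimately show "\<exists>c\<in>ratlas B. \<exists>d\<in>B. w0 \<in> fst c \<and> (\<exists>T g'. snd c w0 \<in> T \<and> local_rep S (\<lambda>w. k (fst w) (snd w)) c d T g')"
      using rd c(1) by blast
  qed
qed

definition joint_smooth :: "('a, 'e::euclidean_space) chart set \<Rightarrow> (real \<Rightarrow> 'a \<Rightarrow> 'a) \<Rightarrow> bool" where
  "joint_smooth A \<phi> \<longleftrightarrow> smooth_map_on (ratlas A) ({0..1} \<times> points A) A (\<lambda>w. \<phi> (fst w) (snd w))"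

lemma is_isotopy_joint:
  "smooth_atlas A \<Longrightarrow> is_isotopy A \<phi> \<longleftrightarrow>
    (\<forall>t\<in>{0..1}. diffeo A (\<phi> t)) \<and> (\<forall>x\<in>points A. \<phi> 0 x = x) \<and> joint_smooth A \<phi>"
  by (simp add: is_isotopy_iff joint_smooth_def case_prod_unfold)

lemma joint_smooth_compose:
  assumes A: "smooth_atlas A" and \<phi>: "joint_smooth A \<phi>" and \<theta>: "joint_smooth A \<theta>"
  shows "joint_smooth A (\<lambda>t x. \<phi> t (\<theta> t x))"
proof -
  note R = smooth_atlas_ratlas[OF A]
  have S: "{0..1} \<times> points A \<subseteq> points (ratlas A)" "{0..1} \<times> points A \<subseteq> UNIV \<times> points A" by auto
  have "smooth_map_on (ratlas A) ({0..1} \<times> points A) (ratlas A) (\<lambda>w. (fst w, \<theta> (fst w) (snd w)))"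
    by (rule smooth_map_on_rpair[OF R A S(1) smooth_map_on_time[OF A S(2)] \<theta>[unfolded joint_smooth_def]])
  moreover have "(\<lambda>w. (fst w, \<theta> (fst w) (snd w))) ` ({0..1} \<times> points A) \<subseteq> {0..1} \<times> points A"
    using smooth_map_on_points[OF \<theta>[unfolded joint_smooth_def] R A] by auto
  ultimately show ?thesis
    unfolding joint_smooth_def
    using smooth_map_on_compose[OF R R A _ \<phi>[unfolded joint_smooth_def] S(1), of "\<lambda>w. (fst w, \<theta> (fst w) (snd w))"] by simp
qed

lemma joint_smooth_const:
  assumes A: "smooth_atlas A" and h: "smooth_map_on A (points A) A h"
  shows "joint_smooth A (\<lambda>_. h)"
  unfolding joint_smooth_def
  by (rule smooth_map_on_compose[OF smooth_atlas_ratlas[OF A] A A smooth_map_on_space[OF A] h]) auto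

lemma smooth_one_minus_time:
  assumes A: "smooth_atlas A"
  shows "smooth_map_on (ratlas A) ({0..1} \<times> points A) euclid (\<lambda>w. 1 - fst w)"
proof -
  have "smooth_map_on euclid UNIV euclid (\<lambda>t::real. 1 - t)"
    by (rule smooth_map_on_euclid[OF open_UNIV]) (auto intro!: Cinf_diff Cinf_const Cinf_id)
  then show ?thesis
    by (intro smooth_map_on_compose[OF smooth_atlas_ratlas[OF A] smooth_atlas_euclid smooth_atlas_euclid smooth_map_on_time[OF A]]) auto
qed

lemma joint_smooth_reverse:
  assumes A: "smooth_atlas A" and \<phi>: "joint_smooth A \<phi>"
  shows "joint_smooth A (\<lambda>t. \<phi> (1 - t))"
proof -
  note R = smooth_atlas_ratlas[OF A]
  have S: "{0..1} \<times> points A \<subseteq> points (ratlas A)" "{0..1} \<times> points A \<subseteq> UNIV \<times> points A" by auto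
  have "smooth_map_on (ratlas A) ({0..1} \<times> points A) (ratlas A) (\<lambda>w. (1 - fst w, snd w))"
    by (rule smooth_map_on_rpair[OF R A S(1) smooth_one_minus_time[OF A] smooth_map_on_space[OF A S(2)]])
  from smooth_map_on_compose[OF R R A this \<phi>[unfolded joint_smooth_def] S(1)]
  show ?thesis unfolding joint_smooth_def by (auto simp: image_subset_iff)
qed

lemma image_inv_diffeo:
  assumes "diffeo A h" "S \<subseteq> points A"
  shows "inv_into (points A) h ` (h ` S) = S"
  using diffeoD(5)[OF assms(1)] assms(2) by (auto simp: image_image subset_iff)

lemma Def_L_relI:
  assumes "\<omega>' \<in> Def_L A B" "\<omega>'' \<in> Def_L A B" "is_isotopy A \<rho>" "pullback A A (\<rho> 1) \<omega>'' = \<omega>'"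
    "\<And>t. t \<in> {0..1} \<Longrightarrow> \<rho> t ` points B = points B"
  shows "(\<omega>', \<omega>'') \<in> Def_L_rel A B"
  using assms unfolding Def_L_rel_def by blast

lemma equiv_Def_L:
  fixes A :: "('a, 'e::euclidean_space) chart set" and B :: "('a, 'n::euclidean_space) chart set"
  assumes A: "smooth_atlas A" and BA: "points B \<subseteq> points A"
  shows "equiv (Def_L A B) (Def_L_rel A B)"
proof (rule equivI)
  have two: "\<omega> \<in> two_forms A" if "\<omega> \<in> Def_L A B" for \<omega> using that by (auto simp: Def_L_def symplectic_forms_def)
  show "Def_L_rel A B \<subseteq> Def_L A B \<times> Def_L A B" by (auto simp: Def_L_rel_def)
  show "refl_on (Def_L A B) (Def_L_rel A B)"
  proof (rule refl_onI)
    fix \<omega> assume \<omega>: "\<omega> \<in> Def_L A B"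
    have "is_isotopy A (\<lambda>t x. x)"
      using diffeo_id[OF A] joint_smooth_const[OF A smooth_map_on_id[OF A subset_refl]] by (simp add: is_isotopy_joint[OF A])
    then show "(\<omega>, \<omega>) \<in> Def_L_rel A B"
      using pullback_id[OF A two[OF \<omega>]] by (intro Def_L_relI[OF \<omega> \<omega>, of "\<lambda>t x. x"]) auto
  qed
  show "sym (Def_L_rel A B)"
  proof (rule symI)
    fix \<omega>' \<omega>'' assume "(\<omega>', \<omega>'') \<in> Def_L_rel A B"
    then obtain \<rho> where D: "\<omega>' \<in> Def_L A B" "\<omega>'' \<in> Def_L A B" and \<rho>: "is_isotopy A \<rho>"
      "pullback A A (\<rho> 1) \<omega>'' = \<omega>'" "\<forall>t\<in>{0..1}. \<rho> t ` points B = points B"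
      unfolding Def_L_rel_def by blast
    have d: "diffeo A (\<rho> t)" if "t \<in> {0..1}" for t using \<rho>(1) that by (simp add: is_isotopy_joint[OF A])
    have d1: "diffeo A (\<rho> 1)" by (rule d) simp
    have r0: "\<rho> 0 x = x" if "x \<in> points A" for x using \<rho>(1) that by (simp add: is_isotopy_joint[OF A])
    define k where "k = inv_into (points A) (\<rho> 1)"
    have k: "diffeo A k" unfolding k_def by (rule diffeo_inv[OF A d1])
    \<comment> \<open>At time 0 this is \<open>\<rho> 1\<close> after its inverse, hence the
      identity, and at time 1 it is the inverse of \<open>\<rho> 1\<close>. Reversing time in this
      way requires the inverse of a single diffeomorphism instead of a family of inverses.\<close>
    define \<theta> where "\<theta> t x = \<rho> (1 - t) (k x)" for t x
    have "is_isotopy A \<theta>"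
      unfolding is_isotopy_joint[OF A] \<theta>_def
      using diffeo_compose[OF A d k] diffeoD(6)[OF d1] \<rho>(1)
        joint_smooth_compose[OF A joint_smooth_reverse[OF A] joint_smooth_const[OF A diffeoD(1)[OF k]]]
      by (auto simp: is_isotopy_joint[OF A] k_def)
    moreover have "pullback A A (\<theta> 1) \<omega>' = \<omega>''"
    proof -
      have "pullback A A (\<theta> 1) \<omega>' = pullback A A k \<omega>'"
        by (rule pullback_cong[OF diffeoD(1)[OF k] A A]) (simp add: \<theta>_def r0 diffeoD(3)[OF k])
      also have "\<dots> = pullback A A (\<lambda>x. \<rho> 1 (k x)) \<omega>''"
        unfolding \<rho>(2)[symmetric] by (rule pullback_compose[OF diffeoD(1)[OF k] diffeoD(1)[OF d1] A A A, symmetric])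
      also have "\<dots> = pullback A A (\<lambda>x. x) \<omega>''"
        by (rule pullback_cong[OF smooth_map_on_id[OF A subset_refl] A A]) (simp add: k_def diffeoD(6)[OF d1])
      finally show ?thesis using pullback_id[OF A two[OF D(2)]] by simp
    qed
    moreover have "\<theta> t ` points B = points B" if t: "t \<in> {0..1}" for t
    proof -
      have "\<rho> 1 ` points B = points B" using \<rho>(3) by simp
      then have "k ` points B = points B" using image_inv_diffeo[OF d1 BA] by (simp add: k_def)
      then have "\<theta> t ` points B = \<rho> (1 - t) ` points B" by (metis (no_types, lifting) \<theta>_def image_cong image_image)
      then show ?thesis using \<rho>(3) t by auto
    qed
    ultimately show "(\<omega>'', \<omega>') \<in> Def_L_rel A B" by (rule Def_L_relI[OF D(2,1)])
  qed
  show "trans (Def_L_rel A B)"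
  proof (rule transI)
    fix \<omega>1 \<omega>2 \<omega>3 assume "(\<omega>1, \<omega>2) \<in> Def_L_rel A B" "(\<omega>2, \<omega>3) \<in> Def_L_rel A B"
    then obtain \<rho> \<theta> where D: "\<omega>1 \<in> Def_L A B" "\<omega>3 \<in> Def_L A B" and \<rho>: "is_isotopy A \<rho>"
      "pullback A A (\<rho> 1) \<omega>2 = \<omega>1" "\<forall>t\<in>{0..1}. \<rho> t ` points B = points B" and \<theta>: "is_isotopy A \<theta>"
      "pullback A A (\<theta> 1) \<omega>3 = \<omega>2" "\<forall>t\<in>{0..1}. \<theta> t ` points B = points B"
      unfolding Def_L_rel_def by blast
    have d: "diffeo A (\<rho> t)" "diffeo A (\<theta> t)" if "t \<in> {0..1}" for t using \<rho>(1) \<theta>(1) that by (simp_all add: is_isotopy_joint[OF A])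
    have "is_isotopy A (\<lambda>t x. \<theta> t (\<rho> t x))"
      using diffeo_compose[OF A d(2,1)] \<rho>(1) \<theta>(1) joint_smooth_compose[OF A] by (simp add: is_isotopy_joint[OF A])
    moreover have "pullback A A (\<lambda>x. \<theta> 1 (\<rho> 1 x)) \<omega>3 = \<omega>1"
      using pullback_compose[OF diffeoD(1)[OF d(1)] diffeoD(1)[OF d(2)] A A A, of 1 1 \<omega>3] \<rho>(2) \<theta>(2) by simp
    moreover have "(\<lambda>x. \<theta> t (\<rho> t x)) ` points B = points B" if "t \<in> {0..1}" for t
      using \<rho>(3) \<theta>(3) that by (metis image_image)
    ultimately show "(\<omega>1, \<omega>3) \<in> Def_L_rel A B" by (rule Def_L_relI[OF D])
  qed
qed

section \<open>The comparison of the deformation spaces\<close>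

locale nearby_setup = cutoff_setup A B V U \<psi> f
  for A :: "('a, 'e::euclidean_space) chart set" and B :: "('a, 'n::euclidean_space) chart set" and V U \<psi> f +
  fixes V' :: "('a, 'n) cotangent set"
  assumes V'V: "V' \<subseteq> V" and zero_V': "zero_section B \<subseteq> V'" and conv: "fiberwise_convex B V'"
    and f1: "\<And>z. z \<in> V' \<Longrightarrow> f (\<psi> z) = 1" and \<psi>0: "\<And>x. x \<in> points B \<Longrightarrow> \<psi> (x, \<lambda>_. 0) = x"
    and scA: "second_countable (manifold_topology A)" and compB: "compact_space (manifold_topology B)"
begin

lemma sections_inD:
  assumes "\<sigma> \<in> sections_in B V'"
  shows "sec \<sigma>" "smooth_map_on B (points B) C (\<lambda>x. (x, \<sigma> x))" "x \<in> points B \<Longrightarrow> (x, \<sigma> x) \<in> V'"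
    "x \<notin> points B \<Longrightarrow> \<sigma> x = (\<lambda>_. 0)"
  using assms by (auto simp: sections_in_def sec_def)

lemma zero_V: "x \<in> points B \<Longrightarrow> (x, \<lambda>_. 0) \<in> V'"
  using zero_V' by (auto simp: zero_section_def)

lemma BU: "x \<in> points B \<Longrightarrow> x \<in> U"
  using \<psi>_in[of "(x, \<lambda>_. 0)"] zero_V \<psi>0 V'V by auto

lemma \<psi>i0: "x \<in> points B \<Longrightarrow> \<psi>i x = (x, \<lambda>_. 0)"
  using \<psi>i_\<psi>[of "(x, \<lambda>_. 0)"] zero_V \<psi>0 V'V by auto

lemma BA: "points B \<subseteq> points A" using BU UA by auto

text \<open>\<open>\<psi>\<close> is injective on \<open>V\<close>, so the graph is recovered from
  the image, and the values away from the submanifold are fixed by normalisation. This resolves the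
  description in \<open>section_of\<close>.\<close>

lemma section_image_inj:
  assumes \<sigma>: "\<sigma> \<in> sections_in B V'" and \<tau>: "\<tau> \<in> sections_in B V'"
    and eq: "section_image B \<psi> \<sigma> = section_image B \<psi> \<tau>"
  shows "\<sigma> = \<tau>"
proof
  fix x
  show "\<sigma> x = \<tau> x"
  proof (cases "x \<in> points B")
    case True
    then have "\<psi> (x, \<sigma> x) \<in> section_image B \<psi> \<tau>" unfolding eq[symmetric] by (auto simp: section_image_def)
    then obtain y where y: "y \<in> points B" "\<psi> (x, \<sigma> x) = \<psi> (y, \<tau> y)" by (auto simp: section_image_def)
    have "(x, \<sigma> x) \<in> V" "(y, \<tau> y) \<in> V" using sections_inD(3)[OF \<sigma> True] sections_inD(3)[OF \<tau> y(1)] V'V by auto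
    then have "(x, \<sigma> x) = (y, \<tau> y)" using y(2) \<psi>i_\<psi> by metis
    then show ?thesis by auto
  next
    case False
    then show ?thesis using sections_inD(4)[OF \<sigma>] sections_inD(4)[OF \<tau>] by simp
  qed
qed

lemma section_of_image: "\<sigma> \<in> sections_in B V' \<Longrightarrow> section_of B \<psi> V' (section_image B \<psi> \<sigma>) = \<sigma>"
  unfolding section_of_def using section_image_inj by (intro the_equality) auto

text \<open>The segment from 0 to the value of the section stays in \<open>V'\<close>, where the
  cut-off is 1. Hence the solution is \<open>r\<close> itself up to time 1, and the end point is
  exactly the value of the section.\<close>

lemma Phi_base:
  assumes \<sigma>: "\<sigma> \<in> sections_in B V'" and x: "x \<in> points B"
  shows "Phi \<sigma> x = \<psi> (x, \<sigma> x)"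
proof -
  note s = sections_inD(1)[OF \<sigma>]
  have zC: "(x, \<lambda>_. 0) \<in> points C" using x by (simp add: zero_cotangent)
  obtain L where L: "\<And>a b. \<bar>fibre_rhs \<sigma> (x, \<lambda>_. 0) a - fibre_rhs \<sigma> (x, \<lambda>_. 0) b\<bar> \<le> L * \<bar>a - b\<bar>"
    using fibre_rhs_lipschitz[OF zC s] by blast
  have one: "fibre_rhs \<sigma> (x, \<lambda>_. 0) r = 1" if r: "r \<in> {0..1}" for r
  proof -
    have "(x, lincomb (1 - r) (\<lambda>_. 0) r (\<sigma> x)) \<in> V'"
      using conv x r zero_V[OF x] sections_inD(3)[OF \<sigma> x] unfolding fiberwise_convex_def by blast
    then have "(x, lincomb 1 (\<lambda>_. 0) r (\<sigma> x)) \<in> V'" by (simp add: lincomb_def)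
    then show ?thesis using f1 V'V by (auto simp: fibre_rhs_def F_def)
  qed
  have "ode_sol (fibre_rhs \<sigma> (x, \<lambda>_. 0)) 1 = (\<lambda>r. r) 1"
    by (rule ode_sol_eq[where u = "\<lambda>r. r", OF L]) (use one in auto)
  then have "fibre_flow \<sigma> 1 (x, \<lambda>_. 0) = (x, \<sigma> x)" by (simp add: fibre_flow_def lincomb_def)
  then show ?thesis using BU[OF x] \<psi>i0[OF x] by (simp add: Phi_def)
qed

lemma Phi_image: "\<sigma> \<in> sections_in B V' \<Longrightarrow> Phi \<sigma> ` points B = section_image B \<psi> \<sigma>"
  unfolding section_image_def using Phi_base by (intro image_cong) auto

lemma Phi_diffeo_const:
  assumes "\<sigma> \<in> sections_in B V'"
  shows "diffeo A (Phi \<sigma>)" "diffeo A (Phi (opposite \<sigma>))"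
proof -
  have f: "smooth_family (\<lambda>_. \<sigma>)" by (rule smooth_family_const[OF sections_inD(2)[OF assms]])
  show "diffeo A (Phi \<sigma>)" using Phi_diffeo(1)[OF f, of 0] by simp
  show "diffeo A (Phi (opposite \<sigma>))" using Phi_diffeo(1)[OF smooth_family_opposite[OF f], of 0] by simp
qed

lemma Phi_opposite_image:
  assumes "sec \<sigma>" "S \<subseteq> points A"
  shows "Phi (opposite \<sigma>) ` (Phi \<sigma> ` S) = S"
  using Phi_opposite[OF assms(1)] assms(2) by (auto simp: image_image subset_iff)

abbreviation "q \<equiv> q_map A B V U \<psi> V' f"
abbreviation "DN \<equiv> D_nearby A B \<psi> V'"

lemma nearbyE:
  assumes "S \<in> nearby B \<psi> V'"
  obtains \<sigma> where "\<sigma> \<in> sections_in B V'" "S = section_image B \<psi> \<sigma>"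
  using assms by (auto simp: nearby_def)

text \<open>\<open>nearby_diffeo\<close> and \<open>Phi\<close> are known to agree at points of the
  manifold, and pullbacks see no other values.\<close>

lemma q_eq:
  assumes \<sigma>: "\<sigma> \<in> sections_in B V'"
  shows "q (\<omega>, section_image B \<psi> \<sigma>) = pullback A A (Phi \<sigma>) \<omega>"
  unfolding q_map_def prod.case nearby_diffeo_def section_of_image[OF \<sigma>]
  by (rule pullback_cong[OF diffeoD(1)[OF Phi_diffeo_const(1)[OF \<sigma>]] A A])
     (simp add: time_one_flow_eq[OF sections_inD(1)[OF \<sigma>]])

text \<open>\<open>lagrangian_image\<close> is applied to the opposite flow, which carries the
  nearby submanifold back and has \<open>Phi \<sigma>\<close> as its inverse.\<close>

lemma q_Def_L:
  assumes "p \<in> DN"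
  shows "q p \<in> Def_L A B"
proof -
  obtain \<omega>' S where p: "p = (\<omega>', S)" "\<omega>' \<in> symplectic_forms A" "S \<in> nearby B \<psi> V'" "lagrangian TYPE('n) A \<omega>' S"
    using assms by (auto simp: D_nearby_def)
  obtain \<sigma> where \<sigma>: "\<sigma> \<in> sections_in B V'" "S = section_image B \<psi> \<sigma>" using p(3) by (rule nearbyE)
  note s = sections_inD(1)[OF \<sigma>(1)] and d = Phi_diffeo_const[OF \<sigma>(1)]
  define k where "k = Phi (opposite \<sigma>)"
  have kS: "k ` S = points B"
    unfolding k_def \<sigma>(2) Phi_image[OF \<sigma>(1), symmetric] by (rule Phi_opposite_image[OF s BA])
  have "Phi \<sigma> x = inv_into (points A) k x" if x: "x \<in> points A" for x
    using diffeoD(5)[OF d(2) Phi_in[OF s x]] by (simp add: k_def Phi_opposite[OF s x])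
  then have "pullback A A (inv_into (points A) k) \<omega>' = pullback A A (Phi \<sigma>) \<omega>'"
    by (rule pullback_cong[OF diffeoD(1)[OF d(1)] A A])
  then have "lagrangian TYPE('n) A (pullback A A (Phi \<sigma>) \<omega>') (points B)"
    using lagrangian_image[OF A hausA scA d(2)[folded k_def] p(4)] kS by simp
  then show ?thesis
    using pullback_symplectic[OF A d(1) p(2)] unfolding p(1) \<sigma>(2) q_eq[OF \<sigma>(1)] by (simp add: Def_L_def)
qed

lemma slice_smooth:
  assumes \<sigma>: "smooth_family \<sigma>" and t: "t \<in> {0..1}"
  shows "smooth_map_on B (points B) C (\<lambda>x. (x, \<sigma> t x))"
proof -
  have "smooth_map_on B (points B) (ratlas B) (\<lambda>x. (t, x))"
    by (rule smooth_map_on_rpair[OF B B subset_refl smooth_map_on_const[OF B smooth_atlas_euclid subset_refl] smooth_map_on_id[OF B subset_refl]]) simp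
  from smooth_map_on_compose[OF B ratB C this \<sigma>[unfolded smooth_family_def] subset_refl] t
  show ?thesis by (simp add: image_subset_iff)
qed

lemma joint_Phi: "smooth_family \<sigma> \<Longrightarrow> joint_smooth A (\<lambda>t. Phi (\<sigma> t))"
  unfolding joint_smooth_def by (rule Phi_smooth)

lemma two_forms_D: "(\<omega>', S) \<in> DN \<Longrightarrow> \<omega>' \<in> two_forms A"
  by (auto simp: D_nearby_def symplectic_forms_def)

text \<open>The sections of \<open>L'\<close> and \<open>L''\<close> are joined by a segment, along which the flows carry \<open>L\<close>.\<close>

lemma D_rel_if:
  assumes p: "(\<omega>', S') \<in> DN" and p': "(\<omega>'', S'') \<in> DN" and rel: "(q (\<omega>', S'), q (\<omega>'', S'')) \<in> Def_L_rel A B"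
  shows "((\<omega>', S'), (\<omega>'', S'')) \<in> D_nearby_rel A B \<psi> V'"
proof -
  obtain \<sigma>' where \<sigma>': "\<sigma>' \<in> sections_in B V'" "S' = section_image B \<psi> \<sigma>'"
    using p by (auto simp: D_nearby_def elim: nearbyE)
  obtain \<sigma>'' where \<sigma>'': "\<sigma>'' \<in> sections_in B V'" "S'' = section_image B \<psi> \<sigma>''"
    using p' by (auto simp: D_nearby_def elim: nearbyE)
  note s' = sections_inD(1)[OF \<sigma>'(1)] and d' = Phi_diffeo_const[OF \<sigma>'(1)] and d'' = Phi_diffeo_const[OF \<sigma>''(1)]
  obtain \<rho> where \<rho>: "is_isotopy A \<rho>" "pullback A A (\<rho> 1) (q (\<omega>'', S'')) = q (\<omega>', S')"
    "\<And>t. t \<in> {0..1} \<Longrightarrow> \<rho> t ` points B = points B"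
    using rel unfolding Def_L_rel_def by blast
  have d\<rho>: "diffeo A (\<rho> t)" if "t \<in> {0..1}" for t using \<rho>(1) that by (simp add: is_isotopy_joint[OF A])
  have \<rho>0: "\<rho> 0 x = x" if "x \<in> points A" for x using \<rho>(1) that by (simp add: is_isotopy_joint[OF A])
  define \<sigma> where "\<sigma> t x = lincomb (1 - t) (\<sigma>' x) t (\<sigma>'' x)" for t x
  have fam: "smooth_family \<sigma>"
    unfolding smooth_family_def \<sigma>_def
    by (rule smooth_map_on_fibre_lincomb[OF ratB B _ smooth_one_minus_time[OF B] smooth_map_on_time[OF B]
          smooth_family_const[OF sections_inD(2)[OF \<sigma>'(1)], unfolded smooth_family_def]
          smooth_family_const[OF sections_inD(2)[OF \<sigma>''(1)], unfolded smooth_family_def]]) auto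
  have \<sigma>0: "\<sigma> 0 = \<sigma>'" and \<sigma>1: "\<sigma> 1 = \<sigma>''" by (auto simp: \<sigma>_def lincomb_def)
  have sect: "\<sigma> t \<in> sections_in B V'" if t: "t \<in> {0..1}" for t
    unfolding sections_in_def
  proof (intro CollectI conjI ballI allI impI)
    fix x assume x: "x \<in> points B"
    show "\<sigma> t x \<in> cotangent_space B x" by (rule secD[OF smooth_family_sec[OF fam t] x])
    show "(x, \<sigma> t x) \<in> V'"
      using conv x t sections_inD(3)[OF \<sigma>'(1) x] sections_inD(3)[OF \<sigma>''(1) x]
      unfolding fiberwise_convex_def \<sigma>_def by blast
  next
    fix x assume "x \<notin> points B"
    then show "\<sigma> t x = (\<lambda>_. 0)" using sections_inD(4)[OF \<sigma>'(1)] sections_inD(4)[OF \<sigma>''(1)] by (simp add: \<sigma>_def lincomb_def)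
  qed (rule slice_smooth[OF fam t])
  define k where "k = Phi (opposite \<sigma>')"
  note dk = d'(2)[folded k_def]
  \<comment> \<open>It begins at the identity because \<open>\<sigma> 0 = \<sigma>'\<close> and
    \<open>k\<close> inverts \<open>Phi \<sigma>'\<close>. The image of \<open>S'\<close> at time
    \<open>t\<close> is the graph of \<open>\<sigma> t\<close>, since \<open>\<rho> t\<close>
    preserves \<open>points B\<close>.\<close>
  define \<phi> where "\<phi> t x = Phi (\<sigma> t) (\<rho> t (k x))" for t x
  have img: "\<phi> t ` S' = section_image B \<psi> (\<sigma> t)" if t: "t \<in> {0..1}" for t
  proof -
    have "k ` S' = points B"
      unfolding k_def \<sigma>'(2) Phi_image[OF \<sigma>'(1), symmetric] by (rule Phi_opposite_image[OF s' BA])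
    moreover have "\<phi> t ` S' = Phi (\<sigma> t) ` (\<rho> t ` (k ` S'))" by (simp add: \<phi>_def image_image)
    ultimately have "\<phi> t ` S' = Phi (\<sigma> t) ` (\<rho> t ` points B)" by simp
    then show ?thesis using \<rho>(3)[OF t] Phi_image[OF sect[OF t]] by simp
  qed
  have iso: "is_isotopy A \<phi>"
    unfolding is_isotopy_joint[OF A]
  proof (intro conjI ballI)
    show "diffeo A (\<phi> t)" if "t \<in> {0..1}" for t
      unfolding \<phi>_def using diffeo_compose[OF A Phi_diffeo_const(1)[OF sect[OF that]] diffeo_compose[OF A d\<rho>[OF that] dk]] .
    show "\<phi> 0 x = x" if "x \<in> points A" for x
      using that \<rho>0[OF diffeoD(3)[OF dk that]] Phi_opposite'[OF s' that] by (simp add: \<phi>_def \<sigma>0 k_def)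
    have "joint_smooth A \<rho>" using \<rho>(1) by (simp add: is_isotopy_joint[OF A])
    from joint_smooth_compose[OF A joint_Phi[OF fam] joint_smooth_compose[OF A this joint_smooth_const[OF A diffeoD(1)[OF dk]]]]
    show "joint_smooth A \<phi>" by (simp add: \<phi>_def[abs_def])
  qed
  have dr: "diffeo A (\<rho> 1)" by (rule d\<rho>) simp
  have "pullback A A (\<phi> 1) \<omega>'' = pullback A A (\<lambda>x. \<rho> 1 (k x)) (pullback A A (Phi \<sigma>'') \<omega>'')"
    unfolding \<phi>_def \<sigma>1
    by (rule pullback_compose[OF diffeoD(1)[OF diffeo_compose[OF A dr dk]] diffeoD(1)[OF d''(1)] A A A])
  also have "\<dots> = pullback A A k (pullback A A (\<rho> 1) (pullback A A (Phi \<sigma>'') \<omega>''))"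
    by (rule pullback_compose[OF diffeoD(1)[OF dk] diffeoD(1)[OF dr] A A A])
  also have "\<dots> = pullback A A k (pullback A A (Phi \<sigma>') \<omega>')"
    using \<rho>(2) unfolding \<sigma>'(2) \<sigma>''(2) q_eq[OF \<sigma>'(1)] q_eq[OF \<sigma>''(1)] by simp
  also have "\<dots> = pullback A A (\<lambda>x. Phi \<sigma>' (k x)) \<omega>'"
    by (rule pullback_compose[OF diffeoD(1)[OF dk] diffeoD(1)[OF d'(1)] A A A, symmetric])
  also have "\<dots> = pullback A A (\<lambda>x. x) \<omega>'"
    by (rule pullback_cong[OF smooth_map_on_id[OF A subset_refl] A A]) (simp add: k_def Phi_opposite'[OF s'])
  also have "\<dots> = \<omega>'" by (rule pullback_id[OF A two_forms_D[OF p]])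
  finally have pb: "pullback A A (\<phi> 1) \<omega>'' = \<omega>'" .
  have "\<phi> 1 ` S' = S''" using img[of 1] by (simp add: \<sigma>1 \<sigma>''(2))
  moreover have "\<forall>t\<in>{0..1}. \<phi> t ` S' \<in> nearby B \<psi> V'" using img sect by (auto simp: nearby_def)
  ultimately show ?thesis using p p' iso pb unfolding D_nearby_rel_def by blast
qed

text \<open>If \<open>L\<^sub>t = \<phi>\<^sub>t(L')\<close> is the graph of \<open>\<sigma>\<^sub>t\<close>, then \<open>p \<psi>\<^sup>-\<^sup>1 \<phi>\<^sub>t\<close> restricts to a diffeomorphism from \<open>L'\<close> to \<open>L\<close>;
  inverting it shows that \<open>\<sigma>\<^sub>t\<close> is smooth in \<open>t\<close>.\<close>

lemma isotopy_sections_smooth: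
  assumes \<phi>: "is_isotopy A \<phi>" and \<sigma>': "\<sigma>' \<in> sections_in B V'"
    and \<sigma>: "\<And>t. t \<in> {0..1} \<Longrightarrow> \<sigma> t \<in> sections_in B V'"
    and im: "\<And>t. t \<in> {0..1} \<Longrightarrow> \<phi> t ` section_image B \<psi> \<sigma>' = section_image B \<psi> (\<sigma> t)"
  shows "smooth_family \<sigma>"
proof -
  let ?S = "{0..1} \<times> points B"
  have S: "?S \<subseteq> points (ratlas B)" "?S \<subseteq> UNIV \<times> points B" by auto
  have d: "diffeo A (\<phi> t)" if "t \<in> {0..1}" for t using \<phi> that by (simp add: is_isotopy_joint[OF A])
  have j: "smooth_map_on (ratlas A) ({0..1} \<times> points A) A (\<lambda>w. \<phi> (fst w) (snd w))"
    using \<phi> by (simp add: is_isotopy_joint[OF A] joint_smooth_def)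
  define e where "e \<sigma> x = \<psi> (x, \<sigma> x)" for \<sigma> :: "'a \<Rightarrow> ('a, 'n) covector" and x
  have e_smooth: "smooth_map_on B (points B) A (e \<sigma>)" and e_in: "\<And>x. x \<in> points B \<Longrightarrow> e \<sigma> x \<in> U"
    and e_inv: "\<And>x. x \<in> points B \<Longrightarrow> \<psi>i (e \<sigma> x) = (x, \<sigma> x)" if s: "\<sigma> \<in> sections_in B V'" for \<sigma>
  proof -
    have v: "(x, \<sigma> x) \<in> V" if "x \<in> points B" for x using sections_inD(3)[OF s that] V'V by auto
    show "smooth_map_on B (points B) A (e \<sigma>)"
      unfolding e_def using v by (intro smooth_map_on_compose[OF B C A sections_inD(2)[OF s] \<psi> subset_refl]) auto
    show "e \<sigma> x \<in> U" "\<psi>i (e \<sigma> x) = (x, \<sigma> x)" if "x \<in> points B" for x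
      using \<psi>_in[OF v[OF that]] \<psi>i_\<psi>[OF v[OF that]] by (simp_all add: e_def)
  qed
  have eA: "e \<sigma> x \<in> points A" if "\<sigma> \<in> sections_in B V'" "x \<in> points B" for \<sigma> x using e_in[OF that] UA by auto
  have section_image_e: "section_image B \<psi> \<sigma> = e \<sigma> ` points B" for \<sigma> by (simp add: section_image_def e_def)
  have hit: "\<exists>y\<in>points B. \<phi> t (e \<sigma>' x) = e (\<sigma> t) y" if "t \<in> {0..1}" "x \<in> points B" for t x
    using im[OF that(1)] that(2) unfolding section_image_e by (auto simp: image_iff set_eq_iff)
  have hit': "\<exists>x\<in>points B. e (\<sigma> t) y = \<phi> t (e \<sigma>' x)" if "t \<in> {0..1}" "y \<in> points B" for t y
    using im[OF that(1)] that(2) unfolding section_image_e by (auto simp: image_iff set_eq_iff)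
  define G where "G t x = \<psi>i (\<phi> t (e \<sigma>' x))" for t x
  define g where "g t x = fst (G t x)" for t x
  \<comment> \<open>The inverse of \<open>g t\<close> on the submanifold, taken from the inverse of
    \<open>\<phi> t\<close> on the ambient manifold; its smoothness at each fixed time is then a
    matter of composition.\<close>
  define k where "k t y = fst (\<psi>i (inv_into (points A) (\<phi> t) (e (\<sigma> t) y)))" for t y
  have G: "G t x = (g t x, \<sigma> t (g t x)) \<and> g t x \<in> points B \<and> \<phi> t (e \<sigma>' x) = e (\<sigma> t) (g t x)"
    if t: "t \<in> {0..1}" and x: "x \<in> points B" for t x
  proof -
    obtain y where y: "y \<in> points B" "\<phi> t (e \<sigma>' x) = e (\<sigma> t) y" using hit[OF t x] by blast
    then show ?thesis using e_inv[OF \<sigma>[OF t] y(1)] by (simp add: G_def g_def)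
  qed
  have kg: "k t (g t x) = x" if t: "t \<in> {0..1}" and x: "x \<in> points B" for t x
  proof -
    have "e (\<sigma> t) (g t x) = \<phi> t (e \<sigma>' x)" using G[OF t x] by simp
    then show ?thesis using diffeoD(5)[OF d[OF t] eA[OF \<sigma>' x]] e_inv[OF \<sigma>' x] by (simp add: k_def)
  qed
  have gk: "g t (k t y) = y" if t: "t \<in> {0..1}" and y: "y \<in> points B" for t y
  proof -
    obtain x where x: "x \<in> points B" "e (\<sigma> t) y = \<phi> t (e \<sigma>' x)" using hit'[OF t y] by blast
    have "k t y = x" unfolding k_def x(2) using diffeoD(5)[OF d[OF t] eA[OF \<sigma>' x(1)]] e_inv[OF \<sigma>' x(1)] by simp
    then show ?thesis using e_inv[OF \<sigma>[OF t] y] by (simp add: g_def G_def x(2)[symmetric])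
  qed
  have kU: "inv_into (points A) (\<phi> t) (e (\<sigma> t) y) \<in> U" if t: "t \<in> {0..1}" and y: "y \<in> points B" for t y
  proof -
    obtain x where x: "x \<in> points B" "e (\<sigma> t) y = \<phi> t (e \<sigma>' x)" using hit'[OF t y] by blast
    then show ?thesis using diffeoD(5)[OF d[OF t] eA[OF \<sigma>' x(1)]] e_in[OF \<sigma>' x(1)] by simp
  qed
  have k_smooth: "smooth_map_on B (points B) B (k t)" if t: "t \<in> {0..1}" for t
  proof -
    have "smooth_map_on B (points B) A (\<lambda>y. inv_into (points A) (\<phi> t) (e (\<sigma> t) y))"
      using eA[OF \<sigma>[OF t]] by (intro smooth_map_on_compose[OF B A A e_smooth[OF \<sigma>[OF t]] diffeoD(2)[OF d[OF t]] subset_refl]) auto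
    from smooth_map_on_compose[OF B A C this \<psi>i subset_refl]
    have "smooth_map_on B (points B) C (\<lambda>y. \<psi>i (inv_into (points A) (\<phi> t) (e (\<sigma> t) y)))" using kU[OF t] by blast
    from smooth_map_on_compose[OF B C B this smooth_map_on_projection[OF B subset_refl] subset_refl]
    show ?thesis unfolding k_def using \<psi>i_C[OF kU[OF t]] by blast
  qed
  have G_smooth: "smooth_map_on (ratlas B) ?S C (\<lambda>w. G (fst w) (snd w))"
  proof -
    have "smooth_map_on (ratlas B) ?S A (\<lambda>w. e \<sigma>' (snd w))"
      by (rule smooth_map_on_compose[OF ratB B A smooth_map_on_space[OF B S(2)] e_smooth[OF \<sigma>'] S(1)]) auto
    from smooth_map_on_rpair[OF ratB A S(1) smooth_map_on_time[OF B S(2)] this]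
    have "smooth_map_on (ratlas B) ?S (ratlas A) (\<lambda>w. (fst w, e \<sigma>' (snd w)))" .
    from smooth_map_on_compose[OF ratB ratA A this j S(1)]
    have 1: "smooth_map_on (ratlas B) ?S A (\<lambda>w. \<phi> (fst w) (e \<sigma>' (snd w)))" using eA[OF \<sigma>'] by force
    have "\<phi> t (e \<sigma>' x) \<in> U" if "t \<in> {0..1}" "x \<in> points B" for t x
      using G[OF that] e_in[OF \<sigma>[OF that(1)]] by simp
    then show ?thesis unfolding G_def
      by (intro smooth_map_on_compose[OF ratB A C 1 \<psi>i S(1)]) auto
  qed
  have GC: "G t x \<in> points C" if "t \<in> {0..1}" "x \<in> points B" for t x
    using smooth_map_on_points[OF G_smooth ratB C, of "(t, x)"] that by simp
  have g_smooth: "smooth_map_on (ratlas B) ?S B (\<lambda>w. g (fst w) (snd w))"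
    unfolding g_def
    by (rule smooth_map_on_compose[OF ratB C B G_smooth smooth_map_on_projection[OF B subset_refl] S(1)])
      (use GC in \<open>auto simp: image_subset_iff simp del: points_cotangent\<close>)
  have ks: "smooth_map_on (ratlas B) ?S B (\<lambda>w. k (fst w) (snd w))"
    by (rule smooth_inverse_family[OF B hausB compB g_smooth k_smooth kg gk])
  have kB: "k t y \<in> points B" if "t \<in> {0..1}" "y \<in> points B" for t y
    using smooth_map_on_points[OF k_smooth[OF that(1)] B B that(2,2)] .
  from smooth_map_on_rpair[OF ratB B S(1) smooth_map_on_time[OF B S(2)] ks]
  have "smooth_map_on (ratlas B) ?S (ratlas B) (\<lambda>w. (fst w, k (fst w) (snd w)))" .
  \<comment> \<open>Reparametrising by \<open>k\<close> turns the moving embedding into a graph: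
    \<open>G t (k t y)\<close> is \<open>(y, \<sigma> t y)\<close>.\<close>
  from smooth_map_on_compose[OF ratB ratB C this G_smooth S(1)]
  have "smooth_map_on (ratlas B) ?S C (\<lambda>w. G (fst w) (k (fst w) (snd w)))" using kB by force
  then show ?thesis unfolding smooth_family_def
  proof (rule smooth_map_on_cong[OF _ ratB C S(1)])
    fix w :: "real \<times> 'a" assume "w \<in> ?S"
    then obtain t y where w: "w = (t, y)" "t \<in> {0..1}" "y \<in> points B" by auto
    show "G (fst w) (k (fst w) (snd w)) = (snd w, \<sigma> (fst w) (snd w))"
      using G[OF w(2) kB[OF w(2,3)]] gk[OF w(2,3)] by (simp add: w(1))
  qed
qed

lemma Def_rel_if:
  assumes rel: "((\<omega>', S'), (\<omega>'', S'')) \<in> D_nearby_rel A B \<psi> V'"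
  shows "(q (\<omega>', S'), q (\<omega>'', S'')) \<in> Def_L_rel A B"
proof -
  obtain \<phi> where p: "(\<omega>', S') \<in> DN" and p': "(\<omega>'', S'') \<in> DN" and \<phi>: "is_isotopy A \<phi>" "\<phi> 1 ` S' = S''"
    "pullback A A (\<phi> 1) \<omega>'' = \<omega>'" "\<And>t. t \<in> {0..1} \<Longrightarrow> \<phi> t ` S' \<in> nearby B \<psi> V'"
    using rel unfolding D_nearby_rel_def by blast
  obtain \<sigma>' where \<sigma>': "\<sigma>' \<in> sections_in B V'" "S' = section_image B \<psi> \<sigma>'"
    using p by (auto simp: D_nearby_def elim: nearbyE)
  obtain \<sigma>'' where \<sigma>'': "\<sigma>'' \<in> sections_in B V'" "S'' = section_image B \<psi> \<sigma>''"
    using p' by (auto simp: D_nearby_def elim: nearbyE)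
  note s' = sections_inD(1)[OF \<sigma>'(1)] and s'' = sections_inD(1)[OF \<sigma>''(1)]
    and d' = Phi_diffeo_const[OF \<sigma>'(1)] and d'' = Phi_diffeo_const[OF \<sigma>''(1)]
  \<comment> \<open>The sections are chosen independently at each time; their smooth dependence on
    time follows from \<open>isotopy_sections_smooth\<close>.\<close>
  have "\<forall>t. \<exists>\<sigma>. t \<in> {0..1} \<longrightarrow> \<sigma> \<in> sections_in B V' \<and> \<phi> t ` S' = section_image B \<psi> \<sigma>"
    using \<phi>(4) by (meson nearbyE)
  then obtain \<sigma> where \<sigma>: "\<And>t. t \<in> {0..1} \<Longrightarrow> \<sigma> t \<in> sections_in B V'"
    "\<And>t. t \<in> {0..1} \<Longrightarrow> \<phi> t ` S' = section_image B \<psi> (\<sigma> t)" by metis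
  have d: "diffeo A (\<phi> t)" if "t \<in> {0..1}" for t using \<phi>(1) that by (simp add: is_isotopy_joint[OF A])
  have \<phi>0: "\<phi> 0 x = x" if "x \<in> points A" for x using \<phi>(1) that by (simp add: is_isotopy_joint[OF A])
  have S'A: "S' \<subseteq> points A"
    unfolding \<sigma>'(2) Phi_image[OF \<sigma>'(1), symmetric] using Phi_in[OF s'] BA by auto
  \<comment> \<open>A section is determined by its image, so the sections chosen at times 0 and 1
    are the given ones.\<close>
  have "\<phi> 0 ` S' = S'" using \<phi>0 S'A by force
  then have \<sigma>0: "\<sigma> 0 = \<sigma>'" using section_image_inj[OF \<sigma>(1) \<sigma>'(1), of 0] \<sigma>(2)[of 0] \<sigma>'(2) by simp
  have \<sigma>1: "\<sigma> 1 = \<sigma>''" using section_image_inj[OF \<sigma>(1) \<sigma>''(1), of 1] \<sigma>(2)[of 1] \<phi>(2) \<sigma>''(2) by simp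
  have fam: "smooth_family \<sigma>"
    by (rule isotopy_sections_smooth[of \<phi> \<sigma>' \<sigma>, OF \<phi>(1) \<sigma>'(1) \<sigma>(1) \<sigma>(2)[unfolded \<sigma>'(2)]])
  define \<rho> where "\<rho> t x = Phi (opposite (\<sigma> t)) (\<phi> t (Phi \<sigma>' x))" for t x
  have iso: "is_isotopy A \<rho>"
    unfolding is_isotopy_joint[OF A]
  proof (intro conjI ballI)
    show "diffeo A (\<rho> t)" if "t \<in> {0..1}" for t
      unfolding \<rho>_def using diffeo_compose[OF A Phi_diffeo_const(2)[OF \<sigma>(1)[OF that]] diffeo_compose[OF A d[OF that] d'(1)]] .
    show "\<rho> 0 x = x" if "x \<in> points A" for x
      using \<phi>0[OF Phi_in[OF s' that]] Phi_opposite[OF s' that] by (simp add: \<rho>_def \<sigma>0)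
    have "joint_smooth A \<phi>" using \<phi>(1) by (simp add: is_isotopy_joint[OF A])
    from joint_smooth_compose[OF A joint_Phi[OF smooth_family_opposite[OF fam]] joint_smooth_compose[OF A this joint_smooth_const[OF A diffeoD(1)[OF d'(1)]]]]
    show "joint_smooth A \<rho>" by (simp add: \<rho>_def[abs_def])
  qed
  have img: "\<rho> t ` points B = points B" if t: "t \<in> {0..1}" for t
  proof -
    have "\<rho> t ` points B = Phi (opposite (\<sigma> t)) ` (\<phi> t ` (Phi \<sigma>' ` points B))"
      unfolding \<rho>_def by (simp add: image_image)
    also have "\<dots> = Phi (opposite (\<sigma> t)) ` (Phi (\<sigma> t) ` points B)"
      using \<sigma>(2)[OF t] by (simp only: Phi_image[OF \<sigma>'(1)] \<sigma>'(2)[symmetric] Phi_image[OF \<sigma>(1)[OF t]])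
    finally show ?thesis using Phi_opposite_image[OF sections_inD(1)[OF \<sigma>(1)[OF t]] BA] by simp
  qed
  have d1: "diffeo A (\<phi> 1)" and dr: "diffeo A (\<rho> 1)" using d iso by (auto simp: is_isotopy_joint[OF A])
  have "pullback A A (\<rho> 1) (pullback A A (Phi \<sigma>'') \<omega>'') = pullback A A (\<lambda>x. Phi \<sigma>'' (\<rho> 1 x)) \<omega>''"
    by (rule pullback_compose[OF diffeoD(1)[OF dr] diffeoD(1)[OF d''(1)] A A A, symmetric])
  also have "\<dots> = pullback A A (\<lambda>x. \<phi> 1 (Phi \<sigma>' x)) \<omega>''"
    by (rule pullback_cong[OF diffeoD(1)[OF diffeo_compose[OF A d1 d'(1)]] A A])
       (simp add: \<rho>_def \<sigma>1 Phi_opposite'[OF s''] diffeoD(3)[OF d1] Phi_in[OF s'])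
  also have "\<dots> = pullback A A (Phi \<sigma>') (pullback A A (\<phi> 1) \<omega>'')"
    by (rule pullback_compose[OF diffeoD(1)[OF d'(1)] diffeoD(1)[OF d1] A A A])
  finally have "pullback A A (\<rho> 1) (q (\<omega>'', S'')) = q (\<omega>', S')"
    unfolding \<sigma>'(2) \<sigma>''(2) q_eq[OF \<sigma>'(1)] q_eq[OF \<sigma>''(1)] \<phi>(3) .
  from Def_L_relI[OF q_Def_L[OF p] q_Def_L[OF p'] iso this img] show ?thesis .
qed

lemma D_rel_iff: "(p, p') \<in> D_nearby_rel A B \<psi> V' \<longleftrightarrow> p \<in> DN \<and> p' \<in> DN \<and> (q p, q p') \<in> Def_L_rel A B"
proof -
  obtain \<omega>' S' \<omega>'' S'' where p: "p = (\<omega>', S')" "p' = (\<omega>'', S'')" by (cases p, cases p')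
  have "(p, p') \<in> D_nearby_rel A B \<psi> V' \<Longrightarrow> p \<in> DN \<and> p' \<in> DN" by (auto simp: D_nearby_rel_def)
  then show ?thesis unfolding p using D_rel_if Def_rel_if by blast
qed

lemma q_surj:
  assumes \<omega>: "\<omega> \<in> Def_L A B"
  shows "\<exists>p\<in>DN. q p = \<omega>"
proof -
  \<comment> \<open>With the zero section the displacement in the fibre is zero whatever the
    solution of the scalar equation, so the flow is the identity.\<close>
  define \<sigma> where "\<sigma> = (\<lambda>(x::'a) (v :: ('a, 'n) tvector). 0 :: real)"
  have \<sigma>: "\<sigma> \<in> sections_in B V'"
    using smooth_map_on_zero_section[OF B B subset_refl smooth_map_on_id[OF B subset_refl]] zero_V
    by (simp add: sections_in_def \<sigma>_def zero_cotangent)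
  have im: "section_image B \<psi> \<sigma> = points B"
    using \<psi>0 by (force simp: section_image_def \<sigma>_def)
  have "Phi \<sigma> y = y" if y: "y \<in> points A" for y
  proof (cases "y \<in> U")
    case True
    have "fibre_flow \<sigma> 1 (\<psi>i y) = \<psi>i y" by (simp add: fibre_flow_def \<sigma>_def lincomb_def)
    then show ?thesis using True by (simp add: Phi_def \<psi>_\<psi>i)
  qed (simp add: Phi_def)
  then have "pullback A A (Phi \<sigma>) \<omega> = pullback A A (\<lambda>x. x) \<omega>"
    by (intro pullback_cong[OF smooth_map_on_id[OF A subset_refl] A A]) simp
  then have "q (\<omega>, section_image B \<psi> \<sigma>) = \<omega>"
    using \<omega> pullback_id[OF A, of \<omega>] by (simp add: q_eq[OF \<sigma>] Def_L_def symplectic_forms_def)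
  moreover have "(\<omega>, section_image B \<psi> \<sigma>) \<in> DN"
    using \<omega> \<sigma> im unfolding D_nearby_def Def_L_def nearby_def by auto
  ultimately show ?thesis by blast
qed

end

text \<open>Pulling back an equivalence relation along a map onto \<open>Y\<close> gives an
  equivalence relation whose classes are the preimages of classes. The union over representatives
  collapses to one class, because \<open>q\<close> sends related elements to related ones.\<close>

lemma quotient_bijection:
  fixes q :: "'p \<Rightarrow> 'd"
  assumes R: "equiv Y R" and q: "\<And>p. p \<in> X \<Longrightarrow> q p \<in> Y" and surj: "\<And>y. y \<in> Y \<Longrightarrow> \<exists>p\<in>X. q p = y"
    and Q: "\<And>p p'. (p, p') \<in> Q \<longleftrightarrow> p \<in> X \<and> p' \<in> X \<and> (q p, q p') \<in> R"
  shows "equiv X Q" and "\<And>p. p \<in> X \<Longrightarrow> (\<Union>p'\<in>Q `` {p}. R `` {q p'}) = R `` {q p}"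
    and "bij_betw (\<lambda>D. \<Union>p\<in>D. R `` {q p}) (X // Q) (Y // R)"
proof -
  have r: "refl_on Y R" "sym R" "trans R" using R by (auto elim: equivE)
  show eq: "equiv X Q"
  proof (rule equivI)
    show "Q \<subseteq> X \<times> X" using Q by auto
    show "refl_on X Q" using Q q refl_onD[OF r(1)] by (intro refl_onI) auto
    show "sym Q" using Q symD[OF r(2)] by (intro symI) auto
    show "trans Q" using Q transD[OF r(3)] by (intro transI) blast
  qed
  show cls: "(\<Union>p'\<in>Q `` {p}. R `` {q p'}) = R `` {q p}" if p: "p \<in> X" for p
  proof -
    have "R `` {q p'} = R `` {q p}" if "p' \<in> Q `` {p}" for p'
      using that Q equiv_class_eq[OF R, of "q p" "q p'"] by auto
    moreover have "p \<in> Q `` {p}" using eq p by (rule equiv_class_self)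
    ultimately show ?thesis by blast
  qed
  show "bij_betw (\<lambda>D. \<Union>p\<in>D. R `` {q p}) (X // Q) (Y // R)"
    unfolding bij_betw_def
  proof
    show "inj_on (\<lambda>D. \<Union>p\<in>D. R `` {q p}) (X // Q)"
    proof (rule inj_onI)
      fix D D' assume D: "D \<in> X // Q" and D': "D' \<in> X // Q"
        and e: "(\<Union>p\<in>D. R `` {q p}) = (\<Union>p\<in>D'. R `` {q p})"
      obtain p where p: "p \<in> X" "D = Q `` {p}" using D by (rule quotientE)
      obtain p' where p': "p' \<in> X" "D' = Q `` {p'}" using D' by (rule quotientE)
      have "R `` {q p} = R `` {q p'}" using e unfolding p(2) p'(2) cls[OF p(1)] cls[OF p'(1)] .
      then have "(q p, q p') \<in> R" by (rule eq_equiv_class[OF _ R q[OF p'(1)]])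
      then have "(p, p') \<in> Q" using Q p p' by blast
      then show "D = D'" unfolding p(2) p'(2) by (rule equiv_class_eq[OF eq])
    qed
    show "(\<lambda>D. \<Union>p\<in>D. R `` {q p}) ` (X // Q) = Y // R"
    proof (intro equalityI subsetI)
      fix E assume "E \<in> (\<lambda>D. \<Union>p\<in>D. R `` {q p}) ` (X // Q)"
      then obtain D where D: "D \<in> X // Q" "E = (\<Union>p\<in>D. R `` {q p})" by auto
      obtain p where p: "p \<in> X" "D = Q `` {p}" using D(1) by (rule quotientE)
      show "E \<in> Y // R" unfolding D(2) p(2) cls[OF p(1)] by (rule quotientI[OF q[OF p(1)]])
    next
      fix E assume "E \<in> Y // R"
      then obtain y where y: "y \<in> Y" "E = R `` {y}" by (rule quotientE)
      obtain p where p: "p \<in> X" "q p = y" using surj[OF y(1)] by blast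
      have "E = (\<Union>p'\<in>Q `` {p}. R `` {q p'})" unfolding cls[OF p(1)] p(2) y(2) ..
      then show "E \<in> (\<lambda>D. \<Union>p\<in>D. R `` {q p}) ` (X // Q)" using quotientI[OF p(1)] by (rule image_eqI)
    qed
  qed
qed

theorem proposition2p17:
  fixes A :: "('a, 'e::euclidean_space) chart set"
    and B :: "('a, 'n::euclidean_space) chart set"
    and \<omega> :: "('a, 'e) form2"
    and V V' :: "('a, 'n) cotangent set"
    and U U' :: "'a set"
    and \<psi> :: "('a, 'n) cotangent \<Rightarrow> 'a"
    and f :: "'a \<Rightarrow> real"
  assumes "smooth_manifold A" and "compact_space (manifold_topology A)"
    and "\<omega> \<in> symplectic_forms A"
    and "lagrangian_atlas A \<omega> B" and "compact_space (manifold_topology B)"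
    and "weinstein_chart A \<omega> B V U \<psi>"
    and "openin (manifold_topology (cotangent_atlas B)) V'" and "zero_section B \<subseteq> V'"
    and "manifold_topology (cotangent_atlas B) closure_of V' \<subseteq> V"
    and "U' = \<psi> ` V'" and "openin (manifold_topology A) U'"
    and "manifold_topology A closure_of U' \<subseteq> U"
    and "fiberwise_convex B V'"
    and "smooth_function A f"
    and "\<forall>x \<in> manifold_topology A closure_of U'. f x = 1"
    and "manifold_topology A closure_of {x \<in> points A. f x \<noteq> 0} \<subseteq> U"
  shows "equiv (D_nearby A B \<psi> V') (D_nearby_rel A B \<psi> V') \<and>
         equiv (Def_L A B) (Def_L_rel A B) \<and>
         (\<forall>p \<in> D_nearby A B \<psi> V'. q_map A B V U \<psi> V' f p \<in> Def_L A B) \<and>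
         (\<forall>(p, p') \<in> D_nearby_rel A B \<psi> V'.
           (q_map A B V U \<psi> V' f p, q_map A B V U \<psi> V' f p') \<in> Def_L_rel A B) \<and>
         (\<forall>p \<in> D_nearby A B \<psi> V'. q_bar A B V U \<psi> V' f (D_nearby_rel A B \<psi> V' `` {p}) =
           Def_L_rel A B `` {q_map A B V U \<psi> V' f p}) \<and>
         bij_betw (q_bar A B V U \<psi> V' f) (D_nearby A B \<psi> V' // D_nearby_rel A B \<psi> V')
           (Def_L A B // Def_L_rel A B)"
proof -
  have emb: "smooth_manifold B" "points B \<subseteq> points A"
    using assms(4) by (auto simp: lagrangian_atlas_def embedded_submanifold_def)
  note A = smooth_manifold_atlas[OF assms(1)] and B = smooth_manifold_atlas[OF emb(1)]
  note W = assms(6)[unfolded weinstein_chart_def]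
  have "U' \<subseteq> manifold_topology A closure_of U'"
    by (rule closure_of_subset[OF openin_subset[OF assms(11)]])
  then have f1: "f (\<psi> z) = 1" if "z \<in> V'" for z using assms(10,15) that by blast
  have V'V: "V' \<subseteq> V"
    using closure_of_subset[OF openin_subset[OF assms(7)]] assms(9) by (rule subset_trans)
  interpret nearby_setup A B V U \<psi> f V'
    by unfold_locales
       (use A B W f1 V'V assms emb(1) in \<open>simp_all add: smooth_manifold_def smooth_function_def euclid_def\<close>)
  note Q = quotient_bijection[of _ _ DN q, OF equiv_Def_L[OF A emb(2)] q_Def_L q_surj D_rel_iff]
  have qb: "q_bar A B V U \<psi> V' f = (\<lambda>D. \<Union>p\<in>D. Def_L_rel A B `` {q p})"
    by (rule ext) (simp add: q_bar_def)
  show ?thesis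
    unfolding qb using Q equiv_Def_L[OF A emb(2)] q_Def_L by (auto simp: D_rel_iff)
qed

end
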